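(* Let $m\geq 2$ be an integer, let $(\mathsf H_i)_{1\leq i\leq m}$ be real Hilbert spaces and let $T\in\left]0,+\infty\right[$. For every $i\in\{1,\ldots,m\}$, set $$\mathcal W_i=\{x\in\mathcal C([0,T];\mathsf H_i)\cap W^{1,2}([0,T];\mathsf H_i)\mid x(T)=x(0)\},$$ let $\mathsf f_i\in\Gamma_0(\mathsf H_i)$, and let $\mathsf B_i\colon\mathsf H_1\times\cdots\times\mathsf H_m\to\mathsf H_i$. Suppose that there exists $\beta\in\left]0,+\infty\right[$ such that, for all $(\mathsf x_1,\ldots,\mathsf x_m)$ and $(\mathsf y_1,\ldots,\mathsf y_m)$ in $\mathsf H_1\times\cdots\times\mathsf H_m$, $$\sum_{i=1}^m\langle\mathsf B_i(\mathsf x_1,\ldots,\mathsf x_m)-\mathsf B_i(\mathsf y_1,\ldots,\mathsf y_m)\mid\mathsf x_i-\mathsf y_i\rangle_{\mathsf H_i}\geq\beta\sum_{i=1}^m\|\mathsf B_i(\mathsf x_1,\ldots,\mathsf x_m)-\mathsf B_i(\mathsf y_1,\ldots,\mathsf y_m)\|_{\mathsf H_i}^2,$$ and suppose that the problem $$\text{(P)}\quad\text{find } x_1\in\mathcal W_1,\ldots,x_m\in\mathcal W_m\text{ such that }(\forall i\in\{1,\ldots,m\})\quad 0\in x_i'(t)+\partial\mathsf f_i(x_i(t))+\mathsf B_i(x_1(t),\ldots,x_m(t))\ \text{ a.e. on }\left]0,T\right[$$ has at least one solution. Fix $\varepsilon\in\left]0,\min\{1,\beta\}\right[$, a sequence $(\gamma_n)_{n\in\mathbb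 N}$ in $[\varepsilon,2\beta-\varepsilon]$, and a sequence $(\lambda_n)_{n\in\mathbb N}$ in $[0,1-\varepsilon]$. For every $i\in\{1,\ldots,m\}$, let: (i) $x_{i,0}\in W^{1,2}([0,T];\mathsf H_i)$; (ii) $(b_{i,n})_{n\in\mathbb N}$ and $(e_{i,n})_{n\in\mathbb N}$ be sequences in $L^2([0,T];\mathsf H_i)$ such that $\sum_{n\in\mathbb N}\sqrt{\int_0^T\|b_{i,n}(t)\|_{\mathsf H_i}^2dt}<+\infty$ and $\sum_{n\in\mathbb N}\sqrt{\int_0^T\|e_{i,n}(t)\|_{\mathsf H_i}^2dt}<+\infty$; (iii) $(\lambda_{i,n})_{n\in\mathbb N}$ be a sequence in $\left[0,1\right[$ such that $\sum_{n\in\mathbb N}|\lambda_{i,n}-\lambda_n|<+\infty$. For every $n\in\mathbb N$ and every $i\in\{1,\ldots,m\}$, let $y_{i,n}$ be the unique solution in $\mathcal W_i$ to the inclusion $$\frac{x_{i,n}(t)-y_{i,n}(t)}{\gamma_n}-\big(\mathsf B_i(x_{1,n}(t),\ldots,x_{m,n}(t))+b_{i,n}(t)\big)\in y_{i,n}'(t)+\partial\mathsf f_i(y_{i,n}(t))+e_{i,n}(t)\quad\text{a.e. on }\left]0,T\right[$$ and set $x_{i,n+1}=\lambda_{i,n}x_{i,n}+(1-\lambda_{i,n})y_{i,n}$. Then, for every $i\in\{1,\ldots,m\}$, $(x_{i,n})_{n\in\mathbb N}$ converges weakly in $W^{1,2}([0,T];\mathsf H_i)$ to a point $x_i\in\mathcal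 W_i$, and $(x_i)_{1\leq i\leq m}$ is a solution to (P).
   Context: $\Gamma_0(\mathsf H)$ is the class of lower semicontinuous convex functions $f\colon\mathsf H\to\left]-\infty,+\infty\right]$ that are proper ($f\not\equiv+\infty$). The subdifferential of $f$ is $\partial f(x)=\{u\in\mathsf H\mid(\forall y\in\mathsf H)\ \langle y-x\mid u\rangle+f(x)\leq f(y)\}$. $\mathcal C([0,T];\mathsf H)$ is the space of continuous functions from $[0,T]$ to $\mathsf H$. $L^p([0,T];\mathsf H)$ is the space of (classes of) Borel measurable functions $x\colon[0,T]\to\mathsf H$ with $\int_0^T\|x(t)\|_{\mathsf H}^pdt<+\infty$; $L^2([0,T];\mathsf H)$ has scalar product $(x,y)\mapsto\int_0^T\langle x(t)\mid y(t)\rangle_{\mathsf H}dt$. For $x,y\in L^1([0,T];\mathsf H)$, $y=x'$ is the weak derivative of $x$ if $\int_0^T\phi(t)y(t)dt=-\int_0^T(d\phi(t)/dt)x(t)dt$ for every infinitely differentiable $\phi\colon\left]0,T\right[\to\mathbb R$ with compact support in $\left]0,T\right[$. $W^{1,2}([0,T];\mathsf H)=\{x\in L^2([0,T];\mathsf H)\mid x'\in L^2([0,T];\mathsf H)\}$, with its usual Hilbert space structure. *)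

theory Defs
  imports "HOL-Analysis.Analysis"
begin

text \<open>
  The Hilbert spaces \<open>H 1, \<dots>, H m\<close> may all be different, and a type cannot depend on an
  index. They are therefore closed linear subspaces of one Hilbert space type. This is no
  restriction: every finite family of Hilbert spaces embeds isometrically, as closed subspaces,
  in its Hilbert direct sum. Separability is not assumed.

  Classes of functions on \<open>[0,T]\<close> are handled through representatives of type
  \<open>real \<Rightarrow> 'a\<close>; the values of a representative outside \<open>[0,T]\<close> play no role.
\<close>

definition hilbert_subspace :: "'a::{real_inner, banach} set \<Rightarrow> bool" where
  "hilbert_subspace H \<longleftrightarrow> subspace H \<and> closed H"

definition Gamma0 :: "'a::{real_inner, banach} set \<Rightarrow> ('a \<Rightarrow> ereal) set" where
  "Gamma0 H = {f.
     (\<forall>x\<in>H. f x \<noteq> -\<infinity>) \<and> (\<exists>x\<in>H. f x \<noteq> \<infinity>) \<and>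
     (\<forall>x\<in>H. \<forall>y\<in>H. \<forall>a\<in>{0<..<1}.
        f (a *\<^sub>R x + (1 - a) *\<^sub>R y) \<le> ereal a * f x + ereal (1 - a) * f y) \<and>
     (\<forall>x\<in>H. \<forall>r<f x. \<forall>\<^sub>F y in at x within H. r < f y)}"

definition subdiff :: "'a::{real_inner, banach} set \<Rightarrow> ('a \<Rightarrow> ereal) \<Rightarrow> 'a \<Rightarrow> 'a set" where
  "subdiff H f x = {u \<in> H. \<forall>y\<in>H. ereal ((y - x) \<bullet> u) + f x \<le> f y}"

text \<open>
  If \<open>H\<close> is separable, the condition on the range holds for every function. Otherwise it is the
  usual requirement of Bochner measurability, without which sums of measurable functions need not
  be measurable and the functions with finite integral need not form a vector space.
\<close>

definition Lp :: "nat \<Rightarrow> real \<Rightarrow> 'a::{real_inner, banach} set \<Rightarrow> (real \<Rightarrow> 'a) set" where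
  "Lp p T H = {x.
     x \<in> borel_measurable (restrict_space lborel {0..T}) \<and>
     separable_space (top_of_set (x ` {0..T})) \<and>
     x ` {0..T} \<subseteq> H \<and>
     set_integrable lborel {0..T} (\<lambda>t. norm (x t) ^ p)}"

definition L2_norm :: "real \<Rightarrow> (real \<Rightarrow> 'a::{real_inner, banach}) \<Rightarrow> real" where
  "L2_norm T x = sqrt (LINT t:{0..T}|lborel. (norm (x t))\<^sup>2)"

definition L2_inner :: "real \<Rightarrow> (real \<Rightarrow> 'a::{real_inner, banach}) \<Rightarrow> (real \<Rightarrow> 'a) \<Rightarrow> real" where
  "L2_inner T x y = (LINT t:{0..T}|lborel. x t \<bullet> y t)"

definition test_function :: "real \<Rightarrow> (real \<Rightarrow> real) \<Rightarrow> bool" where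
  "test_function T \<phi> \<longleftrightarrow>
     (\<forall>k. \<forall>t\<in>{0<..<T}. (deriv ^^ k) \<phi> differentiable (at t)) \<and>
     (\<exists>K. compact K \<and> K \<subseteq> {0<..<T} \<and> (\<forall>t\<in>{0<..<T} - K. \<phi> t = 0))"

text \<open>
  The library's Bochner integral is only available for second countable types. The
  Henstock-Kurzweil integral used for the vector-valued integrals below extends it: every Bochner
  integrable function on \<open>[0,T]\<close> is Henstock-Kurzweil integrable, with the same integral. The
  values of \<open>\<phi>\<close> at the end points \<open>0\<close> and \<open>T\<close> do not affect the integrals.
\<close>

definition has_weak_deriv ::
  "real \<Rightarrow> 'a::{real_inner, banach} set \<Rightarrow> (real \<Rightarrow> 'a) \<Rightarrow> (real \<Rightarrow> 'a) \<Rightarrow> bool" where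
  "has_weak_deriv T H x y \<longleftrightarrow> x \<in> Lp 1 T H \<and> y \<in> Lp 1 T H \<and>
     (\<forall>\<phi>. test_function T \<phi> \<longrightarrow>
        integral {0..T} (\<lambda>t. \<phi> t *\<^sub>R y t) = - integral {0..T} (\<lambda>t. deriv \<phi> t *\<^sub>R x t))"

text \<open>A representative of the weak derivative, which is unique almost everywhere.\<close>

definition weak_deriv :: "real \<Rightarrow> 'a::{real_inner, banach} set \<Rightarrow> (real \<Rightarrow> 'a) \<Rightarrow> real \<Rightarrow> 'a" where
  "weak_deriv T H x = (SOME y. has_weak_deriv T H x y)"

definition W12 :: "real \<Rightarrow> 'a::{real_inner, banach} set \<Rightarrow> (real \<Rightarrow> 'a) set" where
  "W12 T H = {x \<in> Lp 2 T H. \<exists>y \<in> Lp 2 T H. has_weak_deriv T H x y}"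

definition W12_inner ::
  "real \<Rightarrow> 'a::{real_inner, banach} set \<Rightarrow> (real \<Rightarrow> 'a) \<Rightarrow> (real \<Rightarrow> 'a) \<Rightarrow> real" where
  "W12_inner T H x y = L2_inner T x y + L2_inner T (weak_deriv T H x) (weak_deriv T H y)"

definition W12_weakly_converges ::
  "real \<Rightarrow> 'a::{real_inner, banach} set \<Rightarrow> (nat \<Rightarrow> real \<Rightarrow> 'a) \<Rightarrow> (real \<Rightarrow> 'a) \<Rightarrow> bool" where
  "W12_weakly_converges T H X x \<longleftrightarrow>
     (\<forall>n. X n \<in> W12 T H) \<and> x \<in> W12 T H \<and>
     (\<forall>z \<in> W12 T H. (\<lambda>n. W12_inner T H (X n) z) \<longlonglongrightarrow> W12_inner T H x z)"

definition W_per :: "real \<Rightarrow> 'a::{real_inner, banach} set \<Rightarrow> (real \<Rightarrow> 'a) set" where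
  "W_per T H = {x \<in> W12 T H. continuous_on {0..T} x \<and> x T = x 0}"

text \<open>
  Points of \<open>H 1 \<times> \<dots> \<times> H m\<close> are extensional functions on \<open>{1..m}\<close>; this is why the
  arguments of \<open>B\<close> are restricted below.
\<close>

definition solves_P ::
  "nat \<Rightarrow> real \<Rightarrow> (nat \<Rightarrow> 'a::{real_inner, banach} set) \<Rightarrow> (nat \<Rightarrow> 'a \<Rightarrow> ereal)
    \<Rightarrow> (nat \<Rightarrow> (nat \<Rightarrow> 'a) \<Rightarrow> 'a) \<Rightarrow> (nat \<Rightarrow> real \<Rightarrow> 'a) \<Rightarrow> bool" where
  "solves_P m T H f B x \<longleftrightarrow>
     (\<forall>i\<in>{1..m}. x i \<in> W_per T (H i)) \<and>
     (\<forall>i\<in>{1..m}. AE t in lborel. t \<in> {0<..<T} \<longrightarrow>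
        0 \<in> (\<lambda>u. weak_deriv T (H i) (x i) t + u + B i (\<lambda>j\<in>{1..m}. x j t))
              ` subdiff (H i) (f i) (x i t))"

text \<open>
  \<open>w\<close> stands for the forward term \<open>B i (x 1, \<dots>, x m) + b i\<close>. Functions on \<open>[0,T]\<close>
  are identified when they agree there, so this is what uniqueness means.
\<close>

definition solves_step ::
  "real \<Rightarrow> 'a::{real_inner, banach} set \<Rightarrow> ('a \<Rightarrow> ereal) \<Rightarrow> real
    \<Rightarrow> (real \<Rightarrow> 'a) \<Rightarrow> (real \<Rightarrow> 'a) \<Rightarrow> (real \<Rightarrow> 'a) \<Rightarrow> (real \<Rightarrow> 'a) \<Rightarrow> bool" where
  "solves_step T H f \<gamma> x w e y \<longleftrightarrow>
     y \<in> W_per T H \<and>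
     (AE t in lborel. t \<in> {0<..<T} \<longrightarrow>
        (1 / \<gamma>) *\<^sub>R (x t - y t) - w t
          \<in> (\<lambda>u. weak_deriv T H y t + u + e t) ` subdiff H f (y t))"

definition is_unique_step ::
  "real \<Rightarrow> 'a::{real_inner, banach} set \<Rightarrow> ('a \<Rightarrow> ereal) \<Rightarrow> real
    \<Rightarrow> (real \<Rightarrow> 'a) \<Rightarrow> (real \<Rightarrow> 'a) \<Rightarrow> (real \<Rightarrow> 'a) \<Rightarrow> (real \<Rightarrow> 'a) \<Rightarrow> bool" where
  "is_unique_step T H f \<gamma> x w e y \<longleftrightarrow>
     solves_step T H f \<gamma> x w e y \<and>
     (\<forall>z. solves_step T H f \<gamma> x w e z \<longrightarrow> (\<forall>t\<in>{0..T}. z t = y t))"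

definition is_iteration ::
  "nat \<Rightarrow> real \<Rightarrow> (nat \<Rightarrow> 'a::{real_inner, banach} set) \<Rightarrow> (nat \<Rightarrow> 'a \<Rightarrow> ereal)
    \<Rightarrow> (nat \<Rightarrow> (nat \<Rightarrow> 'a) \<Rightarrow> 'a) \<Rightarrow> (nat \<Rightarrow> real) \<Rightarrow> (nat \<Rightarrow> nat \<Rightarrow> real)
    \<Rightarrow> (nat \<Rightarrow> nat \<Rightarrow> real \<Rightarrow> 'a) \<Rightarrow> (nat \<Rightarrow> nat \<Rightarrow> real \<Rightarrow> 'a) \<Rightarrow> (nat \<Rightarrow> real \<Rightarrow> 'a)
    \<Rightarrow> (nat \<Rightarrow> nat \<Rightarrow> real \<Rightarrow> 'a) \<Rightarrow> (nat \<Rightarrow> nat \<Rightarrow> real \<Rightarrow> 'a) \<Rightarrow> bool" where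
  "is_iteration m T H f B \<gamma> \<mu> b e x0 x y \<longleftrightarrow>
     (\<forall>i\<in>{1..m}. \<forall>t\<in>{0..T}. x i 0 t = x0 i t) \<and>
     (\<forall>n. \<forall>i\<in>{1..m}.
        is_unique_step T (H i) (f i) (\<gamma> n) (x i n)
          (\<lambda>t. B i (\<lambda>j\<in>{1..m}. x j n t) + b i n t) (e i n) (y i n) \<and>
        (\<forall>t\<in>{0..T}. x i (Suc n) t = \<mu> i n *\<^sub>R x i n t + (1 - \<mu> i n) *\<^sub>R y i n t))"

end

theory Submission
  imports Defs "HOL-Library.Diagonal_Subsequence" "HOL-Real_Asymp.Real_Asymp"
begin

text \<open>
  On \<open>L\<^sup>2([0,T]; H i)\<close> the operator \<open>A x = x' + \<partial>f(x)\<close> with periodic domain is maximally monotone: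
  \<open>\<integral>\<langle>x', x\<rangle> = 0\<close> for periodic \<open>x\<close> gives monotonicity, and the range condition is solved by implicit
  Euler steps that use the periodic shift. Testing with the difference quotient, cyclic monotonicity
  of \<open>\<partial>f\<close> bounds the derivative of the solution of \<open>y' + y/\<gamma> + \<partial>f(y) \<ni> g\<close> by the norm of \<open>g\<close>.

  The iteration is a relaxed forward-backward method for \<open>A + B\<close> with summable errors. The squared
  distances to a solution form a quasi-Fejer sequence, so \<open>B x\<^sub>n\<close> converges strongly and
  \<open>x\<^sub>n - y\<^sub>n\<close> tends to \<open>0\<close>; by weak-strong closedness of the graph of \<open>A\<close> every weak cluster point
  solves the problem, and Opial's argument yields weak convergence in \<open>L\<^sup>2\<close>. The bound on \<open>y\<^sub>n'\<close>
  bounds \<open>x\<^sub>n'\<close>, which upgrades this to weak convergence in \<open>W\<^sup>1\<^sup>,\<^sup>2\<close>.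
\<close>

section \<open>Proximal points and weak convergence in Hilbert spaces\<close>

text \<open>The spaces may be nonseparable. Measurability is therefore carried by approximation with
  simple functions (\<open>smeas\<close>), and a vector integral is evaluated by pairing it with a
  fixed vector, which makes it a Lebesgue integral of a real function; the null sets depending on
  that vector are merged through the separable range. Square-integrable classes form a type
  \<open>'a L2\<close> of class \<open>{real_inner, banach}\<close>, in which the classes with
  values in \<open>H i\<close> are a closed subspace, so that orthogonal projection, the Riesz
  theorem and weak compactness, all resting on proximal points, apply there.

  The chain rule for \<open>f\<close> along \<open>y\<close>, the usual source of the derivative
  bound, would differentiate a merely lower semicontinuous function. Instead the difference quotient
  is taken with the shift by \<open>T / N\<close> on the circle. Its \<open>N\<close>-th iterate is
  the identity almost everywhere, so cyclic monotonicity of the subdifferential takes the place of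
  the chain rule, and periodicity is built in from the start.\<close>

definition epi :: "'a::{real_inner, banach} set \<Rightarrow> ('a \<Rightarrow> ereal) \<Rightarrow> ('a \<times> real) set" where
  "epi H f = {(p, r). p \<in> H \<and> f p \<le> ereal r}"

lemma epi_convex:
  assumes "f \<in> Gamma0 H" "subspace H" "(p, r) \<in> epi H f" "(q, s) \<in> epi H f" "0 < a" "a < 1"
  shows "(a *\<^sub>R p + (1 - a) *\<^sub>R q, a * r + (1 - a) * s) \<in> epi H f"
proof -
  have H: "p \<in> H" "q \<in> H" "f p \<le> ereal r" "f q \<le> ereal s" using assms by (auto simp: epi_def)
  have "f (a *\<^sub>R p + (1 - a) *\<^sub>R q) \<le> ereal a * f p + ereal (1 - a) * f q"
    using assms H by (auto simp: Gamma0_def)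
  also have "\<dots> \<le> ereal a * ereal r + ereal (1 - a) * ereal s"
    using H assms by (intro add_mono ereal_mult_left_mono) auto
  finally show ?thesis using H assms by (auto simp: epi_def subspace_add subspace_scale)
qed

lemma epi_closed:
  assumes f: "f \<in> Gamma0 H" and "p \<in> H" and e: "\<And>n. (P n, R n) \<in> epi H f"
    and P: "P \<longlonglongrightarrow> p" and R: "R \<longlonglongrightarrow> r"
  shows "(p, r) \<in> epi H f"
proof (rule ccontr)
  assume "(p, r) \<notin> epi H f"
  then have "ereal r < f p" using \<open>p \<in> H\<close> by (auto simp: epi_def)
  then obtain s where s: "ereal r < ereal s" "ereal s < f p" using ereal_dense2 by blast
  have "\<forall>\<^sub>F y in at p within H. ereal s < f y"
    using f \<open>p \<in> H\<close> s by (auto simp: Gamma0_def)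
  then obtain d where d: "d > 0" "\<And>y. y \<in> H \<Longrightarrow> y \<noteq> p \<Longrightarrow> dist y p < d \<Longrightarrow> ereal s < f y"
    unfolding eventually_at by blast
  have "\<forall>\<^sub>F n in sequentially. dist (P n) p < d" using P d(1) by (simp add: tendsto_iff)
  moreover have "\<forall>\<^sub>F n in sequentially. R n < s" using R s by (intro order_tendstoD) auto
  ultimately have "\<forall>\<^sub>F n in sequentially. False"
  proof eventually_elim
    case (elim n)
    have "P n \<in> H" "f (P n) \<le> ereal (R n)" using e[of n] by (auto simp: epi_def)
    moreover have "ereal s < f (P n)" using d(2)[of "P n"] elim s \<open>P n \<in> H\<close> by (cases "P n = p") auto
    ultimately have "ereal s < ereal (R n)" by (meson less_le_trans)
    then show False using elim by simp
  qed
  then show False by simp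
qed

text \<open>Lower semicontinuity at one point \<open>p0\<close> of the domain bounds
  \<open>f\<close> from below on a ball of radius \<open>d\<close>. A point outside the ball with
  too small a value would, by convexity along the segment to \<open>p0\<close>, produce a violation
  inside the ball. The minorant is linear in the norm, hence dominated by any quadratic.\<close>

lemma epi_lower_bound:
  assumes f: "f \<in> Gamma0 H" and H: "subspace H"
  shows "\<exists>p0 a b. 0 \<le> b \<and> (\<forall>(p, r) \<in> epi H f. a - b * norm (p - p0) \<le> r)"
proof -
  obtain p0 where p0: "p0 \<in> H" "f p0 \<noteq> \<infinity>" "f p0 \<noteq> -\<infinity>" using f by (auto simp: Gamma0_def)
  then obtain s0 where s0: "f p0 = ereal s0" by (cases "f p0") auto
  define r0 where "r0 = s0 - 1"
  have "\<forall>\<^sub>F y in at p0 within H. ereal r0 < f y"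
    using f p0(1) s0 by (auto simp: Gamma0_def r0_def)
  then obtain d where d: "d > 0" "\<And>y. y \<in> H \<Longrightarrow> y \<noteq> p0 \<Longrightarrow> dist y p0 < d \<Longrightarrow> ereal r0 < f y"
    unfolding eventually_at by blast
  have d': "ereal r0 < f y" if "y \<in> H" "dist y p0 < d" for y
    using that d(2)[of y] s0 by (cases "y = p0") (auto simp: r0_def)
  have "r0 - (2 / d) * norm (p - p0) \<le> r" if pr: "(p, r) \<in> epi H f" for p r
  proof (cases "norm (p - p0) < d")
    case True
    have "ereal r0 < f p" using True pr d'[of p] by (auto simp: epi_def dist_norm)
    also have "f p \<le> ereal r" using pr by (auto simp: epi_def)
    finally show ?thesis using d(1) by (smt (verit) divide_nonneg_pos ereal_less_le less_ereal.simps(1) mult_nonneg_nonneg norm_ge_zero)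
  next
    case False
    define n where "n = norm (p - p0)"
    have n: "n \<ge> d" "n > 0" using False d(1) by (auto simp: n_def)
    \<comment> \<open>This weight puts \<open>q\<close> at distance \<open>d / 2\<close> from
      \<open>p0\<close>, inside the ball.\<close>
    define a where "a = d / (2 * n)"
    have a: "0 < a" "a < 1" using n d(1) by (auto simp: a_def divide_simps)
    define q where "q = a *\<^sub>R p + (1 - a) *\<^sub>R p0"
    have qE: "(q, a * r + (1 - a) * s0) \<in> epi H f"
      unfolding q_def using epi_convex[OF f H pr _ a, of p0 s0] p0(1) s0 by (auto simp: epi_def)
    have "q - p0 = a *\<^sub>R (p - p0)" by (simp add: q_def algebra_simps)
    then have "norm (q - p0) = a * n" using a by (simp add: n_def)
    also have "\<dots> < d" using n d(1) by (simp add: a_def)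
    finally have "ereal r0 < f q" using qE d'[of q] by (auto simp: epi_def dist_norm)
    also have "f q \<le> ereal (a * r + (1 - a) * s0)" using qE by (auto simp: epi_def)
    finally have "r0 < a * r + (1 - a) * s0" by simp
    then have "a * (s0 - r) < 1" by (simp add: r0_def algebra_simps)
    then have "s0 - r < 1 / a" using a by (simp add: field_simps)
    also have "1 / a = (2 / d) * n" using n d by (simp add: a_def)
    finally show ?thesis by (simp add: r0_def n_def)
  qed
  then show ?thesis using d(1) by (intro exI[of _ p0] exI[of _ r0] exI[of _ "2/d"]) auto
qed

lemma norm_add_scale_sq:
  fixes x y :: "'a::real_inner"
  shows "(norm (x + t *\<^sub>R y))\<^sup>2 = (norm x)\<^sup>2 + 2 * t * (x \<bullet> y) + t\<^sup>2 * (norm y)\<^sup>2"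
  unfolding power2_norm_eq_inner
  by (simp add: inner_add_left inner_add_right inner_commute power2_eq_square algebra_simps)

lemma midpoint_norm_sq:
  fixes x y :: "'a::real_inner"
  shows "(norm ((1/2) *\<^sub>R x + (1/2) *\<^sub>R y))\<^sup>2 = (norm x)\<^sup>2 / 2 + (norm y)\<^sup>2 / 2 - (norm (x - y))\<^sup>2 / 4"
  by (simp add: power2_norm_eq_inner inner_add_left inner_add_right inner_diff_left inner_diff_right inner_commute field_simps)

text \<open>\<open>p\<close> minimises \<open>f p + (norm (p - x))^2 / (2 c)\<close>. The
  minimisation runs over pairs in the epigraph, so that infinite values never enter the arithmetic.
  Minimising sequences are Cauchy by the parallelogram identity, and the subgradient is the
  first-order optimality condition.\<close>

lemma prox_exists:
  fixes H :: "'a::{real_inner, banach} set"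
  assumes f: "f \<in> Gamma0 H" and HH: "hilbert_subspace H" and x: "x \<in> H" and c: "c > 0"
  shows "\<exists>p\<in>H. (1 / c) *\<^sub>R (x - p) \<in> subdiff H f p"
proof -
  have H: "subspace H" "closed H" using HH by (auto simp: hilbert_subspace_def)
  define Q :: "'a \<times> real \<Rightarrow> real" where "Q = (\<lambda>(p, r). r + (norm (p - x))\<^sup>2 / (2 * c))"
  let ?E = "epi H f"
  obtain p0 a b where b: "0 \<le> b" "\<And>p r. (p, r) \<in> ?E \<Longrightarrow> a - b * norm (p - p0) \<le> r"
    using epi_lower_bound[OF f H(1)] by fast
  \<comment> \<open>Completing the square: the quadratic term beats the linear decay of
    \<open>epi_lower_bound\<close>, and the worst case is \<open>n = c * b\<close>.\<close>
  have lb: "a - b * norm (x - p0) - c * b\<^sup>2 / 2 \<le> Q e" if "e \<in> ?E" for e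
  proof (cases e)
    case (Pair p r)
    define n where "n = norm (p - x)"
    have "norm (p - p0) \<le> n + norm (x - p0)" unfolding n_def using norm_triangle_ineq[of "p - x" "x - p0"] by simp
    then have "a - b * (n + norm (x - p0)) \<le> r"
      using b(2)[of p r] that Pair b(1) by (smt (verit) mult_left_mono)
    moreover have "0 \<le> (n - c * b)\<^sup>2 / (2 * c)" using c by simp
    moreover have "(n - c * b)\<^sup>2 / (2 * c) = n\<^sup>2 / (2 * c) - b * n + c * b\<^sup>2 / 2"
      using c by (simp add: power2_eq_square field_simps)
    ultimately show ?thesis unfolding Q_def Pair by (simp add: n_def algebra_simps)
  qed
  obtain pp where "pp \<in> H" "f pp \<noteq> \<infinity>" "f pp \<noteq> -\<infinity>" using f by (auto simp: Gamma0_def)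
  then have "(pp, real_of_ereal (f pp)) \<in> ?E" by (cases "f pp") (auto simp: epi_def)
  then obtain e0 where e0: "e0 \<in> ?E" by blast
  define \<mu> where "\<mu> = Inf (Q ` ?E)"
  have bdd: "bdd_below (Q ` ?E)" by (rule bdd_belowI2, rule lb)
  have mu: "\<mu> \<le> Q e" if "e \<in> ?E" for e unfolding \<mu>_def using that bdd by (simp add: cInf_lower)
  have "\<exists>e\<in>?E. Q e < \<mu> + 1 / Suc n" for n
  proof -
    have "Inf (Q ` ?E) < \<mu> + 1 / Suc n" by (simp add: \<mu>_def)
    then show ?thesis using cInf_lessD[of "Q ` ?E"] e0 by blast
  qed
  then obtain e where e: "\<And>n. e n \<in> ?E" "\<And>n. Q (e n) < \<mu> + 1 / Suc n" by metis
  define P R where "P = (\<lambda>n. fst (e n))" and "R = (\<lambda>n. snd (e n))"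
  have PR: "e n = (P n, R n)" for n by (simp add: P_def R_def)
  have PH: "P n \<in> H" for n using e(1)[of n] by (auto simp: PR epi_def)
  \<comment> \<open>The midpoint of two almost minimal pairs is again in the epigraph, so its value
    is at least \<open>\<mu>\<close>; the defect in the midpoint identity then bounds the
    distance.\<close>
  have close: "(norm (P n - P k))\<^sup>2 \<le> 4 * c * (1 / Suc n + 1 / Suc k)" for n k
  proof -
    have "((1/2) *\<^sub>R P n + (1 - 1/2) *\<^sub>R P k, 1/2 * R n + (1 - 1/2) * R k) \<in> ?E"
      using e(1)[of n] e(1)[of k] by (intro epi_convex[OF f H(1)]) (auto simp: PR)
    from mu[OF this] have "\<mu> \<le> 1/2 * R n + 1/2 * R k + (norm ((1/2) *\<^sub>R P n + (1/2) *\<^sub>R P k - x))\<^sup>2 / (2 * c)"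
      by (simp add: Q_def)
    also have "(1/2) *\<^sub>R P n + (1/2) *\<^sub>R P k - x = (1/2) *\<^sub>R (P n - x) + (1/2) *\<^sub>R (P k - x)"
      by (simp add: algebra_simps) (metis scaleR_half_double scaleR_add_right)
    also have "(norm \<dots>)\<^sup>2 = (norm (P n - x))\<^sup>2 / 2 + (norm (P k - x))\<^sup>2 / 2 - (norm (P n - P k))\<^sup>2 / 4"
      by (subst midpoint_norm_sq) simp
    finally have "\<mu> \<le> (Q (e n) + Q (e k)) / 2 - (norm (P n - P k))\<^sup>2 / (8 * c)"
      by (simp add: Q_def PR add_divide_distrib diff_divide_distrib)
    then have "(norm (P n - P k))\<^sup>2 / (8 * c) \<le> (1 / Suc n + 1 / Suc k) / 2" using e(2)[of n] e(2)[of k] by argo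
    then have "(norm (P n - P k))\<^sup>2 \<le> (1 / Suc n + 1 / Suc k) / 2 * (8 * c)"
      using c by (simp only: pos_divide_le_eq)
    moreover have "a / 2 * (8 * c) = 4 * c * a" for a :: real by simp
    ultimately show ?thesis by metis
  qed
  have "Cauchy P"
  proof (rule metric_CauchyI)
    fix \<epsilon> :: real assume \<epsilon>: "\<epsilon> > 0"
    obtain N where N: "8 * c / \<epsilon>\<^sup>2 < real N" using reals_Archimedean2 by blast
    show "\<exists>M. \<forall>m\<ge>M. \<forall>n\<ge>M. dist (P m) (P n) < \<epsilon>"
    proof (intro exI[of _ N] allI impI)
      fix m n assume mn: "m \<ge> N" "n \<ge> N"
      have "real N > 0" using N c \<epsilon> by (smt (verit) divide_pos_pos zero_less_power)
      have "1 / Suc m < 1 / N" "1 / Suc n < 1 / N" using mn \<open>real N > 0\<close>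
        by (simp_all add: frac_less2)
      then have "1 / Suc m + 1 / Suc n < 2 / N" by linarith
      then have "4 * c * (1 / Suc m + 1 / Suc n) < 4 * c * (2 / N)"
        using c by (intro mult_strict_left_mono) auto
      also have "\<dots> < \<epsilon>\<^sup>2" using N \<epsilon> \<open>real N > 0\<close> by (simp add: field_simps)
      finally have "(norm (P m - P n))\<^sup>2 < \<epsilon>\<^sup>2" using close[of m n] by linarith
      then show "dist (P m) (P n) < \<epsilon>" using \<epsilon> by (simp add: dist_norm power2_less_imp_less)
    qed
  qed
  then obtain p where p: "P \<longlonglongrightarrow> p" using Cauchy_convergent_iff convergent_def by blast
  have pH: "p \<in> H" using closed_sequentially[OF H(2)] PH p by blast
  have "(\<lambda>n. \<mu> + 1 / Suc n) \<longlonglongrightarrow> \<mu> + 0"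
    using LIMSEQ_inverse_real_of_nat by (intro tendsto_add tendsto_const) (simp add: inverse_eq_divide)
  then have lim: "(\<lambda>n. \<mu> + 1 / Suc n) \<longlonglongrightarrow> \<mu>" by simp
  have QL: "(\<lambda>n. Q (e n)) \<longlonglongrightarrow> \<mu>"
    by (rule tendsto_sandwich[OF _ _ tendsto_const lim]) (intro always_eventually allI mu e less_imp_le)+
  \<comment> \<open>\<open>r\<close> is the limit of the heights \<open>R\<close>, not the value of
    \<open>f\<close>; closedness of the epigraph yields \<open>f p \<le> ereal r\<close>, the
    direction used in the subgradient inequality.\<close>
  define r where "r = \<mu> - (norm (p - x))\<^sup>2 / (2 * c)"
  have "(\<lambda>n. Q (e n) - (norm (P n - x))\<^sup>2 / (2 * c)) \<longlonglongrightarrow> r"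
    unfolding r_def by (intro tendsto_intros QL p) (use c in auto)
  then have "R \<longlonglongrightarrow> r" by (simp add: Q_def PR)
  then have prE: "(p, r) \<in> ?E" using epi_closed[OF f pH _ p, of R r] e(1) unfolding PR by blast
  have "ereal ((y - p) \<bullet> ((1 / c) *\<^sub>R (x - p))) + f p \<le> f y" if y: "y \<in> H" for y
  proof (cases "f y = \<infinity>")
    case True then show ?thesis by simp
  next
    case False
    then obtain s where s: "f y = ereal s" using f y by (cases "f y") (auto simp: Gamma0_def)
    then have ysE: "(y, s) \<in> ?E" using y by (auto simp: epi_def)
    define A B where "A = (y - p) \<bullet> (x - p)" and "B = (norm (y - p))\<^sup>2"
    \<comment> \<open>The minimum is compared with the point at parameter \<open>t\<close> on the
      segment towards \<open>(y, s)\<close>; after division by \<open>t\<close> the quadratic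
      remainder vanishes as \<open>t\<close> tends to 0.\<close>
    have *: "r - s \<le> - A / c + t * (B / (2 * c))" if t: "0 < t" "t < 1" for t
    proof -
      have "(t *\<^sub>R y + (1 - t) *\<^sub>R p, t * s + (1 - t) * r) \<in> ?E"
        using epi_convex[OF f H(1) ysE prE t] .
      from mu[OF this] have "\<mu> \<le> t * s + (1 - t) * r + (norm (t *\<^sub>R y + (1 - t) *\<^sub>R p - x))\<^sup>2 / (2 * c)"
        by (simp add: Q_def)
      also have "t *\<^sub>R y + (1 - t) *\<^sub>R p - x = (p - x) + t *\<^sub>R (y - p)" by (simp add: algebra_simps)
      also have "(norm \<dots>)\<^sup>2 = (norm (p - x))\<^sup>2 - 2 * t * A + t\<^sup>2 * B"
      proof -
        have "(p - x) \<bullet> (y - p) = - A"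
          unfolding A_def by (metis inner_commute inner_minus_right minus_diff_eq)
        then show ?thesis using norm_add_scale_sq[of "p - x" t "y - p"] unfolding B_def by simp
      qed
      finally have "t * (r - s) \<le> (- 2 * t * A + t\<^sup>2 * B) / (2 * c)"
        using c by (simp add: r_def field_simps)
      also have "\<dots> = t * (- A / c + t * (B / (2 * c)))" using c by (simp add: field_simps power2_eq_square)
      finally show ?thesis using t by simp
    qed
    have "((\<lambda>t. - A / c + t * (B / (2 * c))) \<longlongrightarrow> - A / c + 0 * (B / (2 * c))) (at_right 0)"
      by (intro tendsto_intros)
    moreover have "\<forall>\<^sub>F t in at_right 0. r - s \<le> - A / c + t * (B / (2 * c))"
      unfolding eventually_at_right_field using * by (intro exI[of _ 1]) auto
    ultimately have "r - s \<le> - A / c + 0 * (B / (2 * c))"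
      by (intro tendsto_lowerbound[where F="at_right 0"]) auto
    then have "A / c + r \<le> s" by simp
    have "ereal ((y - p) \<bullet> ((1 / c) *\<^sub>R (x - p))) + f p \<le> ereal (A / c) + ereal r"
      using prE by (intro add_mono) (auto simp: epi_def A_def)
    also have "\<dots> \<le> f y" using \<open>A / c + r \<le> s\<close> s by simp
    finally show ?thesis .
  qed
  moreover have "(1 / c) *\<^sub>R (x - p) \<in> H" using x pH H(1) by (simp add: subspace_diff subspace_scale)
  ultimately show ?thesis using pH by (auto simp: subdiff_def)
qed

lemma hilbert_UNIV: "hilbert_subspace UNIV"
  by (simp add: hilbert_subspace_def)

text \<open>The proximal point with parameter 1 of the indicator function of \<open>M\<close> is the
  nearest point of \<open>M\<close>. Its subgradient inequality, tested at \<open>p + y\<close> and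
  \<open>p - y\<close>, becomes orthogonality.\<close>

lemma orthogonal_projection_exists:
  fixes M :: "'a::{real_inner, banach} set"
  assumes M: "hilbert_subspace M"
  shows "\<exists>p\<in>M. \<forall>y\<in>M. (x - p) \<bullet> y = 0"
proof -
  have sM: "subspace M" "closed M" using M by (auto simp: hilbert_subspace_def)
  define f where "f = (\<lambda>p. if p \<in> M then 0 else \<infinity> :: ereal)"
  have conv: "f (a *\<^sub>R x + (1 - a) *\<^sub>R y) \<le> ereal a * f x + ereal (1 - a) * f y" if a: "a \<in> {0<..<1}" for x y a
    using a sM(1) by (auto simp: f_def subspace_add subspace_scale)
  have lsc: "\<forall>\<^sub>F y in at x. r < f y" if "r < f x" for x r
  proof (cases "x \<in> M")
    case True
    then show ?thesis using that by (intro always_eventually) (auto simp: f_def)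
  next
    case False
    then have "\<forall>\<^sub>F y in at x. y \<in> - M" using sM(2) by (metis ComplI eventually_at_topological open_Compl)
    then show ?thesis by eventually_elim (use that False in \<open>auto simp: f_def\<close>)
  qed
  have f: "f \<in> Gamma0 UNIV"
    using conv lsc subspace_0[OF sM(1)] unfolding Gamma0_def by (auto simp: f_def)
  obtain p where p: "(1 / 1) *\<^sub>R (x - p) \<in> subdiff UNIV f p"
    using prox_exists[OF f hilbert_UNIV, of x 1] by auto
  have le: "ereal ((y - p) \<bullet> (x - p)) + f p \<le> f y" for y using p by (auto simp: subdiff_def)
  have pM: "p \<in> M" using le[of 0] subspace_0[OF sM(1)] by (auto simp: f_def split: if_splits)
  have le': "(y - p) \<bullet> (x - p) \<le> 0" if "y \<in> M" for y using le[of y] that pM by (simp add: f_def)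
  have "(x - p) \<bullet> y = 0" if y: "y \<in> M" for y
    using le'[of "p + y"] le'[of "p - y"] y pM sM(1) by (simp add: subspace_add subspace_diff inner_commute)
  then show ?thesis using pM by auto
qed

text \<open>The proximal point of \<open>- L\<close> at the origin with parameter 1 minimises
  \<open>(norm p)^2 / 2 - L p\<close>, and this minimiser is the representing vector: the
  subgradient inequality holds for \<open>y\<close> and \<open>- y\<close> and is thus an
  equality.\<close>

lemma riesz_representation:
  fixes L :: "'a::{real_inner, banach} \<Rightarrow> real"
  assumes L: "bounded_linear L"
  shows "\<exists>p. \<forall>y. L y = p \<bullet> y"
proof -
  interpret bounded_linear L by fact
  define f where "f = (\<lambda>x. ereal (- L x))"
  have f: "f \<in> Gamma0 UNIV"
  proof -
    have "\<forall>\<^sub>F y in at x. r < f y" if "r < f x" for x r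
    proof -
      have "isCont (\<lambda>x. ereal (- L x)) x" by (intro continuous_intros) (rule L[THEN linear_continuous_at])
      then have "((\<lambda>x. ereal (- L x)) \<longlongrightarrow> f x) (at x)" by (simp add: isCont_def f_def)
      from order_tendstoD(1)[OF this that] show ?thesis by (simp add: f_def)
    qed
    then show ?thesis unfolding Gamma0_def by (auto simp: f_def add scaleR)
  qed
  obtain p where p: "(1 / 1) *\<^sub>R (0 - p) \<in> subdiff UNIV f p"
    using prox_exists[OF f hilbert_UNIV, of 0 1] by auto
  have le: "L (y - p) \<le> (y - p) \<bullet> p" for y
  proof -
    have "- ((y - p) \<bullet> p) - L p \<le> - L y" using p by (auto simp: subdiff_def f_def)
    then show ?thesis by (simp add: diff)
  qed
  have "L y \<le> y \<bullet> p" for y using le[of "p + y"] by simp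
  from this[of "y" for y] this[of "- y" for y] have "L y = y \<bullet> p" for y
    by (smt (verit) neg inner_minus_left)
  then show ?thesis by (auto simp: inner_commute)
qed

section \<open>Weak convergence and weak sequential compactness\<close>

definition wconv :: "(nat \<Rightarrow> 'a::real_inner) \<Rightarrow> 'a \<Rightarrow> bool" where
  "wconv X l \<longleftrightarrow> (\<forall>w. (\<lambda>n. X n \<bullet> w) \<longlonglongrightarrow> l \<bullet> w)"

lemma wconv_subseq: "wconv X l \<Longrightarrow> strict_mono r \<Longrightarrow> wconv (X \<circ> r) l"
  unfolding wconv_def using LIMSEQ_subseq_LIMSEQ by (fastforce simp: comp_def)

lemma wconv_unique: "wconv X l \<Longrightarrow> wconv X l' \<Longrightarrow> l = l'"
  unfolding wconv_def by (metis LIMSEQ_unique vector_eq_rdot)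

lemma wconv_diff: "wconv X l \<Longrightarrow> wconv Y k \<Longrightarrow> wconv (\<lambda>n. X n - Y n) (l - k)"
  unfolding wconv_def by (auto simp: inner_diff_left intro: tendsto_diff)

lemma tendsto_imp_wconv: "X \<longlonglongrightarrow> l \<Longrightarrow> wconv X l"
  unfolding wconv_def by (auto intro: tendsto_inner)

text \<open>The sequence is tested with its own limit.\<close>

lemma wconv_norm_le:
  assumes "wconv X l" "\<And>n. norm (X n) \<le> C"
  shows "norm l \<le> C"
proof -
  have C: "C \<ge> 0" using assms(2)[of 0] norm_ge_zero order_trans by blast
  have "(\<lambda>n. X n \<bullet> l) \<longlonglongrightarrow> l \<bullet> l" using assms(1) by (simp add: wconv_def)
  moreover have "X n \<bullet> l \<le> C * norm l" for n
    using norm_cauchy_schwarz[of "X n" l] assms(2)[of n] by (smt (verit) mult_right_mono norm_ge_zero)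
  ultimately have "l \<bullet> l \<le> C * norm l" by (intro LIMSEQ_le_const2) auto
  then have "norm l * norm l \<le> C * norm l" by (metis power2_eq_square power2_norm_eq_inner)
  then show ?thesis using C by (cases "l = 0") auto
qed

text \<open>Splitting off \<open>Y n - y\<close> leaves a term that is small in norm paired with a
  bounded sequence, and a term with a fixed test vector.\<close>

lemma wconv_inner_strong:
  assumes "wconv X l" "\<And>n. norm (X n) \<le> C" "Y \<longlonglongrightarrow> y"
  shows "(\<lambda>n. X n \<bullet> Y n) \<longlonglongrightarrow> l \<bullet> y"
proof -
  have "(\<lambda>n. C * norm (Y n - y)) \<longlonglongrightarrow> C * norm (y - y)" by (intro tendsto_intros assms)
  then have null: "(\<lambda>n. C * norm (Y n - y)) \<longlonglongrightarrow> 0" by simp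
  have "norm (X n \<bullet> (Y n - y)) \<le> C * norm (Y n - y)" for n
    using Cauchy_Schwarz_ineq2[of "X n" "Y n - y"] assms(2)[of n]
    by simp (meson mult_right_mono norm_ge_zero order_trans)
  then have "(\<lambda>n. X n \<bullet> (Y n - y)) \<longlonglongrightarrow> 0"
    by (intro Lim_null_comparison[OF _ null] always_eventually allI)
  moreover have "(\<lambda>n. X n \<bullet> y) \<longlonglongrightarrow> l \<bullet> y" using assms(1) by (simp add: wconv_def)
  ultimately have "(\<lambda>n. X n \<bullet> (Y n - y) + X n \<bullet> y) \<longlonglongrightarrow> 0 + l \<bullet> y" by (rule tendsto_add)
  then show ?thesis by (simp add: inner_diff_right)
qed

text \<open>The component of the limit orthogonal to \<open>M\<close> is a legitimate test vector
  and annihilates every \<open>X n\<close>.\<close>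

lemma wconv_closed_subspace:
  fixes M :: "'a::{real_inner, banach} set"
  assumes "hilbert_subspace M" "wconv X l" "\<And>n. X n \<in> M"
  shows "l \<in> M"
proof -
  obtain p where p: "p \<in> M" "\<And>y. y \<in> M \<Longrightarrow> (l - p) \<bullet> y = 0"
    using orthogonal_projection_exists[OF assms(1)] by metis
  have "(\<lambda>n. X n \<bullet> (l - p)) \<longlonglongrightarrow> l \<bullet> (l - p)" using assms(2) by (simp add: wconv_def)
  moreover have "X n \<bullet> (l - p) = 0" for n using p(2)[OF assms(3)] by (simp add: inner_commute)
  ultimately have "l \<bullet> (l - p) = 0" by (simp add: LIMSEQ_const_iff)
  moreover have "p \<bullet> (l - p) = 0" using p by (metis inner_commute)
  ultimately have "(l - p) \<bullet> (l - p) = 0" by (simp add: inner_diff_left)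
  then show ?thesis using p by simp
qed

text \<open>A diagonal sequence makes the products with every \<open>x m\<close> converge. The
  vectors whose products converge form a closed subspace containing all \<open>x m\<close>; vectors
  orthogonal to the sequence belong to it as well, because their products vanish. Hence the products
  with every vector converge, also in a nonseparable space, and the Riesz theorem supplies the
  limit.\<close>

lemma weak_compactness:
  fixes x :: "nat \<Rightarrow> 'a::{real_inner, banach}"
  assumes bd: "\<And>n. norm (x n) \<le> C"
  shows "\<exists>r l. strict_mono r \<and> wconv (x \<circ> r) l"
proof -
  have C: "C \<ge> 0" using bd[of 0] norm_ge_zero order_trans by blast
  interpret subseqs "\<lambda>m s. convergent (\<lambda>k. x (s k) \<bullet> x m)"
  proof
    fix n and s :: "nat \<Rightarrow> nat"
    have "norm (x (s k) \<bullet> x n) \<le> C * C" for k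
      using Cauchy_Schwarz_ineq2[of "x (s k)" "x n"] bd[of "s k"] bd[of n] C
      by (simp) (meson mult_mono norm_ge_zero order_trans)
    then have "bounded (range (\<lambda>k. x (s k) \<bullet> x n))" unfolding bounded_iff by (intro exI[of _ "C * C"]) blast
    then obtain l r where "strict_mono r" "((\<lambda>k. x (s k) \<bullet> x n) \<circ> r) \<longlonglongrightarrow> l"
      using bounded_imp_convergent_subsequence by blast
    then show "\<exists>r'. strict_mono r' \<and> convergent (\<lambda>k. x ((s \<circ> r') k) \<bullet> x n)"
      by (auto simp: comp_def convergent_def)
  qed
  let ?r = "diagseq"
  have r: "strict_mono ?r" by (rule subseq_diagseq)
  \<comment> \<open>Only the tail of the diagonal sequence refines stage \<open>m\<close>, hence the
    shift by \<open>Suc m\<close>.\<close>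
  have conv_gen: "convergent (\<lambda>k. x (?r k) \<bullet> x m)" for m
  proof -
    have "convergent (\<lambda>k. x ((?r \<circ> (+) (Suc m)) k) \<bullet> x m)"
    proof (rule diagseq_holds)
      fix n s and r :: "nat \<Rightarrow> nat" assume "strict_mono r" "convergent (\<lambda>k. x (s k) \<bullet> x n)"
      then show "convergent (\<lambda>k. x ((s \<circ> r) k) \<bullet> x n)"
        using convergent_subseq_convergent[of "\<lambda>k. x (s k) \<bullet> x n" r] by (simp add: comp_def)
    qed
    then have "convergent (\<lambda>k. x (?r (k + Suc m)) \<bullet> x m)" by (simp add: comp_def add.commute)
    then show ?thesis using convergent_ignore_initial_segment[of "\<lambda>k. x (?r k) \<bullet> x m" "Suc m"] by simp
  qed
  define S where "S = {w. convergent (\<lambda>k. x (?r k) \<bullet> w)}"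
  have subS: "subspace S" unfolding S_def subspace_def
    by (auto simp: inner_add_right convergent_const intro!: convergent_add convergent_mult)
  have clS: "closed S"
  proof (unfold closed_sequential_limits, intro allI impI, elim conjE)
    fix W w assume W: "\<forall>n. W n \<in> S" "W \<longlonglongrightarrow> w"
    have "Cauchy (\<lambda>k. x (?r k) \<bullet> w)"
    proof (rule metric_CauchyI)
      fix e :: real assume e: "e > 0"
      have "\<forall>\<^sub>F n in sequentially. dist (W n) w < e / (3 * (C + 1))" using W(2) e C by (simp add: tendsto_iff)
      then obtain n where n: "dist (W n) w < e / (3 * (C + 1))" using eventually_happens by fastforce
      have cl: "\<bar>x k \<bullet> w - x k \<bullet> W n\<bar> < e / 3" for k
      proof -
        have "\<bar>x k \<bullet> w - x k \<bullet> W n\<bar> \<le> norm (x k) * norm (w - W n)"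
          using Cauchy_Schwarz_ineq2[of "x k" "w - W n"] by (simp add: inner_diff_right)
        also have "\<dots> \<le> (C + 1) * norm (w - W n)" using bd[of k] by (intro mult_right_mono) auto
        also have "\<dots> < (C + 1) * (e / (3 * (C + 1)))"
          using n C by (intro mult_strict_left_mono) (auto simp: dist_norm norm_minus_commute)
        also have "\<dots> = e / 3" using C by (simp add: divide_simps)
        finally show ?thesis .
      qed
      have "Cauchy (\<lambda>k. x (?r k) \<bullet> W n)" using W(1) by (auto simp: S_def intro: convergent_Cauchy)
      then obtain M where M: "\<And>a b. a \<ge> M \<Longrightarrow> b \<ge> M \<Longrightarrow> dist (x (?r a) \<bullet> W n) (x (?r b) \<bullet> W n) < e / 3"
        using metric_CauchyD[of "\<lambda>k. x (?r k) \<bullet> W n" "e / 3"] e by auto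
      show "\<exists>M. \<forall>m\<ge>M. \<forall>n\<ge>M. dist (x (?r m) \<bullet> w) (x (?r n) \<bullet> w) < e"
      proof (intro exI[of _ M] allI impI)
        fix a b assume "a \<ge> M" "b \<ge> M"
        from M[OF this] cl[of "?r a"] cl[of "?r b"] show "dist (x (?r a) \<bullet> w) (x (?r b) \<bullet> w) < e"
          unfolding dist_real_def by linarith
      qed
    qed
    then show "w \<in> S" by (simp add: S_def Cauchy_convergent)
  qed
  have S_UNIV: "w \<in> S" for w
  proof -
    obtain p where p: "p \<in> S" "\<And>y. y \<in> S \<Longrightarrow> (w - p) \<bullet> y = 0"
      using orthogonal_projection_exists[of S w] subS clS by (auto simp: hilbert_subspace_def)
    have "x m \<in> S" for m using conv_gen by (simp add: S_def)
    then have "x m \<bullet> (w - p) = 0" for m using p(2) by (simp add: inner_commute)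
    then have "w - p \<in> S" by (simp add: S_def convergent_const)
    then show ?thesis using p(1) subS by (metis diff_add_cancel subspace_add)
  qed
  define L where "L = (\<lambda>w. lim (\<lambda>k. x (?r k) \<bullet> w))"
  have L: "(\<lambda>k. x (?r k) \<bullet> w) \<longlonglongrightarrow> L w" for w
    using S_UNIV[of w] by (simp add: S_def L_def convergent_LIMSEQ_iff)
  have "bounded_linear L"
  proof (rule bounded_linear_intro[of _ C])
    fix a b and c :: real
    have "(\<lambda>k. x (?r k) \<bullet> a + x (?r k) \<bullet> b) \<longlonglongrightarrow> L a + L b" by (intro tendsto_add L)
    then show "L (a + b) = L a + L b" using L[of "a + b"] by (simp add: inner_add_right LIMSEQ_unique)
    have "(\<lambda>k. c * (x (?r k) \<bullet> a)) \<longlonglongrightarrow> c * L a" by (intro tendsto_mult_left L)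
    then show "L (c *\<^sub>R a) = c *\<^sub>R L a" using L[of "c *\<^sub>R a"] by (simp add: LIMSEQ_unique)
    have "(\<lambda>k. norm (x (?r k) \<bullet> a)) \<longlonglongrightarrow> norm (L a)" by (intro tendsto_norm L)
    moreover have "norm (x (?r k) \<bullet> a) \<le> norm a * C" for k
      using Cauchy_Schwarz_ineq2[of "x (?r k)" a] bd[of "?r k"]
      by (simp) (metis (no_types, lifting) mult.commute mult_left_mono norm_ge_zero order_trans)
    ultimately show "norm (L a) \<le> norm a * C" by (intro LIMSEQ_le_const2) auto
  qed
  then obtain l where "\<And>w. L w = l \<bullet> w" using riesz_representation by blast
  then show ?thesis using r L by (auto simp: wconv_def comp_def intro!: exI[of _ ?r])
qed

text \<open>A failure would leave a subsequence at distance \<open>e\<close> on one test vector; a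
  further weakly convergent subsequence of it has limit \<open>l\<close> by assumption, a
  contradiction.\<close>

lemma wconv_subseq_principle:
  fixes x :: "nat \<Rightarrow> 'a::{real_inner, banach}"
  assumes bd: "\<And>n. norm (x n) \<le> C"
    and u: "\<And>r k. strict_mono r \<Longrightarrow> wconv (x \<circ> r) k \<Longrightarrow> k = l"
  shows "wconv x l"
  unfolding wconv_def
proof (rule ccontr, simp, elim exE)
  fix w assume "\<not> (\<lambda>n. x n \<bullet> w) \<longlonglongrightarrow> l \<bullet> w"
  then obtain e where e: "e > 0" "\<not> (\<forall>\<^sub>F n in sequentially. dist (x n \<bullet> w) (l \<bullet> w) < e)"
    by (auto simp: tendsto_iff)
  then have "\<exists>\<^sub>F n in sequentially. \<not> dist (x n \<bullet> w) (l \<bullet> w) < e" by (simp add: not_eventually)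
  then have "infinite {n. \<not> dist (x n \<bullet> w) (l \<bullet> w) < e}"
    by (simp add: frequently_sequentially infinite_nat_iff_unbounded_le)
  then obtain r where r: "strict_mono (r :: nat \<Rightarrow> nat)" "\<And>n. \<not> dist (x (r n) \<bullet> w) (l \<bullet> w) < e"
    using infinite_enumerate by (metis (mono_tags, lifting) mem_Collect_eq)
  obtain s k where s: "strict_mono s" "wconv ((x \<circ> r) \<circ> s) k"
    using weak_compactness[of "x \<circ> r" C] bd by auto
  then have "k = l" using u[of "r \<circ> s"] r(1) by (simp add: strict_mono_o comp_assoc)
  with s have "(\<lambda>n. x (r (s n)) \<bullet> w) \<longlonglongrightarrow> l \<bullet> w" by (simp add: wconv_def)
  then have "\<forall>\<^sub>F n in sequentially. dist (x (r (s n)) \<bullet> w) (l \<bullet> w) < e" using e(1) by (simp add: tendsto_iff)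
  then show False using r(2) by simp
qed

section \<open>Strong measurability\<close>

text \<open>Bochner measurability for values in an arbitrary metric space. In this form it is
  preserved under sums, products and inner products, because continuous operations can be applied to
  the simple approximants.\<close>

definition smeas :: "'b measure \<Rightarrow> ('b \<Rightarrow> 'a::metric_space) \<Rightarrow> bool" where
  "smeas M x \<longleftrightarrow> (\<exists>s. (\<forall>n. simple_function M (s n)) \<and> (\<forall>t\<in>space M. (\<lambda>n. s n t) \<longlonglongrightarrow> x t))"

lemma smeasI: "(\<And>n. simple_function M (s n)) \<Longrightarrow> (\<And>t. t \<in> space M \<Longrightarrow> (\<lambda>n. s n t) \<longlonglongrightarrow> x t) \<Longrightarrow> smeas M x"
  unfolding smeas_def by blast

lemma smeas_cong: "(\<And>t. t \<in> space M \<Longrightarrow> x t = y t) \<Longrightarrow> smeas M x \<longleftrightarrow> smeas M y"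
  unfolding smeas_def by simp

lemma smeas_simple: "simple_function M x \<Longrightarrow> smeas M x"
  by (rule smeasI[of M "\<lambda>_. x"]) auto

lemma smeas_const: "smeas M (\<lambda>_. c)"
  by (intro smeas_simple simple_function_const)

lemma smeas_borel: "smeas M x \<Longrightarrow> x \<in> borel_measurable M"
  unfolding smeas_def using borel_measurable_LIMSEQ_metric borel_measurable_simple_function by metis

lemma smeas_compose_continuous:
  assumes "smeas M x" "continuous_on UNIV g"
  shows "smeas M (\<lambda>t. g (x t))"
proof -
  obtain s where s: "\<And>n. simple_function M (s n)" "\<And>t. t \<in> space M \<Longrightarrow> (\<lambda>n. s n t) \<longlonglongrightarrow> x t"
    using assms(1) unfolding smeas_def by blast
  show ?thesis
  proof (rule smeasI)
    show "simple_function M (\<lambda>t. g (s n t))" for n using s(1) by (rule simple_function_compose1)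
    show "(\<lambda>n. g (s n t)) \<longlonglongrightarrow> g (x t)" if "t \<in> space M" for t
      using s(2)[OF that] assms(2) by (intro continuous_on_tendsto_compose[of UNIV g]) auto
  qed
qed

lemma smeas_Pair:
  assumes "smeas M x" "smeas M y"
  shows "smeas M (\<lambda>t. (x t, y t))"
proof -
  obtain s where s: "\<And>n. simple_function M (s n)" "\<And>t. t \<in> space M \<Longrightarrow> (\<lambda>n. s n t) \<longlonglongrightarrow> x t"
    using assms(1) unfolding smeas_def by blast
  obtain r where r: "\<And>n. simple_function M (r n)" "\<And>t. t \<in> space M \<Longrightarrow> (\<lambda>n. r n t) \<longlonglongrightarrow> y t"
    using assms(2) unfolding smeas_def by blast
  show ?thesis
    by (rule smeasI[of M "\<lambda>n t. (s n t, r n t)"]) (auto intro!: s r tendsto_Pair)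
qed

lemma smeas_compose2:
  assumes "smeas M x" "smeas M y" "continuous_on UNIV (\<lambda>(a, b). h a b)"
  shows "smeas M (\<lambda>t. h (x t) (y t))"
  using smeas_compose_continuous[OF smeas_Pair[OF assms(1,2)] assms(3)] by simp

lemma smeas_add:
  fixes x y :: "_ \<Rightarrow> 'a::real_normed_vector"
  shows "smeas M x \<Longrightarrow> smeas M y \<Longrightarrow> smeas M (\<lambda>t. x t + y t)"
  by (rule smeas_compose2) (auto simp: case_prod_unfold intro!: continuous_intros)

lemma smeas_diff:
  fixes x y :: "_ \<Rightarrow> 'a::real_normed_vector"
  shows "smeas M x \<Longrightarrow> smeas M y \<Longrightarrow> smeas M (\<lambda>t. x t - y t)"
  by (rule smeas_compose2) (auto simp: case_prod_unfold intro!: continuous_intros)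

lemma smeas_scaleR:
  fixes y :: "_ \<Rightarrow> 'a::real_normed_vector"
  shows "smeas M x \<Longrightarrow> smeas M y \<Longrightarrow> smeas M (\<lambda>t. x t *\<^sub>R y t)"
  by (rule smeas_compose2) (auto simp: case_prod_unfold intro!: continuous_intros)

lemma smeas_inner:
  fixes y :: "_ \<Rightarrow> 'a::real_inner"
  shows "smeas M x \<Longrightarrow> smeas M y \<Longrightarrow> smeas M (\<lambda>t. x t \<bullet> y t)"
  by (rule smeas_compose2) (auto simp: case_prod_unfold intro!: continuous_intros)

lemma borel_measurable_inner_smeas:
  fixes y :: "_ \<Rightarrow> 'a::real_inner"
  shows "smeas M x \<Longrightarrow> smeas M y \<Longrightarrow> (\<lambda>t. x t \<bullet> y t) \<in> borel_measurable M"
  by (intro smeas_borel smeas_inner)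

lemma borel_measurable_norm_smeas:
  fixes x :: "_ \<Rightarrow> 'a::real_normed_vector"
  shows "smeas M x \<Longrightarrow> (\<lambda>t. norm (x t)) \<in> borel_measurable M"
  by (rule smeas_borel, erule smeas_compose_continuous) (intro continuous_intros)

lemma smeas_real: "(x :: _ \<Rightarrow> real) \<in> borel_measurable M \<Longrightarrow> smeas M x"
  using borel_measurable_implies_sequence_metric[of x M 0] unfolding smeas_def by blast

lemma smeas_comp_measurable:
  assumes "smeas N x" "\<phi> \<in> measurable M N"
  shows "smeas M (\<lambda>t. x (\<phi> t))"
proof -
  obtain s where s: "\<And>n. simple_function N (s n)" "\<And>t. t \<in> space N \<Longrightarrow> (\<lambda>n. s n t) \<longlonglongrightarrow> x t"
    using assms(1) unfolding smeas_def by blast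
  show ?thesis
    by (rule smeasI[of M "\<lambda>n t. s n (\<phi> t)"])
      (auto intro!: s simple_function_comp[OF assms(2), unfolded comp_def] measurable_space[OF assms(2)])
qed

lemma smeas_restrict: "smeas M x \<Longrightarrow> smeas (restrict_space M A) x"
  by (rule smeas_comp_measurable) (auto intro: measurable_restrict_space1)

lemma smeas_extend_zero:
  fixes x :: "_ \<Rightarrow> 'a::real_normed_vector"
  assumes A: "A \<in> sets M" and x: "smeas (restrict_space M A) x"
  shows "smeas M (\<lambda>t. indicator A t *\<^sub>R x t)"
proof -
  have sp: "space (restrict_space M A) = A" using A sets.sets_into_space by (auto simp: space_restrict_space)
  obtain s where s: "\<And>n. simple_function (restrict_space M A) (s n)" "\<And>t. t \<in> A \<Longrightarrow> (\<lambda>n. s n t) \<longlonglongrightarrow> x t"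
    using x unfolding smeas_def sp by blast
  show ?thesis
  proof (rule smeasI[of M "\<lambda>n t. indicator A t *\<^sub>R s n t"])
    fix n
    have fin: "finite (s n ` A)" and meas: "\<And>v. s n -` {v} \<inter> A \<in> sets M"
      using simple_functionD[OF s(1)[of n]] A by (auto simp: sp sets_restrict_space_iff)
    have "(\<lambda>t. indicator A t *\<^sub>R s n t) ` space M \<subseteq> insert 0 (s n ` A)" by (auto simp: indicator_def)
    then have "finite ((\<lambda>t. indicator A t *\<^sub>R s n t) ` space M)" using fin finite_subset by blast
    moreover have "(\<lambda>t. indicator A t *\<^sub>R s n t) -` {v} \<inter> space M \<in> sets M" for v
    proof -
      have "(\<lambda>t. indicator A t *\<^sub>R s n t) -` {v} \<inter> space M =
          (s n -` {v} \<inter> A) \<union> (if v = 0 then space M - A else {})"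
        using sets.sets_into_space[OF A] by (auto simp: indicator_def split: if_splits)
      then show ?thesis using meas A by auto
    qed
    ultimately show "simple_function M (\<lambda>t. indicator A t *\<^sub>R s n t)" unfolding simple_function_def by blast
  qed (auto simp: indicator_def s)
qed

text \<open>The approximants have countably many values, but these need not be values of
  \<open>x\<close>. For each of them and each \<open>k\<close> a value of \<open>x\<close> within
  \<open>1 / Suc k\<close> is picked if there is one; the picked values are dense in the range. A
  dense set inside the range is what the separability condition in \<open>Lp\<close> asks
  for.\<close>

lemma smeas_separable:
  assumes "smeas M x"
  shows "\<exists>D. countable D \<and> D \<subseteq> x ` space M \<and> x ` space M \<subseteq> closure D"
proof -
  obtain s where s: "\<And>n. simple_function M (s n)" "\<And>t. t \<in> space M \<Longrightarrow> (\<lambda>n. s n t) \<longlonglongrightarrow> x t"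
    using assms unfolding smeas_def by blast
  let ?S = "x ` space M"
  define C where "C = (\<Union>n. s n ` space M)"
  have C: "countable C" unfolding C_def using simple_functionD(1)[OF s(1)] by (auto intro: countable_finite)
  define g where "g = (\<lambda>(c, k). SOME y. y \<in> ?S \<and> dist c y < 1 / real (Suc k))"
  define D where "D = g ` {(c, k). c \<in> C \<and> (\<exists>y\<in>?S. dist c y < 1 / real (Suc k))}"
  have g: "g (c, k) \<in> ?S \<and> dist c (g (c, k)) < 1 / real (Suc k)" if "\<exists>y\<in>?S. dist c y < 1 / real (Suc k)" for c k
    unfolding g_def prod.case using someI_ex[of "\<lambda>y. y \<in> ?S \<and> dist c y < 1 / real (Suc k)"] that by blast
  have "countable D"
    unfolding D_def by (rule countable_image, rule countable_subset[of _ "C \<times> UNIV"]) (auto intro: C)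
  moreover have "D \<subseteq> ?S" using g unfolding D_def by blast
  moreover have "?S \<subseteq> closure D"
  proof
    fix y assume y: "y \<in> ?S"
    show "y \<in> closure D" unfolding closure_approachable
    proof (intro allI impI)
      fix e :: real assume e: "e > 0"
      obtain k where k: "1 / real (Suc k) < e / 2"
        using reals_Archimedean[of "e/2"] e by (auto simp: inverse_eq_divide)
      obtain t where t: "t \<in> space M" "y = x t" using y by blast
      have "\<forall>\<^sub>F n in sequentially. dist (s n t) y < 1 / real (Suc k)"
        using s(2)[OF t(1)] t(2) by (simp add: tendsto_iff)
      then obtain n where n: "dist (s n t) y < 1 / real (Suc k)" by (meson eventually_happens sequentially_bot)
      let ?c = "s n t"
      have "?c \<in> C" using t by (auto simp: C_def)
      moreover have ex: "\<exists>y\<in>?S. dist ?c y < 1 / real (Suc k)" using n y by blast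
      ultimately have "g (?c, k) \<in> D" unfolding D_def by blast
      moreover have "dist (g (?c, k)) y < e"
        using conjunct2[OF g[OF ex]] n k dist_triangle3[of "g (?c, k)" y ?c] by linarith
      ultimately show "\<exists>y'\<in>D. dist y' y < e" by blast
    qed
  qed
  ultimately show ?thesis by blast
qed

text \<open>\<open>s n t\<close> is a nearest point to \<open>x t\<close> among the first
  \<open>n + 1\<close> points of an enumeration of \<open>D\<close>. The distance never increases
  with \<open>n\<close>, so the initial point \<open>d\<close> provides the domination used later
  for integrals.\<close>

lemma smeas_approx:
  fixes x :: "_ \<Rightarrow> 'a::metric_space"
  assumes x: "x \<in> borel_measurable M" and D: "countable D" "D \<noteq> {}" "x ` space M \<subseteq> closure D"
  shows "\<exists>s d. (\<forall>n. simple_function M (s n)) \<and> (\<forall>n t. s n t \<in> D) \<and> s 0 = (\<lambda>_. d) \<and>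
    (\<forall>t\<in>space M. (\<lambda>n. s n t) \<longlonglongrightarrow> x t) \<and> (\<forall>n t. dist (x t) (s n t) \<le> dist (x t) d)"
proof -
  define d where "d = from_nat_into D"
  have dD: "d n \<in> D" for n using D from_nat_into by (simp add: d_def)
  define s where "s = rec_nat (\<lambda>_. d 0) (\<lambda>n r t. if dist (x t) (d (Suc n)) < dist (x t) (r t) then d (Suc n) else r t)"
  have s0: "s 0 = (\<lambda>_. d 0)" by (simp add: s_def)
  have sS: "s (Suc n) = (\<lambda>t. if dist (x t) (d (Suc n)) < dist (x t) (s n t) then d (Suc n) else s n t)" for n
    unfolding s_def by simp
  have simple: "simple_function M (s n)" for n
  proof (induction n)
    case (Suc n)
    define R where "R = s n ` space M"
    have R: "finite R" using simple_functionD[OF Suc] by (simp add: R_def)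
    have "{t \<in> space M. dist (x t) (d (Suc n)) < dist (x t) (s n t)} =
      (\<Union>r\<in>R. (s n -` {r} \<inter> space M) \<inter> (x -` {y. dist y (d (Suc n)) < dist y r} \<inter> space M))"
      by (auto simp: R_def)
    also have "\<dots> \<in> sets M"
      by (intro sets.finite_UN R sets.Int simple_functionD[OF Suc] measurable_sets[OF x] borel_open
          open_Collect_less continuous_intros)
    finally show ?case unfolding sS by (intro simple_function_If simple_function_const Suc) simp_all
  qed (simp add: s0)
  have sD: "s n t \<in> D" for n t by (induction n) (auto simp: s0 sS dD)
  have dec: "dist (x t) (s n t) \<le> dist (x t) (d k)" if "k \<le> n" for k n t
    using that
  proof (induction n)
    case (Suc n)
    then show ?case by (cases "k = Suc n") (auto simp: sS)
  qed (simp add: s0)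
  have "(\<lambda>n. s n t) \<longlonglongrightarrow> x t" if t: "t \<in> space M" for t
  proof (rule metric_LIMSEQ_I)
    fix e :: real assume "e > 0"
    moreover have "x t \<in> closure D" using D(3) t by blast
    ultimately obtain y where y: "y \<in> D" "dist y (x t) < e" unfolding closure_approachable by blast
    then obtain k where "y = d k" unfolding d_def using D(1) by (metis from_nat_into_surj)
    then show "\<exists>no. \<forall>n\<ge>no. dist (s n t) (x t) < e"
      using dec[of k _ t] y by (intro exI[of _ k] allI impI) (metis dist_commute order_le_less_trans)
  qed
  then show ?thesis using simple sD dec s0 by (intro exI[of _ s] exI[of _ "d 0"]) auto
qed

text \<open>The nearest-point approximants prove the harder direction. The equivalence ties
  \<open>smeas\<close> to the definition of \<open>Lp\<close> by Borel measurability and a separable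
  range.\<close>

lemma smeas_iff_separable:
  "smeas M x \<longleftrightarrow> x \<in> borel_measurable M \<and> (\<exists>D. countable D \<and> x ` space M \<subseteq> closure D)"
proof safe
  fix D assume "x \<in> borel_measurable M" and D: "countable D" "x ` space M \<subseteq> closure D"
  show "smeas M x"
  proof (cases "D = {}")
    case True
    then have "space M = {}" using D by simp
    then show ?thesis using smeas_cong[of M x "\<lambda>_. undefined"] smeas_const by fastforce
  next
    case False
    then show ?thesis using smeas_approx[OF \<open>x \<in> _\<close> D(1) False D(2)] unfolding smeas_def by blast
  qed
qed (auto intro: smeas_borel dest: smeas_separable)

text \<open>Countable dense sets for the ranges of the \<open>X n\<close> have a countable union,
  whose closure contains the limits.\<close>

lemma smeas_LIMSEQ:
  fixes X :: "nat \<Rightarrow> _ \<Rightarrow> 'a::metric_space"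
  assumes "\<And>n. smeas M (X n)" "\<And>t. t \<in> space M \<Longrightarrow> (\<lambda>n. X n t) \<longlonglongrightarrow> x t"
  shows "smeas M x"
proof -
  have "x \<in> borel_measurable M"
    by (rule borel_measurable_LIMSEQ_metric[of X]) (simp_all add: assms smeas_borel)
  obtain D where D: "\<And>n. countable (D n)" "\<And>n. X n ` space M \<subseteq> closure (D n)"
    using smeas_separable[OF assms(1)] by metis
  have "x t \<in> closure (\<Union>n. D n)" if "t \<in> space M" for t
  proof -
    have "X n t \<in> closure (\<Union>n. D n)" for n
      using D(2)[of n] that closure_mono[of "D n" "\<Union>n. D n"] by blast
    then show ?thesis using assms(2)[OF that] by (rule closed_sequentially[OF closed_closure])
  qed
  then show ?thesis unfolding smeas_iff_separable
    using D(1) \<open>x \<in> _\<close> by (intro conjI exI[of _ "\<Union>n. D n"]) auto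
qed

lemma separable_space_iff:
  "separable_space (top_of_set S) \<longleftrightarrow> (\<exists>D. countable D \<and> D \<subseteq> S \<and> S \<subseteq> closure D)"
proof -
  have "(top_of_set S) closure_of D = S \<longleftrightarrow> S \<subseteq> closure D" if "D \<subseteq> S" for D
    using that by (auto simp: closure_of_subtopology Int_absorb1)
  then show ?thesis unfolding separable_space_def by auto
qed

section \<open>Extension by zero from the interval to the line\<close>

definition zext :: "real \<Rightarrow> (real \<Rightarrow> 'a::real_normed_vector) \<Rightarrow> real \<Rightarrow> 'a" where
  "zext T x = (\<lambda>t. indicator {0..T} t *\<^sub>R x t)"

lemma zext_in: "t \<in> {0..T} \<Longrightarrow> zext T x t = x t"
  and zext_out: "t \<notin> {0..T} \<Longrightarrow> zext T x t = 0"
  by (auto simp: zext_def)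

lemma zext_cong: "(\<And>t. t \<in> {0..T} \<Longrightarrow> x t = y t) \<Longrightarrow> zext T x = zext T y"
  by (auto simp: zext_def fun_eq_iff indicator_def)

lemma zext_add: "zext T (\<lambda>t. x t + y t) = (\<lambda>t. zext T x t + zext T y t)"
  and zext_diff: "zext T (\<lambda>t. x t - y t) = (\<lambda>t. zext T x t - zext T y t)"
  and zext_scaleR: "zext T (\<lambda>t. c *\<^sub>R x t) = (\<lambda>t. c *\<^sub>R zext T x t)"
  by (auto simp: zext_def fun_eq_iff indicator_def)

lemma space_interval: "space (restrict_space lborel {0..T::real}) = {0..T}"
  by (simp add: space_restrict_space)

lemma smeas_zext_iff: "smeas lborel (zext T x) \<longleftrightarrow> smeas (restrict_space lborel {0..T}) x"
proof
  assume "smeas (restrict_space lborel {0..T}) x"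
  then show "smeas lborel (zext T x)" unfolding zext_def by (intro smeas_extend_zero) auto
next
  assume "smeas lborel (zext T x)"
  then have "smeas (restrict_space lborel {0..T}) (zext T x)" by (rule smeas_restrict)
  then show "smeas (restrict_space lborel {0..T}) x"
    by (subst smeas_cong[of _ _ "zext T x"]) (auto simp: space_interval zext_in)
qed

lemma Lp_iff:
  "x \<in> Lp p T H \<longleftrightarrow> smeas lborel (zext T x) \<and> x ` {0..T} \<subseteq> H \<and>
     set_integrable lborel {0..T} (\<lambda>t. norm (x t) ^ p)"
proof -
  have "smeas (restrict_space lborel {0..T}) x \<longleftrightarrow>
      x \<in> borel_measurable (restrict_space lborel {0..T}) \<and> separable_space (top_of_set (x ` {0..T}))"
    using smeas_separable[of "restrict_space lborel {0..T}" x] smeas_iff_separable[of "restrict_space lborel {0..T}" x]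
    unfolding separable_space_iff space_interval by blast
  then show ?thesis unfolding Lp_def smeas_zext_iff by blast
qed

section \<open>The Hilbert space of square-integrable classes\<close>

definition sqi :: "(real \<Rightarrow> 'a::{real_inner, banach}) set" where
  "sqi = {x. smeas lborel x \<and> integrable lborel (\<lambda>t. (norm (x t))\<^sup>2)}"

lemma sqi_smeas: "x \<in> sqi \<Longrightarrow> smeas lborel x"
  and sqi_integrable: "x \<in> sqi \<Longrightarrow> integrable lborel (\<lambda>t. (norm (x t))\<^sup>2)"
  by (auto simp: sqi_def)

lemma sqi_inner_integrable:
  assumes "x \<in> sqi" "y \<in> sqi"
  shows "integrable lborel (\<lambda>t. x t \<bullet> y t)"
proof (rule Bochner_Integration.integrable_bound[where f="\<lambda>t. (norm (x t))\<^sup>2 + (norm (y t))\<^sup>2"])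
  show "integrable lborel (\<lambda>t. (norm (x t))\<^sup>2 + (norm (y t))\<^sup>2)"
    using assms by (intro Bochner_Integration.integrable_add sqi_integrable)
  show "(\<lambda>t. x t \<bullet> y t) \<in> borel_measurable lborel"
    using assms by (intro borel_measurable_inner_smeas sqi_smeas)
  have "\<bar>x t \<bullet> y t\<bar> \<le> (norm (x t))\<^sup>2 + (norm (y t))\<^sup>2" for t
  proof -
    have "2 * (norm (x t) * norm (y t)) \<le> (norm (x t))\<^sup>2 + (norm (y t))\<^sup>2"
      using sum_squares_bound[of "norm (x t)" "norm (y t)"] by (simp add: mult.assoc)
    moreover have "0 \<le> norm (x t) * norm (y t)" by simp
    ultimately show ?thesis using Cauchy_Schwarz_ineq2[of "x t" "y t"] by linarith
  qed
  then show "AE t in lborel. norm (x t \<bullet> y t) \<le> norm ((norm (x t))\<^sup>2 + (norm (y t))\<^sup>2)"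
    by simp
qed

lemma sqi_add: "x \<in> sqi \<Longrightarrow> y \<in> sqi \<Longrightarrow> (\<lambda>t. x t + y t) \<in> sqi"
  unfolding sqi_def
proof safe
  assume a: "smeas lborel x" "smeas lborel y" "integrable lborel (\<lambda>t. (norm (x t))\<^sup>2)" "integrable lborel (\<lambda>t. (norm (y t))\<^sup>2)"
  then show "smeas lborel (\<lambda>t. x t + y t)" by (intro smeas_add)
  have xy: "x \<in> sqi" "y \<in> sqi" using a by (auto simp: sqi_def)
  have "(norm (x t + y t))\<^sup>2 = (norm (x t))\<^sup>2 + 2 * (x t \<bullet> y t) + (norm (y t))\<^sup>2" for t
    by (simp add: power2_norm_eq_inner inner_add_left inner_add_right inner_commute)
  then show "integrable lborel (\<lambda>t. (norm (x t + y t))\<^sup>2)"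
    using a sqi_inner_integrable[OF xy] by simp
qed

lemma sqi_scaleR: "x \<in> sqi \<Longrightarrow> (\<lambda>t. c *\<^sub>R x t) \<in> sqi"
  unfolding sqi_def by (auto simp: power_mult_distrib intro: smeas_scaleR smeas_const)

lemma sqi_diff: "x \<in> sqi \<Longrightarrow> y \<in> sqi \<Longrightarrow> (\<lambda>t. x t - y t) \<in> sqi"
  using sqi_add[of x "\<lambda>t. (-1) *\<^sub>R y t"] sqi_scaleR[of y "-1"] by simp

lemma sqi_zero: "(\<lambda>_. 0) \<in> sqi"
  by (simp add: sqi_def smeas_const)

definition L2rel :: "(real \<Rightarrow> 'a::{real_inner, banach}) \<Rightarrow> (real \<Rightarrow> 'a) \<Rightarrow> bool" where
  "L2rel x y \<longleftrightarrow> x \<in> sqi \<and> y \<in> sqi \<and> (AE t in lborel. x t = y t)"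

lemma L2rel_part_equivp: "part_equivp L2rel"
proof (rule part_equivpI)
  show "\<exists>x. L2rel x x" by (rule exI[of _ "\<lambda>_. 0"]) (simp add: L2rel_def sqi_zero)
  show "symp L2rel" by (rule sympI) (auto simp: L2rel_def)
  show "transp L2rel" by (rule transpI) (auto simp: L2rel_def elim: AE_mp)
qed

\<comment> \<open>The classes form a type rather than a set, so that everything proved for types of
  class \<open>{real_inner, banach}\<close> applies to them. The underlying functions live on the
  whole line; the interval enters through \<open>zext\<close>.\<close>
quotient_type (overloaded) 'a L2 = "real \<Rightarrow> 'a::{real_inner, banach}" / partial: L2rel
  by (rule L2rel_part_equivp)

instantiation L2 :: ("{real_inner, banach}") real_vector
begin

lift_definition zero_L2 :: "'a L2" is "\<lambda>_. 0" by (simp add: L2rel_def sqi_zero)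

lift_definition plus_L2 :: "'a L2 \<Rightarrow> 'a L2 \<Rightarrow> 'a L2" is "\<lambda>x y t. x t + y t"
  by (auto simp: L2rel_def intro: sqi_add elim: AE_mp)

lift_definition scaleR_L2 :: "real \<Rightarrow> 'a L2 \<Rightarrow> 'a L2" is "\<lambda>c x t. c *\<^sub>R x t"
  by (auto simp: L2rel_def intro: sqi_scaleR elim: AE_mp)

lift_definition minus_L2 :: "'a L2 \<Rightarrow> 'a L2 \<Rightarrow> 'a L2" is "\<lambda>x y t. x t - y t"
  by (auto simp: L2rel_def intro: sqi_diff elim: AE_mp)

lift_definition uminus_L2 :: "'a L2 \<Rightarrow> 'a L2" is "\<lambda>x t. (-1) *\<^sub>R x t"
  by (auto simp: L2rel_def intro: sqi_scaleR[of _ "-1", simplified] elim: AE_mp)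

instance
proof
  fix x y z :: "'a L2" and r s :: real
  show "x + y + z = x + (y + z)" by transfer (auto simp: L2rel_def add.assoc intro: sqi_add)
  show "x + y = y + x" by transfer (auto simp: L2rel_def add.commute intro: sqi_add)
  show "0 + x = x" by transfer (auto simp: L2rel_def)
  show "- x + x = 0"
    by transfer (auto simp: L2rel_def sqi_zero)
  show "x - y = x + - y"
    by transfer (auto simp: L2rel_def intro: sqi_diff)
  show "r *\<^sub>R (x + y) = r *\<^sub>R x + r *\<^sub>R y"
    by transfer (auto simp: L2rel_def scaleR_add_right intro: sqi_scaleR sqi_add)
  show "(r + s) *\<^sub>R x = r *\<^sub>R x + s *\<^sub>R x"
    by transfer (auto simp: L2rel_def scaleR_add_left intro: sqi_scaleR sqi_add)
  show "r *\<^sub>R s *\<^sub>R x = (r * s) *\<^sub>R x"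
    by transfer (auto simp: L2rel_def intro: sqi_scaleR)
  show "1 *\<^sub>R x = x" by transfer (auto simp: L2rel_def)
qed

end

instantiation L2 :: ("{real_inner, banach}") real_inner
begin

lift_definition inner_L2 :: "'a L2 \<Rightarrow> 'a L2 \<Rightarrow> real" is "\<lambda>x y. LINT t|lborel. x t \<bullet> y t"
proof -
  fix x x' y y' :: "real \<Rightarrow> 'a"
  assume "L2rel x x'" "L2rel y y'"
  then have *: "smeas lborel x" "smeas lborel x'" "smeas lborel y" "smeas lborel y'"
    and ae: "AE t in lborel. x t = x' t" "AE t in lborel. y t = y' t" by (auto simp: L2rel_def sqi_def)
  show "(LINT t|lborel. x t \<bullet> y t) = (LINT t|lborel. x' t \<bullet> y' t)"
  proof (rule integral_cong_AE)
    show "AE t in lborel. x t \<bullet> y t = x' t \<bullet> y' t" using ae by eventually_elim simp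
  qed (intro borel_measurable_inner_smeas *)+
qed

definition norm_L2 :: "'a L2 \<Rightarrow> real" where "norm_L2 x = sqrt (x \<bullet> x)"
definition sgn_L2 :: "'a L2 \<Rightarrow> 'a L2" where "sgn_L2 x = x /\<^sub>R norm x"
definition dist_L2 :: "'a L2 \<Rightarrow> 'a L2 \<Rightarrow> real" where "dist_L2 x y = norm (x - y)"
definition uniformity_L2 :: "('a L2 \<times> 'a L2) filter" where
  "uniformity_L2 = (INF e\<in>{0<..}. principal {(x, y). dist x y < e})"
definition open_L2 :: "'a L2 set \<Rightarrow> bool" where
  "open_L2 U \<longleftrightarrow> (\<forall>x\<in>U. \<forall>\<^sub>F (x', y) in uniformity. x' = x \<longrightarrow> y \<in> U)"

instance
proof
  fix x y z :: "'a L2" and r s :: real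
  show "dist x y = norm (x - y)" by (simp add: dist_L2_def)
  show "sgn x = x /\<^sub>R norm x" by (simp add: sgn_L2_def)
  show "uniformity = (INF e\<in>{0<..}. principal {(x, y :: 'a L2). dist x y < e})" by (simp add: uniformity_L2_def)
  show "open U \<longleftrightarrow> (\<forall>x\<in>U. \<forall>\<^sub>F (x', y) in uniformity. x' = x \<longrightarrow> y \<in> U)" for U :: "'a L2 set"
    by (simp add: open_L2_def)
  show "x \<bullet> y = y \<bullet> x" by transfer (simp add: inner_commute)
  show "(x + y) \<bullet> z = x \<bullet> z + y \<bullet> z"
    by transfer (auto simp: L2rel_def inner_add_left sqi_inner_integrable)
  show "(r *\<^sub>R x) \<bullet> y = r * (x \<bullet> y)" by transfer simp
  show "0 \<le> x \<bullet> x" by transfer simp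
  show "x \<bullet> x = 0 \<longleftrightarrow> x = 0"
  proof transfer
    fix x :: "real \<Rightarrow> 'a" assume "L2rel x x"
    then have x: "x \<in> sqi" by (simp add: L2rel_def)
    have "(LINT t|lborel. x t \<bullet> x t) = 0 \<longleftrightarrow> (AE t in lborel. x t \<bullet> x t = 0)"
      by (rule integral_nonneg_eq_0_iff_AE) (auto intro: sqi_inner_integrable x)
    then show "((LINT t|lborel. x t \<bullet> x t) = 0) = L2rel x (\<lambda>_. 0)"
      using x by (simp add: L2rel_def sqi_zero)
  qed
  show "norm x = sqrt (x \<bullet> x)" by (simp add: norm_L2_def)
qed

end

section \<open>Classes, representatives and completeness\<close>

lemma abs_L2_eq_iff: "x \<in> sqi \<Longrightarrow> y \<in> sqi \<Longrightarrow> abs_L2 x = abs_L2 y \<longleftrightarrow> (AE t in lborel. x t = y t)"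
  using Quotient_rel[OF Quotient_L2, of x y] by (auto simp: L2rel_def)

lemma rep_L2_sqi: "rep_L2 X \<in> sqi"
  using Quotient_rep_reflp[OF Quotient_L2, of X] by (auto simp: L2rel_def)

lemma abs_rep_L2: "abs_L2 (rep_L2 X) = X"
  by (rule Quotient_abs_rep[OF Quotient_L2])

lemma L2rel_refl: "x \<in> sqi \<Longrightarrow> L2rel x x"
  by (simp add: L2rel_def)

lemma inner_abs_L2: "x \<in> sqi \<Longrightarrow> y \<in> sqi \<Longrightarrow> abs_L2 x \<bullet> abs_L2 y = (LINT t|lborel. x t \<bullet> y t)"
  by (simp add: inner_L2.abs_eq L2rel_refl)

lemma plus_abs_L2: "x \<in> sqi \<Longrightarrow> y \<in> sqi \<Longrightarrow> abs_L2 x + abs_L2 y = abs_L2 (\<lambda>t. x t + y t)"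
  by (simp add: plus_L2.abs_eq L2rel_refl)

lemma minus_abs_L2: "x \<in> sqi \<Longrightarrow> y \<in> sqi \<Longrightarrow> abs_L2 x - abs_L2 y = abs_L2 (\<lambda>t. x t - y t)"
  by (simp add: minus_L2.abs_eq L2rel_refl)

lemma scaleR_abs_L2: "x \<in> sqi \<Longrightarrow> c *\<^sub>R abs_L2 x = abs_L2 (\<lambda>t. c *\<^sub>R x t)"
  by (simp add: scaleR_L2.abs_eq L2rel_refl)

lemma norm_abs_L2: "x \<in> sqi \<Longrightarrow> (norm (abs_L2 x))\<^sup>2 = (LINT t|lborel. (norm (x t))\<^sup>2)"
  by (simp add: power2_norm_eq_inner inner_abs_L2)

text \<open>Weighting the squares by \<open>2 ^ n\<close> keeps their integrals summable, so the
  weighted series is finite almost everywhere. The inequality between arithmetic and geometric mean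
  then bounds \<open>d n\<close> itself by a summable sequence.\<close>

lemma AE_summable_of_fast_decay:
  fixes d :: "nat \<Rightarrow> 'b \<Rightarrow> real"
  assumes d: "\<And>n. d n \<in> borel_measurable M" "\<And>n t. 0 \<le> d n t"
    and le: "\<And>n. (\<integral>\<^sup>+ t. ennreal ((d n t)\<^sup>2) \<partial>M) \<le> ennreal ((1/4) ^ n)"
  shows "AE t in M. summable (\<lambda>n. d n t)"
proof -
  have "(\<integral>\<^sup>+ t. (\<Sum>n. ennreal (2 ^ n * (d n t)\<^sup>2)) \<partial>M) = (\<Sum>n. \<integral>\<^sup>+ t. ennreal (2 ^ n * (d n t)\<^sup>2) \<partial>M)"
    by (rule nn_integral_suminf) (use d in measurable)
  also have "\<dots> \<le> (\<Sum>n. ennreal ((1/2) ^ n))"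
  proof (rule suminf_le)
    fix n
    have "(\<integral>\<^sup>+ t. ennreal (2 ^ n * (d n t)\<^sup>2) \<partial>M) = ennreal (2 ^ n) * (\<integral>\<^sup>+ t. ennreal ((d n t)\<^sup>2) \<partial>M)"
      by (subst nn_integral_cmult[symmetric]) (use d in \<open>auto simp: ennreal_mult\<close>)
    also have "\<dots> \<le> ennreal (2 ^ n) * ennreal ((1/4) ^ n)" by (intro mult_left_mono le) auto
    also have "\<dots> = ennreal ((1/2) ^ n)"
      by (subst ennreal_mult[symmetric]) (auto simp: power_mult_distrib[symmetric])
    finally show "(\<integral>\<^sup>+ t. ennreal (2 ^ n * (d n t)\<^sup>2) \<partial>M) \<le> ennreal ((1/2) ^ n)" .
  qed auto
  also have "\<dots> = ennreal (\<Sum>n. (1/2) ^ n)"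
    by (rule suminf_ennreal2) (auto intro: summable_geometric)
  finally have fin: "(\<integral>\<^sup>+ t. (\<Sum>n. ennreal (2 ^ n * (d n t)\<^sup>2)) \<partial>M) \<noteq> \<infinity>"
    by (auto simp: top_unique)
  have "AE t in M. (\<Sum>n. ennreal (2 ^ n * (d n t)\<^sup>2)) \<noteq> \<infinity>"
    by (rule nn_integral_PInf_AE[OF _ fin]) (use d in measurable)
  then show ?thesis
  proof eventually_elim
    case (elim t)
    have "summable (\<lambda>n. 2 ^ n * (d n t)\<^sup>2)"
      by (rule summable_suminf_not_top) (use elim in \<open>auto simp: top_ennreal_def infinity_ennreal_def\<close>)
    then have s: "summable (\<lambda>n. (1/2) ^ n + 2 ^ n * (d n t)\<^sup>2)"
      by (intro summable_add summable_geometric) auto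
    have "d n t \<le> (1/2) ^ n + 2 ^ n * (d n t)\<^sup>2" for n
    proof -
      have "0 \<le> (1/2) ^ n * (1 - 2 ^ n * d n t)\<^sup>2" by simp
      also have "(1/2) ^ n * (1 - 2 ^ n * d n t)\<^sup>2 = (1/2) ^ n - 2 * d n t + 2 ^ n * (d n t)\<^sup>2"
        by (simp add: power2_eq_square field_simps power_divide)
      finally show ?thesis using d(2)[of n t] by linarith
    qed
    then show ?case using d(2) by (intro summable_comparison_test'[OF s]) auto
  qed
qed

lemma L2_dist_nn_integral:
  assumes "x \<in> sqi" "y \<in> sqi"
  shows "(\<integral>\<^sup>+ t. ennreal ((norm (x t - y t))\<^sup>2) \<partial>lborel) = ennreal ((norm (abs_L2 x - abs_L2 y))\<^sup>2)"
  using assms sqi_integrable[OF sqi_diff[OF assms]]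
  by (simp add: minus_abs_L2 norm_abs_L2 sqi_diff nn_integral_eq_integral)

text \<open>On the exceptional null set the limit is put to 0 and the sequence is multiplied by an
  indicator, which makes it converge everywhere. The last conjunct keeps control at every point: a
  value is 0 or a genuine limit, so closed conditions satisfied by 0 pass to the limit.\<close>

lemma smeas_AE_limit:
  fixes X :: "nat \<Rightarrow> real \<Rightarrow> 'a::real_normed_vector"
  assumes X: "\<And>n. smeas lborel (X n)" and ae: "AE t in lborel. convergent (\<lambda>n. X n t)"
  shows "\<exists>l. smeas lborel l \<and> (AE t in lborel. (\<lambda>n. X n t) \<longlonglongrightarrow> l t) \<and>
     (\<forall>t. l t = 0 \<or> (\<lambda>n. X n t) \<longlonglongrightarrow> l t)"
proof -
  from ae obtain N where N: "{t \<in> space lborel. \<not> convergent (\<lambda>n. X n t)} \<subseteq> N" "N \<in> null_sets lborel"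
    unfolding eventually_ae_filter by blast
  define l where "l = (\<lambda>t. if t \<in> N then 0 else lim (\<lambda>n. X n t))"
  have lt: "(\<lambda>n. X n t) \<longlonglongrightarrow> l t" if "t \<notin> N" for t
    using N(1) that by (auto simp: l_def convergent_LIMSEQ_iff)
  have "smeas lborel l"
  proof (rule smeas_LIMSEQ)
    show "smeas lborel (\<lambda>t. indicat_real (- N) t *\<^sub>R X n t)" for n
      using N(2) by (intro smeas_scaleR X smeas_real borel_measurable_indicator) auto
    show "(\<lambda>n. indicat_real (- N) t *\<^sub>R X n t) \<longlonglongrightarrow> l t" for t
      using lt[of t] by (cases "t \<in> N") (auto simp: l_def)
  qed
  moreover have "AE t in lborel. (\<lambda>n. X n t) \<longlonglongrightarrow> l t"
    using AE_not_in[OF N(2)] by eventually_elim (rule lt)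
  moreover have "l t = 0 \<or> (\<lambda>n. X n t) \<longlonglongrightarrow> l t" for t using lt by (auto simp: l_def)
  ultimately show ?thesis by blast
qed

text \<open>The Riesz-Fischer argument: fast decay makes the telescoping series absolutely
  convergent almost everywhere, and Fatou's lemma turns the Cauchy estimate into an estimate of the
  distance to the pointwise limit.\<close>

lemma L2_convergent_of_fast_Cauchy:
  assumes x: "\<And>n. x n \<in> sqi" and C: "Cauchy (\<lambda>n. abs_L2 (x n))"
    and fast: "\<And>n. norm (abs_L2 (x (Suc n)) - abs_L2 (x n)) \<le> (1/2) ^ n"
  shows "convergent (\<lambda>n. abs_L2 (x n))"
proof -
  have "AE t in lborel. summable (\<lambda>n. norm (x (Suc n) t - x n t))"
  proof (rule AE_summable_of_fast_decay)
    show "(\<lambda>t. norm (x (Suc n) t - x n t)) \<in> borel_measurable lborel" for n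
      by (intro borel_measurable_norm_smeas smeas_diff sqi_smeas x)
    show "(\<integral>\<^sup>+ t. ennreal ((norm (x (Suc n) t - x n t))\<^sup>2) \<partial>lborel) \<le> ennreal ((1/4) ^ n)" for n
    proof -
      have "(norm (abs_L2 (x (Suc n)) - abs_L2 (x n)))\<^sup>2 \<le> ((1/2) ^ n)\<^sup>2" by (intro power_mono fast) auto
      also have "\<dots> = (1/4) ^ n" by (simp add: power2_eq_square power_mult_distrib[symmetric])
      finally show ?thesis by (simp add: L2_dist_nn_integral x ennreal_leI)
    qed
  qed auto
  then have "AE t in lborel. convergent (\<lambda>n. x n t)"
  proof eventually_elim
    case (elim t)
    then have "summable (\<lambda>n. x (Suc n) t - x n t)" by (rule summable_norm_cancel)
    then have "convergent (\<lambda>n. x n t - x 0 t)"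
      using sum_lessThan_telescope[of "\<lambda>n. x n t"] by (simp add: summable_iff_convergent)
    then have "convergent (\<lambda>n. (x n t - x 0 t) + x 0 t)" by (intro convergent_add convergent_const)
    then show ?case by simp
  qed
  then obtain l where l: "smeas lborel l" "AE t in lborel. (\<lambda>n. x n t) \<longlonglongrightarrow> l t"
    using smeas_AE_limit[of x] x sqi_smeas by metis
  have fatou: "(\<integral>\<^sup>+ t. ennreal ((norm (l t - x n t))\<^sup>2) \<partial>lborel) \<le> ennreal (e\<^sup>2)"
    if e: "\<And>m. m \<ge> N \<Longrightarrow> norm (abs_L2 (x m) - abs_L2 (x n)) \<le> e" "e \<ge> 0" for n N e
  proof -
    have "(\<integral>\<^sup>+ t. ennreal ((norm (l t - x n t))\<^sup>2) \<partial>lborel) =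
        (\<integral>\<^sup>+ t. liminf (\<lambda>m. ennreal ((norm (x m t - x n t))\<^sup>2)) \<partial>lborel)"
    proof (rule nn_integral_cong_AE)
      show "AE t in lborel. ennreal ((norm (l t - x n t))\<^sup>2) = liminf (\<lambda>m. ennreal ((norm (x m t - x n t))\<^sup>2))"
        using l(2)
      proof eventually_elim
        case (elim t)
        then have "(\<lambda>m. ennreal ((norm (x m t - x n t))\<^sup>2)) \<longlonglongrightarrow> ennreal ((norm (l t - x n t))\<^sup>2)"
          by (intro tendsto_intros)
        then show ?case by (rule lim_imp_Liminf[OF sequentially_bot, symmetric])
      qed
    qed
    also have "\<dots> \<le> liminf (\<lambda>m. \<integral>\<^sup>+ t. ennreal ((norm (x m t - x n t))\<^sup>2) \<partial>lborel)"
      by (rule nn_integral_liminf)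
        (intro measurable_compose[OF _ measurable_ennreal] borel_measurable_power borel_measurable_norm_smeas smeas_diff sqi_smeas x)
    also have "\<dots> \<le> liminf (\<lambda>m. ennreal (e\<^sup>2))"
    proof (rule Liminf_mono)
      show "\<forall>\<^sub>F m in sequentially. (\<integral>\<^sup>+ t. ennreal ((norm (x m t - x n t))\<^sup>2) \<partial>lborel) \<le> ennreal (e\<^sup>2)"
        using eventually_ge_at_top[of N]
        by eventually_elim (auto simp: L2_dist_nn_integral x intro!: ennreal_leI power_mono e)
    qed
    also have "\<dots> = ennreal (e\<^sup>2)" by (simp add: Liminf_const)
    finally show ?thesis .
  qed
  have ln: "(\<lambda>t. norm (l t - x n t)) \<in> borel_measurable lborel" for n
    by (intro borel_measurable_norm_smeas smeas_diff sqi_smeas x l)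
  obtain N0 where "\<And>m n. m \<ge> N0 \<Longrightarrow> n \<ge> N0 \<Longrightarrow> norm (abs_L2 (x m) - abs_L2 (x n)) < 1"
    using metric_CauchyD[OF C, of 1] by (auto simp: dist_norm)
  then have "(\<integral>\<^sup>+ t. ennreal ((norm (l t - x N0 t))\<^sup>2) \<partial>lborel) \<le> ennreal (1\<^sup>2)"
    by (intro fatou[of N0]) (auto intro: less_imp_le)
  then have "(\<integral>\<^sup>+ t. ennreal ((norm (l t - x N0 t))\<^sup>2) \<partial>lborel) < \<infinity>"
    by (rule order_le_less_trans) simp
  then have "integrable lborel (\<lambda>t. (norm (l t - x N0 t))\<^sup>2)"
    using borel_measurable_power[OF ln[of N0], of 2] by (intro integrableI_nonneg) simp_all
  then have "(\<lambda>t. l t - x N0 t) \<in> sqi"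
    unfolding sqi_def using smeas_diff[OF l(1) sqi_smeas[OF x[of N0]]] by simp
  then have lsq: "l \<in> sqi" using sqi_add[OF _ x[of N0]] by fastforce
  have "(\<lambda>n. abs_L2 (x n)) \<longlonglongrightarrow> abs_L2 l"
  proof (rule metric_LIMSEQ_I)
    fix e :: real assume "e > 0"
    then obtain N where N: "\<And>m n. m \<ge> N \<Longrightarrow> n \<ge> N \<Longrightarrow> norm (abs_L2 (x m) - abs_L2 (x n)) < e / 2"
      using metric_CauchyD[OF C, of "e/2"] by (auto simp: dist_norm)
    have "dist (abs_L2 (x n)) (abs_L2 l) < e" if "n \<ge> N" for n
    proof -
      have "(\<integral>\<^sup>+ t. ennreal ((norm (l t - x n t))\<^sup>2) \<partial>lborel) \<le> ennreal ((e/2)\<^sup>2)"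
        using N that \<open>e > 0\<close> by (intro fatou[of N]) (auto intro: less_imp_le)
      then have "(norm (abs_L2 l - abs_L2 (x n)))\<^sup>2 \<le> (e/2)\<^sup>2"
        by (simp add: L2_dist_nn_integral lsq x)
      then have "norm (abs_L2 l - abs_L2 (x n)) \<le> e/2" using \<open>e > 0\<close> by (auto intro: power2_le_imp_le)
      then show ?thesis using \<open>e > 0\<close> by (simp add: dist_norm norm_minus_commute)
    qed
    then show "\<exists>no. \<forall>n\<ge>no. dist (abs_L2 (x n)) (abs_L2 l) < e" by blast
  qed
  then show ?thesis by (auto simp: convergent_def)
qed

text \<open>The partial sums of the thresholds, plus \<open>k\<close>, dominate each threshold and
  increase strictly.\<close>

lemma fast_subseq:
  fixes P :: "nat \<Rightarrow> nat \<Rightarrow> nat \<Rightarrow> bool"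
  assumes "\<And>k. \<exists>N. \<forall>m\<ge>N. \<forall>n\<ge>N. P k m n"
  shows "\<exists>r. strict_mono r \<and> (\<forall>k. \<forall>m\<ge>r k. \<forall>n\<ge>r k. P k m n)"
proof -
  obtain N where N: "\<And>k m n. m \<ge> N k \<Longrightarrow> n \<ge> N k \<Longrightarrow> P k m n" using assms by metis
  define r where "r = (\<lambda>k. (\<Sum>j\<le>k. N j) + k)"
  have "strict_mono r" by (rule strict_monoI_Suc) (simp add: r_def)
  moreover have "N k \<le> r k" for k
    unfolding r_def by (simp add: trans_le_add1 member_le_sum)
  ultimately show ?thesis using N order_trans by meson
qed

instance L2 :: ("{real_inner, banach}") banach
proof
  fix X :: "nat \<Rightarrow> 'a L2" assume C: "Cauchy X"
  then have "\<exists>N. \<forall>m\<ge>N. \<forall>n\<ge>N. norm (X m - X n) \<le> (1/2) ^ k" for k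
    using metric_CauchyD[OF C, of "(1/2) ^ k"] by (auto simp: dist_norm intro: less_imp_le)
  then obtain r where r: "strict_mono (r :: nat \<Rightarrow> nat)" "\<And>k m n. m \<ge> r k \<Longrightarrow> n \<ge> r k \<Longrightarrow> norm (X m - X n) \<le> (1/2) ^ k"
    using fast_subseq[of "\<lambda>k m n. norm (X m - X n) \<le> (1/2) ^ k"] by blast
  have "convergent (\<lambda>n. abs_L2 (rep_L2 (X (r n))))"
  proof (rule L2_convergent_of_fast_Cauchy)
    show "Cauchy (\<lambda>n. abs_L2 (rep_L2 (X (r n))))"
      using Cauchy_subseq_Cauchy[OF C r(1)] by (simp add: abs_rep_L2 comp_def)
    show "norm (abs_L2 (rep_L2 (X (r (Suc n)))) - abs_L2 (rep_L2 (X (r n)))) \<le> (1/2) ^ n" for n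
      unfolding abs_rep_L2 by (rule r(2)) (simp_all add: strict_mono_leD[OF r(1)])
  qed (rule rep_L2_sqi)
  then obtain l where "(X \<circ> r) \<longlonglongrightarrow> l" by (auto simp: convergent_def abs_rep_L2 comp_def)
  then have "X \<longlonglongrightarrow> l" by (rule Cauchy_converges_subseq[OF C r(1)])
  then show "convergent X" by (rule convergentI)
qed

text \<open>Along a subsequence with geometric decay of the distances, the pointwise errors are
  summable almost everywhere, hence tend to 0.\<close>

lemma L2_tendsto_AE_subseq:
  assumes x: "\<And>n. x n \<in> sqi" "l \<in> sqi" and L: "(\<lambda>n. abs_L2 (x n)) \<longlonglongrightarrow> abs_L2 l"
  shows "\<exists>r. strict_mono r \<and> (AE t in lborel. (\<lambda>n. x (r n) t) \<longlonglongrightarrow> l t)"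
proof -
  have "\<exists>N. \<forall>m\<ge>N. norm (abs_L2 (x m) - abs_L2 l) \<le> (1/2) ^ k" for k
    using metric_LIMSEQ_D[OF L, of "(1/2) ^ k"] by (auto simp: dist_norm intro: less_imp_le)
  then have "\<exists>N. \<forall>m\<ge>N. \<forall>n\<ge>N. norm (abs_L2 (x m) - abs_L2 l) \<le> (1/2) ^ k" for k by blast
  from fast_subseq[of "\<lambda>k m n. norm (abs_L2 (x m) - abs_L2 l) \<le> (1/2) ^ k", OF this]
  obtain r where r: "strict_mono (r :: nat \<Rightarrow> nat)" "\<And>k. norm (abs_L2 (x (r k)) - abs_L2 l) \<le> (1/2) ^ k"
    by blast
  have "AE t in lborel. summable (\<lambda>n. norm (x (r n) t - l t))"
  proof (rule AE_summable_of_fast_decay)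
    show "(\<lambda>t. norm (x (r n) t - l t)) \<in> borel_measurable lborel" for n
      by (intro borel_measurable_norm_smeas smeas_diff sqi_smeas x)
    show "(\<integral>\<^sup>+ t. ennreal ((norm (x (r n) t - l t))\<^sup>2) \<partial>lborel) \<le> ennreal ((1/4) ^ n)" for n
    proof -
      have "(norm (abs_L2 (x (r n)) - abs_L2 l))\<^sup>2 \<le> ((1/2) ^ n)\<^sup>2" by (intro power_mono r(2)) auto
      also have "\<dots> = (1/4) ^ n" by (simp add: power2_eq_square power_mult_distrib[symmetric])
      finally show ?thesis by (simp add: L2_dist_nn_integral x ennreal_leI)
    qed
  qed auto
  then have "AE t in lborel. (\<lambda>n. x (r n) t) \<longlonglongrightarrow> l t"
  proof eventually_elim
    case (elim t)
    from summable_LIMSEQ_zero[OF this] show ?case by (simp add: LIM_zero_iff tendsto_norm_zero_iff)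
  qed
  then show ?thesis using r(1) by blast
qed

section \<open>Measurability of compositions with several arguments\<close>

lemma simple_function_restrict_family:
  assumes I: "finite I" and s: "\<And>i. i \<in> I \<Longrightarrow> simple_function M (s i)"
  shows "simple_function M (\<lambda>t. restrict (\<lambda>i. s i t) I)"
  unfolding simple_function_def
proof (intro conjI ballI)
  have "(\<lambda>t. restrict (\<lambda>i. s i t) I) ` space M \<subseteq> (\<Pi>\<^sub>E i\<in>I. s i ` space M)" by auto
  moreover have "finite (\<Pi>\<^sub>E i\<in>I. s i ` space M)"
    by (intro finite_PiE I simple_functionD(1)[OF s])
  ultimately show "finite ((\<lambda>t. restrict (\<lambda>i. s i t) I) ` space M)" by (rule finite_subset)
next
  fix g assume "g \<in> (\<lambda>t. restrict (\<lambda>i. s i t) I) ` space M"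
  then have g: "g \<in> extensional I" by auto
  have "(\<lambda>t. restrict (\<lambda>i. s i t) I) -` {g} \<inter> space M = {t \<in> space M. \<forall>i\<in>I. s i t = g i}"
    using g by (auto simp: fun_eq_iff extensional_def)
  also have "\<dots> \<in> sets M"
  proof (rule sets.sets_Collect_finite_All[OF _ I])
    show "{t \<in> space M. s i t = g i} \<in> sets M" if "i \<in> I" for i
      using simple_functionD(2)[OF s[OF that], of "{g i}"] by (simp add: vimage_def Int_def conj_commute)
  qed
  finally show "(\<lambda>t. restrict (\<lambda>i. s i t) I) -` {g} \<inter> space M \<in> sets M" .
qed

text \<open>Approximants with values in the range of \<open>x\<close> stay in the set on which a map
  such as \<open>B i\<close> is controlled.\<close>

lemma smeas_approx_range:
  assumes "smeas M x"
  shows "\<exists>s. (\<forall>n. simple_function M (s n)) \<and> (\<forall>n. \<forall>t\<in>space M. s n t \<in> x ` space M) \<and>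
    (\<forall>t\<in>space M. (\<lambda>n. s n t) \<longlonglongrightarrow> x t)"
proof -
  obtain D where D: "countable D" "D \<subseteq> x ` space M" "x ` space M \<subseteq> closure D"
    using smeas_separable[OF assms] by blast
  show ?thesis
  proof (cases "D = {}")
    case True
    then have "space M = {}" using D by simp
    then show ?thesis by (intro exI[of _ "\<lambda>_ _. undefined"]) auto
  next
    case False
    from smeas_approx[OF smeas_borel[OF assms] D(1) False D(3)] D(2) show ?thesis by blast
  qed
qed

text \<open>\<open>F\<close> is sequentially continuous only on tuples with components in the sets
  \<open>H i\<close>, so the approximants must stay in these sets. Tuples are extensional functions,
  and their convergence is meant componentwise.\<close>

lemma smeas_compose_finite:
  fixes x :: "'i \<Rightarrow> 'b \<Rightarrow> 'a::metric_space"
  assumes I: "finite I" and x: "\<And>i. i \<in> I \<Longrightarrow> smeas M (x i)"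
    and H: "\<And>i t. i \<in> I \<Longrightarrow> t \<in> space M \<Longrightarrow> x i t \<in> H i"
    and F: "\<And>s y. (\<And>n i. i \<in> I \<Longrightarrow> s n i \<in> H i) \<Longrightarrow> (\<And>i. i \<in> I \<Longrightarrow> y i \<in> H i) \<Longrightarrow>
       (\<And>i. i \<in> I \<Longrightarrow> (\<lambda>n. s n i) \<longlonglongrightarrow> y i) \<Longrightarrow> (\<lambda>n. F (restrict (s n) I)) \<longlonglongrightarrow> F (restrict y I)"
  shows "smeas M (\<lambda>t. F (\<lambda>i\<in>I. x i t))"
proof -
  have "\<forall>i\<in>I. \<exists>s. (\<forall>n. simple_function M (s n)) \<and> (\<forall>n. \<forall>t\<in>space M. s n t \<in> x i ` space M) \<and>
    (\<forall>t\<in>space M. (\<lambda>n. s n t) \<longlonglongrightarrow> x i t)"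
    using smeas_approx_range[OF x] by blast
  then obtain s where s: "\<And>i n. i \<in> I \<Longrightarrow> simple_function M (s i n)"
    "\<And>i n t. i \<in> I \<Longrightarrow> t \<in> space M \<Longrightarrow> s i n t \<in> x i ` space M"
    "\<And>i t. i \<in> I \<Longrightarrow> t \<in> space M \<Longrightarrow> (\<lambda>n. s i n t) \<longlonglongrightarrow> x i t"
    by metis
  show ?thesis
  proof (rule smeasI)
    show "simple_function M (\<lambda>t. F (\<lambda>i\<in>I. s i n t))" for n
      by (rule simple_function_compose1[of M "\<lambda>t. \<lambda>i\<in>I. s i n t" F]) (rule simple_function_restrict_family[OF I s(1)])
    show "(\<lambda>n. F (\<lambda>i\<in>I. s i n t)) \<longlonglongrightarrow> F (\<lambda>i\<in>I. x i t)" if t: "t \<in> space M" for t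
    proof (rule F)
      show "s i n t \<in> H i" if "i \<in> I" for i n
        using s(2)[OF that t, of n] H[OF that] by auto
    qed (use t H s(3) in auto)
  qed
qed

section \<open>Lebesgue spaces over the interval and their classes\<close>

lemma integrable_indicator_interval: "integrable lborel (indicat_real {0..T::real})"
  by (intro integrable_real_indicator) (auto simp: emeasure_lborel_Icc_eq)

lemma Lp_smeas: "x \<in> Lp p T H \<Longrightarrow> smeas lborel (zext T x)"
  and Lp_in: "x \<in> Lp p T H \<Longrightarrow> t \<in> {0..T} \<Longrightarrow> x t \<in> H"
  by (auto simp: Lp_iff)

lemma Lp_mono: "x \<in> Lp p T H \<Longrightarrow> H \<subseteq> K \<Longrightarrow> x \<in> Lp p T K"
  by (auto simp: Lp_iff)

lemma Lp_cong:
  assumes "\<And>t. t \<in> {0..T} \<Longrightarrow> x t = y t"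
  shows "x \<in> Lp p T H \<longleftrightarrow> y \<in> Lp p T H"
proof -
  have "set_integrable lborel {0..T} (\<lambda>t. norm (x t) ^ p) = set_integrable lborel {0..T} (\<lambda>t. norm (y t) ^ p)"
    by (rule set_integrable_cong) (use assms in auto)
  moreover have "zext T x = zext T y" using assms by (rule zext_cong)
  ultimately show ?thesis unfolding Lp_iff using assms by (auto simp: image_subset_iff)
qed

lemma Lp_bounded_by:
  assumes x: "x \<in> Lp p T H" and y: "smeas lborel (zext T y)" "y ` {0..T} \<subseteq> K"
    and le: "AE t in lborel. t \<in> {0..T} \<longrightarrow> norm (y t) \<le> C * norm (x t)"
  shows "y \<in> Lp p T K"
proof -
  have "integrable lborel (\<lambda>t. indicator {0..T} t *\<^sub>R (norm (y t) ^ p))"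
  proof (rule Bochner_Integration.integrable_bound)
    show "integrable lborel (\<lambda>t. \<bar>C\<bar> ^ p * (indicator {0..T} t *\<^sub>R (norm (x t) ^ p)))"
      using x by (auto simp: Lp_iff set_integrable_def)
    have "(\<lambda>t. indicator {0..T} t *\<^sub>R (norm (zext T y t) ^ p)) \<in> borel_measurable lborel"
      using borel_measurable_norm_smeas[OF y(1)] by measurable
    moreover have "(\<lambda>t. indicator {0..T} t *\<^sub>R (norm (zext T y t) ^ p)) = (\<lambda>t. indicator {0..T} t *\<^sub>R (norm (y t) ^ p))"
      by (auto simp: zext_def indicator_def fun_eq_iff)
    ultimately show "(\<lambda>t. indicator {0..T} t *\<^sub>R (norm (y t) ^ p)) \<in> borel_measurable lborel" by simp
    show "AE t in lborel. norm (indicator {0..T} t *\<^sub>R (norm (y t) ^ p)) \<le>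
        norm (\<bar>C\<bar> ^ p * (indicator {0..T} t *\<^sub>R (norm (x t) ^ p)))"
      using le
    proof eventually_elim
      case (elim t)
      have "norm (y t) ^ p \<le> \<bar>C\<bar> ^ p * norm (x t) ^ p" if "t \<in> {0..T}"
      proof -
        have "C * norm (x t) \<le> \<bar>C\<bar> * norm (x t)" by (intro mult_right_mono) auto
        then have "norm (y t) \<le> \<bar>C\<bar> * norm (x t)" using elim that by linarith
        then show ?thesis by (metis norm_ge_zero power_mono power_mult_distrib)
      qed
      then show ?case by (auto simp: indicator_def abs_mult)
    qed
  qed
  then show ?thesis using y by (auto simp: Lp_iff set_integrable_def)
qed

lemma Lp_const: "c \<in> H \<Longrightarrow> (\<lambda>_. c) \<in> Lp p T H"
  unfolding Lp_iff set_integrable_def smeas_zext_iff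
  using integrable_indicator_interval[of T] by (auto simp: smeas_const)

lemma Lp_AE:
  assumes "x \<in> Lp p T H" "smeas lborel (zext T y)" "y ` {0..T} \<subseteq> K" "AE t in lborel. t \<in> {0..T} \<longrightarrow> x t = y t"
  shows "y \<in> Lp p T K"
proof (rule Lp_bounded_by[OF assms(1-3), of 1])
  show "AE t in lborel. t \<in> {0..T} \<longrightarrow> norm (y t) \<le> 1 * norm (x t)" using assms(4) by eventually_elim simp
qed

lemma Lp_continuous:
  fixes x :: "real \<Rightarrow> 'a::{real_inner, banach}"
  assumes c: "continuous_on {0..T} x" and H: "x ` {0..T} \<subseteq> H" and T: "0 \<le> T"
  shows "x \<in> Lp p T H"
proof -
  \<comment> \<open>Clamping the argument extends \<open>x\<close> to a continuous function on the
    whole line without changing it on the interval.\<close>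
  define cl where "cl = (\<lambda>t. max 0 (min T t))"
  have "smeas lborel cl" by (rule smeas_real) (simp add: cl_def)
  moreover have "continuous_on UNIV (\<lambda>t. x (cl t))"
    by (rule continuous_on_compose2[OF c]) (use T in \<open>auto simp: cl_def intro!: continuous_intros\<close>)
  moreover have "smeas lborel (\<lambda>t::real. t)" by (rule smeas_real) simp
  ultimately have m: "smeas lborel (\<lambda>t. x (cl t))" using smeas_compose_continuous[of lborel "\<lambda>t. t" "\<lambda>t. x (cl t)"] by simp
  have "smeas lborel (zext T (\<lambda>t. x (cl t)))"
    unfolding zext_def by (intro smeas_scaleR m smeas_real) simp
  moreover have "zext T (\<lambda>t. x (cl t)) = zext T x" by (rule zext_cong) (auto simp: cl_def)
  ultimately have sm: "smeas lborel (zext T x)" by simp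
  have "bounded (x ` {0..T})" by (intro compact_imp_bounded compact_continuous_image c) simp
  then obtain B where B: "\<And>t. t \<in> {0..T} \<Longrightarrow> norm (x t) \<le> B" unfolding bounded_iff by (metis imageI)
  show ?thesis
  proof (rule Lp_mono[OF Lp_bounded_by[OF Lp_const[OF UNIV_I] sm]])
    show "AE t in lborel. t \<in> {0..T} \<longrightarrow> norm (x t) \<le> B * norm (1::real)" using B by auto
  qed (use H in auto)
qed

lemma Lp2_sqi: "x \<in> Lp 2 T H \<Longrightarrow> zext T x \<in> sqi"
proof -
  assume x: "x \<in> Lp 2 T H"
  have "(\<lambda>t. (norm (zext T x t))\<^sup>2) = (\<lambda>t. indicator {0..T} t *\<^sub>R (norm (x t))\<^sup>2)"
    by (auto simp: zext_def indicator_def fun_eq_iff)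
  then show ?thesis using x by (auto simp: sqi_def Lp_iff set_integrable_def)
qed

lemma sqi_Lp2:
  assumes "x \<in> sqi" "x ` {0..T} \<subseteq> H"
  shows "x \<in> Lp 2 T H"
  unfolding Lp_iff set_integrable_def
proof (intro conjI assms(2))
  show "smeas lborel (zext T x)" unfolding zext_def
    by (intro smeas_scaleR sqi_smeas assms smeas_real) simp
  show "integrable lborel (\<lambda>t. indicator {0..T} t *\<^sub>R (norm (x t))\<^sup>2)"
    using integrable_real_mult_indicator[OF _ sqi_integrable[OF assms(1)], of "{0..T}"] by (simp add: mult.commute)
qed

lemma Lp2_iff_sqi: "x \<in> Lp 2 T H \<longleftrightarrow> zext T x \<in> sqi \<and> x ` {0..T} \<subseteq> H"
proof
  assume a: "zext T x \<in> sqi \<and> x ` {0..T} \<subseteq> H"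
  then have "zext T x \<in> Lp 2 T H" by (intro sqi_Lp2) (auto simp: zext_in)
  then show "x \<in> Lp 2 T H" by (subst Lp_cong[of T x "zext T x"]) (auto simp: zext_in)
qed (auto simp: Lp2_sqi Lp_iff)

lemma Lp2_add: "subspace H \<Longrightarrow> x \<in> Lp 2 T H \<Longrightarrow> y \<in> Lp 2 T H \<Longrightarrow> (\<lambda>t. x t + y t) \<in> Lp 2 T H"
  and Lp2_diff: "subspace H \<Longrightarrow> x \<in> Lp 2 T H \<Longrightarrow> y \<in> Lp 2 T H \<Longrightarrow> (\<lambda>t. x t - y t) \<in> Lp 2 T H"
  and Lp2_scaleR: "subspace H \<Longrightarrow> x \<in> Lp 2 T H \<Longrightarrow> (\<lambda>t. c *\<^sub>R x t) \<in> Lp 2 T H"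
  unfolding Lp2_iff_sqi zext_add zext_diff zext_scaleR
  by (auto simp: image_subset_iff intro: sqi_add sqi_diff sqi_scaleR subspace_add subspace_diff subspace_scale)

lemma Lp_mult_bounded:
  assumes x: "x \<in> Lp p T H" and H: "subspace H" and \<phi>: "\<phi> \<in> borel_measurable borel" "\<And>t. t \<in> {0..T} \<Longrightarrow> \<bar>\<phi> t\<bar> \<le> C"
  shows "(\<lambda>t. \<phi> t *\<^sub>R x t) \<in> Lp p T H"
proof (rule Lp_bounded_by[OF x, of _ _ C])
  have "zext T (\<lambda>t. \<phi> t *\<^sub>R x t) = (\<lambda>t. \<phi> t *\<^sub>R zext T x t)" by (auto simp: zext_def)
  then show "smeas lborel (zext T (\<lambda>t. \<phi> t *\<^sub>R x t))"
    using \<phi>(1) by (simp add: smeas_scaleR smeas_real Lp_smeas[OF x])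
  show "AE t in lborel. t \<in> {0..T} \<longrightarrow> norm (\<phi> t *\<^sub>R x t) \<le> C * norm (x t)"
    by (intro AE_I2 impI) (simp add: mult_right_mono[OF \<phi>(2)])
qed (use x H in \<open>auto simp: Lp_in subspace_scale\<close>)

text \<open>The interval has finite measure, and \<open>a \<le> 1 + a^2\<close>.\<close>

lemma Lp2_imp_Lp1: "x \<in> Lp 2 T H \<Longrightarrow> x \<in> Lp 1 T H"
proof -
  assume x: "x \<in> Lp 2 T H"
  have c: "integrable lborel (\<lambda>t. indicator {0..T} t *\<^sub>R (1::real))"
    using integrable_indicator_interval[of T] by simp
  have "integrable lborel (\<lambda>t. indicator {0..T} t *\<^sub>R (norm (x t) ^ 1))"
  proof (rule Bochner_Integration.integrable_bound)
    show "integrable lborel (\<lambda>t. indicator {0..T} t *\<^sub>R (1::real) + indicator {0..T} t *\<^sub>R (norm (x t))\<^sup>2)"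
      using x by (intro Bochner_Integration.integrable_add c) (auto simp: Lp_iff set_integrable_def)
    have "(\<lambda>t. indicator {0..T} t *\<^sub>R (norm (x t) ^ 1)) = (\<lambda>t. norm (zext T x t))"
      by (auto simp: zext_def indicator_def fun_eq_iff)
    then show "(\<lambda>t. indicator {0..T} t *\<^sub>R (norm (x t) ^ 1)) \<in> borel_measurable lborel"
      using borel_measurable_norm_smeas[OF Lp_smeas[OF x]] by simp
    have "norm (x t) \<le> 1 + (norm (x t))\<^sup>2" for t
      using sum_squares_bound[of 1 "norm (x t)"] norm_ge_zero[of "x t"] by (simp, linarith)
    then show "AE t in lborel. norm (indicator {0..T} t *\<^sub>R (norm (x t) ^ 1))
         \<le> norm (indicator {0..T} t *\<^sub>R (1::real) + indicator {0..T} t *\<^sub>R (norm (x t))\<^sup>2)"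
      by (auto simp: indicator_def)
  qed
  then show ?thesis using x by (auto simp: Lp_iff set_integrable_def)
qed

text \<open>Extension by zero embeds the functions on \<open>[0, T]\<close> into classes on the
  line, so one type serves every \<open>T\<close>.\<close>

definition cls :: "real \<Rightarrow> (real \<Rightarrow> 'a::{real_inner, banach}) \<Rightarrow> 'a L2" where
  "cls T x = abs_L2 (zext T x)"

lemma cls_inner: "x \<in> Lp 2 T H \<Longrightarrow> y \<in> Lp 2 T K \<Longrightarrow> cls T x \<bullet> cls T y = L2_inner T x y"
proof -
  assume xy: "x \<in> Lp 2 T H" "y \<in> Lp 2 T K"
  have "(\<lambda>t. zext T x t \<bullet> zext T y t) = (\<lambda>t. indicator {0..T} t *\<^sub>R (x t \<bullet> y t))"
    by (auto simp: zext_def indicator_def fun_eq_iff)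
  then show ?thesis
    using xy by (simp add: cls_def inner_abs_L2 Lp2_sqi L2_inner_def set_lebesgue_integral_def)
qed

lemma cls_norm: "x \<in> Lp 2 T H \<Longrightarrow> norm (cls T x) = L2_norm T x"
  by (simp add: norm_eq_sqrt_inner cls_inner L2_norm_def L2_inner_def power2_norm_eq_inner)

lemma cls_eq_iff:
  "x \<in> Lp 2 T H \<Longrightarrow> y \<in> Lp 2 T K \<Longrightarrow> cls T x = cls T y \<longleftrightarrow> (AE t in lborel. t \<in> {0..T} \<longrightarrow> x t = y t)"
  unfolding cls_def by (subst abs_L2_eq_iff) (auto simp: Lp2_sqi, auto simp: zext_def indicator_def elim!: AE_mp)

lemma cls_cong: "(\<And>t. t \<in> {0..T} \<Longrightarrow> x t = y t) \<Longrightarrow> cls T x = cls T y"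
  unfolding cls_def by (subst zext_cong[of T x y]) auto

lemma cls_add: "x \<in> Lp 2 T H \<Longrightarrow> y \<in> Lp 2 T K \<Longrightarrow> cls T (\<lambda>t. x t + y t) = cls T x + cls T y"
  and cls_diff: "x \<in> Lp 2 T H \<Longrightarrow> y \<in> Lp 2 T K \<Longrightarrow> cls T (\<lambda>t. x t - y t) = cls T x - cls T y"
  and cls_scaleR: "x \<in> Lp 2 T H \<Longrightarrow> cls T (\<lambda>t. c *\<^sub>R x t) = c *\<^sub>R cls T x"
  by (auto simp: cls_def zext_add zext_diff zext_scaleR plus_abs_L2 minus_abs_L2 scaleR_abs_L2 Lp2_sqi)

text \<open>Along a subsequence the representatives converge almost everywhere. The limit function
  is 0 or a limit of values in \<open>H\<close> at every point, so closedness of \<open>H\<close>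
  gives a representative with values in \<open>H\<close> everywhere, as \<open>Lp\<close>
  demands.\<close>

lemma cls_closed_subspace:
  fixes H :: "'a::{real_inner, banach} set"
  assumes "hilbert_subspace H"
  shows "hilbert_subspace (cls T ` Lp 2 T H)"
proof -
  have H: "subspace H" "closed H" using assms by (auto simp: hilbert_subspace_def)
  have "subspace (cls T ` Lp 2 T H)"
    unfolding subspace_def
  proof (intro conjI ballI allI)
    have "cls T (\<lambda>_. 0) = (0 :: 'a L2)"
      using cls_scaleR[OF Lp_const[of 0 H 2 T], of 0] subspace_0[OF H(1)] by simp
    then show "0 \<in> cls T ` Lp 2 T H" using Lp_const[OF subspace_0[OF H(1)]] by (metis imageI)
  next
    fix X Y :: "'a L2" assume "X \<in> cls T ` Lp 2 T H" "Y \<in> cls T ` Lp 2 T H"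
    then obtain x y where x: "x \<in> Lp 2 T H" "X = cls T x" and y: "y \<in> Lp 2 T H" "Y = cls T y" by blast
    show "X + Y \<in> cls T ` Lp 2 T H"
      unfolding x(2) y(2) cls_add[OF x(1) y(1), symmetric] by (intro imageI Lp2_add H x y)
  next
    fix X :: "'a L2" and c :: real assume "X \<in> cls T ` Lp 2 T H"
    then obtain x where x: "x \<in> Lp 2 T H" "X = cls T x" by blast
    show "c *\<^sub>R X \<in> cls T ` Lp 2 T H"
      unfolding x(2) cls_scaleR[OF x(1), symmetric] by (intro imageI Lp2_scaleR H x)
  qed
  moreover have "closed (cls T ` Lp 2 T H)"
    unfolding closed_sequential_limits
  proof (intro allI impI, elim conjE)
    fix X and L :: "'a L2" assume X: "\<forall>n. X n \<in> cls T ` Lp 2 T H" and lim: "X \<longlonglongrightarrow> L"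
    then have "\<forall>n. \<exists>x. x \<in> Lp 2 T H \<and> X n = cls T x" by blast
    then obtain x where x: "\<And>n. x n \<in> Lp 2 T H" "\<And>n. X n = cls T (x n)" by metis
    have z: "zext T (x n) \<in> sqi" for n using x(1) by (rule Lp2_sqi)
    have "(\<lambda>n. abs_L2 (zext T (x n))) = X" by (rule ext) (simp add: x(2) cls_def)
    then have "(\<lambda>n. abs_L2 (zext T (x n))) \<longlonglongrightarrow> abs_L2 (rep_L2 L)"
      using lim by (simp add: abs_rep_L2)
    from L2_tendsto_AE_subseq[OF z rep_L2_sqi this] obtain r where
      r: "AE t in lborel. (\<lambda>n. zext T (x (r n)) t) \<longlonglongrightarrow> rep_L2 L t" by blast
    have "AE t in lborel. convergent (\<lambda>n. zext T (x (r n)) t)"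
      using r by eventually_elim (rule convergentI)
    then obtain l where l: "smeas lborel l" "AE t in lborel. (\<lambda>n. zext T (x (r n)) t) \<longlonglongrightarrow> l t"
      "\<And>t. l t = 0 \<or> (\<lambda>n. zext T (x (r n)) t) \<longlonglongrightarrow> l t"
      using smeas_AE_limit[of "\<lambda>n. zext T (x (r n))", OF sqi_smeas[OF z]] by blast
    have ae: "AE t in lborel. rep_L2 L t = l t" using r l(2) by eventually_elim (rule LIMSEQ_unique)
    have "l \<in> sqi" unfolding sqi_def
    proof (intro CollectI conjI l(1))
      show "integrable lborel (\<lambda>t. (norm (l t))\<^sup>2)"
      proof (rule integrable_cong_AE_imp[OF sqi_integrable[OF rep_L2_sqi[of L]]])
        show "(\<lambda>t. (norm (l t))\<^sup>2) \<in> borel_measurable lborel"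
          by (intro borel_measurable_power borel_measurable_norm_smeas l)
        show "AE t in lborel. (norm (rep_L2 L t))\<^sup>2 = (norm (l t))\<^sup>2" using ae by eventually_elim simp
      qed
    qed
    have lH: "l t \<in> H" for t
    proof (cases "l t = 0")
      case False
      have "zext T (x (r n)) t \<in> H" for n
        using Lp_in[OF x(1)] subspace_0[OF H(1)] by (cases "t \<in> {0..T}") (auto simp: zext_in zext_out)
      then show ?thesis
        using l(3)[of t] False closed_sequentially[OF H(2), of "\<lambda>n. zext T (x (r n)) t" "l t"] by blast
    qed (use subspace_0[OF H(1)] in simp)
    have l0: "l t = 0" if "t \<notin> {0..T}" for t
      using l(3)[of t] that by (auto simp: zext_out LIMSEQ_const_iff)
    have "zext T l = l" using l0 by (auto simp: zext_def indicator_def fun_eq_iff)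
    moreover have "abs_L2 l = abs_L2 (rep_L2 L)"
      by (subst abs_L2_eq_iff) (use ae \<open>l \<in> sqi\<close> rep_L2_sqi in \<open>auto elim: AE_mp\<close>)
    ultimately have "L = cls T l" by (simp add: cls_def abs_rep_L2)
    moreover have "l \<in> Lp 2 T H" by (rule sqi_Lp2[OF \<open>l \<in> sqi\<close>]) (use lH in auto)
    ultimately show "L \<in> cls T ` Lp 2 T H" by blast
  qed
  ultimately show ?thesis by (simp add: hilbert_subspace_def)
qed

section \<open>Henstock-Kurzweil integrability of Bochner integrable functions\<close>

lemma norm_diff_through:
  fixes a b c d :: "'a::real_normed_vector"
  shows "norm (a - b) \<le> norm (a - c) + norm (c - d) + norm (b - d)"
  using norm_triangle_ineq[of "a - c" "c - d"] norm_triangle_ineq4[of "a - d" "b - d"] by simp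

text \<open>Domination of Riemann sums: for a fine division the sums of \<open>x\<close> and of the
  approximation \<open>s\<close> differ by at most the sum of \<open>h\<close>, which is close to
  the small integral of \<open>h\<close>. The Cauchy criterion thus passes from \<open>s\<close> to
  \<open>x\<close>.\<close>

lemma HK_integrable_approx:
  fixes x :: "real \<Rightarrow> 'a::banach"
  assumes ap: "\<And>e. e > 0 \<Longrightarrow> \<exists>s h. s integrable_on {a..b} \<and> h integrable_on {a..b} \<and>
      (\<forall>t\<in>{a..b}. norm (x t - s t) \<le> h t) \<and> integral {a..b} h < (e::real)"
  shows "x integrable_on {a..b}"
  unfolding box_real[symmetric] integrable_Cauchy
proof (intro allI impI)
  fix e :: real assume e: "e > 0"
  obtain s h where s: "s integrable_on cbox a b" and h: "h integrable_on cbox a b"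
    and le: "\<And>t. t \<in> cbox a b \<Longrightarrow> norm (x t - s t) \<le> h t" and small: "integral (cbox a b) h < e / 8"
    using ap[of "e/8"] e unfolding box_real[symmetric] by auto
  obtain g1 where g1: "gauge g1" and g1': "\<And>D1 D2. D1 tagged_division_of cbox a b \<Longrightarrow> g1 fine D1 \<Longrightarrow>
      D2 tagged_division_of cbox a b \<Longrightarrow> g1 fine D2 \<Longrightarrow>
      norm ((\<Sum>(x, K)\<in>D1. measure lborel K *\<^sub>R s x) - (\<Sum>(x, K)\<in>D2. measure lborel K *\<^sub>R s x)) < e / 4"
    using s[unfolded integrable_Cauchy, rule_format, of "e/4"] e by auto
  obtain g2 where g2: "gauge g2" and g2': "\<And>D. D tagged_division_of cbox a b \<Longrightarrow> g2 fine D \<Longrightarrow>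
      norm ((\<Sum>(x, K)\<in>D. measure lborel K *\<^sub>R h x) - integral (cbox a b) h) < e / 8"
    using integrable_integral[OF h, unfolded has_integral, rule_format, of "e/8"] e by auto
  \<comment> \<open>The bound is \<open>e / 8\<close> from the integral of \<open>h\<close> plus
    \<open>e / 8\<close> from its gauge.\<close>
  have near: "norm ((\<Sum>(t, K)\<in>D. measure lborel K *\<^sub>R x t) - (\<Sum>(t, K)\<in>D. measure lborel K *\<^sub>R s t)) < e / 4"
    if D: "D tagged_division_of cbox a b" "g2 fine D" for D
  proof -
    have "(\<Sum>(t, K)\<in>D. measure lborel K *\<^sub>R x t) - (\<Sum>(t, K)\<in>D. measure lborel K *\<^sub>R s t) = (\<Sum>(t, K)\<in>D. measure lborel K *\<^sub>R (x t - s t))"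
      by (subst sum_subtractf[symmetric]) (auto simp: case_prod_unfold scaleR_diff_right intro: sum.cong)
    also have "norm \<dots> \<le> (\<Sum>(t, K)\<in>D. measure lborel K *\<^sub>R h t)"
    proof (rule sum_norm_le)
      fix p assume "p \<in> D"
      moreover obtain t K where p: "p = (t, K)" by (cases p)
      ultimately have "t \<in> cbox a b" using D(1) tag_in_interval by blast
      from le[OF this] show "norm (case p of (t, K) \<Rightarrow> measure lborel K *\<^sub>R (x t - s t)) \<le> (case p of (t, K) \<Rightarrow> measure lborel K *\<^sub>R h t)"
        by (simp add: p mult_left_mono)
    qed
    also have "\<dots> < e / 4" using g2'[OF D] small unfolding real_norm_def by linarith
    finally show ?thesis .
  qed
  show "\<exists>\<gamma>. gauge \<gamma> \<and> (\<forall>D1 D2. D1 tagged_division_of cbox a b \<and> \<gamma> fine D1 \<and> D2 tagged_division_of cbox a b \<and> \<gamma> fine D2 \<longrightarrow>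
      norm ((\<Sum>(t, K)\<in>D1. measure lborel K *\<^sub>R x t) - (\<Sum>(t, K)\<in>D2. measure lborel K *\<^sub>R x t)) < e)"
  proof (intro exI[of _ "\<lambda>t. g1 t \<inter> g2 t"] conjI allI impI; (elim conjE)?)
    show "gauge (\<lambda>t. g1 t \<inter> g2 t)" by (rule gauge_Int[OF g1 g2])
    fix D1 D2 assume D: "D1 tagged_division_of cbox a b" "(\<lambda>t. g1 t \<inter> g2 t) fine D1"
      "D2 tagged_division_of cbox a b" "(\<lambda>t. g1 t \<inter> g2 t) fine D2"
    then have f: "g1 fine D1" "g2 fine D1" "g1 fine D2" "g2 fine D2" by (auto simp: fine_Int)
    let ?S = "\<lambda>D f. (\<Sum>(t, K)\<in>D. measure lborel K *\<^sub>R f t)"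
    have "norm (?S D1 x - ?S D2 x) \<le> norm (?S D1 x - ?S D1 s) + norm (?S D1 s - ?S D2 s) + norm (?S D2 x - ?S D2 s)"
      by (rule norm_diff_through)
    then show "norm (?S D1 x - ?S D2 x) < e"
      using near[OF D(1) f(2)] near[OF D(3) f(4)] g1'[OF D(1) f(1) D(3) f(3)] e by linarith
  qed
qed

text \<open>Nearest-point simple functions are no farther from \<open>x t\<close> than
  \<open>d\<close> is, so scalar dominated convergence makes the integral of the error small. A
  simple function is a finite sum of scalar indicators times vectors, and for scalars Lebesgue
  integrability gives Henstock-Kurzweil integrability.\<close>

lemma Lp1_HK_integrable:
  fixes x :: "real \<Rightarrow> 'a::{real_inner, banach}"
  assumes x: "x \<in> Lp 1 T H"
  shows "x integrable_on {0..T}"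
proof (rule HK_integrable_approx)
  fix e :: real assume e: "e > 0"
  let ?M = "restrict_space lborel {0..T}"
  have sm: "smeas lborel (zext T x)" using x by (rule Lp_smeas)
  obtain D where D: "countable D" "D \<subseteq> range (zext T x)" "range (zext T x) \<subseteq> closure D"
    using smeas_separable[OF sm] by auto
  then have "D \<noteq> {}" by auto
  then obtain s d where s: "\<And>n. simple_function lborel (s n)"
    "\<And>t. (\<lambda>n. s n t) \<longlonglongrightarrow> zext T x t" "\<And>n t. dist (zext T x t) (s n t) \<le> dist (zext T x t) d"
    using smeas_approx[OF smeas_borel[OF sm] D(1) _, of ] D(3) by (simp) metis
  define h where "h = (\<lambda>n t. indicator {0..T} t *\<^sub>R norm (zext T x t - s n t))"
  have hm: "h n \<in> borel_measurable lborel" for n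
  proof -
    have "(\<lambda>t. norm (zext T x t - s n t)) \<in> borel_measurable lborel"
      by (intro borel_measurable_norm_smeas smeas_diff sm smeas_simple s)
    then show ?thesis unfolding h_def by measurable
  qed
  have dom: "integrable lborel (\<lambda>t. indicator {0..T} t *\<^sub>R norm (x t) + indicator {0..T} t *\<^sub>R norm d)"
    using x integrable_indicator_interval[of T]
    by (intro Bochner_Integration.integrable_add) (auto simp: Lp_iff set_integrable_def)
  have hb: "norm (h n t) \<le> indicator {0..T} t *\<^sub>R norm (x t) + indicator {0..T} t *\<^sub>R norm d" for n t
    using s(3)[of t n] norm_triangle_ineq4[of "x t" d] by (auto simp: h_def indicator_def zext_in dist_norm)
  have hi: "integrable lborel (h n)" for n
    by (rule Bochner_Integration.integrable_bound[OF dom hm]) (use hb in \<open>auto intro!: AE_I2 order_trans[OF hb]\<close>)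
  have lim0: "AE t in lborel. (\<lambda>n. h n t) \<longlonglongrightarrow> 0"
  proof (rule AE_I2)
    fix t
    have "(\<lambda>n. indicator {0..T} t *\<^sub>R norm (zext T x t - s n t)) \<longlonglongrightarrow> indicator {0..T} t *\<^sub>R norm (zext T x t - zext T x t)"
      by (intro tendsto_intros s)
    then show "(\<lambda>n. h n t) \<longlonglongrightarrow> 0" by (simp add: h_def)
  qed
  have "(\<lambda>n. LINT t|lborel. h n t) \<longlonglongrightarrow> (LINT t::real|lborel. (0::real))"
    by (rule integral_dominated_convergence[OF _ hm dom lim0]) (use hb in auto)
  then have "\<forall>\<^sub>F n in sequentially. (LINT t|lborel. h n t) < e" using e by (intro order_tendstoD) auto
  then obtain n where n: "(LINT t|lborel. h n t) < e" by (meson eventually_happens sequentially_bot)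
  have hset: "set_integrable lborel {0..T} (h n)"
    unfolding set_integrable_def using integrable_real_mult_indicator[OF _ hi, of "{0..T}"] by (simp add: mult.commute)
  have "(LINT t:{0..T}|lborel. h n t) = (LINT t|lborel. h n t)"
    unfolding set_lebesgue_integral_def by (rule Bochner_Integration.integral_cong) (auto simp: h_def indicator_def)
  then have I: "h n integrable_on {0..T}" "integral {0..T} (h n) < e"
    using set_borel_integral_eq_integral[OF hset] n by auto
  have fin: "finite (range (s n))" using simple_functionD(1)[OF s(1)[of n]] by simp
  have "s n = (\<lambda>t. \<Sum>z\<in>range (s n). indicat_real (s n -` {z}) t *\<^sub>R z)"
  proof
    fix t
    have "(\<Sum>z\<in>range (s n). indicat_real (s n -` {z}) t *\<^sub>R z) = (\<Sum>z\<in>range (s n). if z = s n t then s n t else 0)"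
      by (rule sum.cong) (auto simp: indicator_def)
    then show "s n t = (\<Sum>z\<in>range (s n). indicat_real (s n -` {z}) t *\<^sub>R z)" using fin by simp
  qed
  moreover have "(\<lambda>t. \<Sum>z\<in>range (s n). indicat_real (s n -` {z}) t *\<^sub>R z) integrable_on {0..T}"
  proof (intro integrable_sum fin integrable_on_scaleR_left)
    fix z
    have sz: "s n -` {z} \<in> sets lborel" using simple_functionD(2)[OF s(1)[of n], of "{z}"] by simp
    have "set_integrable lborel {0..T} (indicat_real (s n -` {z}))"
      unfolding set_integrable_def
    proof (rule Bochner_Integration.integrable_bound[OF integrable_indicator_interval[of T]])
      show "(\<lambda>t. indicat_real {0..T} t *\<^sub>R indicat_real (s n -` {z}) t) \<in> borel_measurable lborel"
        using sz by measurable
    qed (auto simp: indicator_def)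
    then show "indicat_real (s n -` {z}) integrable_on {0..T}" by (rule set_borel_integral_eq_integral)
  qed
  ultimately have "s n integrable_on {0..T}" by simp
  moreover have "\<forall>t\<in>{0..T}. norm (x t - s n t) \<le> h n t" by (auto simp: h_def zext_in)
  ultimately show "\<exists>s h. s integrable_on {0..T} \<and> h integrable_on {0..T} \<and>
      (\<forall>t\<in>{0..T}. norm (x t - s t) \<le> h t) \<and> integral {0..T} h < e" using I by blast
qed

section \<open>Primitives and integration by parts\<close>

lemma Lp1_norm_integrable: "x \<in> Lp 1 T H \<Longrightarrow> integrable lborel (\<lambda>t. norm (zext T x t))"
proof -
  assume x: "x \<in> Lp 1 T H"
  have "(\<lambda>t. norm (zext T x t)) = (\<lambda>t. indicator {0..T} t *\<^sub>R (norm (x t) ^ 1))"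
    by (auto simp: zext_def indicator_def fun_eq_iff)
  then show ?thesis using x by (simp add: Lp_iff set_integrable_def)
qed

lemma Lp1_iff: "x \<in> Lp 1 T H \<longleftrightarrow> smeas lborel (zext T x) \<and> x ` {0..T} \<subseteq> H \<and> integrable lborel (\<lambda>t. norm (zext T x t))"
proof -
  have "(\<lambda>t. norm (zext T x t)) = (\<lambda>t. indicator {0..T} t *\<^sub>R (norm (x t) ^ 1))"
    by (auto simp: zext_def indicator_def fun_eq_iff)
  then show ?thesis by (simp add: Lp_iff set_integrable_def)
qed

lemma Lp1_add:
  assumes H: "subspace H" and x: "x \<in> Lp 1 T H" and y: "y \<in> Lp 1 T H"
  shows "(\<lambda>t. x t + y t) \<in> Lp 1 T H"
  unfolding Lp1_iff zext_add
proof (intro conjI)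
  show m: "smeas lborel (\<lambda>t. zext T x t + zext T y t)" by (intro smeas_add Lp_smeas[OF x] Lp_smeas[OF y])
  show "(\<lambda>t. x t + y t) ` {0..T} \<subseteq> H"
    using Lp_in[OF x] Lp_in[OF y] subspace_add[OF H] by (auto simp: image_subset_iff)
  show "integrable lborel (\<lambda>t. norm (zext T x t + zext T y t))"
  proof (rule Bochner_Integration.integrable_bound)
    show "integrable lborel (\<lambda>t. norm (zext T x t) + norm (zext T y t))"
      by (intro Bochner_Integration.integrable_add Lp1_norm_integrable[OF x] Lp1_norm_integrable[OF y])
    show "(\<lambda>t. norm (zext T x t + zext T y t)) \<in> borel_measurable lborel"
      by (rule borel_measurable_norm_smeas[OF m])
  qed (auto intro: norm_triangle_ineq)
qed

lemma Lp1_scaleR: "subspace H \<Longrightarrow> x \<in> Lp 1 T H \<Longrightarrow> (\<lambda>t. c *\<^sub>R x t) \<in> Lp 1 T H"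
  by (rule Lp_mult_bounded[of _ _ _ _ "\<lambda>_. c" "\<bar>c\<bar>"]) auto

lemma Lp1_diff: "subspace H \<Longrightarrow> x \<in> Lp 1 T H \<Longrightarrow> y \<in> Lp 1 T H \<Longrightarrow> (\<lambda>t. x t - y t) \<in> Lp 1 T H"
  using Lp1_add[of H x T "\<lambda>t. (-1) *\<^sub>R y t"] Lp1_scaleR[of H y T "-1"] by simp

lemma integrable_mult_inner:
  fixes g :: "real \<Rightarrow> real"
  assumes x: "x \<in> Lp 1 T H" and g: "g \<in> borel_measurable lborel" "\<And>t. t \<in> {0..T} \<Longrightarrow> \<bar>g t\<bar> \<le> C"
  shows "integrable lborel (\<lambda>t. g t * (zext T x t \<bullet> w))"
proof (rule Bochner_Integration.integrable_bound)
  show "integrable lborel (\<lambda>t. (C * norm w) * norm (zext T x t))"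
    using Lp1_norm_integrable[OF x] by simp
  have [measurable]: "(\<lambda>t. zext T x t \<bullet> w) \<in> borel_measurable lborel"
    by (intro borel_measurable_inner_smeas Lp_smeas[OF x] smeas_const)
  show "(\<lambda>t. g t * (zext T x t \<bullet> w)) \<in> borel_measurable lborel" using g(1) by measurable
  have "\<bar>g t * (zext T x t \<bullet> w)\<bar> \<le> (C * norm w) * norm (zext T x t)" for t
  proof (cases "t \<in> {0..T}")
    case True
    have "\<bar>g t * (zext T x t \<bullet> w)\<bar> \<le> C * (norm (zext T x t) * norm w)"
      unfolding abs_mult using g(2)[OF True] Cauchy_Schwarz_ineq2[of "zext T x t" w] by (intro mult_mono) auto
    then show ?thesis by (simp add: mult_ac)
  qed (simp add: zext_out)
  then show "AE t in lborel. norm (g t * (zext T x t \<bullet> w)) \<le> norm ((C * norm w) * norm (zext T x t))"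
    by (intro AE_I2) (simp, meson abs_ge_self order_trans)
qed

definition prim :: "(real \<Rightarrow> 'a::{real_inner, banach}) \<Rightarrow> real \<Rightarrow> 'a" where
  "prim x t = integral {0..t} x"

text \<open>The bridge from vector-valued Henstock-Kurzweil integrals to real Lebesgue integrals:
  pairing with \<open>w\<close> commutes with the integral.\<close>

lemma prim_inner:
  assumes x: "x \<in> Lp 1 T H" and t: "t \<le> T"
  shows "prim x t \<bullet> w = (LINT s|lborel. indicator {0..t} s * (zext T x s \<bullet> w))"
proof -
  have "x integrable_on {0..t}"
    by (rule integrable_on_subinterval[OF Lp1_HK_integrable[OF x]]) (use t in auto)
  then have "integral {0..t} ((\<lambda>v. v \<bullet> w) \<circ> x) = integral {0..t} x \<bullet> w"
    by (rule integral_linear) (rule bounded_linear_inner_left)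
  then have "prim x t \<bullet> w = integral {0..t} (\<lambda>s. x s \<bullet> w)" by (simp add: prim_def comp_def)
  also have eq: "(\<lambda>s. indicator {0..t} s * (zext T x s \<bullet> w)) = (\<lambda>s. indicator {0..t} s *\<^sub>R (x s \<bullet> w))"
    using t by (auto simp: fun_eq_iff indicator_def zext_def)
  have "integrable lborel (\<lambda>s. indicator {0..t} s * (zext T x s \<bullet> w))"
    by (rule integrable_mult_inner[OF x, of _ 1]) (auto simp: indicator_def)
  then have "set_integrable lborel {0..t} (\<lambda>s. x s \<bullet> w)" by (simp add: set_integrable_def eq)
  from set_borel_integral_eq_integral(2)[OF this]
  have "integral {0..t} (\<lambda>s. x s \<bullet> w) = (LINT s|lborel. indicator {0..t} s *\<^sub>R (x s \<bullet> w))"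
    by (simp add: set_lebesgue_integral_def)
  finally show ?thesis by (simp add: eq)
qed

lemma integral_inner_zext:
  assumes x: "x \<in> Lp 1 T H"
  shows "integral {0..T} x \<bullet> w = (LINT s|lborel. zext T x s \<bullet> w)"
proof -
  have "(\<lambda>s. indicator {0..T} s * (zext T x s \<bullet> w)) = (\<lambda>s. zext T x s \<bullet> w)"
  proof
    show "indicator {0..T} s * (zext T x s \<bullet> w) = zext T x s \<bullet> w" for s
      by (cases "s \<in> {0..T}") (simp_all add: zext_out)
  qed
  then show ?thesis using prim_inner[OF x, of T w] by (simp add: prim_def)
qed

lemma prim_continuous: "x \<in> Lp 1 T H \<Longrightarrow> continuous_on {0..T} (prim x)"
  unfolding prim_def[abs_def] by (rule indefinite_integral_continuous_1[OF Lp1_HK_integrable])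

lemma prim_0: "prim x 0 = 0"
  by (simp add: prim_def)

text \<open>The component of the integral orthogonal to \<open>H\<close> pairs to zero with all
  values of \<open>x\<close>, hence with the integral itself.\<close>

lemma prim_in:
  assumes H: "hilbert_subspace H" and x: "x \<in> Lp 1 T H" and t: "t \<le> T"
  shows "prim x t \<in> H"
proof -
  obtain p where p: "p \<in> H" "\<And>y. y \<in> H \<Longrightarrow> (prim x t - p) \<bullet> y = 0"
    using orthogonal_projection_exists[OF H] by metis
  have H0: "0 \<in> H" using H by (simp add: hilbert_subspace_def subspace_0)
  have "zext T x s \<bullet> (prim x t - p) = 0" for s
    using p(2)[of "zext T x s"] Lp_in[OF x] H0
    by (cases "s \<in> {0..T}") (auto simp: zext_in zext_out inner_commute)
  then have "prim x t \<bullet> (prim x t - p) = 0" by (simp add: prim_inner[OF x t])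
  moreover have "p \<bullet> (prim x t - p) = 0" using p by (metis inner_commute)
  ultimately have "(prim x t - p) \<bullet> (prim x t - p) = 0" by (simp add: inner_diff_left)
  then show ?thesis using p(1) by simp
qed

lemma prim_Lp:
  assumes "hilbert_subspace H" "x \<in> Lp 1 T H" "0 \<le> T"
  shows "prim x \<in> Lp p T H"
  by (rule Lp_continuous[OF prim_continuous[OF assms(2)] _ assms(3)]) (use prim_in[OF assms(1,2)] in auto)

text \<open>Fubini's theorem on the triangle \<open>s \<le> t\<close>, integrated in both orders. It
  serves as integration by parts for primitives, without any appeal to their pointwise
  derivatives.\<close>

lemma integral_parts:
  fixes v w :: "real \<Rightarrow> 'a::{real_inner, banach}"
  assumes v: "v \<in> Lp 1 T H" and w: "w \<in> Lp 1 T K"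
  shows "(LINT t|lborel. prim v t \<bullet> zext T w t) = (LINT s|lborel. zext T v s \<bullet> (prim w T - prim w s))"
proof -
  define F where "F = (\<lambda>s t :: real. (if s \<le> t then 1 else 0 :: real) * (zext T v s \<bullet> zext T w t))"
  have sv: "smeas (lborel \<Otimes>\<^sub>M lborel) (\<lambda>p :: real \<times> real. zext T v (fst p))"
    by (rule smeas_comp_measurable[OF Lp_smeas[OF v]]) simp
  have sw: "smeas (lborel \<Otimes>\<^sub>M lborel) (\<lambda>p :: real \<times> real. zext T w (snd p))"
    by (rule smeas_comp_measurable[OF Lp_smeas[OF w]]) simp
  note [measurable] = borel_measurable_inner_smeas[OF sv sw] borel_measurable_norm_smeas[OF sv] borel_measurable_norm_smeas[OF sw]
  have "integrable (lborel \<Otimes>\<^sub>M lborel) (\<lambda>p :: real \<times> real. norm (zext T v (fst p)) * norm (zext T w (snd p)))"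
    by (rule lborel_pair.Fubini_integrable) (auto intro!: Lp1_norm_integrable[OF v] Lp1_norm_integrable[OF w])
  then have "integrable (lborel \<Otimes>\<^sub>M lborel) (case_prod F)"
  proof (rule Bochner_Integration.integrable_bound)
    show "case_prod F \<in> borel_measurable (lborel \<Otimes>\<^sub>M lborel)"
      unfolding F_def case_prod_beta by measurable
    show "AE p in lborel \<Otimes>\<^sub>M lborel. norm (case_prod F p) \<le> norm (norm (zext T v (fst p)) * norm (zext T w (snd p)))"
      by (intro AE_I2) (auto simp: F_def case_prod_beta Cauchy_Schwarz_ineq2)
  qed
  from lborel_pair.Fubini_integral[OF this]
  have "(LINT t|lborel. LINT s|lborel. F s t) = (LINT s|lborel. LINT t|lborel. F s t)" .
  also have "(\<lambda>t. LINT s|lborel. F s t) = (\<lambda>t. prim v t \<bullet> zext T w t)"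
  proof
    fix t
    show "(LINT s|lborel. F s t) = prim v t \<bullet> zext T w t"
    proof (cases "t \<in> {0..T}")
      case True
      have "F s t = indicator {0..t} s * (zext T v s \<bullet> zext T w t)" for s
        by (cases "s < 0") (auto simp: F_def indicator_def zext_def)
      then show ?thesis using True by (simp add: prim_inner[OF v])
    qed (simp add: F_def zext_out)
  qed
  also have "(\<lambda>s. LINT t|lborel. F s t) = (\<lambda>s. zext T v s \<bullet> (prim w T - prim w s))"
  proof
    fix s
    show "(LINT t|lborel. F s t) = zext T v s \<bullet> (prim w T - prim w s)"
    proof (cases "s \<in> {0..T}")
      case True
      let ?z = "zext T v s"
      have i: "integrable lborel (\<lambda>t. indicator {0..r} t * (zext T w t \<bullet> ?z))" for r
        by (rule integrable_mult_inner[OF w, of _ 1]) (auto simp: indicator_def)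
      have "?z \<bullet> (prim w T - prim w s) = (LINT t|lborel. indicator {0..T} t * (zext T w t \<bullet> ?z)) - (LINT t|lborel. indicator {0..s} t * (zext T w t \<bullet> ?z))"
        using True by (simp add: inner_diff_right inner_commute[of ?z] prim_inner[OF w])
      also have "\<dots> = (LINT t|lborel. indicator {0..T} t * (zext T w t \<bullet> ?z) - indicator {0..s} t * (zext T w t \<bullet> ?z))"
        by (rule Bochner_Integration.integral_diff[symmetric]; rule i)
      also have "\<dots> = (LINT t|lborel. F s t)"
      proof (rule integral_cong_AE)
        have [measurable]: "(\<lambda>t. zext T w t \<bullet> ?z) \<in> borel_measurable lborel" "(\<lambda>t. ?z \<bullet> zext T w t) \<in> borel_measurable lborel"
          by (intro borel_measurable_inner_smeas Lp_smeas[OF w] smeas_const)+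
        show "(\<lambda>t. indicator {0..T} t * (zext T w t \<bullet> ?z) - indicator {0..s} t * (zext T w t \<bullet> ?z)) \<in> borel_measurable lborel"
          by measurable
        show "(\<lambda>t. F s t) \<in> borel_measurable lborel" unfolding F_def by measurable
        \<comment> \<open>The two integrands differ at \<open>t = s\<close> only.\<close>
        show "AE t in lborel. indicator {0..T} t * (zext T w t \<bullet> ?z) - indicator {0..s} t * (zext T w t \<bullet> ?z) = F s t"
          using AE_lborel_singleton[of s]
        proof eventually_elim
          case (elim t)
          then show ?case using True
            by (cases "t \<in> {0..T}") (auto simp: F_def indicator_def zext_out inner_commute)
        qed
      qed
      finally show ?thesis by simp
    qed (simp add: F_def zext_out)
  qed
  finally show ?thesis .
qed

text \<open>Open intervals generate the Borel sets and are stable under intersection, so a Dynkin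
  system argument extends the vanishing to all Borel sets, in particular to the sets where
  \<open>r\<close> is positive or negative.\<close>

lemma AE_zero_of_integral_intervals:
  fixes r :: "real \<Rightarrow> real"
  assumes r: "integrable lborel r" and z: "\<And>a b. a < b \<Longrightarrow> (LINT t:{a<..<b}|lborel. r t) = 0"
  shows "AE t in lborel. r t = 0"
proof -
  have si: "set_integrable lborel A r" if "A \<in> sets borel" for A
    unfolding set_integrable_def using integrable_mult_indicator[OF _ r, of A] that by simp
  have zero: "(LINT t:A|lborel. r t) = 0" if "A \<in> sets borel" for A
  proof -
    let ?G = "range (\<lambda>(a, b). {a<..<b::real})"
    have G: "range (\<lambda>(a, b). box a b) = ?G" by (rule image_cong) auto
    have "Int_stable ?G"
    proof (rule Int_stableI)
      fix A B assume "A \<in> ?G" "B \<in> ?G"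
      then obtain a b c d where "A = {a<..<b}" "B = {c<..<d}" by auto
      then have "A \<inter> B = {max a c<..<min b d}" by auto
      then show "A \<inter> B \<in> ?G" by auto
    qed
    moreover have "?G \<subseteq> Pow UNIV" by simp
    moreover have "A \<in> sigma_sets UNIV ?G"
      using that unfolding borel_eq_box G by simp
    ultimately show ?thesis
    proof (induction rule: sigma_sets_induct_disjoint)
      case (basic A)
      then obtain a b where "A = {a<..<b}" by auto
      then show ?case using z[of a b] by (cases "a < b") (auto simp: set_lebesgue_integral_def)
    next
      case empty
      show ?case by (simp add: set_lebesgue_integral_def)
    next
      case (compl A)
      \<comment> \<open>Complements require the total integral, which is the limit of the integrals
        over the intervals from \<open>- n\<close> to \<open>n\<close>.\<close>
      have "(\<lambda>n::nat. LINT t:{- real n<..<real n}|lborel. r t) \<longlonglongrightarrow> (LINT t|lborel. r t)"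
        unfolding set_lebesgue_integral_def
      proof (rule integral_dominated_convergence[where w="\<lambda>t. \<bar>r t\<bar>"])
        show "AE t in lborel. (\<lambda>n. indicat_real {- real n<..<real n} t *\<^sub>R r t) \<longlonglongrightarrow> r t"
        proof (rule AE_I2, rule tendsto_eventually)
          fix t :: real
          obtain N where "\<bar>t\<bar> < real N" using reals_Archimedean2 by blast
          then show "\<forall>\<^sub>F n in sequentially. indicat_real {- real n<..<real n} t *\<^sub>R r t = r t"
            unfolding eventually_sequentially by (intro exI[of _ N]) (auto simp: indicator_def)
        qed
      qed (use r in \<open>auto simp: indicator_def\<close>)
      moreover have "(LINT t:{- real n<..<real n}|lborel. r t) = 0" for n
        using z[of "- real n" "real n"] by (cases n) (auto simp: set_lebesgue_integral_def)
      ultimately have tot: "(LINT t|lborel. r t) = 0" by (simp add: LIMSEQ_const_iff)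
      have A: "A \<in> sets borel" using compl(1) unfolding borel_eq_box G by simp
      have "(LINT t:(A \<union> (UNIV - A))|lborel. r t) = (LINT t:A|lborel. r t) + (LINT t:(UNIV - A)|lborel. r t)"
        by (rule set_integral_Un) (use A in \<open>auto intro: si\<close>)
      then show ?case using compl(2) tot by (simp add: set_lebesgue_integral_def)
    next
      case (union A)
      have A: "A i \<in> sets borel" for i using union(2) unfolding borel_eq_box G by auto
      have "(LINT t:(\<Union>i. A i)|lborel. r t) = (\<Sum>i. (LINT t:(A i)|lborel. r t))"
        by (rule lebesgue_integral_countable_add)
          (use A union(1) in \<open>auto intro!: si simp: disjoint_family_on_def\<close>)
      then show ?case using union(3) by simp
    qed
  qed
  have half: "AE t in lborel. \<not> 0 < s * r t" if s: "s = 1 \<or> s = -1" for s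
  proof -
    define A where "A = {t. 0 < s * r t}"
    have [measurable]: "r \<in> borel_measurable lborel" using r by auto
    have A: "A \<in> sets borel" unfolding A_def by measurable
    have "(LINT t|lborel. indicator A t * (s * r t)) = s * (LINT t:A|lborel. r t)"
      unfolding set_lebesgue_integral_def integral_mult_right_zero[symmetric]
      by (rule Bochner_Integration.integral_cong) auto
    then have "(LINT t|lborel. indicator A t * (s * r t)) = 0" using zero[OF A] by simp
    moreover have "integrable lborel (\<lambda>t. indicator A t * (s * r t))"
      using integrable_mult_indicator[OF _ r, of A] A
      by (subst mult.left_commute, intro integrable_mult_right) simp
    ultimately have "AE t in lborel. indicator A t * (s * r t) = 0"
      by (subst (asm) integral_nonneg_eq_0_iff_AE) (auto simp: A_def indicator_def)
    then show ?thesis by eventually_elim (auto simp: A_def indicator_def)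
  qed
  have "AE t in lborel. \<not> 0 < 1 * r t" "AE t in lborel. \<not> 0 < (-1) * r t" by (intro half; simp)+
  then show ?thesis by eventually_elim auto
qed

text \<open>Pairing with a fixed \<open>w\<close> gives a real function whose integrals over
  intervals vanish, hence a null set depending on \<open>w\<close>. For a countable \<open>D\<close>
  whose closure contains the range a single null set is enough, and off it each value is orthogonal
  to itself.\<close>

lemma AE_zero_of_prim_zero:
  assumes x: "x \<in> Lp 1 T H" and z: "\<And>t. t \<in> {0..T} \<Longrightarrow> prim x t = 0" and T: "0 < T"
  shows "AE t in lborel. zext T x t = 0"
proof -
  obtain D where D: "countable D" "range (zext T x) \<subseteq> closure D"
    using smeas_separable[OF Lp_smeas[OF x]] by auto
  have w: "AE t in lborel. zext T x t \<bullet> w = 0" for w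
  proof (rule AE_zero_of_integral_intervals)
    show int: "integrable lborel (\<lambda>t. zext T x t \<bullet> w)"
      using integrable_mult_inner[OF x, of "\<lambda>_. 1" 1 w] by simp
    fix a b :: real assume "a < b"
    define a' b' where "a' = max 0 (min T a)" and "b' = max 0 (min T b)"
    have ab: "a' \<in> {0..T}" "b' \<in> {0..T}" "a' \<le> b'" using \<open>a < b\<close> T by (auto simp: a'_def b'_def)
    have i: "integrable lborel (\<lambda>t. indicator {0..r} t * (zext T x t \<bullet> w))" for r
      by (rule integrable_mult_inner[OF x, of _ 1]) (auto simp: indicator_def)
    have "0 = (LINT t|lborel. indicator {0..b'} t * (zext T x t \<bullet> w)) - (LINT t|lborel. indicator {0..a'} t * (zext T x t \<bullet> w))"
      using prim_inner[OF x, of a' w] prim_inner[OF x, of b' w] ab z by auto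
    also have "\<dots> = (LINT t|lborel. indicator {0..b'} t * (zext T x t \<bullet> w) - indicator {0..a'} t * (zext T x t \<bullet> w))"
      by (rule Bochner_Integration.integral_diff[symmetric]; rule i)
    also have "\<dots> = (LINT t|lborel. indicator {a<..<b} t * (zext T x t \<bullet> w))"
    proof (rule integral_cong_AE)
      have [measurable]: "(\<lambda>t. zext T x t \<bullet> w) \<in> borel_measurable lborel" using int by auto
      show "(\<lambda>t. indicator {0..b'} t * (zext T x t \<bullet> w) - indicator {0..a'} t * (zext T x t \<bullet> w)) \<in> borel_measurable lborel"
        "(\<lambda>t. indicator {a<..<b} t * (zext T x t \<bullet> w)) \<in> borel_measurable lborel" by measurable
      show "AE t in lborel. indicator {0..b'} t * (zext T x t \<bullet> w) - indicator {0..a'} t * (zext T x t \<bullet> w) = indicator {a<..<b} t * (zext T x t \<bullet> w)"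
        using AE_lborel_singleton[of a] AE_lborel_singleton[of b] AE_lborel_singleton[of 0] AE_lborel_singleton[of T]
      proof eventually_elim
        case (elim t)
        then show ?case using \<open>a < b\<close> T
          by (cases "t \<in> {0..T}") (auto simp: indicator_def zext_out a'_def b'_def)
      qed
    qed
    finally show "(LINT t:{a<..<b}|lborel. zext T x t \<bullet> w) = 0" by (simp add: set_lebesgue_integral_def)
  qed
  have "AE t in lborel. \<forall>d\<in>D. zext T x t \<bullet> d = 0"
    using w by (subst AE_ball_countable[OF D(1)]) auto
  then show ?thesis
  proof eventually_elim
    case (elim t)
    have "zext T x t \<in> closure D" using D(2) by auto
    moreover have "closed {d. zext T x t \<bullet> d = 0}" by (intro closed_Collect_eq continuous_intros)
    moreover have "D \<subseteq> {d. zext T x t \<bullet> d = 0}" using elim by auto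
    ultimately have "zext T x t \<bullet> zext T x t = 0" using closure_minimal by blast
    then show ?case by simp
  qed
qed

lemma continuous_on_interval_bounded:
  fixes g :: "real \<Rightarrow> real"
  assumes "continuous_on {a..b} g"
  shows "\<exists>C. \<forall>t\<in>{a..b}. \<bar>g t\<bar> \<le> C"
proof -
  have "bounded (g ` {a..b})" by (intro compact_imp_bounded compact_continuous_image assms) simp
  then show ?thesis unfolding bounded_iff real_norm_def by (metis imageI)
qed

text \<open>A nonzero value would persist on an open interval, which has positive measure.\<close>

lemma continuous_AE_zero:
  fixes g :: "real \<Rightarrow> 'a::real_normed_vector"
  assumes ae: "AE t in lborel. t \<in> {0..T} \<longrightarrow> g t = 0" and g: "continuous_on {0..T} g" and T: "0 < T"
    and t: "t \<in> {0..T}"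
  shows "g t = 0"
proof (rule ccontr)
  assume "g t \<noteq> 0"
  then obtain d where d: "d > 0" "\<And>s. s \<in> {0..T} \<Longrightarrow> dist s t < d \<Longrightarrow> dist (g s) (g t) < norm (g t)"
    using g t unfolding continuous_on_iff by (metis zero_less_norm_iff)
  define a b where "a = max 0 (t - d)" and "b = min T (t + d)"
  have ab: "a < b" using t d(1) T by (auto simp: a_def b_def)
  have nz: "g s \<noteq> 0" if "s \<in> {a<..<b}" for s
    using d(2)[of s] that t by (auto simp: a_def b_def dist_norm abs_less_iff)
  have "AE s in lborel. s \<notin> {a<..<b}"
    using ae by eventually_elim (use nz in \<open>auto simp: a_def b_def\<close>)
  then have "{a<..<b} \<in> null_sets lborel" by (subst AE_iff_null_sets) simp_all
  then have "emeasure lborel {a<..<b} = 0" by auto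
  then show False using ab by simp
qed

section \<open>Test functions\<close>

text \<open>The functions \<open>p (1 / x) exp (-1 / x)\<close>, continued by 0. Admitting every
  polynomial \<open>p\<close> makes the family closed under differentiation, which is how infinite
  differentiability is obtained.\<close>

definition flat :: "real poly \<Rightarrow> real \<Rightarrow> real" where
  "flat p x = (if x \<le> 0 then 0 else poly p (1 / x) * exp (- (1 / x)))"

lemma poly_div_exp_tendsto_0: "((\<lambda>u. poly p u / exp u) \<longlongrightarrow> (0::real)) at_top"
proof -
  have "((\<lambda>u. \<Sum>i\<le>degree p. coeff p i * (u ^ i / exp u)) \<longlongrightarrow> (\<Sum>i\<le>degree p. coeff p i * 0)) at_top"
    by (intro tendsto_sum tendsto_mult tendsto_const tendsto_power_div_exp_0)
  then show ?thesis by (simp add: poly_altdef sum_divide_distrib)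
qed

text \<open>Differentiation replaces \<open>p\<close> by \<open>X^2 (p - p')\<close>, the factor
  \<open>X^2\<close> coming from the derivative of \<open>1 / x\<close>. At 0 the difference
  quotient has the same shape, and the exponential dominates every polynomial.\<close>

lemma flat_has_derivative:
  "(flat p has_real_derivative flat ([:0, 0, 1:] * (p - pderiv p)) x) (at x)"
proof -
  let ?q = "[:0, 0, 1:] * (p - pderiv p)"
  consider "x < 0" | "x = 0" | "x > 0" by linarith
  then show ?thesis
  proof cases
    case 1
    have "((\<lambda>_. 0) has_real_derivative 0) (at x)" by simp
    then have "(flat p has_real_derivative 0) (at x)"
      by (rule has_field_derivative_transform_within_open[of _ _ _ "{..<0}"]) (use 1 in \<open>auto simp: flat_def\<close>)
    then show ?thesis using 1 by (simp add: flat_def)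
  next
    case 3
    have "((\<lambda>x. poly p (1 / x) * exp (- (1 / x))) has_real_derivative
        poly (pderiv p) (1 / x) * (- 1 / x\<^sup>2) * exp (- (1 / x)) + (exp (- (1 / x)) * (1 / x\<^sup>2)) * poly p (1 / x)) (at x)"
    proof (rule DERIV_mult)
      have i: "((\<lambda>x. 1 / x) has_real_derivative - 1 / x\<^sup>2) (at x)"
        using 3 by (auto intro!: derivative_eq_intros simp: power2_eq_square divide_simps)
      show "((\<lambda>x. poly p (1 / x)) has_real_derivative poly (pderiv p) (1 / x) * (- 1 / x\<^sup>2)) (at x)"
        by (rule DERIV_chain2[OF poly_DERIV i])
      have "((\<lambda>x. - (1 / x)) has_real_derivative - (- 1 / x\<^sup>2)) (at x)" by (rule DERIV_minus[OF i])
      then have "((\<lambda>x. exp (- (1 / x))) has_real_derivative exp (- (1 / x)) * - (- 1 / x\<^sup>2)) (at x)"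
        by (rule DERIV_chain2[OF DERIV_exp])
      then show "((\<lambda>x. exp (- (1 / x))) has_real_derivative exp (- (1 / x)) * (1 / x\<^sup>2)) (at x)" by simp
    qed
    then have "(flat p has_real_derivative
        poly (pderiv p) (1 / x) * (- 1 / x\<^sup>2) * exp (- (1 / x)) + (exp (- (1 / x)) * (1 / x\<^sup>2)) * poly p (1 / x)) (at x)"
      by (rule has_field_derivative_transform_within_open[of _ _ _ "{0<..}"]) (use 3 in \<open>auto simp: flat_def\<close>)
    moreover have "poly (pderiv p) (1 / x) * (- 1 / x\<^sup>2) * exp (- (1 / x)) + (exp (- (1 / x)) * (1 / x\<^sup>2)) * poly p (1 / x) = flat ?q x"
      using 3 by (simp add: flat_def power2_eq_square field_simps)
    ultimately show ?thesis by simp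
  next
    case 2
    have "((\<lambda>h. flat p h / h) \<longlongrightarrow> 0) (at 0)"
    proof (rule filterlim_split_at)
      show "((\<lambda>h. flat p h / h) \<longlongrightarrow> 0) (at_left 0)"
        by (rule tendsto_eventually) (auto simp: eventually_at_filter flat_def)
      \<comment> \<open>Division by \<open>h\<close> multiplies the polynomial by its variable,
        hence \<open>pCons 0 p\<close>.\<close>
      have "((\<lambda>h. poly (pCons 0 p) (inverse h) / exp (inverse h)) \<longlongrightarrow> 0) (at_right (0::real))"
        by (rule filterlim_compose[OF poly_div_exp_tendsto_0 filterlim_inverse_at_top_right])
      moreover have "\<forall>\<^sub>F h in at_right 0. poly (pCons 0 p) (inverse h) / exp (inverse h) = flat p h / h"
        by (auto simp: eventually_at_filter flat_def exp_minus divide_simps)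
      ultimately show "((\<lambda>h. flat p h / h) \<longlongrightarrow> 0) (at_right 0)" by (rule Lim_transform_eventually)
    qed
    then have "(flat p has_real_derivative 0) (at 0)" by (simp add: DERIV_def flat_def)
    then show ?thesis using 2 by (simp add: flat_def)
  qed
qed

text \<open>A set that contains the derivatives of its members, so that they are infinitely
  differentiable. The rules suffice for bumps and their linear combinations.\<close>

inductive_set Smooth :: "(real \<Rightarrow> real) set" where
  Sm_flat: "(\<lambda>x. flat p (a * x + b)) \<in> Smooth"
| Sm_const: "(\<lambda>_. c) \<in> Smooth"
| Sm_add: "f \<in> Smooth \<Longrightarrow> g \<in> Smooth \<Longrightarrow> (\<lambda>x. f x + g x) \<in> Smooth"
| Sm_mult: "f \<in> Smooth \<Longrightarrow> g \<in> Smooth \<Longrightarrow> (\<lambda>x. f x * g x) \<in> Smooth"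

lemma Smooth_deriv: "f \<in> Smooth \<Longrightarrow> \<exists>f'\<in>Smooth. \<forall>x. (f has_real_derivative f' x) (at x)"
proof (induction rule: Smooth.induct)
  case (Sm_flat p a b)
  let ?q = "[:0, 0, 1:] * (p - pderiv p)"
  have "((\<lambda>x. flat p (a * x + b)) has_real_derivative flat ?q (a * x + b) * a) (at x)" for x
  proof (rule DERIV_chain2[OF flat_has_derivative])
    show "((\<lambda>x. a * x + b) has_real_derivative a) (at x)" by (auto intro!: derivative_eq_intros)
  qed
  moreover have "(\<lambda>x. flat ?q (a * x + b) * a) \<in> Smooth" by (intro Smooth.intros)
  ultimately show ?case by (intro bexI[of _ "\<lambda>x. flat ?q (a * x + b) * a"] allI)
next
  case (Sm_const c)
  show ?case by (rule bexI[OF _ Smooth.Sm_const[of 0]]) auto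
next
  case (Sm_add f g)
  then obtain f' g' where *: "f' \<in> Smooth" "g' \<in> Smooth"
    "\<And>x. (f has_real_derivative f' x) (at x)" "\<And>x. (g has_real_derivative g' x) (at x)" by blast
  then have "(\<lambda>x. f' x + g' x) \<in> Smooth" by (intro Smooth.intros)
  moreover have "((\<lambda>x. f x + g x) has_real_derivative f' x + g' x) (at x)" for x
    by (rule DERIV_add) (rule *)+
  ultimately show ?case by (intro bexI[of _ "\<lambda>x. f' x + g' x"] allI)
next
  case (Sm_mult f g)
  then obtain f' g' where *: "f' \<in> Smooth" "g' \<in> Smooth"
    "\<And>x. (f has_real_derivative f' x) (at x)" "\<And>x. (g has_real_derivative g' x) (at x)" by blast
  then have "(\<lambda>x. f' x * g x + g' x * f x) \<in> Smooth" using Sm_mult.hyps by (intro Smooth.intros)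
  moreover have "((\<lambda>x. f x * g x) has_real_derivative f' x * g x + g' x * f x) (at x)" for x
    by (rule DERIV_mult) (rule *)+
  ultimately show ?case by (intro bexI[of _ "\<lambda>x. f' x * g x + g' x * f x"] allI)
qed

lemma Smooth_continuous: "f \<in> Smooth \<Longrightarrow> isCont f x"
  using Smooth_deriv DERIV_isCont by blast

text \<open>The function \<open>\<phi>\<close> enters as an antiderivative and need not belong to
  \<open>Smooth\<close> itself; only its derivative does.\<close>

lemma Smooth_iterated_deriv:
  assumes "f \<in> Smooth" "\<And>x. (\<phi> has_real_derivative f x) (at x)"
  shows "(deriv ^^ k) \<phi> differentiable (at x)"
  using assms
proof (induction k arbitrary: f \<phi>)
  case 0
  then show ?case by (auto simp: real_differentiable_def)
next
  case (Suc k)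
  have "deriv \<phi> = f" using Suc.prems(2) by (auto intro!: ext DERIV_imp_deriv)
  moreover obtain f' where "f' \<in> Smooth" "\<And>x. (f has_real_derivative f' x) (at x)"
    using Smooth_deriv[OF Suc.prems(1)] by blast
  ultimately show ?case using Suc.IH[of f' f] by (simp add: funpow_Suc_right del: funpow.simps)
qed

text \<open>For \<open>n > 0\<close> this is
  \<open>exp (-1 / (n (t - a))) exp (-1 / (n (b - t)))\<close> between \<open>a\<close> and
  \<open>b\<close>, and 0 elsewhere. A large \<open>n\<close> makes it steep, so that it approaches
  the indicator of the interval.\<close>

definition bump :: "real \<Rightarrow> real \<Rightarrow> real \<Rightarrow> real \<Rightarrow> real" where
  "bump n a b t = flat 1 (n * t + (- n * a)) * flat 1 ((- n) * t + n * b)"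

lemma bump_Smooth: "bump n a b \<in> Smooth"
  unfolding bump_def[abs_def] by (intro Smooth.intros)

lemma flat_1_bounds: "0 \<le> flat 1 x" "flat 1 x \<le> 1"
  by (auto simp: flat_def)

lemma bump_bounds: "0 \<le> bump n a b t" "bump n a b t \<le> 1"
  using flat_1_bounds by (auto simp: bump_def intro!: mult_le_one)

lemma bump_zero: "n > 0 \<Longrightarrow> t \<le> a \<or> b \<le> t \<Longrightarrow> bump n a b t = 0"
  by (auto simp: bump_def flat_def algebra_simps)

lemma bump_pos: "n > 0 \<Longrightarrow> a < t \<Longrightarrow> t < b \<Longrightarrow> 0 < bump n a b t"
  by (auto simp: bump_def flat_def algebra_simps)

lemma flat_1_tendsto:
  assumes "filterlim g at_top sequentially"
  shows "(\<lambda>n. flat 1 (g n)) \<longlonglongrightarrow> 1"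
proof -
  have "((\<lambda>x::real. exp (- (inverse x))) \<longlongrightarrow> exp (- 0)) at_top"
    by (intro tendsto_intros tendsto_inverse_0_at_top filterlim_ident)
  moreover have "\<forall>\<^sub>F x::real in at_top. exp (- (inverse x)) = flat 1 x"
    using eventually_gt_at_top[of 0] by eventually_elim (auto simp: flat_def inverse_eq_divide)
  ultimately have "(flat 1 \<longlongrightarrow> exp (- 0)) at_top" by (rule Lim_transform_eventually)
  from filterlim_compose[OF this assms] show ?thesis by simp
qed

text \<open>The support \<open>[a + \<delta> / n, b - \<delta> / n]\<close> stays inside the open interval even when \<open>a\<close> or \<open>b\<close>
  is an end point of \<open>[0, T]\<close>.\<close>

lemma bump_tendsto_indicator:
  assumes "0 \<le> \<delta>"
  shows "(\<lambda>n. bump (real (Suc n)) (a + \<delta> / Suc n) (b - \<delta> / Suc n) t) \<longlonglongrightarrow> indicator {a<..<b} t"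
proof (cases "a < t \<and> t < b")
  case True
  have lim: "filterlim (\<lambda>n. c * real (Suc n) + (- \<delta>)) at_top sequentially" if "c > 0" for c
    using that by real_asymp
  have "real (Suc n) * t + (- real (Suc n) * (a + \<delta> / Suc n)) = (t - a) * real (Suc n) + (- \<delta>)" for n
    by (simp add: field_simps)
  moreover have "(- real (Suc n)) * t + real (Suc n) * (b - \<delta> / Suc n) = (b - t) * real (Suc n) + (- \<delta>)" for n
    by (simp add: field_simps)
  ultimately have "(\<lambda>n. bump (real (Suc n)) (a + \<delta> / Suc n) (b - \<delta> / Suc n) t) \<longlonglongrightarrow> 1 * 1"
    unfolding bump_def using True by (simp only:) (intro tendsto_mult flat_1_tendsto lim; simp)
  then show ?thesis using True by simp
next
  case False
  have "bump (real (Suc n)) (a + \<delta> / Suc n) (b - \<delta> / Suc n) t = 0" for n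
  proof (rule bump_zero)
    have "0 \<le> \<delta> / Suc n" using assms by simp
    then show "t \<le> a + \<delta> / Suc n \<or> b - \<delta> / Suc n \<le> t" using False by linarith
  qed simp
  then show ?thesis using False by auto
qed

lemma isCont_borel: "(\<And>x::real. isCont f x) \<Longrightarrow> (f :: real \<Rightarrow> real) \<in> borel_measurable lborel"
  by (simp add: continuous_at_imp_continuous_on borel_measurable_continuous_onI)

lemma integrable_bounded_mult:
  fixes q f :: "real \<Rightarrow> real"
  assumes "integrable lborel q" "f \<in> borel_measurable lborel" "\<And>t. t \<in> {0..T} \<Longrightarrow> \<bar>f t\<bar> \<le> C"
    "\<And>t. t \<notin> {0..T} \<Longrightarrow> q t = 0"
  shows "integrable lborel (\<lambda>t. f t * q t)"
proof (rule Bochner_Integration.integrable_bound)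
  show "integrable lborel (\<lambda>t. C * q t)" using assms(1) by simp
  show "(\<lambda>t. f t * q t) \<in> borel_measurable lborel" using assms(1,2) by measurable
  have "\<bar>f t * q t\<bar> \<le> \<bar>C * q t\<bar>" for t
    using assms(3)[of t] assms(4)[of t] by (cases "t \<in> {0..T}") (auto simp: abs_mult intro!: mult_right_mono)
  then show "AE t in lborel. norm (f t * q t) \<le> norm (C * q t)" by simp
qed

text \<open>A bump in general has nonzero integral, so its antiderivative is not compactly
  supported. Subtracting a multiple of the fixed bump \<open>\<eta>0\<close> repairs this. Testing
  then shows that \<open>q\<close> and the constant \<open>c\<close> have the same integral against
  every bump, and bumps approximate indicators of intervals.\<close>

lemma du_Bois_Reymond_real:
  fixes q :: "real \<Rightarrow> real"
  assumes T: "0 < T" and q: "integrable lborel q" and q0: "\<And>t. t \<notin> {0..T} \<Longrightarrow> q t = 0"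
    and test: "\<And>\<phi> f lo hi. f \<in> Smooth \<Longrightarrow> (\<And>t. (\<phi> has_real_derivative f t) (at t)) \<Longrightarrow> 0 < lo \<Longrightarrow> lo \<le> hi \<Longrightarrow> hi < T \<Longrightarrow>
       (\<And>t. t \<in> {0..T} \<Longrightarrow> t \<notin> {lo..hi} \<Longrightarrow> \<phi> t = 0) \<Longrightarrow> (LINT t|lborel. f t * q t) = 0"
  shows "\<exists>c. AE t in lborel. t \<in> {0..T} \<longrightarrow> q t = c"
proof -
  let ?I = "indicat_real {0..T}"
  define \<eta>0 where "\<eta>0 = bump 1 (T/3) (2*T/3)"
  define Z where "Z = (LINT t|lborel. \<eta>0 t * ?I t)"
  have bi: "integrable lborel (\<lambda>t. bump n a b t * r t)" if "integrable lborel r" "\<And>t. t \<notin> {0..T} \<Longrightarrow> r t = 0" for n a b and r :: "real \<Rightarrow> real"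
    by (rule integrable_bounded_mult[where T=T and C=1, OF that(1) isCont_borel[OF Smooth_continuous[OF bump_Smooth]]])
      (use that bump_bounds in auto)
  have I: "integrable lborel ?I" by (rule integrable_indicator_interval)
  have "Z \<noteq> 0"
  proof
    assume "Z = 0"
    moreover have "integrable lborel (\<lambda>t. \<eta>0 t * ?I t)" unfolding \<eta>0_def by (rule bi[OF I]) auto
    ultimately have "AE t in lborel. \<eta>0 t * ?I t = 0" unfolding Z_def
      by (subst (asm) integral_nonneg_eq_0_iff_AE) (auto simp: \<eta>0_def bump_bounds)
    then have "AE t in lborel. t \<notin> {T/3<..<2*T/3}"
      by eventually_elim (use bump_pos[of 1 "T/3" _ "2*T/3"] T in \<open>force simp: \<eta>0_def indicator_def\<close>)
    then have "{T/3<..<2*T/3} \<in> null_sets lborel" by (subst AE_iff_null_sets) simp_all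
    then have "emeasure lborel {T/3<..<2*T/3} = 0" by auto
    then show False using T by simp
  qed
  define c where "c = (LINT t|lborel. \<eta>0 t * q t) / Z"
  define r where "r = (\<lambda>t. q t - c * ?I t)"
  have r: "integrable lborel r" unfolding r_def using q I by simp
  have r0: "r t = 0" if "t \<notin> {0..T}" for t using that by (simp add: r_def q0)
  have key: "(LINT t|lborel. bump n a b t * r t) = 0" if n: "n > 0" and ab: "0 < a" "b < T" for n a b
  proof -
    define A where "A = (LINT t|lborel. bump n a b t * ?I t)"
    \<comment> \<open>With this coefficient the integral of \<open>f\<close> over
      \<open>[0, T]\<close> is \<open>A - (A / Z) Z = 0\<close>, so the antiderivative returns to 0
      at \<open>T\<close>.\<close>
    define f where "f = (\<lambda>t. bump n a b t + (- A / Z) * \<eta>0 t)"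
    have f: "f \<in> Smooth" unfolding f_def \<eta>0_def by (intro Smooth.intros bump_Smooth)
    obtain F where F: "\<And>t. (F has_vector_derivative f t) (at t)"
      using einterval_antiderivative[of "-\<infinity>" "\<infinity>" f] Smooth_continuous[OF f] by auto
    define \<phi> where "\<phi> = (\<lambda>t. F t - F 0)"
    have \<phi>: "(\<phi> has_real_derivative f t) (at t)" for t
      using F[of t] unfolding \<phi>_def has_real_derivative_iff_has_vector_derivative by (auto intro!: derivative_eq_intros)
    have FTC: "(f has_integral \<phi> t - \<phi> s) {s..t}" if "s \<le> t" for s t
      by (rule fundamental_theorem_of_calculus[OF that])
        (use \<phi> in \<open>auto simp: has_real_derivative_iff_has_vector_derivative intro: has_vector_derivative_at_within\<close>)
    \<comment> \<open>An interval inside the open interval from 0 to \<open>T\<close> that contains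
      the supports of both bumps.\<close>
    define lo hi where "lo = min a (T/3)" and "hi = max lo (max b (2*T/3))"
    have lohi: "0 < lo" "lo \<le> hi" "hi < T" using T ab by (auto simp: lo_def hi_def)
    have fz: "f t = 0" if "t \<le> lo \<or> hi \<le> t" for t
      using that n T by (auto simp: f_def \<eta>0_def bump_zero lo_def hi_def)
    have "\<phi> T = 0"
    proof -
      have fI: "integrable lborel (\<lambda>t. ?I t * f t)"
        unfolding f_def \<eta>0_def using bi[OF I, of n a b] bi[OF I, of 1 "T/3" "2*T/3"]
        by (simp add: algebra_simps)
      then have "integral {0..T} f = (LINT t|lborel. ?I t * f t)"
        using set_borel_integral_eq_integral(2)[of "{0..T}" f] by (simp add: set_integrable_def set_lebesgue_integral_def)
      also have "\<dots> = (LINT t|lborel. bump n a b t * ?I t + (- A / Z) * (\<eta>0 t * ?I t))"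
        by (rule Bochner_Integration.integral_cong) (auto simp: f_def algebra_simps)
      also have "\<dots> = A + (- A / Z) * Z"
        unfolding A_def Z_def \<eta>0_def
        by (subst Bochner_Integration.integral_add) (auto intro!: bi[OF I] integrable_mult_right)
      also have "\<dots> = 0" using \<open>Z \<noteq> 0\<close> by simp
      finally show ?thesis using FTC[of 0 T] T by (simp add: \<phi>_def integral_unique)
    qed
    have \<phi>z: "\<phi> t = 0" if t: "t \<in> {0..T}" "t \<notin> {lo..hi}" for t
    proof (cases "t < lo")
      case True
      have "(f has_integral 0) {0..t}" by (rule has_integral_is_0) (use fz True in auto)
      moreover have "\<phi> 0 = 0" by (simp add: \<phi>_def)
      moreover have "(f has_integral \<phi> t - \<phi> 0) {0..t}" by (rule FTC) (use t in auto)
      ultimately show ?thesis using has_integral_unique[of f 0 "{0..t}" "\<phi> t - \<phi> 0"] by simp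
    next
      case False
      then have "hi < t" using t by auto
      then have "(f has_integral 0) {t..T}" by (intro has_integral_is_0) (use fz in auto)
      moreover have "(f has_integral \<phi> T - \<phi> t) {t..T}" by (rule FTC) (use t in auto)
      ultimately show ?thesis using has_integral_unique[of f 0 "{t..T}" "\<phi> T - \<phi> t"] \<open>\<phi> T = 0\<close> by simp
    qed
    have "0 = (LINT t|lborel. f t * q t)" by (rule test[OF f \<phi> lohi \<phi>z, symmetric])
    also have "\<dots> = (LINT t|lborel. bump n a b t * q t + (- A / Z) * (\<eta>0 t * q t))"
      by (rule Bochner_Integration.integral_cong) (auto simp: f_def algebra_simps)
    also have "\<dots> = (LINT t|lborel. bump n a b t * q t) + (- A / Z) * (LINT t|lborel. \<eta>0 t * q t)"
      unfolding \<eta>0_def by (subst Bochner_Integration.integral_add) (auto intro!: bi[OF q] q0 integrable_mult_right)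
    also have "\<dots> = (LINT t|lborel. bump n a b t * q t) - c * A" by (simp add: c_def)
    also have "\<dots> = (LINT t|lborel. bump n a b t * q t - c * (bump n a b t * ?I t))"
      unfolding A_def by (subst Bochner_Integration.integral_diff) (auto intro!: bi[OF q] bi[OF I] q0 integrable_mult_right)
    also have "\<dots> = (LINT t|lborel. bump n a b t * r t)"
      by (rule Bochner_Integration.integral_cong) (auto simp: r_def algebra_simps)
    finally show ?thesis by simp
  qed
  have "AE t in lborel. r t = 0"
  proof (rule AE_zero_of_integral_intervals[OF r])
    fix a b :: real assume "a < b"
    \<comment> \<open>Since \<open>r\<close> vanishes outside \<open>[0, T]\<close>, the interval
      may be clipped.\<close>
    define a' b' where "a' = max a 0" and "b' = min b T"
    have "(\<lambda>n. LINT t|lborel. bump (real (Suc n)) (a' + T / Suc n) (b' - T / Suc n) t * r t) \<longlonglongrightarrow> (LINT t|lborel. indicator {a'<..<b'} t * r t)"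
    proof (rule integral_dominated_convergence[where w="\<lambda>t. \<bar>r t\<bar>"])
      show "AE t in lborel. (\<lambda>n. bump (real (Suc n)) (a' + T / Suc n) (b' - T / Suc n) t * r t) \<longlonglongrightarrow> indicator {a'<..<b'} t * r t"
        by (intro AE_I2 tendsto_mult bump_tendsto_indicator tendsto_const) (use T in simp)
      have "norm (bump n a b t * r t) \<le> \<bar>r t\<bar>" for n a b t
        using bump_bounds[of n a b t] by (simp add: abs_mult mult_left_le_one_le)
      then show "AE t in lborel. norm (bump (real (Suc n)) (a' + T / Suc n) (b' - T / Suc n) t * r t) \<le> \<bar>r t\<bar>" for n
        by blast
      show "(\<lambda>t. bump (real (Suc n)) (a' + T / Suc n) (b' - T / Suc n) t * r t) \<in> borel_measurable lborel" for n
        using bi[OF r r0] by auto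
    qed (use r in auto)
    moreover have "(LINT t|lborel. bump (real (Suc n)) (a' + T / Suc n) (b' - T / Suc n) t * r t) = 0" for n
    proof (rule key)
      have "0 < T / Suc n" using T by simp
      then show "0 < a' + T / Suc n" "b' - T / Suc n < T" by (auto simp: a'_def b'_def)
    qed simp
    ultimately have "(LINT t|lborel. indicator {a'<..<b'} t * r t) = 0" by (simp add: LIMSEQ_const_iff)
    moreover have "(LINT t:{a<..<b}|lborel. r t) = (LINT t|lborel. indicator {a'<..<b'} t * r t)"
      unfolding set_lebesgue_integral_def
    proof (rule integral_cong_AE)
      show "AE t in lborel. indicator {a<..<b} t *\<^sub>R r t = indicator {a'<..<b'} t * r t"
        using AE_lborel_singleton[of 0] AE_lborel_singleton[of T]
      proof eventually_elim
        case (elim t)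
        then show ?case using r0[of t] by (cases "t \<in> {0..T}") (auto simp: indicator_def a'_def b'_def)
      qed
    qed (use r in measurable)
    ultimately show "(LINT t:{a<..<b}|lborel. r t) = 0" by simp
  qed
  then have "AE t in lborel. t \<in> {0..T} \<longrightarrow> q t = c" by eventually_elim (auto simp: r_def)
  then show ?thesis by blast
qed

text \<open>Test functions are constrained on the open interval only and have arbitrary values
  elsewhere. Extension by zero gives a continuously differentiable function on the line with compact
  support, which is the form the integral identities work with.\<close>

lemma test_function_extend:
  assumes \<phi>: "test_function T \<phi>" and T: "0 < T"
  shows "\<exists>\<psi> g. (\<forall>t. (\<psi> has_real_derivative g t) (at t)) \<and> (\<forall>t. isCont g t) \<and>
    (\<forall>t\<in>{0<..<T}. \<psi> t = \<phi> t \<and> g t = deriv \<phi> t) \<and> (\<exists>lo hi. 0 < lo \<and> lo \<le> hi \<and> hi < T \<and> (\<forall>t. t \<notin> {lo..hi} \<longrightarrow> \<psi> t = 0 \<and> g t = 0))"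
proof -
  obtain K where K: "compact K" "K \<subseteq> {0<..<T}" "\<And>t. t \<in> {0<..<T} - K \<Longrightarrow> \<phi> t = 0"
    using \<phi> by (auto simp: test_function_def)
  obtain lo hi where lh: "0 < lo" "lo \<le> hi" "hi < T" "K \<subseteq> {lo..hi}"
  proof (cases "K = {}")
    case True
    then show ?thesis using that[of "T/2" "T/2"] T by auto
  next
    case False
    obtain l where l: "l \<in> K" "\<And>x. x \<in> K \<Longrightarrow> l \<le> x" using compact_attains_inf[OF K(1) False] by blast
    obtain h where h: "h \<in> K" "\<And>x. x \<in> K \<Longrightarrow> x \<le> h" using compact_attains_sup[OF K(1) False] by blast
    show ?thesis using that[of l h] l h K(2) by (auto simp: subset_iff)
  qed
  have D: "(deriv ^^ k) \<phi> differentiable (at t)" if "t \<in> {0<..<T}" for k t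
    using \<phi> that by (auto simp: test_function_def)
  have D0: "(\<phi> has_real_derivative deriv \<phi> t) (at t)" if "t \<in> {0<..<T}" for t
    using D[OF that, of 0] by (simp add: DERIV_deriv_iff_real_differentiable)
  have C1: "isCont (deriv \<phi>) t" if "t \<in> {0<..<T}" for t
    using D[OF that, of 1] by (simp add: differentiable_imp_continuous_within)
  define \<psi> where "\<psi> = (\<lambda>t. if t \<in> {0<..<T} then \<phi> t else 0)"
  define g where "g = (\<lambda>t. if t \<in> {0<..<T} then deriv \<phi> t else 0)"
  have \<psi>z: "\<psi> t = 0" if "t \<notin> {lo..hi}" for t proof (cases "t \<in> {0<..<T}")
    case True
    then have "t \<in> {0<..<T} - K" using that lh(4) by blast
    then show ?thesis using K(3) by (simp add: \<psi>_def)
  qed (auto simp: \<psi>_def)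
  have dz: "(\<psi> has_real_derivative 0) (at t)" if "t \<notin> {lo..hi}" for t
  proof -
    have "((\<lambda>_. 0) has_real_derivative 0) (at t)" by simp
    then show ?thesis
      by (rule has_field_derivative_transform_within_open[of _ _ _ "- {lo..hi}"]) (use that \<psi>z in auto)
  qed
  have di: "(\<psi> has_real_derivative g t) (at t)" if t: "t \<in> {0<..<T}" for t
  proof -
    have "(\<psi> has_real_derivative deriv \<phi> t) (at t)"
      by (rule has_field_derivative_transform_within_open[OF D0[OF t], of "{0<..<T}"]) (use t in \<open>auto simp: \<psi>_def\<close>)
    then show ?thesis using t by (simp add: g_def)
  qed
  have d: "(\<psi> has_real_derivative g t) (at t)" for t
  proof (cases "t \<in> {0<..<T}")
    case False
    then have "t \<notin> {lo..hi}" "g t = 0" using lh by (auto simp: g_def)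
    then show ?thesis using dz by simp
  qed (rule di)
  have gz: "g t = 0" if "t \<notin> {lo..hi}" for t using DERIV_unique[OF d dz[OF that]] .
  have cont: "isCont g t" for t
  proof (cases "t \<in> {0<..<T}")
    case True
    have "\<forall>\<^sub>F s in nhds t. g s = deriv \<phi> s"
      using True by (intro eventually_nhds_in_open[of "{0<..<T}", THEN eventually_mono]) (auto simp: g_def)
    then show ?thesis using C1[OF True] by (simp add: isCont_cong)
  next
    case False
    then have "t \<in> - {lo..hi}" using lh by auto
    then have "\<forall>\<^sub>F s in nhds t. g s = 0"
      by (intro eventually_nhds_in_open[of "- {lo..hi}", THEN eventually_mono]) (use gz in auto)
    then show ?thesis by (simp add: isCont_cong)
  qed
  show ?thesis
    by (intro exI[of _ \<psi>] exI[of _ g] conjI allI d cont ballI exI[of _ lo] exI[of _ hi] lh impI \<psi>z gz)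
      (auto simp: \<psi>_def g_def)
qed

section \<open>Weak derivatives and absolutely continuous representatives\<close>

lemma Lp_UNIV: "x \<in> Lp p T H \<Longrightarrow> x \<in> Lp p T UNIV"
  by (rule Lp_mono) auto

lemma prim_diff:
  assumes "v \<in> Lp 1 T H" "u \<in> Lp 1 T H" "t \<le> T"
  shows "prim (\<lambda>s. v s - u s) t = prim v t - prim u t"
  unfolding prim_def
  by (rule Henstock_Kurzweil_Integration.integral_diff; rule integrable_on_subinterval[OF Lp1_HK_integrable])
    (use assms in auto)

lemma prim_lincomb:
  assumes "v \<in> Lp 1 T H" "u \<in> Lp 1 T H" "t \<le> T"
  shows "prim (\<lambda>s. a *\<^sub>R v s + b *\<^sub>R u s) t = a *\<^sub>R prim v t + b *\<^sub>R prim u t"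
proof -
  have *: "v integrable_on {0..t}" "u integrable_on {0..t}"
    by (rule integrable_on_subinterval[OF Lp1_HK_integrable]; use assms in auto)+
  then have "integral {0..t} (\<lambda>s. a *\<^sub>R v s + b *\<^sub>R u s) = integral {0..t} (\<lambda>s. a *\<^sub>R v s) + integral {0..t} (\<lambda>s. b *\<^sub>R u s)"
    by (intro Henstock_Kurzweil_Integration.integral_add integrable_cmul)
  then show ?thesis by (simp add: prim_def)
qed

lemma prim_smooth:
  fixes w :: "'a::{real_inner, banach}"
  assumes "\<And>t. (\<phi> has_real_derivative f t) (at t)" "0 \<le> t"
  shows "prim (\<lambda>s. f s *\<^sub>R w) t = (\<phi> t - \<phi> 0) *\<^sub>R w"
proof -
  have "(f has_integral \<phi> t - \<phi> 0) {0..t}"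
    by (rule fundamental_theorem_of_calculus[OF assms(2)])
      (use assms(1) in \<open>auto simp: has_real_derivative_iff_has_vector_derivative intro: has_vector_derivative_at_within\<close>)
  then have "((\<lambda>s. f s *\<^sub>R w) has_integral (\<phi> t - \<phi> 0) *\<^sub>R w) {0..t}" by (rule has_integral_scaleR_left)
  then show ?thesis by (simp add: prim_def integral_unique)
qed

text \<open>This is \<open>integral_parts\<close> for \<open>v\<close> and \<open>f w\<close>. The
  primitive of \<open>f w\<close> is \<open>\<phi> w\<close> because \<open>\<phi>\<close> vanishes
  at 0, and the boundary term at \<open>T\<close> vanishes too.\<close>

lemma parts_smooth:
  fixes w :: "'a::{real_inner, banach}"
  assumes v: "v \<in> Lp 1 T H" and \<phi>: "\<And>t. (\<phi> has_real_derivative f t) (at t)" "\<And>t. isCont f t"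
    and T: "0 < T" and z: "\<phi> 0 = 0" "\<phi> T = 0"
  shows "(LINT t|lborel. f t * (zext T (prim v) t \<bullet> w)) = - (LINT t|lborel. \<phi> t * (zext T v t \<bullet> w))"
proof -
  have W: "(\<lambda>t. f t *\<^sub>R w) \<in> Lp 1 T UNIV"
    by (rule Lp_continuous) (use \<phi>(2) T in \<open>auto intro!: continuous_intros continuous_at_imp_continuous_on\<close>)
  have "(LINT t|lborel. f t * (zext T (prim v) t \<bullet> w)) = (LINT t|lborel. prim v t \<bullet> zext T (\<lambda>t. f t *\<^sub>R w) t)"
    by (rule Bochner_Integration.integral_cong) (auto simp: zext_def)
  also have "\<dots> = (LINT s|lborel. zext T v s \<bullet> (prim (\<lambda>t. f t *\<^sub>R w) T - prim (\<lambda>t. f t *\<^sub>R w) s))"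
    by (rule integral_parts[OF v W])
  also have "\<dots> = (LINT s|lborel. - (\<phi> s * (zext T v s \<bullet> w)))"
  proof (rule Bochner_Integration.integral_cong[OF refl])
    fix s
    show "zext T v s \<bullet> (prim (\<lambda>t. f t *\<^sub>R w) T - prim (\<lambda>t. f t *\<^sub>R w) s) = - (\<phi> s * (zext T v s \<bullet> w))"
      using prim_smooth[OF \<phi>(1), of T w] prim_smooth[OF \<phi>(1), of s w] z T
      by (cases "s \<in> {0..T}") (auto simp: zext_out inner_diff_right)
  qed
  finally show ?thesis by simp
qed

text \<open>Pairs with \<open>w\<close> the vector integral that occurs in the definition of weak
  derivatives. The function \<open>h\<close> is trusted on the open interval only and is replaced
  there by a continuous \<open>g\<close>; the two end points are negligible.\<close>

lemma test_integral_inner: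
  fixes w :: "'a::{real_inner, banach}"
  assumes v: "v \<in> Lp 1 T H" and g: "\<And>t. isCont g t" "\<And>t. t \<in> {0<..<T} \<Longrightarrow> g t = h t"
  shows "integral {0..T} (\<lambda>t. h t *\<^sub>R v t) \<bullet> w = (LINT t|lborel. g t * (zext T v t \<bullet> w))"
proof -
  have "continuous_on {0..T} g" using g(1) by (intro continuous_at_imp_continuous_on) auto
  then obtain C where C: "\<And>t. t \<in> {0..T} \<Longrightarrow> \<bar>g t\<bar> \<le> C" using continuous_on_interval_bounded by blast
  have gv: "(\<lambda>t. g t *\<^sub>R v t) \<in> Lp 1 T UNIV"
    using Lp_mult_bounded[OF Lp_UNIV[OF v] subspace_UNIV _ C] isCont_borel[OF g(1)] by simp
  have "integral {0..T} (\<lambda>t. h t *\<^sub>R v t) = integral {0..T} (\<lambda>t. g t *\<^sub>R v t)"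
    by (rule integral_spike[of "{0, T}"]) (use g(2) in auto)
  also have "\<dots> \<bullet> w = (LINT t|lborel. zext T (\<lambda>t. g t *\<^sub>R v t) t \<bullet> w)" by (rule integral_inner_zext[OF gv])
  also have "\<dots> = (LINT t|lborel. g t * (zext T v t \<bullet> w))"
    by (rule Bochner_Integration.integral_cong) (auto simp: zext_def)
  finally show ?thesis .
qed

text \<open>Testing against compactly supported, continuously differentiable functions on the line,
  one vector \<open>w\<close> at a time, suffices. In this form the identity is a pairing with fixed
  elements and passes to weak limits.\<close>

lemma has_weak_derivI_test:
  assumes x: "x \<in> Lp 1 T H" and v: "v \<in> Lp 1 T H" and T: "0 < T"
    and test: "\<And>\<phi> f lo hi w. (\<And>t. (\<phi> has_real_derivative f t) (at t)) \<Longrightarrow> (\<And>t. isCont f t) \<Longrightarrow> 0 < lo \<Longrightarrow> lo \<le> hi \<Longrightarrow> hi < T \<Longrightarrow>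
       (\<And>t. t \<notin> {lo..hi} \<Longrightarrow> \<phi> t = 0 \<and> f t = 0) \<Longrightarrow>
       (LINT t|lborel. f t * (zext T x t \<bullet> w)) = - (LINT t|lborel. \<phi> t * (zext T v t \<bullet> w))"
  shows "has_weak_deriv T H x v"
  unfolding has_weak_deriv_def
proof (intro conjI allI impI x v)
  fix \<phi> assume "test_function T \<phi>"
  from test_function_extend[OF this T] obtain \<psi> g lo hi where \<psi>: "\<And>t. (\<psi> has_real_derivative g t) (at t)"
    "\<And>t. isCont g t" "\<And>t. t \<in> {0<..<T} \<Longrightarrow> \<psi> t = \<phi> t" "\<And>t. t \<in> {0<..<T} \<Longrightarrow> g t = deriv \<phi> t"
    "0 < lo" "lo \<le> hi" "hi < T" "\<And>t. t \<notin> {lo..hi} \<Longrightarrow> \<psi> t = 0 \<and> g t = 0" by metis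
  have "integral {0..T} (\<lambda>t. \<phi> t *\<^sub>R v t) \<bullet> w = - integral {0..T} (\<lambda>t. deriv \<phi> t *\<^sub>R x t) \<bullet> w" for w
    using test[OF \<psi>(1,2,5-8), of w] test_integral_inner[OF x \<psi>(2,4), of w] 
      test_integral_inner[OF v DERIV_isCont[OF \<psi>(1)] \<psi>(3), of w] by simp
  then show "integral {0..T} (\<lambda>t. \<phi> t *\<^sub>R v t) = - integral {0..T} (\<lambda>t. deriv \<phi> t *\<^sub>R x t)"
    by (subst vector_eq_rdot[symmetric]) blast
qed

text \<open>The constant \<open>c\<close> contributes a multiple of the integral of
  \<open>f\<close>, which is \<open>\<phi> T - \<phi> 0 = 0\<close>; the primitive contributes by
  \<open>parts_smooth\<close>.\<close>

lemma primitive_test: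
  fixes \<phi> f :: "real \<Rightarrow> real" and w :: "'a::{real_inner, banach}"
  assumes x: "x \<in> Lp 1 T H" and v: "v \<in> Lp 1 T H" and T: "0 < T" and H: "hilbert_subspace H"
    and eq: "AE t in lborel. t \<in> {0..T} \<longrightarrow> x t = c + prim v t"
    and \<phi>: "\<And>t. (\<phi> has_real_derivative f t) (at t)" "\<And>t. isCont f t" "0 < lo" "lo \<le> hi" "hi < T"
      "\<And>t. t \<notin> {lo..hi} \<Longrightarrow> \<phi> t = 0 \<and> f t = 0"
  shows "(LINT t|lborel. f t * (zext T x t \<bullet> w)) = - (LINT t|lborel. \<phi> t * (zext T v t \<bullet> w))"
proof -
  have z: "\<phi> 0 = 0" "\<phi> T = 0" using \<phi>(3-6) by auto
  have pv: "prim v \<in> Lp 1 T H" using prim_Lp[OF H v] T by simp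
  have cc: "(\<lambda>_. c) \<in> Lp 1 T UNIV" by (rule Lp_const) simp
  have "continuous_on {0..T} f" using \<phi>(2) by (intro continuous_at_imp_continuous_on) auto
  then obtain C where C: "\<And>t. t \<in> {0..T} \<Longrightarrow> \<bar>f t\<bar> \<le> C" using continuous_on_interval_bounded by blast
  note i = integrable_mult_inner[OF _ isCont_borel[OF \<phi>(2)] C]
  have "(LINT t|lborel. f t * (zext T (\<lambda>_. c) t \<bullet> w)) = integral {0..T} (\<lambda>t. f t *\<^sub>R c) \<bullet> w"
    by (rule test_integral_inner[OF cc \<phi>(2), symmetric]) simp
  also have "integral {0..T} (\<lambda>t. f t *\<^sub>R c) = 0"
    using prim_smooth[OF \<phi>(1), of T c] z T by (simp add: prim_def)
  finally have 1: "(LINT t|lborel. f t * (zext T (\<lambda>_. c) t \<bullet> w)) = 0" by simp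
  have "(LINT t|lborel. f t * (zext T x t \<bullet> w)) =
      (LINT t|lborel. f t * (zext T (\<lambda>_. c) t \<bullet> w) + f t * (zext T (prim v) t \<bullet> w))"
  proof (rule integral_cong_AE)
    show "AE t in lborel. f t * (zext T x t \<bullet> w) = f t * (zext T (\<lambda>_. c) t \<bullet> w) + f t * (zext T (prim v) t \<bullet> w)"
      using eq by eventually_elim (auto simp: zext_def indicator_def inner_add_left algebra_simps)
    show "(\<lambda>t. f t * (zext T x t \<bullet> w)) \<in> borel_measurable lborel"
      using i[OF x] by (rule borel_measurable_integrable)
    show "(\<lambda>t. f t * (zext T (\<lambda>_. c) t \<bullet> w) + f t * (zext T (prim v) t \<bullet> w)) \<in> borel_measurable lborel"
      using Bochner_Integration.integrable_add[OF i[OF cc] i[OF pv]] by (rule borel_measurable_integrable)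
  qed
  also have "\<dots> = (LINT t|lborel. f t * (zext T (\<lambda>_. c) t \<bullet> w)) + (LINT t|lborel. f t * (zext T (prim v) t \<bullet> w))"
    by (rule Bochner_Integration.integral_add[OF i[OF cc] i[OF pv]])
  finally show ?thesis
    using 1 parts_smooth[OF v \<phi>(1,2) T z, of w] by simp
qed

lemma has_weak_derivI:
  assumes x: "x \<in> Lp 1 T H" and v: "v \<in> Lp 1 T H" and T: "0 < T" and H: "hilbert_subspace H"
    and eq: "AE t in lborel. t \<in> {0..T} \<longrightarrow> x t = c + prim v t"
  shows "has_weak_deriv T H x v"
  by (rule has_weak_derivI_test[OF x v T]) (rule primitive_test[OF x v T H eq])

lemma has_weak_deriv_Lp1: "has_weak_deriv T H x v \<Longrightarrow> x \<in> Lp 1 T H" "has_weak_deriv T H x v \<Longrightarrow> v \<in> Lp 1 T H"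
  by (auto simp: has_weak_deriv_def)

text \<open>The function \<open>x - prim v\<close> has weak derivative 0, so the lemma of du
  Bois-Reymond makes its product with each \<open>w\<close> constant almost everywhere. The vector
  \<open>c\<close> itself is found as the mean value.\<close>

lemma weak_deriv_repr:
  assumes T: "0 < T" and H: "hilbert_subspace H" and xv: "has_weak_deriv T H x v"
  shows "\<exists>c\<in>H. AE t in lborel. t \<in> {0..T} \<longrightarrow> x t = c + prim v t"
proof -
  have sH: "subspace H" using H by (simp add: hilbert_subspace_def)
  note x = has_weak_deriv_Lp1(1)[OF xv] and v = has_weak_deriv_Lp1(2)[OF xv]
  have pv: "prim v \<in> Lp 1 T H" using prim_Lp[OF H v] T by simp
  define d where "d = (\<lambda>t. x t - prim v t)"
  have d: "d \<in> Lp 1 T H" unfolding d_def by (rule Lp1_diff[OF sH x pv])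
  define c where "c = (1 / T) *\<^sub>R integral {0..T} d"
  have cH: "c \<in> H" unfolding c_def using prim_in[OF H d, of T] sH by (simp add: prim_def subspace_scale)
  define z where "z = (\<lambda>t. d t - c)"
  have z: "z \<in> Lp 1 T H" unfolding z_def by (rule Lp1_diff[OF sH d Lp_const[OF cH]])
  have w: "AE t in lborel. zext T z t \<bullet> w = 0" for w
  proof -
    define q where "q = (\<lambda>t. zext T d t \<bullet> w)"
    have q: "integrable lborel q" unfolding q_def using integrable_mult_inner[OF d, of "\<lambda>_. 1" 1 w] by simp
    have "\<exists>k. AE t in lborel. t \<in> {0..T} \<longrightarrow> q t = k"
    proof (rule du_Bois_Reymond_real[OF T q])
      show "q t = 0" if "t \<notin> {0..T}" for t using that by (simp add: q_def zext_out)
      fix \<phi> f lo hi assume f: "f \<in> Smooth" "\<And>t. (\<phi> has_real_derivative f t) (at t)" "0 < lo" "lo \<le> hi" "hi < T"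
        "\<And>t. t \<in> {0..T} \<Longrightarrow> t \<notin> {lo..hi} \<Longrightarrow> \<phi> t = (0::real)"
      have z0: "\<phi> 0 = 0" "\<phi> T = 0" using f(3-6) T by auto
      have "test_function T \<phi>" unfolding test_function_def
        using Smooth_iterated_deriv[OF f(1,2)] f(3-6) by (auto intro!: exI[of _ "{lo..hi}"])
      then have "integral {0..T} (\<lambda>t. \<phi> t *\<^sub>R v t) = - integral {0..T} (\<lambda>t. deriv \<phi> t *\<^sub>R x t)"
        using xv by (simp add: has_weak_deriv_def)
      then have "integral {0..T} (\<lambda>t. \<phi> t *\<^sub>R v t) \<bullet> w = - (integral {0..T} (\<lambda>t. deriv \<phi> t *\<^sub>R x t) \<bullet> w)"
        by simp
      moreover have "integral {0..T} (\<lambda>t. \<phi> t *\<^sub>R v t) \<bullet> w = (LINT t|lborel. \<phi> t * (zext T v t \<bullet> w))"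
        by (rule test_integral_inner[OF v DERIV_isCont[OF f(2)]]) simp
      moreover have "integral {0..T} (\<lambda>t. deriv \<phi> t *\<^sub>R x t) \<bullet> w = (LINT t|lborel. f t * (zext T x t \<bullet> w))"
        by (rule test_integral_inner[OF x Smooth_continuous[OF f(1)]]) (rule DERIV_imp_deriv[OF f(2), symmetric])
      moreover note parts_smooth[OF v f(2) Smooth_continuous[OF f(1)] T z0, of w]
      ultimately have e: "(LINT t|lborel. f t * (zext T x t \<bullet> w)) = (LINT t|lborel. f t * (zext T (prim v) t \<bullet> w))" by simp
      have "continuous_on {0..T} f" using Smooth_continuous[OF f(1)] by (intro continuous_at_imp_continuous_on) auto
      then obtain C where C: "\<And>t. t \<in> {0..T} \<Longrightarrow> \<bar>f t\<bar> \<le> C" using continuous_on_interval_bounded by blast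
      note i = integrable_mult_inner[OF _ isCont_borel[OF Smooth_continuous[OF f(1)]] C]
      have "(LINT t|lborel. f t * q t) = (LINT t|lborel. f t * (zext T x t \<bullet> w) - f t * (zext T (prim v) t \<bullet> w))"
        by (rule Bochner_Integration.integral_cong)
          (auto simp: q_def d_def zext_diff inner_diff_left right_diff_distrib)
      also have "\<dots> = (LINT t|lborel. f t * (zext T x t \<bullet> w)) - (LINT t|lborel. f t * (zext T (prim v) t \<bullet> w))"
        by (rule Bochner_Integration.integral_diff[OF i[OF x] i[OF pv]])
      also have "\<dots> = 0" unfolding e by (rule diff_self)
      finally show "(LINT t|lborel. f t * q t) = 0" .
    qed
    then obtain k where k: "AE t in lborel. t \<in> {0..T} \<longrightarrow> q t = k" by blast
    have "integral {0..T} d \<bullet> w = (LINT t|lborel. q t)" unfolding q_def by (rule integral_inner_zext[OF d])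
    also have "\<dots> = (LINT t|lborel. indicator {0..T} t * k)"
    proof (rule integral_cong_AE)
      show "AE t in lborel. q t = indicator {0..T} t * k"
        using k by eventually_elim (auto simp: indicator_def q_def zext_out)
    qed (use q in auto)
    also have "\<dots> = T * k" using T by simp
    finally have ck: "c \<bullet> w = k" using T by (simp add: c_def)
    show ?thesis using k
    proof eventually_elim
      case (elim t)
      then show ?case using ck
        by (cases "t \<in> {0..T}") (auto simp: z_def q_def zext_in zext_out inner_diff_left)
    qed
  qed
  \<comment> \<open>The null sets so far depend on \<open>w\<close>. The primitive of
    \<open>z\<close> is free of them: it is orthogonal to every \<open>w\<close> at every
    \<open>t\<close>.\<close>
  have "prim z t = 0" if "t \<in> {0..T}" for t
  proof -
    have "prim z t \<bullet> w = 0 \<bullet> w" for w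
    proof -
      have "prim z t \<bullet> w = (LINT s|lborel. indicator {0..t} s * (zext T z s \<bullet> w))"
        by (rule prim_inner[OF z]) (use that in auto)
      also have "\<dots> = 0" by (rule integral_eq_zero_AE) (use w[of w] in \<open>eventually_elim, auto\<close>)
      finally show ?thesis by simp
    qed
    then show ?thesis by (subst vector_eq_rdot[symmetric]) blast
  qed
  from AE_zero_of_prim_zero[OF z this T] have "AE t in lborel. zext T z t = 0" by simp
  then have "AE t in lborel. t \<in> {0..T} \<longrightarrow> x t = c + prim v t"
    by eventually_elim (auto simp: zext_def indicator_def z_def d_def algebra_simps)
  then show ?thesis using cH by blast
qed

text \<open>Both representations of \<open>x\<close> as constant plus primitive are continuous, so
  they agree everywhere; at 0 the constants agree, hence so do the primitives.\<close>

lemma weak_deriv_unique: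
  assumes T: "0 < T" and H: "hilbert_subspace H" and v: "has_weak_deriv T H x v" and u: "has_weak_deriv T H x u"
  shows "AE t in lborel. t \<in> {0..T} \<longrightarrow> v t = u t"
proof -
  have sH: "subspace H" using H by (simp add: hilbert_subspace_def)
  note v1 = has_weak_deriv_Lp1(2)[OF v] and u1 = has_weak_deriv_Lp1(2)[OF u]
  obtain c d where c: "AE t in lborel. t \<in> {0..T} \<longrightarrow> x t = c + prim v t" and d: "AE t in lborel. t \<in> {0..T} \<longrightarrow> x t = d + prim u t"
    using weak_deriv_repr[OF T H v] weak_deriv_repr[OF T H u] by blast
  define g where "g = (\<lambda>t. (c + prim v t) - (d + prim u t))"
  have g: "AE t in lborel. t \<in> {0..T} \<longrightarrow> g t = 0" using c d by eventually_elim (auto simp: g_def)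
  have gc: "continuous_on {0..T} g" unfolding g_def by (intro continuous_intros prim_continuous[OF v1] prim_continuous[OF u1])
  note gz = continuous_AE_zero[OF g gc T]
  have "c = d" using gz[of 0] T by (simp add: g_def prim_0)
  then have "prim (\<lambda>s. v s - u s) t = 0" if "t \<in> {0..T}" for t
    using gz[OF that] prim_diff[OF v1 u1, of t] that by (simp add: g_def)
  from AE_zero_of_prim_zero[OF Lp1_diff[OF sH v1 u1] this T]
  have "AE t in lborel. zext T (\<lambda>s. v s - u s) t = 0" by simp
  then show ?thesis by eventually_elim (auto simp: zext_def indicator_def)
qed

lemma has_weak_deriv_lincomb:
  assumes T: "0 < T" and H: "hilbert_subspace H" and x: "has_weak_deriv T H x v" and y: "has_weak_deriv T H y u"
  shows "has_weak_deriv T H (\<lambda>t. a *\<^sub>R x t + b *\<^sub>R y t) (\<lambda>t. a *\<^sub>R v t + b *\<^sub>R u t)"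
proof -
  have sH: "subspace H" using H by (simp add: hilbert_subspace_def)
  note l = has_weak_deriv_Lp1
  obtain c d where c: "AE t in lborel. t \<in> {0..T} \<longrightarrow> x t = c + prim v t" and d: "AE t in lborel. t \<in> {0..T} \<longrightarrow> y t = d + prim u t"
    using weak_deriv_repr[OF T H x] weak_deriv_repr[OF T H y] by blast
  show ?thesis
  proof (rule has_weak_derivI[OF _ _ T H])
    show "AE t in lborel. t \<in> {0..T} \<longrightarrow> a *\<^sub>R x t + b *\<^sub>R y t = (a *\<^sub>R c + b *\<^sub>R d) + prim (\<lambda>t. a *\<^sub>R v t + b *\<^sub>R u t) t"
      using c d
    proof eventually_elim
      case (elim t)
      then show ?case using prim_lincomb[OF l(2)[OF x] l(2)[OF y], of t a b] by (auto simp: algebra_simps)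
    qed
  qed (intro Lp1_add Lp1_scaleR sH l[OF x] l[OF y])+
qed

text \<open>\<open>weak_deriv\<close> is selected by choice and a priori only integrable; uniqueness
  transfers square-integrability from the witness in \<open>W12\<close>.\<close>

lemma W12_weak_deriv:
  assumes T: "0 < T" and H: "hilbert_subspace H" and x: "x \<in> W12 T H"
  shows "has_weak_deriv T H x (weak_deriv T H x)" "weak_deriv T H x \<in> Lp 2 T H" "x \<in> Lp 2 T H"
proof -
  obtain v where v: "v \<in> Lp 2 T H" "has_weak_deriv T H x v" and xl: "x \<in> Lp 2 T H" using x by (auto simp: W12_def)
  show w: "has_weak_deriv T H x (weak_deriv T H x)" unfolding weak_deriv_def by (rule someI[of _ v]) (rule v)
  have "AE t in lborel. t \<in> {0..T} \<longrightarrow> v t = weak_deriv T H x t" by (rule weak_deriv_unique[OF T H v(2) w])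
  then show "weak_deriv T H x \<in> Lp 2 T H"
    using has_weak_deriv_Lp1(2)[OF w] by (intro Lp_AE[OF v(1)]) (auto simp: Lp_smeas Lp_in)
  show "x \<in> Lp 2 T H" by fact
qed

lemma weak_deriv_AE:
  assumes T: "0 < T" and H: "hilbert_subspace H" and "has_weak_deriv T H x v"
  shows "AE t in lborel. t \<in> {0..T} \<longrightarrow> weak_deriv T H x t = v t"
  using assms(3) unfolding weak_deriv_def by (intro weak_deriv_unique[OF T H _ assms(3)]) (rule someI[where P="has_weak_deriv T H x", OF assms(3)])

lemma W12I: "x \<in> Lp 2 T H \<Longrightarrow> v \<in> Lp 2 T H \<Longrightarrow> has_weak_deriv T H x v \<Longrightarrow> x \<in> W12 T H"
  by (auto simp: W12_def)

lemma has_weak_deriv_cong: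
  assumes "\<And>t. t \<in> {0..T} \<Longrightarrow> x t = y t"
  shows "has_weak_deriv T H x v \<longleftrightarrow> has_weak_deriv T H y v"
proof -
  have "integral {0..T} (\<lambda>t. deriv \<phi> t *\<^sub>R x t) = integral {0..T} (\<lambda>t. deriv \<phi> t *\<^sub>R y t)" for \<phi>
    by (rule Henstock_Kurzweil_Integration.integral_cong) (simp add: assms)
  moreover have "x \<in> Lp 1 T H \<longleftrightarrow> y \<in> Lp 1 T H" by (rule Lp_cong) (rule assms)
  ultimately show ?thesis by (simp add: has_weak_deriv_def)
qed

lemma W12_cong:
  assumes "\<And>t. t \<in> {0..T} \<Longrightarrow> x t = y t"
  shows "x \<in> W12 T H \<longleftrightarrow> y \<in> W12 T H"
  unfolding W12_def using has_weak_deriv_cong[of T x y H, OF assms] Lp_cong[of T x y 2 H, OF assms] by simp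

text \<open>Continuity turns the almost-everywhere representation into one at every point;
  periodicity then says that the primitive of the derivative vanishes at \<open>T\<close>.\<close>

lemma W_perD:
  assumes T: "0 < T" and H: "hilbert_subspace H" and y: "y \<in> W_per T H"
  shows "\<And>t. t \<in> {0..T} \<Longrightarrow> y t = y 0 + prim (weak_deriv T H y) t" "prim (weak_deriv T H y) T = 0"
    "weak_deriv T H y \<in> Lp 2 T H" "y \<in> Lp 2 T H" "has_weak_deriv T H y (weak_deriv T H y)" "continuous_on {0..T} y"
proof -
  have yW: "y \<in> W12 T H" and c: "continuous_on {0..T} y" and per: "y T = y 0" using y by (auto simp: W_per_def)
  note w = W12_weak_deriv[OF T H yW]
  show "weak_deriv T H y \<in> Lp 2 T H" "y \<in> Lp 2 T H" "has_weak_deriv T H y (weak_deriv T H y)" "continuous_on {0..T} y" by fact+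
  let ?v = "weak_deriv T H y"
  obtain a where a: "AE t in lborel. t \<in> {0..T} \<longrightarrow> y t = a + prim ?v t" using weak_deriv_repr[OF T H w(1)] by blast
  define g where "g = (\<lambda>t. y t - (a + prim ?v t))"
  have "AE t in lborel. t \<in> {0..T} \<longrightarrow> g t = 0" using a by eventually_elim (auto simp: g_def)
  moreover have "continuous_on {0..T} g" unfolding g_def
    by (intro continuous_intros c prim_continuous[OF has_weak_deriv_Lp1(2)[OF w(1)]])
  ultimately have "g t = 0" if "t \<in> {0..T}" for t using continuous_AE_zero[OF _ _ T that] by blast
  then have eq: "y t = a + prim ?v t" if "t \<in> {0..T}" for t using that by (simp add: g_def)
  have "y 0 = a" using eq[of 0] T by (simp add: prim_0)
  then show "y t = y 0 + prim ?v t" if "t \<in> {0..T}" for t using eq[OF that] by simp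
  have "a + prim ?v T = a" using eq[of T] \<open>y 0 = a\<close> per T by simp
  then show "prim ?v T = 0" by simp
qed

lemma W_perI:
  assumes T: "0 < T" and H: "hilbert_subspace H" and c: "c \<in> H" and v: "v \<in> Lp 2 T H" and z: "prim v T = 0"
  shows "(\<lambda>t. c + prim v t) \<in> W_per T H" "has_weak_deriv T H (\<lambda>t. c + prim v t) v"
proof -
  have sH: "subspace H" using H by (simp add: hilbert_subspace_def)
  note v1 = Lp2_imp_Lp1[OF v]
  have p: "(\<lambda>t. c + prim v t) \<in> Lp p T H" for p
    by (rule Lp_continuous) (use T c prim_in[OF H v1] sH in \<open>auto intro!: continuous_intros prim_continuous[OF v1] subspace_add\<close>)
  show w: "has_weak_deriv T H (\<lambda>t. c + prim v t) v" by (rule has_weak_derivI[OF p v1 T H]) auto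
  show "(\<lambda>t. c + prim v t) \<in> W_per T H"
    unfolding W_per_def using W12I[OF p v w] z
    by (auto intro!: continuous_intros prim_continuous[OF v1] simp: prim_0)
qed

text \<open>Integration by parts with \<open>prim v T = 0\<close> shows that the integral of
  \<open>v \<bullet> prim v\<close> equals its own negative; the constant \<open>y 0\<close> pairs
  with \<open>prim v T\<close> and contributes nothing.\<close>

lemma W_per_energy:
  assumes T: "0 < T" and H: "hilbert_subspace H" and y: "y \<in> W_per T H"
  shows "L2_inner T (weak_deriv T H y) y = 0"
proof -
  let ?v = "weak_deriv T H y"
  note d = W_perD[OF T H y] and v1 = Lp2_imp_Lp1[OF W_perD(3)[OF T H y]]
  let ?E = "LINT s|lborel. zext T ?v s \<bullet> prim ?v s"
  have "(LINT t|lborel. prim ?v t \<bullet> zext T ?v t) = (LINT s|lborel. zext T ?v s \<bullet> (prim ?v T - prim ?v s))"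
    by (rule integral_parts[OF v1 v1])
  then have E: "?E = 0" using d(2) by (simp add: inner_commute)
  have pv: "prim ?v \<in> Lp 2 T H" using prim_Lp[OF H v1] T by simp
  have 1: "integrable lborel (\<lambda>s. zext T ?v s \<bullet> y 0)"
    using integrable_mult_inner[OF v1, of "\<lambda>_. 1" 1 "y 0"] by simp
  have "integrable lborel (\<lambda>s. zext T ?v s \<bullet> zext T (prim ?v) s)"
    by (intro sqi_inner_integrable Lp2_sqi[OF d(3)] Lp2_sqi[OF pv])
  moreover have "(\<lambda>s. zext T ?v s \<bullet> zext T (prim ?v) s) = (\<lambda>s. zext T ?v s \<bullet> prim ?v s)"
    by (auto simp: zext_def indicator_def fun_eq_iff)
  ultimately have 2: "integrable lborel (\<lambda>s. zext T ?v s \<bullet> prim ?v s)" by simp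
  have "L2_inner T ?v y = (LINT s|lborel. zext T ?v s \<bullet> y 0 + zext T ?v s \<bullet> prim ?v s)"
    unfolding L2_inner_def set_lebesgue_integral_def
  proof (rule Bochner_Integration.integral_cong[OF refl])
    fix s
    show "indicator {0..T} s *\<^sub>R (?v s \<bullet> y s) = zext T ?v s \<bullet> y 0 + zext T ?v s \<bullet> prim ?v s"
    proof (cases "s \<in> {0..T}")
      case True
      have "?v s \<bullet> y s = ?v s \<bullet> y 0 + ?v s \<bullet> prim ?v s"
        by (subst d(1)[OF True]) (rule inner_add_right)
      then show ?thesis using True by (simp add: zext_in)
    qed (simp add: zext_out)
  qed
  also have "\<dots> = integral {0..T} ?v \<bullet> y 0 + ?E"
    by (simp add: Bochner_Integration.integral_add[OF 1 2] integral_inner_zext[OF v1])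
  finally show ?thesis using E d(2) by (simp add: prim_def)
qed

section \<open>Periodic solutions of the evolution inclusion\<close>

lemma subdiff_finite:
  assumes "f \<in> Gamma0 H" "x \<in> H" "u \<in> subdiff H f x"
  shows "\<exists>r. f x = ereal r"
proof -
  obtain p where p: "p \<in> H" "f p \<noteq> \<infinity>" using assms(1) by (auto simp: Gamma0_def)
  have "f x \<noteq> -\<infinity>" using assms by (auto simp: Gamma0_def)
  moreover have "f x \<noteq> \<infinity>"
  proof
    assume "f x = \<infinity>"
    then have "ereal ((p - x) \<bullet> u) + f x = \<infinity>" by simp
    moreover have "ereal ((p - x) \<bullet> u) + f x \<le> f p" using assms(3) p by (auto simp: subdiff_def)
    ultimately show False using p by simp
  qed
  ultimately show ?thesis by (cases "f x") auto
qed

lemma subdiff_real_le: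
  assumes "u \<in> subdiff H f x" "y \<in> H" "f x = ereal r" "f y = ereal s"
  shows "(y - x) \<bullet> u \<le> s - r"
proof -
  have "ereal ((y - x) \<bullet> u) + f x \<le> f y" using assms(1,2) by (auto simp: subdiff_def)
  then show ?thesis using assms(3,4) by simp
qed

text \<open>The subgradient inequalities between consecutive points are added; the values of
  \<open>f\<close> telescope and cancel around the cycle.\<close>

lemma subdiff_cyclic:
  assumes f: "f \<in> Gamma0 H" and p: "\<And>k. k < N \<Longrightarrow> p k \<in> H" "\<And>k. k < N \<Longrightarrow> u k \<in> subdiff H f (p k)" and N: "p N = p 0"
  shows "0 \<le> (\<Sum>k<N. u k \<bullet> (p k - p (Suc k)))"
proof (cases "N = 0")
  case False
  define \<phi> where "\<phi> = (\<lambda>k. real_of_ereal (f (p k)))"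
  have fin: "f (p k) = ereal (\<phi> k)" "p k \<in> H" if "k \<le> N" for k
  proof -
    have *: "f (p j) = ereal (\<phi> j) \<and> p j \<in> H" if j: "j < N" for j
    proof -
      obtain r where "f (p j) = ereal r" using subdiff_finite[OF f p(1)[OF j] p(2)[OF j]] by blast
      then show ?thesis using p(1)[OF j] by (simp add: \<phi>_def)
    qed
    have "f (p k) = ereal (\<phi> k) \<and> p k \<in> H"
    proof (cases "k = N")
      case True
      then show ?thesis using *[of 0] False N by (simp add: \<phi>_def)
    qed (use that * in auto)
    then show "f (p k) = ereal (\<phi> k)" "p k \<in> H" by blast+
  qed
  have "\<phi> k - \<phi> (Suc k) \<le> u k \<bullet> (p k - p (Suc k))" if "k < N" for k
    using subdiff_real_le[OF p(2)[OF that] fin(2)[of "Suc k"] fin(1)[of k] fin(1)[of "Suc k"]] that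
    by (simp add: inner_diff_left inner_diff_right inner_commute)
  then have "(\<Sum>k<N. \<phi> k - \<phi> (Suc k)) \<le> (\<Sum>k<N. u k \<bullet> (p k - p (Suc k)))" by (intro sum_mono) auto
  then show ?thesis unfolding sum_lessThan_telescope' by (simp add: \<phi>_def N)
qed simp

lemma subdiff_monotone:
  assumes "f \<in> Gamma0 H" "x \<in> H" "y \<in> H" "u \<in> subdiff H f x" "v \<in> subdiff H f y"
  shows "0 \<le> (u - v) \<bullet> (x - y)"
proof -
  obtain r s where "f x = ereal r" "f y = ereal s" using subdiff_finite assms by metis
  then show ?thesis
    using subdiff_real_le[OF assms(4,3)] subdiff_real_le[OF assms(5,2)]
    by (force simp: inner_diff_left inner_diff_right inner_commute)
qed

definition prox :: "'a::{real_inner, banach} set \<Rightarrow> ('a \<Rightarrow> ereal) \<Rightarrow> real \<Rightarrow> 'a \<Rightarrow> 'a" where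
  "prox H f c x = (SOME p. p \<in> H \<and> (1 / c) *\<^sub>R (x - p) \<in> subdiff H f p)"

lemma prox:
  assumes "f \<in> Gamma0 H" "hilbert_subspace H" "x \<in> H" "c > 0"
  shows "prox H f c x \<in> H" "(1 / c) *\<^sub>R (x - prox H f c x) \<in> subdiff H f (prox H f c x)"
proof -
  have "\<exists>p. p \<in> H \<and> (1 / c) *\<^sub>R (x - p) \<in> subdiff H f p" using prox_exists[OF assms] by blast
  from someI_ex[OF this] show "prox H f c x \<in> H" "(1 / c) *\<^sub>R (x - prox H f c x) \<in> subdiff H f (prox H f c x)"
    by (auto simp: prox_def)
qed

lemma prox_nonexpansive:
  assumes "f \<in> Gamma0 H" "hilbert_subspace H" "x \<in> H" "y \<in> H" "c > 0"
  shows "norm (prox H f c x - prox H f c y) \<le> norm (x - y)"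
proof -
  let ?p = "prox H f c x" and ?q = "prox H f c y"
  have "0 \<le> ((1 / c) *\<^sub>R (x - ?p) - (1 / c) *\<^sub>R (y - ?q)) \<bullet> (?p - ?q)"
    using assms by (intro subdiff_monotone[OF assms(1)] prox) auto
  also have "(1 / c) *\<^sub>R (x - ?p) - (1 / c) *\<^sub>R (y - ?q) = (1 / c) *\<^sub>R ((x - y) - (?p - ?q))"
    by (simp add: algebra_simps)
  finally have "0 \<le> ((x - y) - (?p - ?q)) \<bullet> (?p - ?q)" using assms(5) by (simp add: zero_le_divide_iff)
  then have "(norm (?p - ?q))\<^sup>2 \<le> (x - y) \<bullet> (?p - ?q)" by (simp only: inner_diff_left[of "x - y"] power2_norm_eq_inner)
  also have "\<dots> \<le> norm (x - y) * norm (?p - ?q)" by (rule norm_cauchy_schwarz)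
  finally show ?thesis by (cases "?p = ?q") (auto simp: power2_eq_square)
qed

text \<open>For measurability, \<open>J\<close> is controlled on \<open>H\<close> only, so the
  composition goes through \<open>smeas_compose_finite\<close> with a one-element index set. For
  integrability, the linear bound holds for \<open>J (X t) - J 0\<close>, and the constant is added
  back.\<close>

lemma Lp2_Lipschitz:
  assumes X: "X \<in> Lp 2 T H" and H: "subspace H" and J: "\<And>a. a \<in> H \<Longrightarrow> J a \<in> H"
    and lip: "\<And>a b. a \<in> H \<Longrightarrow> b \<in> H \<Longrightarrow> norm (J a - J b) \<le> C * norm (a - b)"
  shows "(\<lambda>t. J (X t)) \<in> Lp 2 T H"
proof -
  have H0: "0 \<in> H" using H by (rule subspace_0)
  have sX: "smeas (restrict_space lborel {0..T}) X" using Lp_smeas[OF X] smeas_zext_iff by blast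
  have "smeas (restrict_space lborel {0..T}) (\<lambda>t. (\<lambda>g. J (g ())) (\<lambda>i\<in>{()}. X t))"
  proof (rule smeas_compose_finite[where H="\<lambda>_. H"])
    show "X t \<in> H" if "t \<in> space (restrict_space lborel {0..T})" for t using that Lp_in[OF X] by (simp add: space_interval)
    fix s :: "nat \<Rightarrow> unit \<Rightarrow> 'a" and y :: "unit \<Rightarrow> 'a"
    assume s: "\<And>n i. i \<in> {()} \<Longrightarrow> s n i \<in> H" "\<And>i. i \<in> {()} \<Longrightarrow> y i \<in> H" "\<And>i. i \<in> {()} \<Longrightarrow> (\<lambda>n. s n i) \<longlonglongrightarrow> y i"
    have "(\<lambda>n. C * norm (s n () - y ())) \<longlonglongrightarrow> C * norm (y () - y ())" by (intro tendsto_intros s) simp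
    then have "(\<lambda>n. C * norm (s n () - y ())) \<longlonglongrightarrow> 0" by simp
    moreover have "\<forall>\<^sub>F n in sequentially. norm (J (s n ()) - J (y ())) \<le> C * norm (s n () - y ())"
      using lip s by (intro always_eventually) auto
    ultimately have "(\<lambda>n. J (s n ()) - J (y ())) \<longlonglongrightarrow> 0" by (metis Lim_null_comparison)
    then show "(\<lambda>n. J (restrict (s n) {()} ())) \<longlonglongrightarrow> J (restrict y {()} ())" by (simp add: LIM_zero_iff)
  qed (auto intro: sX)
  then have sJ: "smeas (restrict_space lborel {0..T}) (\<lambda>t. J (X t))" by simp
  have "(\<lambda>t. J (X t) - J 0) \<in> Lp 2 T H"
  proof (rule Lp_bounded_by[OF X])
    show "smeas lborel (zext T (\<lambda>t. J (X t) - J 0))" unfolding smeas_zext_iff by (intro smeas_diff sJ smeas_const)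
    show "(\<lambda>t. J (X t) - J 0) ` {0..T} \<subseteq> H" using Lp_in[OF X] J H0 H by (auto intro!: subspace_diff)
    show "AE t in lborel. t \<in> {0..T} \<longrightarrow> norm (J (X t) - J 0) \<le> C * norm (X t)"
      using lip[OF Lp_in[OF X] H0] by (intro AE_I2) auto
  qed
  from Lp2_add[OF H this Lp_const[OF J[OF H0]]] show ?thesis by simp
qed

lemma L2_inner_zext: "L2_inner T x y = (LINT t|lborel. zext T x t \<bullet> zext T y t)"
  unfolding L2_inner_def set_lebesgue_integral_def
  by (rule Bochner_Integration.integral_cong) (auto simp: zext_def indicator_def)

lemma cls_inner_zext: "x \<in> Lp 2 T H \<Longrightarrow> y \<in> Lp 2 T K \<Longrightarrow> cls T x \<bullet> cls T y = (LINT t|lborel. zext T x t \<bullet> zext T y t)"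
  by (simp add: cls_inner L2_inner_zext)

lemma cls_subdiff_monotone:
  assumes f: "f \<in> Gamma0 H" and "x \<in> Lp 2 T H" "y \<in> Lp 2 T H" "u \<in> Lp 2 T H" "v \<in> Lp 2 T H" and H: "subspace H"
    and u: "AE t in lborel. t \<in> {0..T} \<longrightarrow> u t \<in> subdiff H f (x t)" and v: "AE t in lborel. t \<in> {0..T} \<longrightarrow> v t \<in> subdiff H f (y t)"
  shows "0 \<le> (cls T u - cls T v) \<bullet> (cls T x - cls T y)"
proof -
  have "(cls T u - cls T v) \<bullet> (cls T x - cls T y) = (LINT t|lborel. zext T (\<lambda>t. u t - v t) t \<bullet> zext T (\<lambda>t. x t - y t) t)"
    using assms(2-5) by (simp add: cls_diff[symmetric] cls_inner_zext[OF Lp2_diff[OF H] Lp2_diff[OF H]])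
  also have "\<dots> \<ge> 0"
  proof (rule integral_nonneg_AE)
    show "AE t in lborel. 0 \<le> zext T (\<lambda>t. u t - v t) t \<bullet> zext T (\<lambda>t. x t - y t) t"
      using u v
    proof eventually_elim
      case (elim t)
      then show ?case using subdiff_monotone[OF f] Lp_in[OF assms(2)] Lp_in[OF assms(3)]
        by (cases "t \<in> {0..T}") (auto simp: zext_in zext_out)
    qed
  qed
  finally show ?thesis .
qed

section \<open>The periodic shift\<close>

definition rot :: "real \<Rightarrow> real \<Rightarrow> real \<Rightarrow> real" where
  "rot T h t = (if h \<le> t then t - h else t - h + T)"

lemma rot_range: "0 \<le> h \<Longrightarrow> h \<le> T \<Longrightarrow> t \<in> {0..T} \<Longrightarrow> rot T h t \<in> {0..T}"
  by (auto simp: rot_def)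

text \<open>Within one turn the wrap-around happens at most once, which the conditional records. The
  end point \<open>t = T\<close> is excluded: \<open>N\<close> shifts take it to 0, not to
  \<open>T\<close>.\<close>

lemma rot_power:
  assumes T: "0 < T" and h: "h = T / real N" and N: "0 < N" and t: "0 \<le> t" "t < T" and k: "k \<le> N"
  shows "(rot T h ^^ k) t = t - real k * h + (if real k * h \<le> t then 0 else T)"
  using k
proof (induction k)
  case (Suc k)
  have "real (Suc k) * h \<le> real N * h" using Suc.prems T by (intro mult_right_mono) (auto simp: h)
  moreover have "real N * h = T" using N by (simp add: h)
  ultimately have le: "real k * h + h \<le> T" by (simp add: distrib_right)
  have "h > 0" using T N by (simp add: h)
  then show ?case using Suc.IH Suc.prems le t by (auto simp: rot_def algebra_simps)
qed (use t in simp)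

lemma rot_period:
  assumes "0 < T" "0 < N" "0 \<le> t" "t < T"
  shows "(rot T (T / real N) ^^ N) t = t"
  using rot_power[OF assms(1) refl assms(2-4), of N] assms by simp

lemma rot_measurable: "rot T h \<in> borel_measurable borel"
  unfolding rot_def[abs_def] by measurable

lemma AE_translate:
  assumes "AE t in lborel. P (t::real)"
  shows "AE t in lborel. P (s + t)"
proof -
  obtain N where N: "{t \<in> space lborel. \<not> P t} \<subseteq> N" "N \<in> null_sets lborel"
    using assms unfolding eventually_ae_filter by blast
  have "AE t in lborel. s + 1 * t \<notin> N"
    by (rule AE_borel_affine) (use N(2) AE_not_in[OF N(2)] in auto)
  then show ?thesis by eventually_elim (use N(1) in auto)
qed

lemma AE_rot:
  assumes P: "AE t in lborel. t \<in> {0..T} \<longrightarrow> P t" and h: "0 \<le> h" "h \<le> T"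
  shows "AE t in lborel. t \<in> {0..T} \<longrightarrow> P (rot T h t)"
  using AE_translate[OF P, of "- h"] AE_translate[OF P, of "T - h"]
  by eventually_elim (use h in \<open>auto simp: rot_def algebra_simps\<close>)

text \<open>The shift translates two pieces of the interval separately, with images
  \<open>[0, T - h]\<close> and \<open>{T - h..<T}\<close>; translation invariance of the integral
  gives both claims.\<close>

lemma rot_integral:
  fixes F :: "real \<Rightarrow> real"
  assumes F: "integrable lborel F" and h: "0 \<le> h" "h \<le> T"
  shows "integrable lborel (\<lambda>t. indicator {0..T} t * F (rot T h t))" (is ?A)
    and "(LINT t|lborel. indicator {0..T} t * F (rot T h t)) = (LINT t|lborel. indicator {0..T} t * F t)" (is ?B)
proof -
  define G1 G2 where "G1 = (\<lambda>t. indicator {0..T-h} t * F t)" and "G2 = (\<lambda>t. indicator {T-h..<T} t * F t)"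
  have i: "integrable lborel G1" "integrable lborel G2"
    unfolding G1_def G2_def using integrable_mult_indicator[OF _ F, of "{0..T-h}"] integrable_mult_indicator[OF _ F, of "{T-h..<T}"] by simp_all
  have tr: "has_bochner_integral lborel (\<lambda>t. G (s + 1 * t)) (integral\<^sup>L lborel G)" if "integrable lborel G" for s and G :: "real \<Rightarrow> real"
    using lborel_has_bochner_integral_real_affine_iff[of 1 G "integral\<^sup>L lborel G" s] has_bochner_integral_integrable[OF that] by simp
  have eq: "indicator {0..T} t * F (rot T h t) = G1 (- h + 1 * t) + G2 ((T - h) + 1 * t)" for t
    using h by (auto simp: G1_def G2_def rot_def indicator_def algebra_simps)
  have hb: "has_bochner_integral lborel (\<lambda>t. indicator {0..T} t * F (rot T h t)) (integral\<^sup>L lborel G1 + integral\<^sup>L lborel G2)"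
    unfolding eq by (intro has_bochner_integral_add tr i)
  then show ?A by (rule integrable.intros)
  have "(LINT t|lborel. indicator {0..T} t * F (rot T h t)) = integral\<^sup>L lborel G1 + integral\<^sup>L lborel G2"
    using hb by (rule has_bochner_integral_integral_eq)
  also have "\<dots> = (LINT t|lborel. G1 t + G2 t)" by (rule Bochner_Integration.integral_add[symmetric]; rule i)
  also have "\<dots> = (LINT t|lborel. indicator {0..T} t * F t)"
  proof (rule integral_cong_AE)
    show "AE t in lborel. G1 t + G2 t = indicator {0..T} t * F t"
      using AE_lborel_singleton[of "T - h"] AE_lborel_singleton[of T]
      by eventually_elim (use h in \<open>auto simp: G1_def G2_def indicator_def\<close>)
    show "(\<lambda>t. G1 t + G2 t) \<in> borel_measurable lborel" using i by measurable
    show "(\<lambda>t. indicator {0..T} t * F t) \<in> borel_measurable lborel" using F by measurable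
  qed
  finally show ?B .
qed

lemma rot_Lp2:
  assumes x: "x \<in> Lp 2 T H" and h: "0 \<le> h" "h \<le> T"
  shows "(\<lambda>t. x (rot T h t)) \<in> Lp 2 T H"
proof -
  have z: "zext T (\<lambda>t. x (rot T h t)) = (\<lambda>t. indicat_real {0..T} t *\<^sub>R zext T x (rot T h t))"
    using rot_range[OF h] by (auto simp: zext_def indicator_def fun_eq_iff)
  have "smeas lborel (\<lambda>t. zext T x (rot T h t))"
    by (rule smeas_comp_measurable[OF Lp_smeas[OF x]]) (simp add: rot_measurable)
  then have m: "smeas lborel (zext T (\<lambda>t. x (rot T h t)))"
    unfolding z by (intro smeas_scaleR smeas_real) auto
  have "integrable lborel (\<lambda>t. indicator {0..T} t * (norm (zext T x (rot T h t)))\<^sup>2)"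
    by (rule rot_integral(1)[OF sqi_integrable[OF Lp2_sqi[OF x]] h])
  moreover have "(\<lambda>t. indicator {0..T} t * (norm (zext T x (rot T h t)))\<^sup>2) = (\<lambda>t. (norm (zext T (\<lambda>t. x (rot T h t)) t))\<^sup>2)"
    unfolding z by (auto simp: indicator_def)
  ultimately have "zext T (\<lambda>t. x (rot T h t)) \<in> sqi" using m by (simp add: sqi_def)
  then show ?thesis unfolding Lp2_iff_sqi using rot_range[OF h] Lp_in[OF x] by auto
qed

lemma rot_L2_inner:
  assumes x: "x \<in> Lp 2 T H" and y: "y \<in> Lp 2 T K" and h: "0 \<le> h" "h \<le> T"
  shows "L2_inner T (\<lambda>t. x (rot T h t)) (\<lambda>t. y (rot T h t)) = L2_inner T x y"
proof -
  have "L2_inner T (\<lambda>t. x (rot T h t)) (\<lambda>t. y (rot T h t)) = (LINT t|lborel. indicator {0..T} t * (zext T x (rot T h t) \<bullet> zext T y (rot T h t)))"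
    unfolding L2_inner_zext
    by (rule Bochner_Integration.integral_cong) (use rot_range[OF h] in \<open>auto simp: zext_def indicator_def\<close>)
  also have "\<dots> = (LINT t|lborel. indicator {0..T} t * (zext T x t \<bullet> zext T y t))"
    by (rule rot_integral(2)[OF sqi_inner_integrable[OF Lp2_sqi[OF x] Lp2_sqi[OF y]] h])
  also have "\<dots> = L2_inner T x y" unfolding L2_inner_zext
    by (rule Bochner_Integration.integral_cong) (auto simp: zext_def indicator_def)
  finally show ?thesis .
qed

text \<open>The \<open>N\<close>-fold shift by \<open>T / N\<close> is the identity, so averaging the integrand over the orbit
  of the shift turns it into a cyclic sum.\<close>

lemma shift_subdiff_nonneg:
  assumes f: "f \<in> Gamma0 H" and H: "subspace H" and y: "y \<in> Lp 2 T H" and u: "u \<in> Lp 2 T H" and T: "0 < T" and N: "0 < N"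
    and sd: "AE t in lborel. t \<in> {0..T} \<longrightarrow> u t \<in> subdiff H f (y t)" and h: "h = T / real N"
  shows "0 \<le> L2_inner T u (\<lambda>t. y t - y (rot T h t))"
proof -
  have h0: "0 \<le> h" "h \<le> T" using T N by (auto simp: h divide_simps)
  define R where "R = (\<lambda>k. rot T h ^^ k)"
  have RS: "R (Suc k) = (\<lambda>t. R k (rot T h t))" "R (Suc k) t = rot T h (R k t)" for k t
    by (simp_all add: R_def funpow_Suc_right comp_def del: funpow.simps) (metis comp_apply funpow_swap1 funpow.simps(2))
  define z where "z = (\<lambda>t. y t - y (rot T h t))"
  have z: "z \<in> Lp 2 T H" unfolding z_def by (intro Lp2_diff H y rot_Lp2 h0)
  have uR: "(\<lambda>t. w (R k t)) \<in> Lp 2 T H" if "w \<in> Lp 2 T H" for w k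
  proof (induction k)
    case (Suc k)
    from rot_Lp2[OF Suc h0] show ?case by (simp add: RS(1))
  qed (simp add: R_def that)
  have inv: "L2_inner T (\<lambda>t. u (R k t)) (\<lambda>t. z (R k t)) = L2_inner T u z" for k
  proof (induction k)
    case (Suc k)
    from rot_L2_inner[OF uR[OF u] uR[OF z] h0, of k k] Suc show ?case by (simp add: RS(1))
  qed (simp add: R_def)
  have int: "integrable lborel (\<lambda>t. zext T (\<lambda>t. u (R k t)) t \<bullet> zext T (\<lambda>t. z (R k t)) t)" for k
    by (intro sqi_inner_integrable Lp2_sqi[OF uR[OF u]] Lp2_sqi[OF uR[OF z]])
  have sdk: "AE t in lborel. t \<in> {0..T} \<longrightarrow> u (R k t) \<in> subdiff H f (y (R k t))" for k
  proof (induction k)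
    case (Suc k)
    from AE_rot[OF Suc h0] show ?case by (simp add: RS(1))
  qed (use sd in \<open>simp add: R_def\<close>)
  have "real N * L2_inner T u z = (\<Sum>k<N. L2_inner T (\<lambda>t. u (R k t)) (\<lambda>t. z (R k t)))" by (simp add: inv)
  also have "\<dots> = (LINT t|lborel. (\<Sum>k<N. zext T (\<lambda>t. u (R k t)) t \<bullet> zext T (\<lambda>t. z (R k t)) t))"
    unfolding L2_inner_zext by (rule Bochner_Integration.integral_sum[symmetric]) (rule int)
  also have "\<dots> \<ge> 0"
  proof (rule integral_nonneg_AE)
    have "AE t in lborel. \<forall>k. t \<in> {0..T} \<longrightarrow> u (R k t) \<in> subdiff H f (y (R k t))"
      using sdk by (subst AE_all_countable) blast
    then show "AE t in lborel. 0 \<le> (\<Sum>k<N. zext T (\<lambda>t. u (R k t)) t \<bullet> zext T (\<lambda>t. z (R k t)) t)"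
      using AE_lborel_singleton[of T]
    proof eventually_elim
      case (elim t)
      show ?case
      proof (cases "t \<in> {0..T}")
        case True
        then have t: "0 \<le> t" "t < T" using elim(2) by auto
        have "0 \<le> (\<Sum>k<N. u (R k t) \<bullet> (y (R k t) - y (R (Suc k) t)))"
        proof (rule subdiff_cyclic[OF f])
          show "y (R k t) \<in> H" for k using Lp_in[OF uR[OF y] True] .
          show "u (R k t) \<in> subdiff H f (y (R k t))" for k using elim(1) True by blast
          show "y (R N t) = y (R 0 t)" using rot_period[OF T N t] by (simp add: R_def h)
        qed
        then show ?thesis using True by (simp add: zext_in z_def RS(2))
      qed (simp add: zext_out)
    qed
  qed
  finally show ?thesis using N by (simp add: z_def zero_le_mult_iff)
qed

text \<open>With \<open>1 / c = 1 / h + 1 / \<gamma>\<close> the inclusion says that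
  \<open>y t\<close> is the proximal point, with parameter \<open>c\<close>, of
  \<open>c g t + (c / h) y (rot T h t)\<close>. The proximal map is nonexpansive and the shift
  preserves the norm of classes, so this is a fixed point problem for a contraction with factor
  \<open>c / h = \<gamma> / (h + \<gamma>)\<close>.\<close>

lemma discrete_solution_exists:
  assumes f: "f \<in> Gamma0 H" and H: "hilbert_subspace H" and g: "g \<in> Lp 2 T H" and \<gamma>: "0 < \<gamma>" and h: "0 < h" "h \<le> T"
  shows "\<exists>y\<in>Lp 2 T H. AE t in lborel. t \<in> {0..T} \<longrightarrow>
    g t - (1 / h) *\<^sub>R (y t - y (rot T h t)) - (1 / \<gamma>) *\<^sub>R y t \<in> subdiff H f (y t)"
proof -
  have sH: "subspace H" using H by (simp add: hilbert_subspace_def)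
  define c where "c = h * \<gamma> / (h + \<gamma>)"
  have c: "c > 0" using h \<gamma> by (simp add: c_def)
  have c1: "1 / c = 1 / h + 1 / \<gamma>" using h \<gamma> by (simp add: c_def field_simps)
  have "c / h = \<gamma> / (h + \<gamma>)" using h by (simp add: c_def)
  then have ch: "0 \<le> c / h" "c / h < 1" using h \<gamma> by auto
  define A where "A = (\<lambda>y t. c *\<^sub>R g t + (c / h) *\<^sub>R y (rot T h t))"
  define P where "P = (\<lambda>y t. prox H f c (A y t))"
  have A: "A y \<in> Lp 2 T H" if "y \<in> Lp 2 T H" for y
    unfolding A_def by (intro Lp2_add Lp2_scaleR sH g rot_Lp2 that h less_imp_le)
  have P: "P y \<in> Lp 2 T H" if "y \<in> Lp 2 T H" for y
    unfolding P_def by (rule Lp2_Lipschitz[OF A[OF that] sH, where C=1])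
      (use prox[OF f H _ c] prox_nonexpansive[OF f H _ _ c] in auto)
  have con: "norm (cls T (P y) - cls T (P z)) \<le> (c / h) * norm (cls T y - cls T z)"
    if y: "y \<in> Lp 2 T H" and z: "z \<in> Lp 2 T H" for y z
  proof -
    define d where "d = (\<lambda>t. y t - z t)"
    have d: "d \<in> Lp 2 T H" unfolding d_def by (intro Lp2_diff sH y z)
    have rd: "(\<lambda>t. d (rot T h t)) \<in> Lp 2 T H" by (rule rot_Lp2[OF d]) (use h in auto)
    have pd: "(\<lambda>t. P y t - P z t) \<in> Lp 2 T H" by (intro Lp2_diff sH P y z)
    have "(norm (cls T (\<lambda>t. P y t - P z t)))\<^sup>2 \<le> (c / h)\<^sup>2 * (norm (cls T (\<lambda>t. d (rot T h t))))\<^sup>2"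
      unfolding cls_def norm_abs_L2[OF Lp2_sqi[OF pd]] norm_abs_L2[OF Lp2_sqi[OF rd]] integral_mult_right_zero[symmetric]
    proof (rule integral_mono)
      show "integrable lborel (\<lambda>t. (norm (zext T (\<lambda>t. P y t - P z t) t))\<^sup>2)" by (rule sqi_integrable[OF Lp2_sqi[OF pd]])
      show "integrable lborel (\<lambda>t. (c / h)\<^sup>2 * (norm (zext T (\<lambda>t. d (rot T h t)) t))\<^sup>2)"
        by (rule integrable_mult_right) (rule sqi_integrable[OF Lp2_sqi[OF rd]])
      fix t
      show "(norm (zext T (\<lambda>t. P y t - P z t) t))\<^sup>2 \<le> (c / h)\<^sup>2 * (norm (zext T (\<lambda>t. d (rot T h t)) t))\<^sup>2"
      proof (cases "t \<in> {0..T}")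
        case True
        have "norm (P y t - P z t) \<le> norm (A y t - A z t)"
          unfolding P_def using True by (intro prox_nonexpansive[OF f H _ _ c] Lp_in[OF A] y z)
        also have "A y t - A z t = (c / h) *\<^sub>R d (rot T h t)" by (simp add: A_def d_def algebra_simps)
        also have "norm \<dots> = (c / h) * norm (d (rot T h t))" using ch(1) by (simp only: norm_scaleR abs_of_nonneg)
        finally show ?thesis using True by (simp add: zext_in power_mono flip: power_mult_distrib)
      qed (simp add: zext_out)
    qed
    also have "(norm (cls T (\<lambda>t. d (rot T h t))))\<^sup>2 = (norm (cls T d))\<^sup>2"
      unfolding power2_norm_eq_inner cls_inner[OF rd rd] cls_inner[OF d d] using h by (intro rot_L2_inner[OF d d]) auto
    also have "(c / h)\<^sup>2 * (norm (cls T d))\<^sup>2 = ((c / h) * norm (cls T d))\<^sup>2" by (rule power_mult_distrib[symmetric])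
    finally have "norm (cls T (\<lambda>t. P y t - P z t)) \<le> (c / h) * norm (cls T d)"
      by (rule power2_le_imp_le) (intro mult_nonneg_nonneg ch norm_ge_zero)
    then show ?thesis by (simp add: d_def cls_diff[OF P[OF y] P[OF z]] cls_diff[OF y z])
  qed
  let ?M = "cls T ` Lp 2 T H"
  have M: "hilbert_subspace ?M" by (rule cls_closed_subspace[OF H])
  \<comment> \<open>The fixed point theorem runs on classes, so a representative is chosen before
    \<open>P\<close> can act.\<close>
  define rp where "rp = (\<lambda>X. SOME x. x \<in> Lp 2 T H \<and> cls T x = X)"
  have rp: "rp X \<in> Lp 2 T H" "cls T (rp X) = X" if "X \<in> ?M" for X
    using someI_ex[of "\<lambda>x. x \<in> Lp 2 T H \<and> cls T x = X"] that unfolding rp_def by blast+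
  have "\<exists>!X. X \<in> ?M \<and> cls T (P (rp X)) = X"
  proof (rule Banach_fix)
    show "complete ?M" using M by (simp add: hilbert_subspace_def complete_eq_closed)
    show "?M \<noteq> {}" using g by auto
    show "(\<lambda>X. cls T (P (rp X))) ` ?M \<subseteq> ?M" using P rp(1) by auto
    show "dist (cls T (P (rp X))) (cls T (P (rp Y))) \<le> c / h * dist X Y" if "X \<in> ?M" "Y \<in> ?M" for X Y
      using con[OF rp(1)[OF that(1)] rp(1)[OF that(2)]] rp(2)[OF that(1)] rp(2)[OF that(2)] by (simp add: dist_norm)
  qed (rule ch)+
  then obtain X where X: "X \<in> ?M" "cls T (P (rp X)) = X" by blast
  define y where "y = rp X"
  have y: "y \<in> Lp 2 T H" "cls T (P y) = cls T y" using rp[OF X(1)] X(2) by (auto simp: y_def)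
  have "AE t in lborel. t \<in> {0..T} \<longrightarrow> P y t = y t" using cls_eq_iff[OF P[OF y(1)] y(1)] y(2) by simp
  then have "AE t in lborel. t \<in> {0..T} \<longrightarrow>
    g t - (1 / h) *\<^sub>R (y t - y (rot T h t)) - (1 / \<gamma>) *\<^sub>R y t \<in> subdiff H f (y t)"
  proof eventually_elim
    case (elim t)
    show ?case
    proof
      assume t: "t \<in> {0..T}"
      have "(1 / c) *\<^sub>R (A y t - y t) \<in> subdiff H f (y t)"
        using prox(2)[OF f H Lp_in[OF A[OF y(1)] t] c] elim t by (simp add: P_def)
      moreover have "(1 / c) *\<^sub>R A y t = g t + (1 / h) *\<^sub>R y (rot T h t)" using c by (simp add: A_def scaleR_add_right)
      then have "(1 / c) *\<^sub>R (A y t - y t) = g t + (1 / h) *\<^sub>R y (rot T h t) - (1 / h + 1 / \<gamma>) *\<^sub>R y t"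
        by (simp add: scaleR_diff_right c1)
      also have "\<dots> = g t - (1 / h) *\<^sub>R (y t - y (rot T h t)) - (1 / \<gamma>) *\<^sub>R y t" by (simp add: algebra_simps)
      ultimately show "g t - (1 / h) *\<^sub>R (y t - y (rot T h t)) - (1 / \<gamma>) *\<^sub>R y t \<in> subdiff H f (y t)" by simp
    qed
  qed
  then show ?thesis using y(1) by blast
qed

section \<open>From difference quotients to weak derivatives\<close>

lemma cls_tendsto_bounded:
  fixes X :: "nat \<Rightarrow> real \<Rightarrow> 'a::{real_inner, banach}"
  assumes X: "\<And>n. X n \<in> Lp 2 T H" and x: "x \<in> Lp 2 T H" and bd: "\<And>n t. t \<in> {0..T} \<Longrightarrow> norm (X n t - x t) \<le> C"
    and lim: "\<And>t. t \<in> {0..T} \<Longrightarrow> (\<lambda>n. X n t) \<longlonglongrightarrow> x t" and H: "subspace H"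
  shows "(\<lambda>n. cls T (X n)) \<longlonglongrightarrow> cls T x"
proof -
  have d: "(\<lambda>t. X n t - x t) \<in> Lp 2 T H" for n by (intro Lp2_diff H X x)
  have "(\<lambda>n. LINT t|lborel. (norm (zext T (\<lambda>t. X n t - x t) t))\<^sup>2) \<longlonglongrightarrow> (LINT t::real|lborel. (0::real))"
  proof (rule integral_dominated_convergence[where w="\<lambda>t. indicator {0..T} t * C\<^sup>2"])
    show "integrable lborel (\<lambda>t. indicator {0..T} t * C\<^sup>2)" using integrable_indicator_interval[of T] by simp
    show "(\<lambda>t. (norm (zext T (\<lambda>t. X n t - x t) t))\<^sup>2) \<in> borel_measurable lborel" for n
      using sqi_integrable[OF Lp2_sqi[OF d]] by (rule borel_measurable_integrable)
    show "AE t in lborel. (\<lambda>n. (norm (zext T (\<lambda>t. X n t - x t) t))\<^sup>2) \<longlonglongrightarrow> 0"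
    proof (rule AE_I2)
      fix t
      show "(\<lambda>n. (norm (zext T (\<lambda>t. X n t - x t) t))\<^sup>2) \<longlonglongrightarrow> 0"
      proof (cases "t \<in> {0..T}")
        case True
        have "(\<lambda>n. (norm (X n t - x t))\<^sup>2) \<longlonglongrightarrow> (norm (x t - x t))\<^sup>2" by (intro tendsto_intros lim True)
        then show ?thesis using True by (simp add: zext_in)
      qed (simp add: zext_out)
    qed
    show "AE t in lborel. norm ((norm (zext T (\<lambda>t. X n t - x t) t))\<^sup>2) \<le> indicator {0..T} t * C\<^sup>2" for n
      by (rule AE_I2) (use bd in \<open>auto simp: zext_def indicator_def intro!: power_mono\<close>)
  qed simp
  then have "(\<lambda>n. (norm (cls T (\<lambda>t. X n t - x t)))\<^sup>2) \<longlonglongrightarrow> 0"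
    unfolding cls_def norm_abs_L2[OF Lp2_sqi[OF d]] by simp
  then have "(\<lambda>n. sqrt ((norm (cls T (\<lambda>t. X n t - x t)))\<^sup>2)) \<longlonglongrightarrow> sqrt 0" by (rule tendsto_real_sqrt)
  then have "(\<lambda>n. norm (cls T (X n) - cls T x)) \<longlonglongrightarrow> 0" by (simp add: cls_diff[OF X x])
  then show ?thesis by (simp add: tendsto_norm_zero_iff LIM_zero_iff)
qed

text \<open>By the mean value theorem the quotients obey the same bound as \<open>f\<close>, so
  pointwise convergence and domination suffice.\<close>

lemma difference_quotient_tendsto:
  fixes \<phi> f :: "real \<Rightarrow> real" and w :: "'a::{real_inner, banach}"
  assumes T: "0 < T" and \<phi>: "\<And>t. (\<phi> has_real_derivative f t) (at t)" "\<And>t. isCont f t" "0 < lo" "lo \<le> hi" "hi < T"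
    "\<And>t. t \<notin> {lo..hi} \<Longrightarrow> \<phi> t = 0 \<and> f t = 0"
    and h: "\<And>n. 0 < h n" "h \<longlonglongrightarrow> 0"
  shows "(\<lambda>n. cls T (\<lambda>t. ((\<phi> (t + h n) - \<phi> t) / h n) *\<^sub>R w)) \<longlonglongrightarrow> cls T (\<lambda>t. f t *\<^sub>R w)"
proof -
  have cf: "continuous_on A f" for A using \<phi>(2) by (intro continuous_at_imp_continuous_on) auto
  have c\<phi>: "continuous_on A \<phi>" for A using DERIV_isCont[OF \<phi>(1)] by (intro continuous_at_imp_continuous_on) auto
  obtain C0 where C0: "\<And>t. t \<in> {lo..hi} \<Longrightarrow> \<bar>f t\<bar> \<le> C0" using continuous_on_interval_bounded[OF cf] by blast
  define C where "C = max C0 0"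
  have C: "\<bar>f t\<bar> \<le> C" for t using C0[of t] \<phi>(6)[of t] by (cases "t \<in> {lo..hi}") (auto simp: C_def)
  have q: "\<bar>(\<phi> (t + h n) - \<phi> t) / h n\<bar> \<le> C" for t n
  proof -
    obtain z where "\<phi> (t + h n) - \<phi> t = (t + h n - t) * f z"
      using MVT2[of t "t + h n" \<phi> f] \<phi>(1) h(1)[of n] by auto
    then have "(\<phi> (t + h n) - \<phi> t) / h n = f z" using h(1)[of n] by simp
    then show ?thesis using C by simp
  qed
  show ?thesis
  proof (rule cls_tendsto_bounded)
    show "(\<lambda>t. ((\<phi> (t + h n) - \<phi> t) / h n) *\<^sub>R w) \<in> Lp 2 T UNIV" for n
    proof (rule Lp_continuous)
      show "continuous_on {0..T} (\<lambda>t. ((\<phi> (t + h n) - \<phi> t) / h n) *\<^sub>R w)"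
        by (intro continuous_intros continuous_on_compose2[OF c\<phi>[of UNIV]] c\<phi>) (use h(1)[of n] in auto)
    qed (use T in auto)
    show "(\<lambda>t. f t *\<^sub>R w) \<in> Lp 2 T UNIV"
      by (rule Lp_continuous) (use T in \<open>auto intro!: continuous_intros cf\<close>)
    show "norm (((\<phi> (t + h n) - \<phi> t) / h n) *\<^sub>R w - f t *\<^sub>R w) \<le> 2 * C * norm w" for n t
    proof -
      have "\<bar>(\<phi> (t + h n) - \<phi> t) / h n - f t\<bar> \<le> 2 * C" using q[of t n] C[of t] by linarith
      then show ?thesis unfolding scaleR_diff_left[symmetric] norm_scaleR by (rule mult_right_mono) simp
    qed
    show "(\<lambda>n. ((\<phi> (t + h n) - \<phi> t) / h n) *\<^sub>R w) \<longlonglongrightarrow> f t *\<^sub>R w" for t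
    proof -
      have "((\<lambda>d. (\<phi> (t + d) - \<phi> t) / d) \<longlongrightarrow> f t) (at 0)" using \<phi>(1)[of t] by (simp add: DERIV_def)
      moreover have "filterlim h (at 0) sequentially"
        unfolding filterlim_at using h by (auto intro!: always_eventually simp: less_imp_neq[symmetric])
      ultimately have "(\<lambda>n. (\<phi> (t + h n) - \<phi> t) / h n) \<longlonglongrightarrow> f t" by (rule filterlim_compose)
      then show ?thesis by (intro tendsto_intros)
    qed
  qed simp
qed

text \<open>On test functions the adjoint of the backward shift is the forward shift. No wrap-around
  term appears: for \<open>t < h\<close> both \<open>\<phi> t\<close> and
  \<open>\<phi> (t + T)\<close> vanish, since \<open>t < lo\<close> and
  \<open>hi < t + T\<close>.\<close>

lemma shift_adjoint:
  fixes \<phi> :: "real \<Rightarrow> real"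
  assumes y: "y \<in> Lp 2 T H" and c: "continuous_on UNIV \<phi>" and z: "\<And>t. t \<notin> {lo..hi} \<Longrightarrow> \<phi> t = 0"
    and lohi: "0 < lo" "hi < T" and h: "0 < h" "h < lo" "h \<le> T"
  shows "L2_inner T (\<lambda>t. y (rot T h t)) (\<lambda>t. \<phi> t *\<^sub>R w) = L2_inner T y (\<lambda>t. \<phi> (t + h) *\<^sub>R w)"
proof -
  have T: "0 \<le> T" using h by simp
  have p: "(\<lambda>t. \<phi> (t + h) *\<^sub>R w) \<in> Lp 2 T UNIV"
    by (rule Lp_continuous) (use T in \<open>auto intro!: continuous_intros continuous_on_compose2[OF c]\<close>)
  let ?F = "\<lambda>s. zext T y s \<bullet> zext T (\<lambda>t. \<phi> (t + h) *\<^sub>R w) s"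
  have "L2_inner T (\<lambda>t. y (rot T h t)) (\<lambda>t. \<phi> t *\<^sub>R w) = (LINT t|lborel. indicator {0..T} t * ?F (rot T h t))"
    unfolding L2_inner_def set_lebesgue_integral_def
  proof (rule Bochner_Integration.integral_cong[OF refl])
    fix t
    show "indicator {0..T} t *\<^sub>R (y (rot T h t) \<bullet> \<phi> t *\<^sub>R w) = indicator {0..T} t * ?F (rot T h t)"
    proof (cases "t \<in> {0..T}")
      case True
      have r: "rot T h t \<in> {0..T}" by (rule rot_range) (use h True in auto)
      have "\<phi> (rot T h t + h) = \<phi> t"
        using z[of t] z[of "t + T"] True lohi h by (auto simp: rot_def)
      then show ?thesis using True r by (simp add: zext_in)
    qed simp
  qed
  also have "\<dots> = (LINT t|lborel. indicator {0..T} t * ?F t)"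
    by (rule rot_integral(2)[OF sqi_inner_integrable[OF Lp2_sqi[OF y] Lp2_sqi[OF p]]]) (use h in auto)
  also have "\<dots> = L2_inner T y (\<lambda>t. \<phi> (t + h) *\<^sub>R w)" unfolding L2_inner_zext
    by (rule Bochner_Integration.integral_cong) (auto simp: zext_def indicator_def)
  finally show ?thesis .
qed

lemma inner_le_sq_of_norm_eq:
  fixes a b :: "'a::real_inner"
  assumes "norm b = norm a"
  shows "0 \<le> (a - b) \<bullet> a"
proof -
  have "b \<bullet> a \<le> norm b * norm a" by (rule norm_cauchy_schwarz)
  then show ?thesis using assms by (simp add: inner_diff_left power2_norm_eq_inner[symmetric] power2_eq_square)
qed

text \<open>Implicit Euler approximation: with \<open>h = T / N\<close> and \<open>D y = (y - y (\<cdot> - h)) / h\<close>, cyclic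
  monotonicity makes \<open>u \<bullet> D y\<close> and the Cauchy-Schwarz inequality makes \<open>y \<bullet> D y\<close> nonnegative, so that
  \<open>D y\<close> is bounded by the right-hand side. The weak limit is identified by Minty's device.\<close>

lemma periodic_solution_exists:
  fixes H :: "'a::{real_inner, banach} set"
  assumes T: "0 < T" and H: "hilbert_subspace H" and f: "f \<in> Gamma0 H" and \<gamma>: "0 < \<gamma>" and g: "g \<in> Lp 2 T H"
  shows "\<exists>y\<in>W_per T H. (AE t in lborel. t \<in> {0..T} \<longrightarrow> g t - (1 / \<gamma>) *\<^sub>R y t - weak_deriv T H y t \<in> subdiff H f (y t)) \<and>
     L2_norm T (weak_deriv T H y) \<le> L2_norm T g"
proof -
  have sH: "subspace H" using H by (simp add: hilbert_subspace_def)
  have H0: "0 \<in> H" using sH by (rule subspace_0)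
  define h where "h = (\<lambda>n. T / real (Suc n))"
  have h: "0 < h n" "h n \<le> T" for n using T by (auto simp: h_def divide_simps)
  have h0: "h \<longlonglongrightarrow> 0" unfolding h_def using T by real_asymp
  have "\<forall>n. \<exists>x. x \<in> Lp 2 T H \<and> (AE t in lborel. t \<in> {0..T} \<longrightarrow>
     g t - (1 / h n) *\<^sub>R (x t - x (rot T (h n) t)) - (1 / \<gamma>) *\<^sub>R x t \<in> subdiff H f (x t))"
    using discrete_solution_exists[OF f H g \<gamma> h] by blast
  from choice[OF this] obtain y where y: "\<And>n. y n \<in> Lp 2 T H" and incl: "\<And>n. AE t in lborel. t \<in> {0..T} \<longrightarrow>
     g t - (1 / h n) *\<^sub>R (y n t - y n (rot T (h n) t)) - (1 / \<gamma>) *\<^sub>R y n t \<in> subdiff H f (y n t)"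
    by blast
  define s where "s = (\<lambda>n t. y n (rot T (h n) t))"
  have s: "s n \<in> Lp 2 T H" for n unfolding s_def by (rule rot_Lp2[OF y]) (use h[of n] in auto)
  define d where "d = (\<lambda>n t. (1 / h n) *\<^sub>R (y n t - s n t))"
  have d: "d n \<in> Lp 2 T H" for n unfolding d_def by (intro Lp2_scaleR Lp2_diff sH y s)
  define u where "u = (\<lambda>n t. g t - d n t - (1 / \<gamma>) *\<^sub>R y n t)"
  have u: "u n \<in> Lp 2 T H" for n unfolding u_def by (intro Lp2_scaleR Lp2_diff sH y g d)
  have us: "AE t in lborel. t \<in> {0..T} \<longrightarrow> u n t \<in> subdiff H f (y n t)" for n
    using incl[of n] by (simp add: u_def d_def s_def)
  define Y S D U G where "Y = (\<lambda>n. cls T (y n))" and "S = (\<lambda>n. cls T (s n))" and "D = (\<lambda>n. cls T (d n))"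
    and "U = (\<lambda>n. cls T (u n))" and "G = cls T g"
  have Deq: "D n = (1 / h n) *\<^sub>R (Y n - S n)" for n
    unfolding D_def Y_def S_def d_def by (simp add: cls_scaleR[OF Lp2_diff[OF sH y s]] cls_diff[OF y s])
  have Ueq: "U n = G - D n - (1 / \<gamma>) *\<^sub>R Y n" for n
    unfolding U_def D_def Y_def G_def u_def
    by (simp add: cls_diff[OF Lp2_diff[OF sH g d] Lp2_scaleR[OF sH y]] cls_diff[OF g d] cls_scaleR[OF y])
  have SS: "L2_inner T (s n) (\<lambda>t. x (rot T (h n) t)) = L2_inner T (y n) x" if "x \<in> Lp 2 T UNIV" for n x
    unfolding s_def by (rule rot_L2_inner[OF y that]) (use h[of n] in auto)
  have nS: "norm (S n) = norm (Y n)" for n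
  proof -
    have "S n \<bullet> S n = Y n \<bullet> Y n"
      unfolding S_def Y_def cls_inner[OF s s] cls_inner[OF y y] using SS[OF Lp_UNIV[OF y], of n n] by (simp add: s_def)
    then show ?thesis by (simp add: norm_eq_sqrt_inner)
  qed
  have constS: "S n \<bullet> cls T (\<lambda>_. a) = Y n \<bullet> cls T (\<lambda>_. a)" for n and a :: 'a
    unfolding S_def Y_def cls_inner[OF s Lp_const[OF UNIV_I]] cls_inner[OF y Lp_const[OF UNIV_I]]
    by (rule SS) (rule Lp_const, simp)
  \<comment> \<open>The shift does not change the pairing with constants, so difference quotients
    have mean value zero; in the limit this becomes periodicity.\<close>
  have Dconst: "D n \<bullet> cls T (\<lambda>_. a) = 0" for n and a :: 'a
    using constS[of n a] by (simp add: Deq inner_diff_left)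
  have DY: "0 \<le> D n \<bullet> Y n" for n
    using inner_le_sq_of_norm_eq[OF nS[of n]] h(1)[of n] by (simp add: Deq)
  have UD: "0 \<le> U n \<bullet> D n" for n
  proof -
    have "0 \<le> L2_inner T (u n) (\<lambda>t. y n t - s n t)"
      unfolding s_def using shift_subdiff_nonneg[OF f sH y u T _ us h_def[THEN fun_cong, of n], of n] by simp
    also have "\<dots> = U n \<bullet> (Y n - S n)"
      by (simp add: U_def Y_def S_def cls_inner[OF u Lp2_diff[OF sH y s], symmetric] cls_diff[OF y s])
    finally show ?thesis using h(1)[of n] by (simp add: Deq)
  qed
  have Dbd: "norm (D n) \<le> norm G" for n
  proof -
    have "D n \<bullet> D n = G \<bullet> D n - U n \<bullet> D n - (1 / \<gamma>) * (D n \<bullet> Y n)"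
      unfolding inner_commute[of "D n" "Y n"] by (simp add: Ueq inner_diff_left)
    also have "\<dots> \<le> G \<bullet> D n"
      using UD[of n] mult_nonneg_nonneg[OF _ DY[of n], of "1 / \<gamma>"] \<gamma> by simp
    also have "\<dots> \<le> norm G * norm (D n)" by (rule norm_cauchy_schwarz)
    finally show ?thesis by (cases "D n = 0") (auto simp: power2_norm_eq_inner[symmetric] power2_eq_square)
  qed
  \<comment> \<open>The proximal point of 0 yields the constant pair \<open>(a, - a)\<close> in the
    graph of the subdifferential, against which monotonicity bounds \<open>Y n\<close>.\<close>
  define a where "a = prox H f 1 0"
  have a: "a \<in> H" "- a \<in> subdiff H f a" "- a \<in> H"
    using prox[OF f H H0, of 1] sH subspace_neg by (auto simp: a_def)
  define A where "A = cls T (\<lambda>_. a)"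
  have Am: "- A = cls T (\<lambda>_. - a)" unfolding A_def using cls_scaleR[OF Lp_const[OF a(1)], of T "-1"] by simp
  have Ybd: "norm (Y n - A) \<le> \<gamma> * norm (G + A - (1 / \<gamma>) *\<^sub>R A)" for n
  proof -
    have "0 \<le> (U n - (- A)) \<bullet> (Y n - A)"
      unfolding Am unfolding U_def Y_def A_def
      by (rule cls_subdiff_monotone[OF f y Lp_const[OF a(1)] u Lp_const[OF a(3)] sH us]) (use a(2) in auto)
    also have "U n - (- A) = (G + A - (1 / \<gamma>) *\<^sub>R A) - D n - (1 / \<gamma>) *\<^sub>R (Y n - A)"
      by (simp add: Ueq algebra_simps)
    finally have "(1 / \<gamma>) * ((Y n - A) \<bullet> (Y n - A)) \<le> (G + A - (1 / \<gamma>) *\<^sub>R A) \<bullet> (Y n - A) - D n \<bullet> (Y n - A)"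
      by (simp only: inner_diff_left inner_scaleR_left)
    moreover have "D n \<bullet> (Y n - A) = D n \<bullet> Y n" using Dconst[of n a] by (simp add: A_def inner_diff_right)
    ultimately have "(1 / \<gamma>) * ((Y n - A) \<bullet> (Y n - A)) \<le> (G + A - (1 / \<gamma>) *\<^sub>R A) \<bullet> (Y n - A)" using DY[of n] by linarith
    also have "\<dots> \<le> norm (G + A - (1 / \<gamma>) *\<^sub>R A) * norm (Y n - A)" by (rule norm_cauchy_schwarz)
    finally have "norm (Y n - A) * norm (Y n - A) \<le> \<gamma> * norm (G + A - (1 / \<gamma>) *\<^sub>R A) * norm (Y n - A)"
      using \<gamma> by (simp add: power2_norm_eq_inner[symmetric] power2_eq_square field_simps)
    then show ?thesis using \<gamma> by (cases "Y n = A") auto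
  qed
  define C where "C = norm A + \<gamma> * norm (G + A - (1 / \<gamma>) *\<^sub>R A)"
  have YC: "norm (Y n) \<le> C" for n using Ybd[of n] norm_triangle_ineq2[of "Y n" A] by (simp add: C_def)
  obtain r1 Yl where r1: "strict_mono r1" "wconv (Y \<circ> r1) Yl" using weak_compactness[of Y C, OF YC] by blast
  obtain r2 Dl where r2: "strict_mono r2" "wconv ((D \<circ> r1) \<circ> r2) Dl"
    using weak_compactness[of "D \<circ> r1" "norm G"] Dbd by auto
  define r where "r = r1 \<circ> r2"
  have r: "strict_mono r" unfolding r_def by (rule strict_mono_o[OF r1(1) r2(1)])
  have wY: "wconv (Y \<circ> r) Yl" using wconv_subseq[OF r1(2) r2(1)] by (simp add: r_def comp_assoc)
  have wD: "wconv (D \<circ> r) Dl" using r2(2) by (simp add: r_def comp_assoc)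
  have M: "hilbert_subspace (cls T ` Lp 2 T H)" by (rule cls_closed_subspace[OF H])
  have "Yl \<in> cls T ` Lp 2 T H" by (rule wconv_closed_subspace[OF M wY]) (use y in \<open>simp add: Y_def\<close>)
  then obtain yl where yl: "yl \<in> Lp 2 T H" "Yl = cls T yl" by blast
  have "Dl \<in> cls T ` Lp 2 T H" by (rule wconv_closed_subspace[OF M wD]) (use d in \<open>simp add: D_def\<close>)
  then obtain v where v: "v \<in> Lp 2 T H" "Dl = cls T v" by blast
  have "has_weak_deriv T H yl v"
  proof (rule has_weak_derivI_test[OF Lp2_imp_Lp1[OF yl(1)] Lp2_imp_Lp1[OF v(1)] T])
    fix \<phi> f :: "real \<Rightarrow> real" and lo hi :: real and w :: 'a
    assume \<phi>: "\<And>t. (\<phi> has_real_derivative f t) (at t)" "\<And>t. isCont f t" "0 < lo" "lo \<le> hi" "hi < T"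
      "\<And>t. t \<notin> {lo..hi} \<Longrightarrow> \<phi> t = 0 \<and> f t = 0"
    have c\<phi>: "continuous_on A \<phi>" for A using DERIV_isCont[OF \<phi>(1)] by (intro continuous_at_imp_continuous_on) auto
    have cf: "continuous_on A f" for A using \<phi>(2) by (intro continuous_at_imp_continuous_on) auto
    have p\<phi>: "(\<lambda>t. \<phi> t *\<^sub>R w) \<in> Lp 2 T UNIV" "(\<lambda>t. f t *\<^sub>R w) \<in> Lp 2 T UNIV"
      by (rule Lp_continuous; use T in \<open>auto intro!: continuous_intros c\<phi> cf\<close>)+
    have ph: "(\<lambda>t. \<phi> (t + e) *\<^sub>R w) \<in> Lp 2 T UNIV" for e
      by (rule Lp_continuous) (use T in \<open>auto intro!: continuous_intros continuous_on_compose2[OF c\<phi>[of UNIV]]\<close>)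
    define Q where "Q = (\<lambda>n. cls T (\<lambda>t. ((\<phi> (t + h n) - \<phi> t) / h n) *\<^sub>R w))"
    have Qeq: "Q n = (1 / h n) *\<^sub>R (cls T (\<lambda>t. \<phi> (t + h n) *\<^sub>R w) - cls T (\<lambda>t. \<phi> t *\<^sub>R w))" for n
    proof -
      have "(\<lambda>t. ((\<phi> (t + h n) - \<phi> t) / h n) *\<^sub>R w) = (\<lambda>t. (1 / h n) *\<^sub>R (\<phi> (t + h n) *\<^sub>R w - \<phi> t *\<^sub>R w))"
        by (simp add: scaleR_diff_left[symmetric])
      then show ?thesis unfolding Q_def
        by (simp add: cls_scaleR[OF Lp2_diff[OF subspace_UNIV ph p\<phi>(1)]] cls_diff[OF ph p\<phi>(1)])
    qed
    have Ql: "(Q \<circ> r) \<longlonglongrightarrow> cls T (\<lambda>t. f t *\<^sub>R w)"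
      unfolding Q_def by (rule LIMSEQ_subseq_LIMSEQ[OF difference_quotient_tendsto[OF T \<phi> h(1) h0] r])
    \<comment> \<open>The shift is moved onto the test function, which is legitimate once
      \<open>h (r n) < lo\<close>.\<close>
    have ev: "\<forall>\<^sub>F n in sequentially. (D \<circ> r) n \<bullet> cls T (\<lambda>t. \<phi> t *\<^sub>R w) = - ((Y \<circ> r) n \<bullet> (Q \<circ> r) n)"
    proof -
      have "\<forall>\<^sub>F n in sequentially. (h \<circ> r) n < lo" using LIMSEQ_subseq_LIMSEQ[OF h0 r] \<phi>(3) by (rule order_tendstoD)
      then show ?thesis
      proof eventually_elim
        case (elim n)
        let ?n = "r n"
        have "S ?n \<bullet> cls T (\<lambda>t. \<phi> t *\<^sub>R w) = Y ?n \<bullet> cls T (\<lambda>t. \<phi> (t + h ?n) *\<^sub>R w)"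
          unfolding S_def Y_def cls_inner[OF s p\<phi>(1)] cls_inner[OF y ph] unfolding s_def
          by (rule shift_adjoint[OF y c\<phi>, of lo hi]) (use \<phi>(3-6) h[of ?n] elim in auto)
        then show ?case by (simp add: Deq Qeq inner_diff_left inner_diff_right algebra_simps diff_divide_distrib)
      qed
    qed
    have "(\<lambda>n. (Y \<circ> r) n \<bullet> (Q \<circ> r) n) \<longlonglongrightarrow> Yl \<bullet> cls T (\<lambda>t. f t *\<^sub>R w)"
      by (rule wconv_inner_strong[OF wY _ Ql]) (use YC in auto)
    then have "(\<lambda>n. - ((Y \<circ> r) n \<bullet> (Q \<circ> r) n)) \<longlonglongrightarrow> - (Yl \<bullet> cls T (\<lambda>t. f t *\<^sub>R w))" by (rule tendsto_minus)
    moreover have "(\<lambda>n. (D \<circ> r) n \<bullet> cls T (\<lambda>t. \<phi> t *\<^sub>R w)) \<longlonglongrightarrow> Dl \<bullet> cls T (\<lambda>t. \<phi> t *\<^sub>R w)"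
      using wD by (simp add: wconv_def)
    then have "(\<lambda>n. - ((Y \<circ> r) n \<bullet> (Q \<circ> r) n)) \<longlonglongrightarrow> Dl \<bullet> cls T (\<lambda>t. \<phi> t *\<^sub>R w)"
      by (rule Lim_transform_eventually) (use ev in auto)
    ultimately have "Dl \<bullet> cls T (\<lambda>t. \<phi> t *\<^sub>R w) = - (Yl \<bullet> cls T (\<lambda>t. f t *\<^sub>R w))"
      using LIMSEQ_unique by blast
    then have "(LINT t|lborel. zext T v t \<bullet> zext T (\<lambda>t. \<phi> t *\<^sub>R w) t) = - (LINT t|lborel. zext T yl t \<bullet> zext T (\<lambda>t. f t *\<^sub>R w) t)"
      by (simp add: yl(2) v(2) cls_inner_zext[OF v(1) p\<phi>(1)] cls_inner_zext[OF yl(1) p\<phi>(2)])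
    moreover have "(\<lambda>t. zext T x t \<bullet> zext T (\<lambda>t. k t *\<^sub>R w) t) = (\<lambda>t. k t * (zext T x t \<bullet> w))" for x and k :: "real \<Rightarrow> real"
      by (auto simp: zext_def indicator_def)
    ultimately show "(LINT t|lborel. f t * (zext T yl t \<bullet> w)) = - (LINT t|lborel. \<phi> t * (zext T v t \<bullet> w))" by simp
  qed
  then obtain c where c: "c \<in> H" "AE t in lborel. t \<in> {0..T} \<longrightarrow> yl t = c + prim v t" using weak_deriv_repr[OF T H] by blast
  have "prim v T \<bullet> w = 0 \<bullet> w" for w
  proof -
    have "(\<lambda>n. (D \<circ> r) n \<bullet> cls T (\<lambda>_. w)) \<longlonglongrightarrow> Dl \<bullet> cls T (\<lambda>_. w)" using wD by (simp add: wconv_def)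
    then have "Dl \<bullet> cls T (\<lambda>_. w) = 0" by (simp add: Dconst LIMSEQ_const_iff)
    then have "(LINT t|lborel. zext T v t \<bullet> zext T (\<lambda>_. w) t) = 0"
      unfolding v(2) cls_inner_zext[OF v(1) Lp_const[OF UNIV_I]] .
    moreover have "(\<lambda>t. zext T v t \<bullet> zext T (\<lambda>_. w) t) = (\<lambda>t. zext T v t \<bullet> w)" by (auto simp: zext_def indicator_def)
    ultimately show ?thesis using integral_inner_zext[OF Lp2_imp_Lp1[OF v(1)], of w] by (simp add: prim_def)
  qed
  then have pv: "prim v T = 0" by (subst vector_eq_rdot[symmetric]) blast
  define yy where "yy = (\<lambda>t. c + prim v t)"
  have yW: "yy \<in> W_per T H" and wd: "has_weak_deriv T H yy v"
    unfolding yy_def by (rule W_perI[OF T H c(1) v(1) pv])+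
  have wv: "AE t in lborel. t \<in> {0..T} \<longrightarrow> weak_deriv T H yy t = v t" by (rule weak_deriv_AE[OF T H wd])
  note yd = W_perD[OF T H yW]
  have Yl: "cls T yy = Yl" unfolding yl(2) cls_eq_iff[OF yd(4) yl(1)] using c(2) by eventually_elim (simp add: yy_def)
  have Dl: "cls T (weak_deriv T H yy) = Dl" unfolding v(2) cls_eq_iff[OF yd(3) v(1)] by (rule wv)
  have DlYl: "Dl \<bullet> Yl = 0" unfolding Dl[symmetric] Yl[symmetric] cls_inner[OF yd(3,4)] by (rule W_per_energy[OF T H yW])
  define ul where "ul = (\<lambda>t. g t - (1 / \<gamma>) *\<^sub>R yy t - weak_deriv T H yy t)"
  have ul: "ul \<in> Lp 2 T H" unfolding ul_def by (intro Lp2_diff Lp2_scaleR sH g yd)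
  define Ul where "Ul = G - Dl - (1 / \<gamma>) *\<^sub>R Yl"
  have Ul: "cls T ul = Ul" unfolding ul_def Ul_def G_def
    by (simp add: cls_diff[OF Lp2_diff[OF sH g Lp2_scaleR[OF sH yd(4)]] yd(3)] cls_diff[OF g Lp2_scaleR[OF sH yd(4)]] cls_scaleR[OF yd(4)] Yl Dl)
  \<comment> \<open>The pair \<open>(p, q)\<close> lies in the graph of the subdifferential and has
    the same sum as \<open>(yy, ul)\<close>. Monotonicity against it survives the limit and forces
    \<open>p = yy\<close> almost everywhere.\<close>
  define p where "p = (\<lambda>t. prox H f 1 (yy t + ul t))"
  have p: "p \<in> Lp 2 T H" unfolding p_def
    by (rule Lp2_Lipschitz[OF Lp2_add[OF sH yd(4) ul] sH, where C=1])
      (use prox[OF f H, of _ 1] prox_nonexpansive[OF f H, of _ _ 1] in auto)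
  define q where "q = (\<lambda>t. yy t + ul t - p t)"
  have q: "q \<in> Lp 2 T H" unfolding q_def by (intro Lp2_diff Lp2_add sH yd ul p)
  have qs: "q t \<in> subdiff H f (p t)" if "t \<in> {0..T}" for t
    using prox(2)[OF f H, of "yy t + ul t" 1] Lp_in[OF yd(4) that] Lp_in[OF ul that] sH
    by (simp add: q_def p_def subspace_add)
  define P where "P = cls T p"
  have Q: "cls T q = Yl + Ul - P" unfolding q_def P_def
    by (simp add: cls_diff[OF Lp2_add[OF sH yd(4) ul] p] cls_add[OF yd(4) ul] Yl Ul)
  define Qq where "Qq = Yl + Ul - P"
  \<comment> \<open>\<open>Y n \<bullet> Y n\<close> is not weakly continuous, so its lower bound
    \<open>2 * (Y n \<bullet> Yl) - Yl \<bullet> Yl\<close>, affine in \<open>Y n\<close>, takes its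
    place. The term \<open>D n \<bullet> Y n\<close> is dropped because of its sign; its counterpart
    in the limit is zero by \<open>DlYl\<close>.\<close>
  have mono: "0 \<le> G \<bullet> Y n - (1 / \<gamma>) * (2 * (Y n \<bullet> Yl) - Yl \<bullet> Yl) - Qq \<bullet> Y n - (G \<bullet> P - D n \<bullet> P - (1 / \<gamma>) * (Y n \<bullet> P)) + Qq \<bullet> P" for n
  proof -
    have "0 \<le> (U n - Qq) \<bullet> (Y n - P)"
      unfolding U_def Y_def P_def Qq_def[folded Q]
      by (rule cls_subdiff_monotone[OF f y p u q sH us]) (use qs in auto)
    also have "\<dots> = G \<bullet> Y n - D n \<bullet> Y n - (1 / \<gamma>) * (Y n \<bullet> Y n) - Qq \<bullet> Y n - U n \<bullet> P + Qq \<bullet> P"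
      by (simp add: inner_diff_left inner_diff_right Ueq)
    also have "\<dots> \<le> G \<bullet> Y n - (1 / \<gamma>) * (2 * (Y n \<bullet> Yl) - Yl \<bullet> Yl) - Qq \<bullet> Y n - U n \<bullet> P + Qq \<bullet> P"
    proof -
      have "0 \<le> (Y n - Yl) \<bullet> (Y n - Yl)" by simp
      then have "2 * (Y n \<bullet> Yl) - Yl \<bullet> Yl \<le> Y n \<bullet> Y n" by (simp add: inner_diff_left inner_diff_right inner_commute)
      then have "(1 / \<gamma>) * (2 * (Y n \<bullet> Yl) - Yl \<bullet> Yl) \<le> (1 / \<gamma>) * (Y n \<bullet> Y n)" using \<gamma> by (intro mult_left_mono) auto
      then show ?thesis using DY[of n] by linarith
    qed
    finally show ?thesis by (simp only: Ueq inner_diff_left inner_scaleR_left)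
  qed
  have wl: "(\<lambda>n. (Y \<circ> r) n \<bullet> w) \<longlonglongrightarrow> Yl \<bullet> w" "(\<lambda>n. (D \<circ> r) n \<bullet> w) \<longlonglongrightarrow> Dl \<bullet> w" for w
    using wY wD by (auto simp: wconv_def)
  have "(\<lambda>n. (Y \<circ> r) n \<bullet> G - (1 / \<gamma>) * (2 * ((Y \<circ> r) n \<bullet> Yl) - Yl \<bullet> Yl) - (Y \<circ> r) n \<bullet> Qq - (G \<bullet> P - (D \<circ> r) n \<bullet> P - (1 / \<gamma>) * ((Y \<circ> r) n \<bullet> P)) + Qq \<bullet> P)
      \<longlonglongrightarrow> Yl \<bullet> G - (1 / \<gamma>) * (2 * (Yl \<bullet> Yl) - Yl \<bullet> Yl) - Yl \<bullet> Qq - (G \<bullet> P - Dl \<bullet> P - (1 / \<gamma>) * (Yl \<bullet> P)) + Qq \<bullet> P" (is "?L \<longlonglongrightarrow> ?l")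
    by (intro tendsto_intros wl)
  moreover have "0 \<le> ?L n" for n
    using mono[of "r n"] by (simp add: inner_commute)
  ultimately have "0 \<le> ?l" by (intro LIMSEQ_le_const) auto
  also have "?l = (Ul - Qq) \<bullet> (Yl - P)"
    using DlYl by (simp add: Ul_def inner_diff_left inner_diff_right inner_commute algebra_simps)
  also have "Ul - Qq = - (Yl - P)" by (simp add: Qq_def)
  finally have "(Yl - P) \<bullet> (Yl - P) \<le> 0" by (simp only: inner_minus_left neg_0_le_iff_le)
  then have "Yl = P" by (metis inner_gt_zero_iff not_less right_minus_eq)
  then have "AE t in lborel. t \<in> {0..T} \<longrightarrow> yy t = p t"
    using cls_eq_iff[OF yd(4) p] by (simp add: Yl P_def)
  then have "AE t in lborel. t \<in> {0..T} \<longrightarrow> ul t \<in> subdiff H f (yy t)"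
    by eventually_elim (use qs in \<open>force simp: q_def\<close>)
  moreover have "norm Dl \<le> norm G" by (rule wconv_norm_le[OF wD]) (use Dbd in simp)
  then have "L2_norm T (weak_deriv T H yy) \<le> L2_norm T g"
    by (simp add: cls_norm[OF yd(3), symmetric] cls_norm[OF g, symmetric] Dl G_def)
  ultimately show ?thesis using yW unfolding ul_def by blast
qed

section \<open>The periodic operator and the forward-backward step\<close>

text \<open>The operator lives on classes, where weak limits are taken; a continuous periodic
  representative is recovered only from membership in the graph.\<close>

definition periodic_op :: "real \<Rightarrow> 'a::{real_inner, banach} set \<Rightarrow> ('a \<Rightarrow> ereal) \<Rightarrow> ('a L2 \<times> 'a L2) set" where
  "periodic_op T H f = {(cls T y, cls T (weak_deriv T H y) + cls T u) | y u.
     y \<in> W_per T H \<and> u \<in> Lp 2 T H \<and> (AE t in lborel. t \<in> {0..T} \<longrightarrow> u t \<in> subdiff H f (y t))}"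

lemma W12_lincomb:
  assumes T: "0 < T" and H: "hilbert_subspace H" and x: "x \<in> W12 T H" and y: "y \<in> W12 T H"
  shows "(\<lambda>t. a *\<^sub>R x t + b *\<^sub>R y t) \<in> W12 T H"
    "cls T (weak_deriv T H (\<lambda>t. a *\<^sub>R x t + b *\<^sub>R y t)) = a *\<^sub>R cls T (weak_deriv T H x) + b *\<^sub>R cls T (weak_deriv T H y)"
proof -
  have sH: "subspace H" using H by (simp add: hilbert_subspace_def)
  note dx = W12_weak_deriv[OF T H x] and dy = W12_weak_deriv[OF T H y]
  let ?z = "\<lambda>t. a *\<^sub>R x t + b *\<^sub>R y t" and ?v = "\<lambda>t. a *\<^sub>R weak_deriv T H x t + b *\<^sub>R weak_deriv T H y t"
  have w: "has_weak_deriv T H ?z ?v" by (rule has_weak_deriv_lincomb[OF T H dx(1) dy(1)])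
  have z: "?z \<in> Lp 2 T H" by (intro Lp2_add Lp2_scaleR sH dx dy)
  have v: "?v \<in> Lp 2 T H" by (intro Lp2_add Lp2_scaleR sH dx dy)
  show zW: "?z \<in> W12 T H" by (rule W12I[OF z v w])
  have "cls T (weak_deriv T H ?z) = cls T ?v"
    unfolding cls_eq_iff[OF W12_weak_deriv(2)[OF T H zW] v] by (rule weak_deriv_AE[OF T H w])
  then show "cls T (weak_deriv T H ?z) = a *\<^sub>R cls T (weak_deriv T H x) + b *\<^sub>R cls T (weak_deriv T H y)"
    by (simp add: cls_add[OF Lp2_scaleR[OF sH dx(2)] Lp2_scaleR[OF sH dy(2)]] cls_scaleR[OF dx(2)] cls_scaleR[OF dy(2)])
qed

lemma W_per_lincomb:
  assumes T: "0 < T" and H: "hilbert_subspace H" and x: "x \<in> W_per T H" and y: "y \<in> W_per T H"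
  shows "(\<lambda>t. a *\<^sub>R x t + b *\<^sub>R y t) \<in> W_per T H"
    "cls T (weak_deriv T H (\<lambda>t. a *\<^sub>R x t + b *\<^sub>R y t)) = a *\<^sub>R cls T (weak_deriv T H x) + b *\<^sub>R cls T (weak_deriv T H y)"
proof -
  have W: "x \<in> W12 T H" "y \<in> W12 T H" using x y by (auto simp: W_per_def)
  show "(\<lambda>t. a *\<^sub>R x t + b *\<^sub>R y t) \<in> W_per T H"
    using W12_lincomb(1)[OF T H W] x y by (auto simp: W_per_def intro!: continuous_intros)
  show "cls T (weak_deriv T H (\<lambda>t. a *\<^sub>R x t + b *\<^sub>R y t)) = a *\<^sub>R cls T (weak_deriv T H x) + b *\<^sub>R cls T (weak_deriv T H y)"
    by (rule W12_lincomb(2)[OF T H W])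
qed

text \<open>The difference of two periodic functions is periodic, so its derivative contributes
  nothing by \<open>W_per_energy\<close>; what remains is the pointwise monotonicity of the
  subdifferential.\<close>

lemma periodic_op_monotone:
  assumes T: "0 < T" and H: "hilbert_subspace H" and f: "f \<in> Gamma0 H"
    and "(X, U) \<in> periodic_op T H f" "(Y, V) \<in> periodic_op T H f"
  shows "0 \<le> (U - V) \<bullet> (X - Y)"
proof -
  have sH: "subspace H" using H by (simp add: hilbert_subspace_def)
  obtain x u where x: "x \<in> W_per T H" "u \<in> Lp 2 T H" "AE t in lborel. t \<in> {0..T} \<longrightarrow> u t \<in> subdiff H f (x t)"
    and X: "X = cls T x" "U = cls T (weak_deriv T H x) + cls T u"
    using assms(4) by (auto simp: periodic_op_def)
  obtain y v where y: "y \<in> W_per T H" "v \<in> Lp 2 T H" "AE t in lborel. t \<in> {0..T} \<longrightarrow> v t \<in> subdiff H f (y t)"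
    and Y: "Y = cls T y" "V = cls T (weak_deriv T H y) + cls T v"
    using assms(5) by (auto simp: periodic_op_def)
  note dx = W_perD[OF T H x(1)] and dy = W_perD[OF T H y(1)]
  let ?z = "\<lambda>t. 1 *\<^sub>R x t + (-1) *\<^sub>R y t"
  note z = W_per_lincomb[OF T H x(1) y(1), of 1 "-1"]
  note dz = W_perD[OF T H z(1)]
  have "cls T (weak_deriv T H ?z) \<bullet> cls T ?z = 0"
    unfolding cls_inner[OF dz(3,4)] by (rule W_per_energy[OF T H z(1)])
  moreover have "cls T ?z = X - Y" using cls_diff[OF dx(4) dy(4)] by (simp add: X Y)
  ultimately have "(cls T (weak_deriv T H x) - cls T (weak_deriv T H y)) \<bullet> (X - Y) = 0" using z(2) by simp
  moreover have "0 \<le> (cls T u - cls T v) \<bullet> (X - Y)"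
    unfolding X Y by (rule cls_subdiff_monotone[OF f dx(4) dy(4) x(2) y(2) sH x(3) y(3)])
  ultimately show ?thesis by (simp add: X Y inner_add_left inner_diff_left)
qed

lemma periodic_op_solve:
  assumes T: "0 < T" and H: "hilbert_subspace H" and f: "f \<in> Gamma0 H" and \<gamma>: "0 < \<gamma>" and g: "g \<in> Lp 2 T H"
  shows "\<exists>y\<in>W_per T H. (AE t in lborel. t \<in> {0..T} \<longrightarrow> g t - (1 / \<gamma>) *\<^sub>R y t - weak_deriv T H y t \<in> subdiff H f (y t)) \<and>
    (cls T y, cls T g - (1 / \<gamma>) *\<^sub>R cls T y) \<in> periodic_op T H f \<and> norm (cls T (weak_deriv T H y)) \<le> norm (cls T g)"
proof -
  have sH: "subspace H" using H by (simp add: hilbert_subspace_def)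
  obtain y where y: "y \<in> W_per T H" "AE t in lborel. t \<in> {0..T} \<longrightarrow> g t - (1 / \<gamma>) *\<^sub>R y t - weak_deriv T H y t \<in> subdiff H f (y t)"
    "L2_norm T (weak_deriv T H y) \<le> L2_norm T g"
    using periodic_solution_exists[OF T H f \<gamma> g] by blast
  note d = W_perD[OF T H y(1)]
  define u where "u = (\<lambda>t. g t - (1 / \<gamma>) *\<^sub>R y t - weak_deriv T H y t)"
  have u: "u \<in> Lp 2 T H" unfolding u_def by (intro Lp2_diff Lp2_scaleR sH g d)
  have "cls T u = cls T g - (1 / \<gamma>) *\<^sub>R cls T y - cls T (weak_deriv T H y)"
    unfolding u_def cls_diff[OF Lp2_diff[OF sH g Lp2_scaleR[OF sH d(4)]] d(3)] cls_diff[OF g Lp2_scaleR[OF sH d(4)]] cls_scaleR[OF d(4)] ..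
  then have "cls T g - (1 / \<gamma>) *\<^sub>R cls T y = cls T (weak_deriv T H y) + cls T u" by simp
  then have "(cls T y, cls T g - (1 / \<gamma>) *\<^sub>R cls T y) \<in> periodic_op T H f"
    unfolding periodic_op_def using y(1,2) u by (auto simp: u_def)
  then show ?thesis using y by (auto simp: cls_norm[OF d(3)] cls_norm[OF g])
qed

text \<open>Solving the inclusion at \<open>x + u\<close> with parameter 1 gives a pair
  \<open>(p, q)\<close> in the graph with \<open>p + q = x + u\<close>. Monotonicity against it
  passes to the limit, because each product pairs a weak with a strong limit, and becomes
  \<open>(x - p) \<bullet> (x - p) \<le> 0\<close>.\<close>

lemma periodic_op_weakly_closed:
  assumes T: "0 < T" and H: "hilbert_subspace H" and f: "f \<in> Gamma0 H"
    and g: "\<And>n. (X n, U n) \<in> periodic_op T H f" and X: "wconv X x" "\<And>n. norm (X n) \<le> C" and U: "U \<longlonglongrightarrow> u"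
    and xu: "x \<in> cls T ` Lp 2 T H" "u \<in> cls T ` Lp 2 T H"
  shows "(x, u) \<in> periodic_op T H f"
proof -
  have sH: "subspace H" using H by (simp add: hilbert_subspace_def)
  obtain x' u' where xu': "x' \<in> Lp 2 T H" "x = cls T x'" "u' \<in> Lp 2 T H" "u = cls T u'" using xu by blast
  have "(\<lambda>t. x' t + u' t) \<in> Lp 2 T H" by (intro Lp2_add sH xu')
  from periodic_op_solve[OF T H f zero_less_one this] obtain y where
    y: "(cls T y, (x + u) - cls T y) \<in> periodic_op T H f"
    by (auto simp: xu' cls_add[OF xu'(1,3)])
  define p where "p = cls T y"
  define q where "q = x + u - p"
  have nn: "0 \<le> X n \<bullet> (U n - q) - p \<bullet> (U n - q)" for n
  proof -
    have "0 \<le> (U n - q) \<bullet> (X n - p)"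
      using periodic_op_monotone[OF T H f g[of n] y] by (simp add: p_def q_def)
    also have "\<dots> = (X n - p) \<bullet> (U n - q)" by (rule inner_commute)
    also have "\<dots> = X n \<bullet> (U n - q) - p \<bullet> (U n - q)" by (rule inner_diff_left)
    finally show ?thesis .
  qed
  have "(\<lambda>n. X n \<bullet> (U n - q) - p \<bullet> (U n - q)) \<longlonglongrightarrow> x \<bullet> (u - q) - p \<bullet> (u - q)"
    by (intro tendsto_diff wconv_inner_strong[OF X] tendsto_inner U tendsto_const)
  then have "0 \<le> x \<bullet> (u - q) - p \<bullet> (u - q)"
    by (rule LIMSEQ_le_const) (use nn in blast)
  also have "\<dots> = (x - p) \<bullet> (u - q)" by (rule inner_diff_left[symmetric])
  also have "u - q = - (x - p)" by (simp add: q_def)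
  finally have "(x - p) \<bullet> (x - p) \<le> 0" by (simp only: inner_minus_right neg_0_le_iff_le)
  then have "x = p" by (metis inner_gt_zero_iff not_less right_minus_eq)
  then show ?thesis using y by (simp add: p_def)
qed

section \<open>The inclusions as statements about classes\<close>

lemma AE_interior_iff:
  fixes T :: real
  shows "(AE t in lborel. t \<in> {0<..<T} \<longrightarrow> P t) \<longleftrightarrow> (AE t in lborel. t \<in> {0..T} \<longrightarrow> P t)"
proof
  assume "AE t in lborel. t \<in> {0<..<T} \<longrightarrow> P t"
  with AE_lborel_singleton[of 0] AE_lborel_singleton[of T]
  show "AE t in lborel. t \<in> {0..T} \<longrightarrow> P t" by eventually_elim auto
next
  assume "AE t in lborel. t \<in> {0..T} \<longrightarrow> P t"
  then show "AE t in lborel. t \<in> {0<..<T} \<longrightarrow> P t" by eventually_elim auto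
qed

lemma solves_step_iff:
  assumes T: "0 < T"
  shows "solves_step T H f \<gamma> x w e y \<longleftrightarrow> y \<in> W_per T H \<and>
    (AE t in lborel. t \<in> {0..T} \<longrightarrow> (1 / \<gamma>) *\<^sub>R (x t - y t) - w t - e t - weak_deriv T H y t \<in> subdiff H f (y t))"
proof -
  have eq: "(1 / \<gamma>) *\<^sub>R (x t - y t) - w t \<in> (\<lambda>u. weak_deriv T H y t + u + e t) ` subdiff H f (y t) \<longleftrightarrow>
      (1 / \<gamma>) *\<^sub>R (x t - y t) - w t - e t - weak_deriv T H y t \<in> subdiff H f (y t)" for t
    by (auto simp: image_iff algebra_simps) (metis add.commute add_diff_cancel_left' diff_add_cancel diff_diff_eq2)+
  show ?thesis unfolding solves_step_def eq AE_interior_iff ..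
qed

lemma solves_step_periodic_op:
  assumes T: "0 < T" and H: "hilbert_subspace H" and x: "x \<in> Lp 2 T H" and w: "w \<in> Lp 2 T H" and e: "e \<in> Lp 2 T H"
    and y: "solves_step T H f \<gamma> x w e y"
  shows "(cls T y, (1 / \<gamma>) *\<^sub>R (cls T x - cls T y) - cls T w - cls T e) \<in> periodic_op T H f"
proof -
  have sH: "subspace H" using H by (simp add: hilbert_subspace_def)
  have yW: "y \<in> W_per T H" and s: "AE t in lborel. t \<in> {0..T} \<longrightarrow> (1 / \<gamma>) *\<^sub>R (x t - y t) - w t - e t - weak_deriv T H y t \<in> subdiff H f (y t)"
    using y by (auto simp: solves_step_iff[OF T])
  note d = W_perD[OF T H yW]
  define u where "u = (\<lambda>t. (1 / \<gamma>) *\<^sub>R (x t - y t) - w t - e t - weak_deriv T H y t)"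
  have 1: "(\<lambda>t. (1 / \<gamma>) *\<^sub>R (x t - y t)) \<in> Lp 2 T H" by (intro Lp2_diff Lp2_scaleR sH x d)
  have 2: "(\<lambda>t. (1 / \<gamma>) *\<^sub>R (x t - y t) - w t) \<in> Lp 2 T H" by (rule Lp2_diff[OF sH 1 w])
  have 3: "(\<lambda>t. (1 / \<gamma>) *\<^sub>R (x t - y t) - w t - e t) \<in> Lp 2 T H" by (rule Lp2_diff[OF sH 2 e])
  have u: "u \<in> Lp 2 T H" unfolding u_def by (rule Lp2_diff[OF sH 3 d(3)])
  have "cls T u = (1 / \<gamma>) *\<^sub>R (cls T x - cls T y) - cls T w - cls T e - cls T (weak_deriv T H y)"
    unfolding u_def cls_diff[OF 3 d(3)] cls_diff[OF 2 e] cls_diff[OF 1 w] cls_scaleR[OF Lp2_diff[OF sH x d(4)]] cls_diff[OF x d(4)] ..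
  then have "(1 / \<gamma>) *\<^sub>R (cls T x - cls T y) - cls T w - cls T e = cls T (weak_deriv T H y) + cls T u" by simp
  then show ?thesis unfolding periodic_op_def using yW u s by (auto simp: u_def)
qed

text \<open>For two solutions the second components in the graph differ by
  \<open>- (1 / \<gamma>)\<close> times the difference of the first, so monotonicity makes the
  classes equal; continuity then gives equality at every point. The derivative bound comes with the
  existence proof.\<close>

lemma step_exists_unique:
  assumes T: "0 < T" and H: "hilbert_subspace H" and f: "f \<in> Gamma0 H" and \<gamma>: "0 < \<gamma>"
    and x: "x \<in> Lp 2 T H" and w: "w \<in> Lp 2 T H" and e: "e \<in> Lp 2 T H"
  shows "\<exists>y. is_unique_step T H f \<gamma> x w e y \<and> norm (cls T (weak_deriv T H y)) \<le> norm ((1 / \<gamma>) *\<^sub>R cls T x - cls T w - cls T e)"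
proof -
  have sH: "subspace H" using H by (simp add: hilbert_subspace_def)
  define g where "g = (\<lambda>t. (1 / \<gamma>) *\<^sub>R x t - w t - e t)"
  have 1: "(\<lambda>t. (1 / \<gamma>) *\<^sub>R x t) \<in> Lp 2 T H" by (intro Lp2_scaleR sH x)
  have 2: "(\<lambda>t. (1 / \<gamma>) *\<^sub>R x t - w t) \<in> Lp 2 T H" by (rule Lp2_diff[OF sH 1 w])
  have g: "g \<in> Lp 2 T H" unfolding g_def by (rule Lp2_diff[OF sH 2 e])
  have gc: "cls T g = (1 / \<gamma>) *\<^sub>R cls T x - cls T w - cls T e"
    unfolding g_def cls_diff[OF 2 e] cls_diff[OF 1 w] cls_scaleR[OF x] ..
  obtain y where y: "y \<in> W_per T H" "AE t in lborel. t \<in> {0..T} \<longrightarrow> g t - (1 / \<gamma>) *\<^sub>R y t - weak_deriv T H y t \<in> subdiff H f (y t)"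
    "norm (cls T (weak_deriv T H y)) \<le> norm (cls T g)"
    using periodic_op_solve[OF T H f \<gamma> g] by blast
  have sy: "solves_step T H f \<gamma> x w e y"
    unfolding solves_step_iff[OF T] using y(1,2) by (simp add: g_def algebra_simps)
  have "z t = y t" if z: "solves_step T H f \<gamma> x w e z" and t: "t \<in> {0..T}" for z t
  proof -
    have zW: "z \<in> W_per T H" using z by (simp add: solves_step_def)
    note dy = W_perD[OF T H y(1)] and dz = W_perD[OF T H zW]
    have "0 \<le> (((1 / \<gamma>) *\<^sub>R (cls T x - cls T z) - cls T w - cls T e) - ((1 / \<gamma>) *\<^sub>R (cls T x - cls T y) - cls T w - cls T e)) \<bullet> (cls T z - cls T y)"
      by (rule periodic_op_monotone[OF T H f solves_step_periodic_op[OF T H x w e z] solves_step_periodic_op[OF T H x w e sy]])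
    also have "\<dots> = - (1 / \<gamma>) * ((cls T z - cls T y) \<bullet> (cls T z - cls T y))"
    proof -
      have "((1 / \<gamma>) *\<^sub>R (cls T x - cls T z) - cls T w - cls T e) - ((1 / \<gamma>) *\<^sub>R (cls T x - cls T y) - cls T w - cls T e)
        = (- (1 / \<gamma>)) *\<^sub>R (cls T z - cls T y)" by (simp add: algebra_simps)
      then show ?thesis by (simp only: inner_scaleR_left)
    qed
    finally have "(cls T z - cls T y) \<bullet> (cls T z - cls T y) \<le> 0" using \<gamma> by (simp add: divide_le_0_iff)
    then have "cls T z = cls T y" by (metis inner_gt_zero_iff not_less right_minus_eq)
    then have "AE t in lborel. t \<in> {0..T} \<longrightarrow> z t - y t = 0" unfolding cls_eq_iff[OF dz(4) dy(4)] by eventually_elim simp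
    then have "z t - y t = 0" by (rule continuous_AE_zero[OF _ _ T t]) (intro continuous_intros dy dz)
    then show ?thesis by simp
  qed
  then have "is_unique_step T H f \<gamma> x w e y" using sy unfolding is_unique_step_def by blast
  then show ?thesis using y(3) unfolding gc by blast
qed

lemma solves_P_iff:
  assumes T: "0 < T"
  shows "solves_P m T H f B x \<longleftrightarrow> (\<forall>i\<in>{1..m}. x i \<in> W_per T (H i) \<and>
    (AE t in lborel. t \<in> {0..T} \<longrightarrow> - B i (\<lambda>j\<in>{1..m}. x j t) - weak_deriv T (H i) (x i) t \<in> subdiff (H i) (f i) (x i t)))"
proof -
  have eq: "0 \<in> (\<lambda>u. v + u + b) ` S \<longleftrightarrow> - b - v \<in> S" for v b :: 'a and S
  proof
    assume "0 \<in> (\<lambda>u. v + u + b) ` S"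
    then obtain u where "u \<in> S" "0 = v + u + b" by blast
    moreover then have "u = - b - v" by (metis add.commute add_diff_cancel_left' diff_0 diff_add_eq_diff_diff_swap)
    ultimately show "- b - v \<in> S" by simp
  next
    assume "- b - v \<in> S"
    then show "0 \<in> (\<lambda>u. v + u + b) ` S" by (intro image_eqI[of _ _ "- b - v"]) auto
  qed
  show ?thesis unfolding solves_P_def eq AE_interior_iff by blast
qed

section \<open>Quasi-Fejer sequences and the abstract forward-backward step\<close>

lemma quasi_Fejer_bound:
  fixes s p q :: "nat \<Rightarrow> real"
  assumes nn: "\<And>n. 0 \<le> s n" "\<And>n. 0 \<le> p n" "\<And>n. 0 \<le> q n"
    and step: "\<And>n. s (Suc n) \<le> (1 + p n) * s n + q n"
  shows "s n \<le> exp (\<Sum>k<n. p k) * (s 0 + (\<Sum>k<n. q k))"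
proof (induction n)
  case (Suc n)
  let ?P = "\<Sum>k<n. p k" and ?Q = "\<Sum>k<n. q k"
  have Q: "0 \<le> s 0 + ?Q" using nn by (simp add: sum_nonneg)
  have "s (Suc n) \<le> (1 + p n) * s n + q n" by (rule step)
  also have "\<dots> \<le> exp (p n) * (exp ?P * (s 0 + ?Q)) + exp (?P + p n) * q n"
  proof (rule add_mono)
    show "(1 + p n) * s n \<le> exp (p n) * (exp ?P * (s 0 + ?Q))"
      using Suc nn[of n] exp_ge_add_one_self[of "p n"] by (intro mult_mono) auto
    have "1 \<le> exp (?P + p n)" using nn by (simp add: sum_nonneg)
    then show "q n \<le> exp (?P + p n) * q n" using nn(3)[of n] mult_right_mono by fastforce
  qed
  also have "\<dots> = exp (\<Sum>k<Suc n. p k) * (s 0 + (\<Sum>k<Suc n. q k))"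
    by (simp add: exp_add algebra_simps)
  finally show ?case .
qed simp

text \<open>The discrete Gronwall estimate \<open>quasi_Fejer_bound\<close> makes \<open>s\<close>
  bounded, so the multiplicative perturbation turns into a summable additive one. Subtracting the
  accumulated perturbations leaves a decreasing sequence that is bounded below.\<close>

lemma quasi_Fejer:
  fixes s p q r :: "nat \<Rightarrow> real"
  assumes nn: "\<And>n. 0 \<le> s n" "\<And>n. 0 \<le> p n" "\<And>n. 0 \<le> q n" "\<And>n. 0 \<le> r n"
    and sm: "summable p" "summable q"
    and step: "\<And>n. s (Suc n) \<le> (1 + p n) * s n + q n - r n"
  shows "convergent s" "summable r"
proof -
  define M where "M = exp (suminf p) * (s 0 + suminf q)"
  have sM: "s n \<le> M" for n
  proof -
    have "s n \<le> exp (\<Sum>k<n. p k) * (s 0 + (\<Sum>k<n. q k))"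
    proof (rule quasi_Fejer_bound[OF nn(1-3)])
      show "s (Suc n) \<le> (1 + p n) * s n + q n" for n using step[of n] nn(4)[of n] by linarith
    qed
    also have "\<dots> \<le> M" unfolding M_def
      using sum_le_suminf[OF sm(1), of "{..<n}"] sum_le_suminf[OF sm(2), of "{..<n}"] nn
      by (intro mult_mono) (auto simp: sum_nonneg)
    finally show ?thesis .
  qed
  define c where "c = (\<lambda>n. p n * M + q n)"
  have c: "summable c" unfolding c_def by (intro summable_add summable_mult2 sm)
  have M0: "0 \<le> M" using sM[of 0] nn(1)[of 0] by linarith
  have cn: "0 \<le> c n" for n using nn M0 by (simp add: c_def)
  have st: "s (Suc n) + r n \<le> s n + c n" for n
    using step[of n] mult_left_mono[OF sM[of n] nn(2)[of n]] by (simp add: c_def algebra_simps)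
  have tot: "s n + (\<Sum>k<n. r k) \<le> s 0 + (\<Sum>k<n. c k)" for n
  proof (induction n)
    case (Suc n)
    then show ?case using st[of n] by simp
  qed simp
  show "summable r"
  proof (rule summableI_nonneg_bounded[where x="s 0 + suminf c"])
    show "(\<Sum>k<n. r k) \<le> s 0 + suminf c" for n
      using tot[of n] nn(1)[of n] sum_le_suminf[OF c, of "{..<n}"] cn by force
  qed (rule nn(4))
  define t where "t = (\<lambda>n. s n - (\<Sum>k<n. c k))"
  have "decseq t" unfolding decseq_Suc_iff t_def
  proof
    fix n show "s (Suc n) - (\<Sum>k<Suc n. c k) \<le> s n - (\<Sum>k<n. c k)" using st[of n] nn(4)[of n] by simp
  qed
  moreover have "- suminf c \<le> t n" for n
    using nn(1)[of n] sum_le_suminf[OF c, of "{..<n}"] cn by (force simp: t_def)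
  ultimately obtain l where "t \<longlonglongrightarrow> l" using decseq_convergent by blast
  then have "(\<lambda>n. t n + (\<Sum>k<n. c k)) \<longlonglongrightarrow> l + suminf c" by (intro tendsto_add summable_LIMSEQ c)
  then show "convergent s" by (auto simp: t_def convergent_def)
qed

text \<open>Testing monotonicity at \<open>(Y, Z)\<close> directly with the inexact forward value avoids a comparison
  with an error-free step.\<close>

lemma forward_backward_step:
  fixes X Y Z V W E :: "'i \<Rightarrow> 'h::real_inner"
  assumes I: "finite I" and \<gamma>: "0 < \<gamma>" "\<gamma> \<le> 2 * \<beta>"
    and mono: "\<And>i. i \<in> I \<Longrightarrow> 0 \<le> ((1 / \<gamma>) *\<^sub>R (X i - Y i) - V i - E i + W i) \<bullet> (Y i - Z i)"
    and coco: "\<beta> * (\<Sum>i\<in>I. (norm (V i - W i))\<^sup>2) \<le> (\<Sum>i\<in>I. (V i - W i) \<bullet> (X i - Z i))"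
    and E: "\<And>i. i \<in> I \<Longrightarrow> norm (E i) \<le> \<eta>" "0 \<le> \<eta>"
  defines "R \<equiv> (\<Sum>i\<in>I. (norm ((X i - Y i) - \<gamma> *\<^sub>R (V i - W i)))\<^sup>2) + \<gamma> * (2 * \<beta> - \<gamma>) * (\<Sum>i\<in>I. (norm (V i - W i))\<^sup>2)"
  defines "\<kappa> \<equiv> 4 * \<beta> * \<eta> * real (card I)"
  shows "(\<Sum>i\<in>I. (norm (Y i - Z i))\<^sup>2) \<le> (\<Sum>i\<in>I. (norm (X i - Z i))\<^sup>2) - R + \<kappa> * sqrt (\<Sum>i\<in>I. (norm (Y i - Z i))\<^sup>2)"
proof -
  let ?a = "sqrt (\<Sum>i\<in>I. (norm (Y i - Z i))\<^sup>2)"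
  have each: "(norm (Y i - Z i))\<^sup>2 \<le> (norm (X i - Z i))\<^sup>2 - (norm ((X i - Y i) - \<gamma> *\<^sub>R (V i - W i)))\<^sup>2
      + \<gamma>\<^sup>2 * (norm (V i - W i))\<^sup>2 - 2 * \<gamma> * ((V i - W i) \<bullet> (X i - Z i)) + 4 * \<beta> * \<eta> * ?a" if i: "i \<in> I" for i
  proof -
    define D y v where "D = X i - Y i" and "y = Y i - Z i" and "v = V i - W i"
    have XZ: "X i - Z i = D + y" by (simp add: D_def y_def)
    have "0 \<le> ((1 / \<gamma>) *\<^sub>R D - v - E i) \<bullet> y" using mono[OF i] by (simp add: D_def y_def v_def algebra_simps)
    then have "0 \<le> \<gamma> * (((1 / \<gamma>) *\<^sub>R D - v - E i) \<bullet> y)" using \<gamma> by (intro mult_nonneg_nonneg) auto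
    then have 1: "0 \<le> D \<bullet> y - \<gamma> * (v \<bullet> y) - \<gamma> * (E i \<bullet> y)" using \<gamma> by (simp add: inner_diff_left algebra_simps)
    have "norm y \<le> ?a"
      unfolding y_def by (rule real_le_rsqrt) (rule member_le_sum[OF i], auto simp: I)
    then have "\<bar>E i \<bullet> y\<bar> \<le> \<eta> * ?a"
      using Cauchy_Schwarz_ineq2[of "E i" y] E(1)[OF i] E(2) by (meson mult_mono norm_ge_zero order_trans)
    then have "- (\<gamma> * (E i \<bullet> y)) \<le> \<gamma> * (\<eta> * ?a)" using \<gamma> by (smt (verit) mult_left_mono mult_minus_right)
    \<comment> \<open>Bounding \<open>\<gamma>\<close> by \<open>2 * \<beta>\<close> frees
      \<open>\<kappa>\<close> from the step size.\<close>
    also have "\<dots> \<le> 2 * \<beta> * (\<eta> * ?a)" using \<gamma> E(2) by (intro mult_right_mono mult_nonneg_nonneg) (auto simp: sum_nonneg)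
    finally have 2: "- (2 * \<gamma> * (E i \<bullet> y)) \<le> 4 * \<beta> * \<eta> * ?a" by simp
    have 3: "(norm (D + y))\<^sup>2 = (norm D)\<^sup>2 + 2 * (D \<bullet> y) + (norm y)\<^sup>2"
      using norm_add_scale_sq[of D 1 y] by simp
    have 4: "(norm (D - \<gamma> *\<^sub>R v))\<^sup>2 = (norm D)\<^sup>2 - 2 * \<gamma> * (v \<bullet> D) + \<gamma>\<^sup>2 * (norm v)\<^sup>2"
      using norm_add_scale_sq[of D "- \<gamma>" v] by (simp add: inner_commute)
    have 5: "v \<bullet> (D + y) = v \<bullet> D + v \<bullet> y" by (rule inner_add_right)
    have "(norm y)\<^sup>2 \<le> (norm (D + y))\<^sup>2 - (norm (D - \<gamma> *\<^sub>R v))\<^sup>2 + \<gamma>\<^sup>2 * (norm v)\<^sup>2 - 2 * \<gamma> * (v \<bullet> (D + y)) + 4 * \<beta> * \<eta> * ?a"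
    proof -
      have "2 * \<gamma> * (v \<bullet> D + v \<bullet> y) = 2 * \<gamma> * (v \<bullet> D) + 2 * (\<gamma> * (v \<bullet> y))" by (simp add: distrib_left)
      moreover have "2 * \<gamma> * (E i \<bullet> y) = 2 * (\<gamma> * (E i \<bullet> y))" by simp
      ultimately show ?thesis unfolding 3 4 5 using 1 2 by linarith
    qed
    then show ?thesis unfolding XZ by (simp only: D_def y_def v_def)
  qed
  have "(\<Sum>i\<in>I. (norm (Y i - Z i))\<^sup>2) \<le> (\<Sum>i\<in>I. (norm (X i - Z i))\<^sup>2 - (norm ((X i - Y i) - \<gamma> *\<^sub>R (V i - W i)))\<^sup>2
      + \<gamma>\<^sup>2 * (norm (V i - W i))\<^sup>2 - 2 * \<gamma> * ((V i - W i) \<bullet> (X i - Z i)) + 4 * \<beta> * \<eta> * ?a)"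
    by (intro sum_mono each)
  also have "\<dots> = (\<Sum>i\<in>I. (norm (X i - Z i))\<^sup>2) - (\<Sum>i\<in>I. (norm ((X i - Y i) - \<gamma> *\<^sub>R (V i - W i)))\<^sup>2)
      + \<gamma>\<^sup>2 * (\<Sum>i\<in>I. (norm (V i - W i))\<^sup>2) - 2 * \<gamma> * (\<Sum>i\<in>I. (V i - W i) \<bullet> (X i - Z i)) + \<kappa> * ?a"
    by (simp add: sum.distrib sum_subtractf sum_distrib_left \<kappa>_def)
  also have "\<dots> \<le> (\<Sum>i\<in>I. (norm (X i - Z i))\<^sup>2) - R + \<kappa> * ?a"
  proof -
    have "2 * \<gamma> * (\<beta> * (\<Sum>i\<in>I. (norm (V i - W i))\<^sup>2)) \<le> 2 * \<gamma> * (\<Sum>i\<in>I. (V i - W i) \<bullet> (X i - Z i))"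
      using \<gamma> by (intro mult_left_mono coco) auto
    then show ?thesis unfolding R_def by (simp add: power2_eq_square algebra_simps)
  qed
  finally show ?thesis .
qed

text \<open>Makes an estimate explicit in which \<open>a\<close> occurs on both sides: if
  \<open>a\<close> exceeded \<open>x + \<kappa>\<close>, then \<open>a * (a - \<kappa>)\<close>
  would exceed \<open>x^2\<close>.\<close>

lemma quadratic_bound:
  fixes a x \<kappa> :: real
  assumes "a\<^sup>2 \<le> x\<^sup>2 + \<kappa> * a" "0 \<le> a" "0 \<le> x" "0 \<le> \<kappa>"
  shows "a \<le> x + \<kappa>"
proof (rule ccontr)
  assume "\<not> a \<le> x + \<kappa>"
  then have "x * x \<le> x * (a - \<kappa>)" "x * (a - \<kappa>) \<le> a * (a - \<kappa>)" "a - \<kappa> > x" using assms by (auto intro!: mult_left_mono mult_right_mono)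
  moreover have "x * (a - \<kappa>) < a * (a - \<kappa>)" using \<open>a - \<kappa> > x\<close> assms \<open>\<not> a \<le> x + \<kappa>\<close>
    by (intro mult_strict_right_mono) auto
  ultimately show False using assms(1) by (simp add: power2_eq_square algebra_simps)
qed

lemma relaxation_step:
  fixes X Y Z :: "'h::real_inner"
  assumes "0 \<le> \<mu>" "\<mu> \<le> 1"
  shows "(norm (\<mu> *\<^sub>R X + (1 - \<mu>) *\<^sub>R Y - Z))\<^sup>2 \<le> \<mu> * (norm (X - Z))\<^sup>2 + (1 - \<mu>) * (norm (Y - Z))\<^sup>2"
proof -
  define a b where "a = X - Z" and "b = Y - Z"
  have e: "\<mu> *\<^sub>R X + (1 - \<mu>) *\<^sub>R Y - Z = \<mu> *\<^sub>R a + (1 - \<mu>) *\<^sub>R b" by (simp add: a_def b_def algebra_simps)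
  have "0 \<le> \<mu> * (1 - \<mu>) * (norm (a - b))\<^sup>2" using assms by simp
  moreover have "(norm (\<mu> *\<^sub>R a + (1 - \<mu>) *\<^sub>R b))\<^sup>2 = \<mu> * (norm a)\<^sup>2 + (1 - \<mu>) * (norm b)\<^sup>2 - \<mu> * (1 - \<mu>) * (norm (a - b))\<^sup>2"
    unfolding power2_norm_eq_inner by (simp add: inner_add_left inner_add_right inner_diff_left inner_diff_right inner_commute algebra_simps)
  ultimately show ?thesis unfolding e by (simp add: a_def b_def)
qed

text \<open>One index after the other, the subsequence is refined; weak limits found earlier survive
  the refinement.\<close>

lemma weak_compactness_family:
  fixes X :: "'i \<Rightarrow> nat \<Rightarrow> 'h::{real_inner, banach}"
  assumes "finite I" "\<And>i n. i \<in> I \<Longrightarrow> norm (X i n) \<le> C"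
  shows "\<exists>r l. strict_mono r \<and> (\<forall>i\<in>I. wconv (X i \<circ> r) (l i))"
  using assms
proof (induction I rule: finite_induct)
  case empty
  show ?case by (intro exI[of _ id]) (simp add: strict_mono_def)
next
  case (insert j I)
  have "\<exists>r l. strict_mono r \<and> (\<forall>i\<in>I. wconv (X i \<circ> r) (l i))"
    by (rule insert.IH) (use insert.prems in auto)
  then obtain r l where r: "strict_mono r" "\<And>i. i \<in> I \<Longrightarrow> wconv (X i \<circ> r) (l i)" by blast
  obtain s k where s: "strict_mono s" "wconv ((X j \<circ> r) \<circ> s) k"
    using weak_compactness[of "X j \<circ> r" C] insert.prems by auto
  have "wconv (X i \<circ> (r \<circ> s)) ((l(j := k)) i)" if "i \<in> insert j I" for i
    using that s(2) wconv_subseq[OF r(2) s(1), of i] insert.hyps by (auto simp: comp_assoc)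
  then show ?case using strict_mono_o[OF r(1) s(1)] by blast
qed

section \<open>The coupled system\<close>

lemma tendsto_zero_of_norm_le:
  fixes F :: "nat \<Rightarrow> 'h::real_normed_vector"
  assumes "\<And>n. norm (F n) \<le> g n" "g \<longlonglongrightarrow> 0"
  shows "F \<longlonglongrightarrow> 0"
  by (rule Lim_null_comparison[OF always_eventually assms(2)]) (use assms(1) in blast)

lemma tendsto_zero_of_norm_square:
  fixes F :: "nat \<Rightarrow> 'h::real_normed_vector"
  assumes "(\<lambda>n. (norm (F n))\<^sup>2) \<longlonglongrightarrow> 0"
  shows "F \<longlonglongrightarrow> 0"
  using tendsto_real_sqrt[OF assms] by (simp add: tendsto_norm_zero_iff)

lemma summable_le_suminf:
  fixes \<kappa> :: "nat \<Rightarrow> real"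
  assumes "summable \<kappa>" "\<And>n. 0 \<le> \<kappa> n"
  shows "\<kappa> n \<le> suminf \<kappa>"
  using sum_le_suminf[OF assms(1), of "{n}"] assms(2) by simp

text \<open>Cocoercivity couples the components, so a step is controlled only in the sum over
  \<open>I\<close>, whereas each component has its own relaxation \<open>\<mu> i n\<close>.
  Replacing it by the common \<open>lam n\<close> costs the summable \<open>\<delta> n\<close>. The
  gain of a step is collected in \<open>R\<close>; the sequence \<open>(1 - lam n) * R n\<close> is
  summable and \<open>1 - lam n \<ge> \<epsilon>\<close>, so \<open>R\<close> tends to 0 and yields
  both strong limits.\<close>

lemma forward_backward_Fejer:
  fixes X Y V E :: "'i \<Rightarrow> nat \<Rightarrow> 'h::real_inner"
  assumes I: "finite I" and \<epsilon>: "0 < \<epsilon>" and \<beta>: "0 < \<beta>"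
    and \<gamma>: "\<And>n. \<epsilon> \<le> \<gamma> n" "\<And>n. \<gamma> n \<le> 2 * \<beta> - \<epsilon>" and lam: "\<And>n. 0 \<le> lam n" "\<And>n. lam n \<le> 1 - \<epsilon>"
    and \<mu>: "\<And>i n. i \<in> I \<Longrightarrow> 0 \<le> \<mu> i n" "\<And>i n. i \<in> I \<Longrightarrow> \<mu> i n \<le> 1"
    and sm: "\<And>i. i \<in> I \<Longrightarrow> summable (\<lambda>n. \<bar>\<mu> i n - lam n\<bar>)"
    and mono: "\<And>i n. i \<in> I \<Longrightarrow> 0 \<le> ((1 / \<gamma> n) *\<^sub>R (X i n - Y i n) - V i n - E i n + W i) \<bullet> (Y i n - Z i)"
    and coco: "\<And>n. \<beta> * (\<Sum>i\<in>I. (norm (V i n - W i))\<^sup>2) \<le> (\<Sum>i\<in>I. (V i n - W i) \<bullet> (X i n - Z i))"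
    and upd: "\<And>i n. i \<in> I \<Longrightarrow> X i (Suc n) = \<mu> i n *\<^sub>R X i n + (1 - \<mu> i n) *\<^sub>R Y i n"
    and E: "\<And>i n. i \<in> I \<Longrightarrow> norm (E i n) \<le> \<eta> n" "\<And>n. 0 \<le> \<eta> n" "summable \<eta>"
  shows "convergent (\<lambda>n. \<Sum>i\<in>I. (norm (X i n - Z i))\<^sup>2)"
    and "\<And>i. i \<in> I \<Longrightarrow> V i \<longlonglongrightarrow> W i"
    and "\<And>i. i \<in> I \<Longrightarrow> (\<lambda>n. X i n - Y i n) \<longlonglongrightarrow> 0"
proof -
  define s where "s = (\<lambda>n. \<Sum>i\<in>I. (norm (X i n - Z i))\<^sup>2)"
  define a where "a = (\<lambda>n. sqrt (\<Sum>i\<in>I. (norm (Y i n - Z i))\<^sup>2))"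
  define v where "v = (\<lambda>n. \<Sum>i\<in>I. (norm (V i n - W i))\<^sup>2)"
  define d where "d = (\<lambda>n. \<Sum>i\<in>I. (norm ((X i n - Y i n) - \<gamma> n *\<^sub>R (V i n - W i)))\<^sup>2)"
  define R where "R = (\<lambda>n. d n + \<gamma> n * (2 * \<beta> - \<gamma> n) * v n)"
  define \<kappa> where "\<kappa> = (\<lambda>n. 4 * \<beta> * \<eta> n * real (card I))"
  define \<delta> where "\<delta> = (\<lambda>n. \<Sum>i\<in>I. \<bar>\<mu> i n - lam n\<bar>)"
  have \<gamma>0: "0 < \<gamma> n" "\<gamma> n \<le> 2 * \<beta>" for n using \<gamma>[of n] \<epsilon> by auto
  have nn: "0 \<le> s n" "0 \<le> a n" "0 \<le> v n" "0 \<le> d n" "0 \<le> \<kappa> n" "0 \<le> \<delta> n" for n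
    using \<beta> E(2)[of n] by (auto simp: s_def a_def v_def d_def \<kappa>_def \<delta>_def sum_nonneg)
  have a2: "(a n)\<^sup>2 = (\<Sum>i\<in>I. (norm (Y i n - Z i))\<^sup>2)" for n by (simp add: a_def sum_nonneg)
  have \<gamma>2: "\<epsilon> * \<epsilon> \<le> \<gamma> n * (2 * \<beta> - \<gamma> n)" for n using \<gamma>[of n] \<epsilon> by (intro mult_mono) auto
  have vR: "\<epsilon> * \<epsilon> * v n \<le> R n" for n
    using mult_right_mono[OF \<gamma>2[of n] nn(3)[of n]] nn(4)[of n] by (simp add: R_def)
  have dR: "d n \<le> R n" for n
  proof -
    have "0 \<le> \<gamma> n * (2 * \<beta> - \<gamma> n)" using order_trans[OF _ \<gamma>2[of n], of 0] \<epsilon> by simp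
    then show ?thesis using nn(3)[of n] by (simp add: R_def)
  qed
  have R0: "0 \<le> R n" for n using dR[of n] nn(4)[of n] by linarith
  have fb: "(a n)\<^sup>2 \<le> s n - R n + \<kappa> n * a n" for n
    unfolding a2 unfolding a_def s_def R_def d_def v_def \<kappa>_def
    by (rule forward_backward_step[OF I \<gamma>0 mono coco E(1,2)])
  \<comment> \<open>In \<open>fb\<close> the quantity \<open>a n\<close> stands on both sides; the
    explicit bounds \<open>ab\<close> and \<open>a2b\<close> are what the recursion for
    \<open>s\<close> can use.\<close>
  have ab: "a n \<le> sqrt (s n) + \<kappa> n" for n
    by (rule quadratic_bound) (use fb[of n] R0[of n] nn in auto)
  have a2b: "(a n)\<^sup>2 \<le> 2 * s n + 2 * (\<kappa> n)\<^sup>2" for n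
  proof -
    have "(a n)\<^sup>2 \<le> (sqrt (s n) + \<kappa> n)\<^sup>2" by (intro power_mono ab nn)
    also have "\<dots> \<le> 2 * (sqrt (s n))\<^sup>2 + 2 * (\<kappa> n)\<^sup>2"
      using sum_squares_bound[of "sqrt (s n)" "\<kappa> n"] by (simp add: power2_sum)
    finally show ?thesis using nn(1) by simp
  qed
  have step: "s (Suc n) \<le> (1 + (\<kappa> n + 3 * \<delta> n)) * s n + (\<kappa> n + (\<kappa> n)\<^sup>2 + 2 * \<delta> n * (\<kappa> n)\<^sup>2) - (1 - lam n) * R n" for n
  proof -
    let ?x = "\<lambda>i. (norm (X i n - Z i))\<^sup>2" and ?y = "\<lambda>i. (norm (Y i n - Z i))\<^sup>2"
    have "s (Suc n) \<le> (\<Sum>i\<in>I. lam n * ?x i + (1 - lam n) * ?y i + \<delta> n * (?x i + ?y i))"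
      unfolding s_def
    proof (rule sum_mono)
      fix i assume i: "i \<in> I"
      have "(norm (X i (Suc n) - Z i))\<^sup>2 \<le> \<mu> i n * ?x i + (1 - \<mu> i n) * ?y i"
        unfolding upd[OF i] by (rule relaxation_step[OF \<mu>[OF i]])
      also have "\<dots> = lam n * ?x i + (1 - lam n) * ?y i + (\<mu> i n - lam n) * (?x i - ?y i)" by (simp add: algebra_simps)
      also have "(\<mu> i n - lam n) * (?x i - ?y i) \<le> \<delta> n * (?x i + ?y i)"
      proof -
        have "(\<mu> i n - lam n) * (?x i - ?y i) \<le> \<bar>\<mu> i n - lam n\<bar> * \<bar>?x i - ?y i\<bar>" by (metis abs_ge_self abs_mult)
        also have "\<dots> \<le> \<delta> n * (?x i + ?y i)"
        proof (rule mult_mono)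
          show "\<bar>\<mu> i n - lam n\<bar> \<le> \<delta> n" unfolding \<delta>_def by (rule member_le_sum[OF i]) (auto simp: I)
        qed (auto simp: nn abs_le_iff)
        finally show ?thesis .
      qed
      finally show "(norm (X i (Suc n) - Z i))\<^sup>2 \<le> lam n * ?x i + (1 - lam n) * ?y i + \<delta> n * (?x i + ?y i)" by simp
    qed
    also have "\<dots> = lam n * s n + (1 - lam n) * (a n)\<^sup>2 + \<delta> n * (s n + (a n)\<^sup>2)"
      unfolding a2 s_def by (simp add: sum.distrib sum_distrib_left distrib_left)
    also have "\<dots> \<le> lam n * s n + (1 - lam n) * (s n - R n + \<kappa> n * a n) + \<delta> n * (s n + (2 * s n + 2 * (\<kappa> n)\<^sup>2))"
      using fb[of n] a2b[of n] lam[of n] \<epsilon> nn(6)[of n] by (intro add_mono mult_left_mono) auto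
    also have "\<dots> = s n - (1 - lam n) * R n + (1 - lam n) * (\<kappa> n * a n) + 3 * \<delta> n * s n + 2 * \<delta> n * (\<kappa> n)\<^sup>2"
      by (simp add: algebra_simps)
    \<comment> \<open>The inequality \<open>sqrt (s n) \<le> s n + 1\<close> makes the error term
      affine in \<open>s n\<close>, the form required by \<open>quasi_Fejer\<close>.\<close>
    also have "(1 - lam n) * (\<kappa> n * a n) \<le> \<kappa> n * s n + \<kappa> n + (\<kappa> n)\<^sup>2"
    proof -
      have "(1 - lam n) * (\<kappa> n * a n) \<le> 1 * (\<kappa> n * a n)" using lam(1)[of n] nn by (intro mult_right_mono) auto
      also have "\<kappa> n * a n \<le> \<kappa> n * (sqrt (s n) + \<kappa> n)" using ab nn by (intro mult_left_mono) auto
      also have "\<dots> \<le> \<kappa> n * ((s n + 1) + \<kappa> n)"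
      proof -
        have "sqrt (s n) \<le> s n + 1"
        proof (rule real_le_lsqrt)
          show "s n \<le> (s n + 1)\<^sup>2" using nn(1)[of n] by (simp add: power2_sum)
        qed (use nn(1)[of n] in auto)
        then show ?thesis using nn(5)[of n] by (intro mult_left_mono) auto
      qed
      finally show ?thesis by (simp add: power2_eq_square algebra_simps)
    qed
    finally show ?thesis by (simp add: algebra_simps)
  qed
  have s\<kappa>: "summable \<kappa>" unfolding \<kappa>_def by (intro summable_mult summable_mult2 E(3))
  have s\<delta>: "summable \<delta>" unfolding \<delta>_def by (rule summable_sum) (rule sm)
  have s\<kappa>2: "summable (\<lambda>n. (\<kappa> n)\<^sup>2)"
  proof (rule summable_comparison_test'[OF summable_mult[OF s\<kappa>, of "suminf \<kappa>"]])
    show "norm ((\<kappa> n)\<^sup>2) \<le> suminf \<kappa> * \<kappa> n" for n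
      using mult_right_mono[OF summable_le_suminf[OF s\<kappa> nn(5)] nn(5)] by (simp add: power2_eq_square nn)
  qed
  have s\<delta>\<kappa>: "summable (\<lambda>n. 2 * \<delta> n * (\<kappa> n)\<^sup>2)"
  proof (rule summable_comparison_test'[OF summable_mult[OF s\<delta>, of "2 * suminf (\<lambda>n. (\<kappa> n)\<^sup>2)"]])
    show "norm (2 * \<delta> n * (\<kappa> n)\<^sup>2) \<le> 2 * suminf (\<lambda>n. (\<kappa> n)\<^sup>2) * \<delta> n" for n
      using mult_left_mono[OF summable_le_suminf[OF s\<kappa>2, of n] nn(6)[of n]] by (simp add: nn mult_ac)
  qed
  have lR: "0 \<le> (1 - lam n) * R n" for n using lam(2)[of n] \<epsilon> R0[of n] by (intro mult_nonneg_nonneg) auto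
  define p where "p = (\<lambda>n. \<kappa> n + 3 * \<delta> n)"
  define q where "q = (\<lambda>n. \<kappa> n + (\<kappa> n)\<^sup>2 + 2 * \<delta> n * (\<kappa> n)\<^sup>2)"
  have pq: "0 \<le> p n" "0 \<le> q n" for n using nn by (auto simp: p_def q_def)
  have spq: "summable p" "summable q"
    unfolding p_def q_def by (intro summable_add summable_mult s\<kappa> s\<delta> s\<kappa>2 s\<delta>\<kappa>)+
  have "s (Suc n) \<le> (1 + p n) * s n + q n - (1 - lam n) * R n" for n using step[of n] by (simp add: p_def q_def)
  note qF = quasi_Fejer[where r="\<lambda>n. (1 - lam n) * R n", OF nn(1) pq lR spq this]
  have q: "convergent s \<and> summable (\<lambda>n. (1 - lam n) * R n)" using qF by blast
  then show "convergent (\<lambda>n. \<Sum>i\<in>I. (norm (X i n - Z i))\<^sup>2)" by (simp add: s_def)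
  have Rl: "R \<longlonglongrightarrow> 0"
  proof (rule Lim_null_comparison)
    show "\<forall>\<^sub>F n in sequentially. norm (R n) \<le> (1 / \<epsilon>) * ((1 - lam n) * R n)"
    proof (intro always_eventually allI)
      fix n
      have "\<epsilon> * R n \<le> (1 - lam n) * R n" using lam(2)[of n] R0 by (intro mult_right_mono) auto
      then show "norm (R n) \<le> (1 / \<epsilon>) * ((1 - lam n) * R n)" using \<epsilon> R0[of n] by (simp add: field_simps)
    qed
    have "(\<lambda>n. (1 / \<epsilon>) * ((1 - lam n) * R n)) \<longlonglongrightarrow> (1 / \<epsilon>) * 0"
      using q by (intro tendsto_mult_left summable_LIMSEQ_zero) auto
    then show "(\<lambda>n. (1 / \<epsilon>) * ((1 - lam n) * R n)) \<longlonglongrightarrow> 0" by simp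
  qed
  have null: "F \<longlonglongrightarrow> 0" if F: "\<And>n. (norm (F n))\<^sup>2 \<le> c * R n" for F :: "nat \<Rightarrow> 'h" and c
  proof -
    have "(\<lambda>n. c * R n) \<longlonglongrightarrow> 0" using tendsto_mult_left[OF Rl, of c] by simp
    then have "(\<lambda>n. (norm (F n))\<^sup>2) \<longlonglongrightarrow> 0"
      by (rule tendsto_zero_of_norm_le[rotated]) (use F in simp)
    then show ?thesis by (rule tendsto_zero_of_norm_square)
  qed
  have VW: "(\<lambda>n. V i n - W i) \<longlonglongrightarrow> 0" if i: "i \<in> I" for i
  proof (rule null)
    fix n
    have "(norm (V i n - W i))\<^sup>2 \<le> v n" unfolding v_def by (rule member_le_sum[OF i]) (auto simp: I)
    then show "(norm (V i n - W i))\<^sup>2 \<le> (1 / (\<epsilon> * \<epsilon>)) * R n" proof -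
      have "v n \<le> R n / (\<epsilon> * \<epsilon>)" using vR[of n] \<epsilon> by (subst pos_le_divide_eq) (auto simp: mult_ac)
      then show ?thesis using \<open>(norm (V i n - W i))\<^sup>2 \<le> v n\<close> by simp
    qed
  qed
  then show "V i \<longlonglongrightarrow> W i" if "i \<in> I" for i using that by (simp add: LIM_zero_iff)
  show "(\<lambda>n. X i n - Y i n) \<longlonglongrightarrow> 0" if i: "i \<in> I" for i
  proof -
    have 1: "(\<lambda>n. (X i n - Y i n) - \<gamma> n *\<^sub>R (V i n - W i)) \<longlonglongrightarrow> 0"
    proof (rule null)
      fix n
      have "(norm ((X i n - Y i n) - \<gamma> n *\<^sub>R (V i n - W i)))\<^sup>2 \<le> d n" unfolding d_def by (rule member_le_sum[OF i]) (auto simp: I)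
      then show "(norm ((X i n - Y i n) - \<gamma> n *\<^sub>R (V i n - W i)))\<^sup>2 \<le> 1 * R n" using dR[of n] by simp
    qed
    \<comment> \<open>\<open>X - Y\<close> is recovered from the residual by adding back
      \<open>\<gamma> (V - W)\<close>, which vanishes because the step sizes are bounded.\<close>
    have "(\<lambda>n. norm (V i n - W i)) \<longlonglongrightarrow> 0" by (intro tendsto_norm_zero VW i)
    then have "(\<lambda>n. (2 * \<beta>) * norm (V i n - W i)) \<longlonglongrightarrow> 0" by (rule tendsto_mult_right_zero)
    then have 2: "(\<lambda>n. \<gamma> n *\<^sub>R (V i n - W i)) \<longlonglongrightarrow> 0"
    proof (rule tendsto_zero_of_norm_le[rotated])
      show "norm (\<gamma> n *\<^sub>R (V i n - W i)) \<le> (2 * \<beta>) * norm (V i n - W i)" for n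
        using \<gamma>0[of n] by (simp add: mult_right_mono)
    qed
    from tendsto_add[OF 1 2] show ?thesis by simp
  qed
qed

section \<open>The forward operator on tuples of classes\<close>

locale coupled_system =
  fixes m :: nat and T \<beta> :: real and H :: "nat \<Rightarrow> 'a::{real_inner, banach} set"
    and f :: "nat \<Rightarrow> 'a \<Rightarrow> ereal" and B :: "nat \<Rightarrow> (nat \<Rightarrow> 'a) \<Rightarrow> 'a"
  assumes T: "0 < T" and \<beta>: "0 < \<beta>" and H: "\<And>i. i \<in> {1..m} \<Longrightarrow> hilbert_subspace (H i)"
    and f: "\<And>i. i \<in> {1..m} \<Longrightarrow> f i \<in> Gamma0 (H i)"
    and B: "\<And>i. i \<in> {1..m} \<Longrightarrow> B i \<in> (\<Pi>\<^sub>E j\<in>{1..m}. H j) \<rightarrow> H i"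
    and coco: "\<And>u v. u \<in> (\<Pi>\<^sub>E j\<in>{1..m}. H j) \<Longrightarrow> v \<in> (\<Pi>\<^sub>E j\<in>{1..m}. H j) \<Longrightarrow>
      (\<Sum>i=1..m. (B i u - B i v) \<bullet> (u i - v i)) \<ge> \<beta> * (\<Sum>i=1..m. (norm (B i u - B i v))\<^sup>2)"
begin

lemma sH: "i \<in> {1..m} \<Longrightarrow> subspace (H i)"
  using H by (simp add: hilbert_subspace_def)

definition BX :: "(nat \<Rightarrow> real \<Rightarrow> 'a) \<Rightarrow> nat \<Rightarrow> real \<Rightarrow> 'a" where
  "BX x i t = B i (\<lambda>j\<in>{1..m}. x j t)"

text \<open>Cocoercivity combined with Young's inequality for the weights \<open>\<beta> / 2\<close>
  and \<open>1 / (2 \<beta>)\<close>: half of the left-hand side absorbs the first term, which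
  leaves the Lipschitz constant \<open>1 / \<beta>\<close> for the whole tuple.\<close>

lemma B_Lipschitz:
  assumes u: "u \<in> (\<Pi>\<^sub>E j\<in>{1..m}. H j)" and v: "v \<in> (\<Pi>\<^sub>E j\<in>{1..m}. H j)" and i: "i \<in> {1..m}"
  shows "(norm (B i u - B i v))\<^sup>2 \<le> (1 / \<beta>\<^sup>2) * (\<Sum>j=1..m. (norm (u j - v j))\<^sup>2)"
proof -
  define S where "S = (\<Sum>j=1..m. (norm (B j u - B j v))\<^sup>2)"
  define D where "D = (\<Sum>j=1..m. (norm (u j - v j))\<^sup>2)"
  have "\<beta> * S \<le> (\<Sum>j=1..m. (B j u - B j v) \<bullet> (u j - v j))" unfolding S_def by (rule coco[OF u v])
  also have "\<dots> \<le> (\<Sum>j=1..m. (\<beta> / 2) * (norm (B j u - B j v))\<^sup>2 + (1 / (2 * \<beta>)) * (norm (u j - v j))\<^sup>2)"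
  proof (rule sum_mono)
    fix j
    let ?p = "norm (B j u - B j v)" and ?q = "norm (u j - v j)"
    have "(B j u - B j v) \<bullet> (u j - v j) \<le> ?p * ?q" by (rule norm_cauchy_schwarz)
    also have "\<dots> \<le> (\<beta> / 2) * ?p\<^sup>2 + (1 / (2 * \<beta>)) * ?q\<^sup>2"
    proof -
      have "0 \<le> (\<beta> * ?p - ?q)\<^sup>2 / (2 * \<beta>)" using \<beta> by simp
      also have "\<dots> = (\<beta> / 2) * ?p\<^sup>2 + (1 / (2 * \<beta>)) * ?q\<^sup>2 - ?p * ?q"
        using \<beta> by (simp add: power2_eq_square field_simps)
      finally show ?thesis by simp
    qed
    finally show "(B j u - B j v) \<bullet> (u j - v j) \<le> (\<beta> / 2) * ?p\<^sup>2 + (1 / (2 * \<beta>)) * ?q\<^sup>2" .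
  qed
  also have "\<dots> = (\<beta> / 2) * S + (1 / (2 * \<beta>)) * D" by (simp add: S_def D_def sum.distrib sum_distrib_left)
  finally have "S \<le> (1 / \<beta>\<^sup>2) * D" using \<beta> by (simp add: field_simps power2_eq_square)
  moreover have "(norm (B i u - B i v))\<^sup>2 \<le> S" unfolding S_def by (rule member_le_sum[OF i]) auto
  ultimately show ?thesis by (simp add: D_def)
qed

lemma restrict_PiE_H: "(\<And>j. j \<in> {1..m} \<Longrightarrow> g j \<in> H j) \<Longrightarrow> restrict g {1..m} \<in> (\<Pi>\<^sub>E j\<in>{1..m}. H j)"
  by auto

text \<open>The Lipschitz estimate gives measurability, through sequential continuity on tuples, and
  integrability, by comparison with the value \<open>c\<close> at the origin.\<close>

lemma BX_Lp2:
  assumes x: "\<And>j. j \<in> {1..m} \<Longrightarrow> x j \<in> Lp 2 T (H j)" and i: "i \<in> {1..m}"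
  shows "BX x i \<in> Lp 2 T (H i)"
proof -
  let ?M = "restrict_space lborel {0..T}"
  have "smeas ?M (\<lambda>t. B i (\<lambda>j\<in>{1..m}. x j t))"
  proof (rule smeas_compose_finite[where H=H])
    show "smeas ?M (x j)" if "j \<in> {1..m}" for j using Lp_smeas[OF x[OF that]] smeas_zext_iff by blast
    show "x j t \<in> H j" if "j \<in> {1..m}" "t \<in> space ?M" for j t using Lp_in[OF x[OF that(1)]] that(2) by (simp add: space_interval)
    fix s :: "nat \<Rightarrow> nat \<Rightarrow> 'a" and y
    assume s: "\<And>n j. j \<in> {1..m} \<Longrightarrow> s n j \<in> H j" "\<And>j. j \<in> {1..m} \<Longrightarrow> y j \<in> H j" "\<And>j. j \<in> {1..m} \<Longrightarrow> (\<lambda>n. s n j) \<longlonglongrightarrow> y j"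
    have "(\<lambda>n. (1 / \<beta>\<^sup>2) * (\<Sum>j=1..m. (norm (s n j - y j))\<^sup>2)) \<longlonglongrightarrow> (1 / \<beta>\<^sup>2) * (\<Sum>j=1..m. (norm (y j - y j))\<^sup>2)"
      by (intro tendsto_intros s) auto
    then have lim: "(\<lambda>n. (1 / \<beta>\<^sup>2) * (\<Sum>j=1..m. (norm (s n j - y j))\<^sup>2)) \<longlonglongrightarrow> 0" by simp
    have le: "(norm (B i (restrict (s n) {1..m}) - B i (restrict y {1..m})))\<^sup>2 \<le> (1 / \<beta>\<^sup>2) * (\<Sum>j=1..m. (norm (s n j - y j))\<^sup>2)" for n
    proof -
      have "(norm (B i (restrict (s n) {1..m}) - B i (restrict y {1..m})))\<^sup>2
          \<le> (1 / \<beta>\<^sup>2) * (\<Sum>j=1..m. (norm (restrict (s n) {1..m} j - restrict y {1..m} j))\<^sup>2)"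
        by (rule B_Lipschitz[OF restrict_PiE_H restrict_PiE_H i]) (use s in auto)
      also have "(\<Sum>j=1..m. (norm (restrict (s n) {1..m} j - restrict y {1..m} j))\<^sup>2) = (\<Sum>j=1..m. (norm (s n j - y j))\<^sup>2)"
        by (rule sum.cong) auto
      finally show ?thesis .
    qed
    have "(\<lambda>n. (norm (B i (restrict (s n) {1..m}) - B i (restrict y {1..m})))\<^sup>2) \<longlonglongrightarrow> 0"
      by (rule tendsto_zero_of_norm_le[OF _ lim]) (use le in simp)
    from LIM_zero_cancel[OF tendsto_zero_of_norm_square[OF this]]
    show "(\<lambda>n. B i (restrict (s n) {1..m})) \<longlonglongrightarrow> B i (restrict y {1..m})" .
  qed auto
  then have sB: "smeas ?M (BX x i)" by (simp add: BX_def[abs_def])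
  define c where "c = B i (\<lambda>j\<in>{1..m}. 0)"
  have z: "(\<lambda>j\<in>{1..m}. 0) \<in> (\<Pi>\<^sub>E j\<in>{1..m}. H j)" by (rule restrict_PiE_H) (rule subspace_0[OF sH])
  have cH: "c \<in> H i" unfolding c_def by (rule funcset_mem[OF B[OF i] z])
  have xt: "(\<lambda>j\<in>{1..m}. x j t) \<in> (\<Pi>\<^sub>E j\<in>{1..m}. H j)" if "t \<in> {0..T}" for t
    by (rule restrict_PiE_H) (use Lp_in[OF x] that in auto)
  have BH: "BX x i t \<in> H i" if "t \<in> {0..T}" for t unfolding BX_def by (rule funcset_mem[OF B[OF i] xt[OF that]])
  define d where "d = (\<lambda>t. BX x i t - c)"
  have dm: "smeas lborel (zext T d)" unfolding smeas_zext_iff d_def by (intro smeas_diff sB smeas_const)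
  have "integrable lborel (\<lambda>t. (norm (zext T d t))\<^sup>2)"
  proof (rule Bochner_Integration.integrable_bound)
    show "integrable lborel (\<lambda>t. (1 / \<beta>\<^sup>2) * (\<Sum>j=1..m. (norm (zext T (x j) t))\<^sup>2))"
      by (intro integrable_mult_right Bochner_Integration.integrable_sum sqi_integrable Lp2_sqi[OF x])
    show "(\<lambda>t. (norm (zext T d t))\<^sup>2) \<in> borel_measurable lborel"
      by (intro borel_measurable_power borel_measurable_norm_smeas dm)
    have "(norm (zext T d t))\<^sup>2 \<le> (1 / \<beta>\<^sup>2) * (\<Sum>j=1..m. (norm (zext T (x j) t))\<^sup>2)" for t
    proof (cases "t \<in> {0..T}")
      case True
      have "(norm (BX x i t - c))\<^sup>2 \<le> (1 / \<beta>\<^sup>2) * (\<Sum>j=1..m. (norm ((\<lambda>j\<in>{1..m}. x j t) j - (\<lambda>j\<in>{1..m}. 0) j))\<^sup>2)"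
        unfolding BX_def c_def by (rule B_Lipschitz[OF xt[OF True] z i])
      also have "(\<Sum>j=1..m. (norm ((\<lambda>j\<in>{1..m}. x j t) j - (\<lambda>j\<in>{1..m}. 0) j))\<^sup>2) = (\<Sum>j=1..m. (norm (x j t))\<^sup>2)"
        by (rule sum.cong) auto
      finally show ?thesis using True by (simp add: zext_in d_def)
    qed (simp add: zext_out sum_nonneg)
    then show "AE t in lborel. norm ((norm (zext T d t))\<^sup>2) \<le> norm ((1 / \<beta>\<^sup>2) * (\<Sum>j=1..m. (norm (zext T (x j) t))\<^sup>2))"
      by (intro AE_I2) (simp add: sum_nonneg)
  qed
  then have "d \<in> Lp 2 T (H i)"
    unfolding Lp2_iff_sqi sqi_def using dm BH cH sH[OF i] by (auto simp: d_def subspace_diff)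
  from Lp2_add[OF sH[OF i] this Lp_const[OF cH]] show ?thesis by (simp add: d_def)
qed

lemma BX_coco:
  assumes x: "\<And>j. j \<in> {1..m} \<Longrightarrow> x j \<in> Lp 2 T (H j)" and y: "\<And>j. j \<in> {1..m} \<Longrightarrow> y j \<in> Lp 2 T (H j)"
  shows "\<beta> * (\<Sum>i=1..m. (norm (cls T (BX x i) - cls T (BX y i)))\<^sup>2) \<le> (\<Sum>i=1..m. (cls T (BX x i) - cls T (BX y i)) \<bullet> (cls T (x i) - cls T (y i)))"
proof -
  define d where "d = (\<lambda>i t. BX x i t - BX y i t)"
  define e where "e = (\<lambda>i t. x i t - y i t)"
  have d: "d i \<in> Lp 2 T (H i)" if "i \<in> {1..m}" for i unfolding d_def by (intro Lp2_diff sH BX_Lp2 x y that)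
  have e: "e i \<in> Lp 2 T (H i)" if "i \<in> {1..m}" for i unfolding e_def by (intro Lp2_diff sH x y that)
  have id: "integrable lborel (\<lambda>t. (norm (zext T (d i) t))\<^sup>2)" if "i \<in> {1..m}" for i by (rule sqi_integrable[OF Lp2_sqi[OF d[OF that]]])
  have ie: "integrable lborel (\<lambda>t. zext T (d i) t \<bullet> zext T (e i) t)" if "i \<in> {1..m}" for i
    by (intro sqi_inner_integrable Lp2_sqi[OF d[OF that]] Lp2_sqi[OF e[OF that]])
  have cd: "cls T (BX x i) - cls T (BX y i) = cls T (d i)" if "i \<in> {1..m}" for i
    unfolding d_def by (rule cls_diff[symmetric, OF BX_Lp2[of x, OF x that] BX_Lp2[of y, OF y that]])
  have ce: "cls T (x i) - cls T (y i) = cls T (e i)" if "i \<in> {1..m}" for i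
    unfolding e_def by (rule cls_diff[symmetric, OF x[OF that] y[OF that]])
  have cn: "(norm (cls T (BX x i) - cls T (BX y i)))\<^sup>2 = (LINT t|lborel. (norm (zext T (d i) t))\<^sup>2)" if "i \<in> {1..m}" for i
    unfolding cd[OF that] unfolding cls_def by (rule norm_abs_L2[OF Lp2_sqi[OF d[OF that]]])
  have "\<beta> * (\<Sum>i=1..m. (norm (cls T (BX x i) - cls T (BX y i)))\<^sup>2) = \<beta> * (\<Sum>i=1..m. LINT t|lborel. (norm (zext T (d i) t))\<^sup>2)"
    by (intro arg_cong2[where f="(*)"] sum.cong refl cn)
  also have "\<dots> = (LINT t|lborel. \<beta> * (\<Sum>i=1..m. (norm (zext T (d i) t))\<^sup>2))"
    by (simp add: Bochner_Integration.integral_sum id)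
  also have "\<dots> \<le> (LINT t|lborel. (\<Sum>i=1..m. zext T (d i) t \<bullet> zext T (e i) t))"
  proof (rule integral_mono)
    show "integrable lborel (\<lambda>t. \<beta> * (\<Sum>i=1..m. (norm (zext T (d i) t))\<^sup>2))"
      by (intro integrable_mult_right Bochner_Integration.integrable_sum id)
    show "integrable lborel (\<lambda>t. \<Sum>i=1..m. zext T (d i) t \<bullet> zext T (e i) t)"
      by (intro Bochner_Integration.integrable_sum ie)
    show "\<beta> * (\<Sum>i=1..m. (norm (zext T (d i) t))\<^sup>2) \<le> (\<Sum>i=1..m. zext T (d i) t \<bullet> zext T (e i) t)" for t
    proof (cases "t \<in> {0..T}")
      case True
      have "\<beta> * (\<Sum>i=1..m. (norm (BX x i t - BX y i t))\<^sup>2) \<le> (\<Sum>i=1..m. (BX x i t - BX y i t) \<bullet> ((\<lambda>j\<in>{1..m}. x j t) i - (\<lambda>j\<in>{1..m}. y j t) i))"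
        unfolding BX_def by (rule coco[OF restrict_PiE_H restrict_PiE_H]) (use True Lp_in[OF x] Lp_in[OF y] in auto)
      also have "\<dots> = (\<Sum>i=1..m. zext T (d i) t \<bullet> zext T (e i) t)"
        by (rule sum.cong) (use True in \<open>auto simp: zext_in d_def e_def\<close>)
      finally show ?thesis using True by (simp add: zext_in d_def)
    qed (simp add: zext_out)
  qed
  also have "\<dots> = (\<Sum>i=1..m. LINT t|lborel. zext T (d i) t \<bullet> zext T (e i) t)"
    by (rule Bochner_Integration.integral_sum) (rule ie)
  also have "\<dots> = (\<Sum>i=1..m. (cls T (BX x i) - cls T (BX y i)) \<bullet> (cls T (x i) - cls T (y i)))"
    by (rule sum.cong) (auto simp: cd ce cls_inner_zext[OF d e])
  finally show ?thesis .
qed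

text \<open>Cocoercivity with vanishing right-hand side; it makes the forward operator well defined
  on classes.\<close>

lemma BX_cls_cong:
  assumes x: "\<And>j. j \<in> {1..m} \<Longrightarrow> x j \<in> Lp 2 T (H j)" and y: "\<And>j. j \<in> {1..m} \<Longrightarrow> y j \<in> Lp 2 T (H j)"
    and eq: "\<And>j. j \<in> {1..m} \<Longrightarrow> cls T (x j) = cls T (y j)" and i: "i \<in> {1..m}"
  shows "cls T (BX x i) = cls T (BX y i)"
proof -
  have "(\<Sum>i=1..m. (cls T (BX x i) - cls T (BX y i)) \<bullet> (cls T (x i) - cls T (y i))) = 0"
    by (rule sum.neutral) (simp add: eq)
  then have "\<beta> * (\<Sum>i=1..m. (norm (cls T (BX x i) - cls T (BX y i)))\<^sup>2) \<le> 0" using BX_coco[of x y] x y by simp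
  then have "(\<Sum>i=1..m. (norm (cls T (BX x i) - cls T (BX y i)))\<^sup>2) \<le> 0" using \<beta> by (simp add: mult_le_0_iff)
  moreover have "(norm (cls T (BX x i) - cls T (BX y i)))\<^sup>2 \<le> (\<Sum>i=1..m. (norm (cls T (BX x i) - cls T (BX y i)))\<^sup>2)"
    by (rule member_le_sum[OF i]) auto
  ultimately have "(norm (cls T (BX x i) - cls T (BX y i)))\<^sup>2 \<le> 0" by linarith
  then show ?thesis by simp
qed

text \<open>The problem expressed through classes. The functions \<open>x i\<close> themselves may
  be neither continuous nor periodic; they only have to agree almost everywhere on
  \<open>[0, T]\<close> with functions that are.\<close>

definition sol :: "(nat \<Rightarrow> real \<Rightarrow> 'a) \<Rightarrow> bool" where
  "sol x \<longleftrightarrow> (\<forall>i\<in>{1..m}. x i \<in> Lp 2 T (H i) \<and> (cls T (x i), - cls T (BX x i)) \<in> periodic_op T (H i) (f i))"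

lemma solves_P_imp_sol:
  assumes "solves_P m T H f B x"
  shows "sol x"
  unfolding sol_def
proof (intro ballI)
  fix i assume i: "i \<in> {1..m}"
  have x: "x j \<in> W_per T (H j)" if "j \<in> {1..m}" for j using assms that by (auto simp: solves_P_def)
  note d = W_perD[OF T H[OF i] x[OF i]]
  have xL: "x j \<in> Lp 2 T (H j)" if "j \<in> {1..m}" for j by (rule W_perD(4)[OF T H[OF that] x[OF that]])
  note bx = BX_Lp2[of x, OF xL i]
  define u where "u = (\<lambda>t. (-1) *\<^sub>R BX x i t - weak_deriv T (H i) (x i) t)"
  have nb: "(\<lambda>t. (-1) *\<^sub>R BX x i t) \<in> Lp 2 T (H i)" by (rule Lp2_scaleR[OF sH[OF i] bx])
  have u: "u \<in> Lp 2 T (H i)" unfolding u_def by (rule Lp2_diff[OF sH[OF i] nb d(3)])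
  have us: "AE t in lborel. t \<in> {0..T} \<longrightarrow> u t \<in> subdiff (H i) (f i) (x i t)"
    using assms i unfolding solves_P_iff[OF T] by (auto simp: u_def BX_def)
  have "cls T u = - cls T (BX x i) - cls T (weak_deriv T (H i) (x i))"
    unfolding u_def cls_diff[OF nb d(3)] using cls_scaleR[OF bx, of "-1"] by simp
  then have e: "- cls T (BX x i) = cls T (weak_deriv T (H i) (x i)) + cls T u" by simp
  show "x i \<in> Lp 2 T (H i) \<and> (cls T (x i), - cls T (BX x i)) \<in> periodic_op T (H i) (f i)"
    unfolding e periodic_op_def using x[OF i] u us d(4) by blast
qed

text \<open>Membership in \<open>periodic_op\<close> supplies continuous periodic representatives
  \<open>z i\<close>, and replacing \<open>x\<close> by \<open>z\<close> does not change the classes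
  of \<open>BX\<close>.\<close>

lemma sol_imp_solves_P:
  assumes "sol x"
  shows "\<exists>z. solves_P m T H f B z \<and> (\<forall>i\<in>{1..m}. z i \<in> W_per T (H i) \<and> cls T (z i) = cls T (x i))"
proof -
  have "\<forall>i\<in>{1..m}. \<exists>y u. y \<in> W_per T (H i) \<and> u \<in> Lp 2 T (H i) \<and> (AE t in lborel. t \<in> {0..T} \<longrightarrow> u t \<in> subdiff (H i) (f i) (y t)) \<and>
      cls T (x i) = cls T y \<and> - cls T (BX x i) = cls T (weak_deriv T (H i) y) + cls T u"
    using assms unfolding sol_def periodic_op_def by blast
  from bchoice[OF this] obtain z where "\<forall>i\<in>{1..m}. \<exists>u. z i \<in> W_per T (H i) \<and> u \<in> Lp 2 T (H i) \<and> (AE t in lborel. t \<in> {0..T} \<longrightarrow> u t \<in> subdiff (H i) (f i) (z i t)) \<and>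
      cls T (x i) = cls T (z i) \<and> - cls T (BX x i) = cls T (weak_deriv T (H i) (z i)) + cls T u" ..
  from bchoice[OF this] obtain u where "\<forall>i\<in>{1..m}. z i \<in> W_per T (H i) \<and> u i \<in> Lp 2 T (H i) \<and> (AE t in lborel. t \<in> {0..T} \<longrightarrow> u i t \<in> subdiff (H i) (f i) (z i t)) \<and>
      cls T (x i) = cls T (z i) \<and> - cls T (BX x i) = cls T (weak_deriv T (H i) (z i)) + cls T (u i)" ..
  then have z: "\<And>i. i \<in> {1..m} \<Longrightarrow> z i \<in> W_per T (H i)" "\<And>i. i \<in> {1..m} \<Longrightarrow> u i \<in> Lp 2 T (H i)"
      "\<And>i. i \<in> {1..m} \<Longrightarrow> AE t in lborel. t \<in> {0..T} \<longrightarrow> u i t \<in> subdiff (H i) (f i) (z i t)"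
      "\<And>i. i \<in> {1..m} \<Longrightarrow> cls T (x i) = cls T (z i)"
      "\<And>i. i \<in> {1..m} \<Longrightarrow> - cls T (BX x i) = cls T (weak_deriv T (H i) (z i)) + cls T (u i)" by blast+
  have xL: "x j \<in> Lp 2 T (H j)" if "j \<in> {1..m}" for j using assms that by (auto simp: sol_def)
  have zL: "z j \<in> Lp 2 T (H j)" if "j \<in> {1..m}" for j by (rule W_perD(4)[OF T H[OF that] z(1)[OF that]])
  have "AE t in lborel. t \<in> {0..T} \<longrightarrow> - B i (\<lambda>j\<in>{1..m}. z j t) - weak_deriv T (H i) (z i) t \<in> subdiff (H i) (f i) (z i t)"
    if i: "i \<in> {1..m}" for i
  proof -
    note d = W_perD[OF T H[OF i] z(1)[OF i]] and bz = BX_Lp2[of z, OF zL i]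
    have nb: "(\<lambda>t. (-1) *\<^sub>R BX z i t) \<in> Lp 2 T (H i)" by (rule Lp2_scaleR[OF sH[OF i] bz])
    have nbd: "(\<lambda>t. (-1) *\<^sub>R BX z i t - weak_deriv T (H i) (z i) t) \<in> Lp 2 T (H i)" by (rule Lp2_diff[OF sH[OF i] nb d(3)])
    have "cls T (BX z i) = cls T (BX x i)" by (rule BX_cls_cong[OF zL xL _ i]) (simp_all add: z(4))
    then have "cls T (\<lambda>t. (-1) *\<^sub>R BX z i t - weak_deriv T (H i) (z i) t) = cls T (u i)"
      unfolding cls_diff[OF nb d(3)] using z(5)[OF i] cls_scaleR[OF bz, of "-1"] by simp
    then have "AE t in lborel. t \<in> {0..T} \<longrightarrow> (-1) *\<^sub>R BX z i t - weak_deriv T (H i) (z i) t = u i t"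
      unfolding cls_eq_iff[OF nbd z(2)[OF i]] .
    with z(3)[OF i] show ?thesis by eventually_elim (auto simp: BX_def)
  qed
  then have "solves_P m T H f B z" unfolding solves_P_iff[OF T] using z(1) by blast
  then show ?thesis using z(1,4) by (intro exI[of _ z]) auto
qed

end

section \<open>Convergence of the iteration\<close>

lemma weak_deriv_cong: "(\<And>t. t \<in> {0..T} \<Longrightarrow> x t = y t) \<Longrightarrow> weak_deriv T H x = weak_deriv T H y"
proof -
  assume "\<And>t. t \<in> {0..T} \<Longrightarrow> x t = y t"
  then have "has_weak_deriv T H x = has_weak_deriv T H y" by (intro ext has_weak_deriv_cong)
  then show ?thesis by (simp add: weak_deriv_def)
qed

text \<open>The test identity for weak derivatives is an equality between pairings with fixed
  classes, hence stable under the weak limits of functions and derivatives.\<close>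

lemma weak_deriv_weakly_closed:
  assumes T: "0 < T" and H: "hilbert_subspace H" and x: "\<And>n. x n \<in> W12 T H" and p: "p \<in> Lp 2 T H" and v: "v \<in> Lp 2 T H"
    and wp: "wconv (\<lambda>n. cls T (x n)) (cls T p)" and wv: "wconv (\<lambda>n. cls T (weak_deriv T H (x n))) (cls T v)"
  shows "has_weak_deriv T H p v"
proof (rule has_weak_derivI_test[OF Lp2_imp_Lp1[OF p] Lp2_imp_Lp1[OF v] T])
  fix \<phi> f :: "real \<Rightarrow> real" and lo hi :: real and w :: 'a
  assume \<phi>: "\<And>t. (\<phi> has_real_derivative f t) (at t)" "\<And>t. isCont f t" "0 < lo" "lo \<le> hi" "hi < T"
    "\<And>t. t \<notin> {lo..hi} \<Longrightarrow> \<phi> t = 0 \<and> f t = 0"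
  have c\<phi>: "continuous_on A \<phi>" for A using DERIV_isCont[OF \<phi>(1)] by (intro continuous_at_imp_continuous_on) auto
  have cf: "continuous_on A f" for A using \<phi>(2) by (intro continuous_at_imp_continuous_on) auto
  have p\<phi>: "(\<lambda>t. \<phi> t *\<^sub>R w) \<in> Lp 2 T UNIV" "(\<lambda>t. f t *\<^sub>R w) \<in> Lp 2 T UNIV"
    by (rule Lp_continuous; use T in \<open>auto intro!: continuous_intros c\<phi> cf\<close>)+
  have z: "(\<lambda>t. zext T x t \<bullet> zext T (\<lambda>t. k t *\<^sub>R w) t) = (\<lambda>t. k t * (zext T x t \<bullet> w))" for x and k :: "real \<Rightarrow> real"
    by (auto simp: zext_def indicator_def)
  have eq: "cls T (weak_deriv T H (x n)) \<bullet> cls T (\<lambda>t. \<phi> t *\<^sub>R w) = - (cls T (x n) \<bullet> cls T (\<lambda>t. f t *\<^sub>R w))" for n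
  proof -
    note d = W12_weak_deriv[OF T H x[of n]]
    obtain c where "AE t in lborel. t \<in> {0..T} \<longrightarrow> x n t = c + prim (weak_deriv T H (x n)) t"
      using weak_deriv_repr[OF T H d(1)] by blast
    from primitive_test[OF Lp2_imp_Lp1[OF d(3)] Lp2_imp_Lp1[OF d(2)] T H this \<phi>, of w]
    show ?thesis unfolding cls_inner_zext[OF d(2) p\<phi>(1)] cls_inner_zext[OF d(3) p\<phi>(2)] z by simp
  qed
  have "(\<lambda>n. cls T (weak_deriv T H (x n)) \<bullet> cls T (\<lambda>t. \<phi> t *\<^sub>R w)) \<longlonglongrightarrow> cls T v \<bullet> cls T (\<lambda>t. \<phi> t *\<^sub>R w)"
    using wv by (simp add: wconv_def)
  moreover have "(\<lambda>n. - (cls T (x n) \<bullet> cls T (\<lambda>t. f t *\<^sub>R w))) \<longlonglongrightarrow> - (cls T p \<bullet> cls T (\<lambda>t. f t *\<^sub>R w))"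
    using wp by (intro tendsto_minus) (simp add: wconv_def)
  ultimately have "cls T v \<bullet> cls T (\<lambda>t. \<phi> t *\<^sub>R w) = - (cls T p \<bullet> cls T (\<lambda>t. f t *\<^sub>R w))"
    unfolding eq by (rule LIMSEQ_unique)
  then show "(LINT t|lborel. f t * (zext T p t \<bullet> w)) = - (LINT t|lborel. \<phi> t * (zext T v t \<bullet> w))"
    unfolding cls_inner_zext[OF v p\<phi>(1)] cls_inner_zext[OF p p\<phi>(2)] z by simp
qed

lemma tendsto_imp_norm_bounded:
  fixes F :: "nat \<Rightarrow> 'h::real_normed_vector"
  assumes "F \<longlonglongrightarrow> l"
  shows "\<exists>C. \<forall>n. norm (F n) \<le> C"
  using convergent_imp_Bseq[OF convergentI[OF assms]] unfolding Bseq_def by blast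

section \<open>The iteration\<close>

locale coupled_iteration = coupled_system m T \<beta> H f B
  for m :: nat and T \<beta> :: real and H :: "nat \<Rightarrow> 'a::{real_inner, banach} set" and f and B +
  fixes \<epsilon> :: real and \<gamma> lam :: "nat \<Rightarrow> real" and lami :: "nat \<Rightarrow> nat \<Rightarrow> real"
    and b e :: "nat \<Rightarrow> nat \<Rightarrow> real \<Rightarrow> 'a" and x0 :: "nat \<Rightarrow> real \<Rightarrow> 'a"
  assumes \<epsilon>: "0 < \<epsilon>" and \<gamma>: "\<And>n. \<gamma> n \<in> {\<epsilon>..2 * \<beta> - \<epsilon>}" and lam: "\<And>n. lam n \<in> {0..1 - \<epsilon>}"
    and x0: "\<And>i. i \<in> {1..m} \<Longrightarrow> x0 i \<in> W12 T (H i)"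
    and b: "\<And>i n. i \<in> {1..m} \<Longrightarrow> b i n \<in> Lp 2 T (H i)" and e: "\<And>i n. i \<in> {1..m} \<Longrightarrow> e i n \<in> Lp 2 T (H i)"
    and sb: "\<And>i. i \<in> {1..m} \<Longrightarrow> summable (\<lambda>n. L2_norm T (b i n))"
    and se: "\<And>i. i \<in> {1..m} \<Longrightarrow> summable (\<lambda>n. L2_norm T (e i n))"
    and lami: "\<And>i n. i \<in> {1..m} \<Longrightarrow> lami i n \<in> {0..<1}"
    and slam: "\<And>i. i \<in> {1..m} \<Longrightarrow> summable (\<lambda>n. \<bar>lami i n - lam n\<bar>)"
begin

lemma \<gamma>0: "0 < \<gamma> n"
  using \<gamma>[of n] \<epsilon> by auto

lemma forward_Lp2:
  assumes x: "\<And>j. j \<in> {1..m} \<Longrightarrow> x j \<in> Lp 2 T (H j)" and i: "i \<in> {1..m}"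
  shows "(\<lambda>t. B i (\<lambda>j\<in>{1..m}. x j t) + b i n t) \<in> Lp 2 T (H i)"
    "cls T (\<lambda>t. B i (\<lambda>j\<in>{1..m}. x j t) + b i n t) = cls T (BX x i) + cls T (b i n)"
  using Lp2_add[OF sH[OF i] BX_Lp2[OF x i] b[OF i]] cls_add[OF BX_Lp2[OF x i] b[OF i, of n]]
  by (simp_all add: BX_def)

text \<open>All components advance at once because each of them enters every forward term. The
  chosen step exists only if the preceding iterates are square-integrable, so membership in
  \<open>W12\<close> is carried along by induction.\<close>

lemma iteration_exists: "\<exists>x y. is_iteration m T H f B \<gamma> lami b e x0 x y"
proof -
  define stp where "stp = (\<lambda>n \<xi> i. SOME y. is_unique_step T (H i) (f i) (\<gamma> n) (\<xi> i) (\<lambda>t. B i (\<lambda>j\<in>{1..m}. \<xi> j t) + b i n t) (e i n) y)"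
  define xs where "xs = rec_nat x0 (\<lambda>n \<xi> i t. lami i n *\<^sub>R \<xi> i t + (1 - lami i n) *\<^sub>R stp n \<xi> i t)"
  have xs0: "xs 0 = x0" and xsS: "xs (Suc n) = (\<lambda>i t. lami i n *\<^sub>R xs n i t + (1 - lami i n) *\<^sub>R stp n (xs n) i t)" for n
    unfolding xs_def by simp_all
  have step: "is_unique_step T (H i) (f i) (\<gamma> n) (\<xi> i) (\<lambda>t. B i (\<lambda>j\<in>{1..m}. \<xi> j t) + b i n t) (e i n) (stp n \<xi> i)"
    if \<xi>: "\<And>j. j \<in> {1..m} \<Longrightarrow> \<xi> j \<in> Lp 2 T (H j)" and i: "i \<in> {1..m}" for n \<xi> i
  proof -
    have "\<exists>y. is_unique_step T (H i) (f i) (\<gamma> n) (\<xi> i) (\<lambda>t. B i (\<lambda>j\<in>{1..m}. \<xi> j t) + b i n t) (e i n) y"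
      using step_exists_unique[OF T H[OF i] f[OF i] \<gamma>0 \<xi>[OF i] forward_Lp2(1)[OF \<xi> i] e[OF i]] by blast
    then show ?thesis unfolding stp_def by (rule someI_ex)
  qed
  have W: "\<forall>i\<in>{1..m}. xs n i \<in> W12 T (H i)" for n
  proof (induction n)
    case 0
    show ?case using x0 by (simp add: xs0)
  next
    case (Suc n)
    show ?case
    proof
      fix i assume i: "i \<in> {1..m}"
      have "xs n j \<in> Lp 2 T (H j)" if "j \<in> {1..m}" for j using Suc that W12_weak_deriv(3)[OF T H] by blast
      from step[of "xs n", OF this i] have "stp n (xs n) i \<in> W12 T (H i)"
        by (simp add: is_unique_step_def solves_step_def W_per_def)
      then show "xs (Suc n) i \<in> W12 T (H i)" unfolding xsS using Suc i by (intro W12_lincomb(1)[OF T H]) auto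
    qed
  qed
  have L: "xs n j \<in> Lp 2 T (H j)" if "j \<in> {1..m}" for j n using W that W12_weak_deriv(3)[OF T H] by blast
  have "is_iteration m T H f B \<gamma> lami b e x0 (\<lambda>i n. xs n i) (\<lambda>i n. stp n (xs n) i)"
    unfolding is_iteration_def using step[of "xs n" for n, OF L] by (simp add: xs0 xsS)
  then show ?thesis by blast
qed

context
  fixes x y :: "nat \<Rightarrow> nat \<Rightarrow> real \<Rightarrow> 'a"
  assumes it: "is_iteration m T H f B \<gamma> lami b e x0 x y" and solvable: "\<exists>z. solves_P m T H f B z"
begin

lemma iteration_step: "i \<in> {1..m} \<Longrightarrow> is_unique_step T (H i) (f i) (\<gamma> n) (x i n) (\<lambda>t. B i (\<lambda>j\<in>{1..m}. x j n t) + b i n t) (e i n) (y i n)"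
  and iteration_update: "i \<in> {1..m} \<Longrightarrow> t \<in> {0..T} \<Longrightarrow> x i (Suc n) t = lami i n *\<^sub>R x i n t + (1 - lami i n) *\<^sub>R y i n t"
  and iteration_start: "i \<in> {1..m} \<Longrightarrow> t \<in> {0..T} \<Longrightarrow> x i 0 t = x0 i t"
  using it unfolding is_iteration_def by blast+

lemma step_in_W_per: "i \<in> {1..m} \<Longrightarrow> y i n \<in> W_per T (H i)"
  using iteration_step by (simp add: is_unique_step_def solves_step_def)

lemma step_in_W12: "i \<in> {1..m} \<Longrightarrow> y i n \<in> W12 T (H i)"
  using step_in_W_per by (simp add: W_per_def)

lemma iterate_in_W12: "i \<in> {1..m} \<Longrightarrow> x i n \<in> W12 T (H i)"
proof (induction n)
  case 0
  then show ?case using W12_cong[of T "x i 0" "x0 i" "H i", OF iteration_start] x0 by simp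
next
  case (Suc n)
  then show ?case
    using W12_cong[of T "x i (Suc n)" "\<lambda>t. lami i n *\<^sub>R x i n t + (1 - lami i n) *\<^sub>R y i n t" "H i", OF iteration_update]
      W12_lincomb(1)[OF T H[OF Suc.prems] Suc.IH[OF Suc.prems] step_in_W12[OF Suc.prems]] by simp
qed

lemma iterate_in_Lp2: "i \<in> {1..m} \<Longrightarrow> x i n \<in> Lp 2 T (H i)"
  using W12_weak_deriv(3)[OF T H iterate_in_W12] .

lemma step_in_Lp2: "i \<in> {1..m} \<Longrightarrow> y i n \<in> Lp 2 T (H i)"
  using W12_weak_deriv(3)[OF T H step_in_W12] .

definition X where "X i n = cls T (x i n)"
definition Y where "Y i n = cls T (y i n)"
definition V where "V i n = cls T (BX (\<lambda>j. x j n) i)"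
text \<open>The forward and the backward error enter the inclusion with the same sign and can be
  merged.\<close>

definition E where "E i n = cls T (b i n) + cls T (e i n)"
definition X' where "X' i n = cls T (weak_deriv T (H i) (x i n))"
definition Y' where "Y' i n = cls T (weak_deriv T (H i) (y i n))"
definition \<eta> where "\<eta> n = (\<Sum>i=1..m. L2_norm T (b i n) + L2_norm T (e i n))"

lemma X_update: "i \<in> {1..m} \<Longrightarrow> X i (Suc n) = lami i n *\<^sub>R X i n + (1 - lami i n) *\<^sub>R Y i n"
  unfolding X_def Y_def
  using cls_cong[of T "x i (Suc n)" "\<lambda>t. lami i n *\<^sub>R x i n t + (1 - lami i n) *\<^sub>R y i n t", OF iteration_update]
    cls_add[OF Lp2_scaleR[OF sH iterate_in_Lp2] Lp2_scaleR[OF sH step_in_Lp2]] by (simp add: cls_scaleR[OF iterate_in_Lp2] cls_scaleR[OF step_in_Lp2])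

lemma X'_update: "i \<in> {1..m} \<Longrightarrow> X' i (Suc n) = lami i n *\<^sub>R X' i n + (1 - lami i n) *\<^sub>R Y' i n"
  unfolding X'_def Y'_def
  using weak_deriv_cong[of T "x i (Suc n)" "\<lambda>t. lami i n *\<^sub>R x i n t + (1 - lami i n) *\<^sub>R y i n t" "H i", OF iteration_update]
    W12_lincomb(2)[OF T H iterate_in_W12 step_in_W12] by simp

lemma cls_forward:
  assumes i: "i \<in> {1..m}"
  shows "cls T (\<lambda>t. B i (\<lambda>j\<in>{1..m}. x j n t) + b i n t) = V i n + cls T (b i n)"
  unfolding V_def using forward_Lp2(2)[of "\<lambda>j. x j n" i n] iterate_in_Lp2 i by blast

lemma step_in_periodic_op: "i \<in> {1..m} \<Longrightarrow> (Y i n, (1 / \<gamma> n) *\<^sub>R (X i n - Y i n) - V i n - E i n) \<in> periodic_op T (H i) (f i)"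
proof -
  assume i: "i \<in> {1..m}"
  have xn: "x j n \<in> Lp 2 T (H j)" if "j \<in> {1..m}" for j by (rule iterate_in_Lp2[OF that])
  have "solves_step T (H i) (f i) (\<gamma> n) (x i n) (\<lambda>t. B i (\<lambda>j\<in>{1..m}. x j n t) + b i n t) (e i n) (y i n)"
    using iteration_step[OF i] by (simp add: is_unique_step_def)
  from solves_step_periodic_op[OF T H[OF i] iterate_in_Lp2[OF i] forward_Lp2(1)[of "\<lambda>j. x j n", OF xn i] e[OF i] this]
  show ?thesis
    unfolding cls_forward[OF i] X_def[symmetric] Y_def[symmetric] by (simp add: E_def diff_diff_eq add.assoc)
qed

lemma error_le: "i \<in> {1..m} \<Longrightarrow> norm (E i n) \<le> \<eta> n"
proof -
  assume i: "i \<in> {1..m}"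
  have nn: "0 \<le> L2_norm T (b j n)" "0 \<le> L2_norm T (e j n)" if "j \<in> {1..m}" for j
    using cls_norm[OF b[OF that, of n]] cls_norm[OF e[OF that, of n]] by (metis norm_ge_zero)+
  have "norm (E i n) \<le> L2_norm T (b i n) + L2_norm T (e i n)"
    unfolding E_def using norm_triangle_ineq[of "cls T (b i n)" "cls T (e i n)"] by (simp add: cls_norm[OF b[OF i]] cls_norm[OF e[OF i]])
  also have "\<dots> \<le> \<eta> n" unfolding \<eta>_def by (rule member_le_sum[OF i]) (use nn in \<open>auto intro: add_nonneg_nonneg\<close>)
  finally show ?thesis .
qed

lemma \<eta>_nonneg: "0 \<le> \<eta> n"
proof -
  have nn: "0 \<le> L2_norm T (b j n)" "0 \<le> L2_norm T (e j n)" if "j \<in> {1..m}" for j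
    using cls_norm[OF b[OF that, of n]] cls_norm[OF e[OF that, of n]] by (metis norm_ge_zero)+
  then show ?thesis unfolding \<eta>_def by (intro sum_nonneg add_nonneg_nonneg) auto
qed

lemma \<eta>_summable: "summable \<eta>"
  unfolding \<eta>_def by (intro summable_sum summable_add sb se)

lemma error_tendsto_zero: "i \<in> {1..m} \<Longrightarrow> E i \<longlonglongrightarrow> 0"
  by (rule tendsto_zero_of_norm_le[OF error_le summable_LIMSEQ_zero[OF \<eta>_summable]])

text \<open>Any solution serves as reference point: its own pair in the graph, against that of the
  step, gives the monotonicity inequality, and \<open>BX_coco\<close> gives cocoercivity.\<close>

lemma Fejer:
  assumes p: "sol p"
  shows "convergent (\<lambda>n. \<Sum>i=1..m. (norm (X i n - cls T (p i)))\<^sup>2)"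
    and "\<And>i. i \<in> {1..m} \<Longrightarrow> V i \<longlonglongrightarrow> cls T (BX p i)"
    and "\<And>i. i \<in> {1..m} \<Longrightarrow> (\<lambda>n. X i n - Y i n) \<longlonglongrightarrow> 0"
proof -
  have pL: "p i \<in> Lp 2 T (H i)" "(cls T (p i), - cls T (BX p i)) \<in> periodic_op T (H i) (f i)" if "i \<in> {1..m}" for i
    using p that by (auto simp: sol_def)
  have \<gamma>': "\<epsilon> \<le> \<gamma> n" "\<gamma> n \<le> 2 * \<beta> - \<epsilon>" and lam': "0 \<le> lam n" "lam n \<le> 1 - \<epsilon>" for n using \<gamma>[of n] lam[of n] by auto
  have lami': "0 \<le> lami i n" "lami i n \<le> 1" if "i \<in> {1..m}" for i n using lami[OF that, of n] by auto
  have mono: "0 \<le> ((1 / \<gamma> n) *\<^sub>R (X i n - Y i n) - V i n - E i n + cls T (BX p i)) \<bullet> (Y i n - cls T (p i))"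
    if i: "i \<in> {1..m}" for i n
    using periodic_op_monotone[OF T H[OF i] f[OF i] step_in_periodic_op[OF i, of n] pL(2)[OF i]] by simp
  have co: "\<beta> * (\<Sum>i=1..m. (norm (V i n - cls T (BX p i)))\<^sup>2) \<le> (\<Sum>i=1..m. (V i n - cls T (BX p i)) \<bullet> (X i n - cls T (p i)))" for n
    unfolding V_def X_def by (rule BX_coco[OF iterate_in_Lp2 pL(1)])
  note F = forward_backward_Fejer[where I="{1..m}" and X=X and Y=Y and V=V and E=E and W="\<lambda>i. cls T (BX p i)" and Z="\<lambda>i. cls T (p i)",
      OF _ \<epsilon> \<beta> \<gamma>' lam' lami' slam mono co X_update error_le \<eta>_nonneg \<eta>_summable]
  show "convergent (\<lambda>n. \<Sum>i=1..m. (norm (X i n - cls T (p i)))\<^sup>2)" by (rule F(1)) auto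
  show "V i \<longlonglongrightarrow> cls T (BX p i)" if "i \<in> {1..m}" for i by (rule F(2)) (use that in auto)
  show "(\<lambda>n. X i n - Y i n) \<longlonglongrightarrow> 0" if "i \<in> {1..m}" for i by (rule F(3)) (use that in auto)
qed

lemma sol_exists: "\<exists>p. sol p"
  using solvable solves_P_imp_sol by blast

lemma X_bounded: "\<exists>C. \<forall>i\<in>{1..m}. \<forall>n. norm (X i n) \<le> C"
proof -
  obtain p where p: "sol p" using sol_exists by blast
  let ?s = "\<lambda>n. \<Sum>i=1..m. (norm (X i n - cls T (p i)))\<^sup>2"
  obtain K where K: "\<And>n. norm (?s n) \<le> K"
    using convergent_imp_Bseq[OF Fejer(1)[OF p]] unfolding Bseq_def by blast
  have "norm (X i n) \<le> 1 + K + (\<Sum>i=1..m. norm (cls T (p i)))" if i: "i \<in> {1..m}" for i n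
  proof -
    have "(norm (X i n - cls T (p i)))\<^sup>2 \<le> ?s n" by (rule member_le_sum[OF i]) auto
    also have "\<dots> \<le> K" using K[of n] by simp
    finally have 1: "(norm (X i n - cls T (p i)))\<^sup>2 \<le> K" .
    have 2: "norm (X i n - cls T (p i)) \<le> 1 + (norm (X i n - cls T (p i)))\<^sup>2"
      using sum_squares_bound[of 1 "norm (X i n - cls T (p i))"] norm_ge_zero[of "X i n - cls T (p i)"] by (simp, linarith)
    have 3: "norm (X i n) \<le> norm (X i n - cls T (p i)) + norm (cls T (p i))"
      using norm_triangle_ineq[of "X i n - cls T (p i)" "cls T (p i)"] by simp
    have 4: "norm (cls T (p i)) \<le> (\<Sum>i=1..m. norm (cls T (p i)))" by (rule member_le_sum[OF i]) auto
    show ?thesis using 1 2 3 4 by linarith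
  qed
  then show ?thesis by blast
qed

text \<open>The forward values converge strongly to their value at one solution \<open>q\<close>.
  Cocoercivity against a representative \<open>p\<close> of the weak limit identifies this value
  with the one at \<open>p\<close>, since its right-hand side pairs weak with strong limits and
  tends to 0. The sequence \<open>Y\<close> has the same weak limit as \<open>X\<close>, and its
  images in the graph converge strongly, so \<open>periodic_op_weakly_closed\<close>
  applies.\<close>

lemma cluster_sol:
  assumes r: "strict_mono r" and w: "\<And>i. i \<in> {1..m} \<Longrightarrow> wconv (X i \<circ> r) (P i)"
  shows "\<exists>p. sol p \<and> (\<forall>i\<in>{1..m}. cls T (p i) = P i)"
proof -
  obtain q where q: "sol q" using sol_exists by blast
  obtain C where C: "\<And>i n. i \<in> {1..m} \<Longrightarrow> norm (X i n) \<le> C" using X_bounded by blast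
  have "\<forall>i\<in>{1..m}. \<exists>p. p \<in> Lp 2 T (H i) \<and> P i = cls T p"
  proof
    fix i assume i: "i \<in> {1..m}"
    have "P i \<in> cls T ` Lp 2 T (H i)"
      by (rule wconv_closed_subspace[OF cls_closed_subspace[OF H[OF i]] w[OF i]]) (use iterate_in_Lp2[OF i] in \<open>simp add: X_def\<close>)
    then show "\<exists>p. p \<in> Lp 2 T (H i) \<and> P i = cls T p" by blast
  qed
  from bchoice[OF this] obtain p where p: "\<And>i. i \<in> {1..m} \<Longrightarrow> p i \<in> Lp 2 T (H i)" "\<And>i. i \<in> {1..m} \<Longrightarrow> P i = cls T (p i)" by blast
  have Vl: "V i \<longlonglongrightarrow> cls T (BX q i)" if "i \<in> {1..m}" for i by (rule Fejer(2)[OF q that])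
  have Vr: "(\<lambda>n. V i (r n)) \<longlonglongrightarrow> cls T (BX q i)" if "i \<in> {1..m}" for i
    using LIMSEQ_subseq_LIMSEQ[OF Vl[OF that] r] by (simp add: comp_def)
  have eq: "cls T (BX q i) = cls T (BX p i)" if i: "i \<in> {1..m}" for i
  proof -
    let ?d = "\<lambda>i. cls T (BX q i) - cls T (BX p i)"
    have l: "(\<lambda>n. \<beta> * (\<Sum>i=1..m. (norm (V i (r n) - cls T (BX p i)))\<^sup>2)) \<longlonglongrightarrow> \<beta> * (\<Sum>i=1..m. (norm (?d i))\<^sup>2)"
      by (intro tendsto_intros Vr)
    have rr: "(\<lambda>n. \<Sum>i=1..m. X i (r n) \<bullet> (V i (r n) - cls T (BX p i)) - P i \<bullet> (V i (r n) - cls T (BX p i))) \<longlonglongrightarrow> (\<Sum>i=1..m. P i \<bullet> ?d i - P i \<bullet> ?d i)"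
    proof (rule tendsto_sum)
      fix i assume i: "i \<in> {1..m}"
      have "(\<lambda>n. (X i \<circ> r) n \<bullet> (V i (r n) - cls T (BX p i))) \<longlonglongrightarrow> P i \<bullet> ?d i"
        by (rule wconv_inner_strong[OF w[OF i], of C]) (use C[OF i] in \<open>auto intro!: tendsto_intros Vr i\<close>)
      moreover have "(\<lambda>n. P i \<bullet> (V i (r n) - cls T (BX p i))) \<longlonglongrightarrow> P i \<bullet> ?d i"
        by (intro tendsto_intros Vr i)
      ultimately show "(\<lambda>n. X i (r n) \<bullet> (V i (r n) - cls T (BX p i)) - P i \<bullet> (V i (r n) - cls T (BX p i))) \<longlonglongrightarrow> P i \<bullet> ?d i - P i \<bullet> ?d i"
        unfolding comp_def by (rule tendsto_diff)
    qed
    have le: "\<beta> * (\<Sum>i=1..m. (norm (V i (r n) - cls T (BX p i)))\<^sup>2) \<le> (\<Sum>i=1..m. X i (r n) \<bullet> (V i (r n) - cls T (BX p i)) - P i \<bullet> (V i (r n) - cls T (BX p i)))" for n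
    proof -
      have "\<beta> * (\<Sum>i=1..m. (norm (V i (r n) - cls T (BX p i)))\<^sup>2) \<le> (\<Sum>i=1..m. (V i (r n) - cls T (BX p i)) \<bullet> (X i (r n) - cls T (p i)))"
        unfolding V_def X_def by (rule BX_coco[OF iterate_in_Lp2 p(1)])
      also have "\<dots> = (\<Sum>i=1..m. X i (r n) \<bullet> (V i (r n) - cls T (BX p i)) - P i \<bullet> (V i (r n) - cls T (BX p i)))"
        by (rule sum.cong[OF refl]) (metis inner_commute inner_diff_left p(2))
      finally show ?thesis .
    qed
    have "\<beta> * (\<Sum>i=1..m. (norm (?d i))\<^sup>2) \<le> (\<Sum>i=1..m. P i \<bullet> ?d i - P i \<bullet> ?d i)"
      by (rule LIMSEQ_le[OF l rr]) (use le in blast)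
    then have "(\<Sum>i=1..m. (norm (?d i))\<^sup>2) \<le> 0" using \<beta> by (simp add: mult_le_0_iff)
    moreover have "(norm (?d i))\<^sup>2 \<le> (\<Sum>i=1..m. (norm (?d i))\<^sup>2)" by (rule member_le_sum[OF i]) auto
    ultimately have "(norm (?d i))\<^sup>2 \<le> 0" by linarith
    then show ?thesis by simp
  qed
  have "(P i, - cls T (BX p i)) \<in> periodic_op T (H i) (f i)" if i: "i \<in> {1..m}" for i
  proof -
    have XY: "(\<lambda>n. X i (r n) - Y i (r n)) \<longlonglongrightarrow> 0"
      using LIMSEQ_subseq_LIMSEQ[OF Fejer(3)[OF q i] r] by (simp add: comp_def)
    have "wconv (\<lambda>n. (X i \<circ> r) n - (X i (r n) - Y i (r n))) (P i - 0)"
      by (rule wconv_diff[OF w[OF i] tendsto_imp_wconv[OF XY]])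
    then have wY: "wconv (\<lambda>n. Y i (r n)) (P i)" by simp
    obtain D where D: "\<And>n. norm (X i (r n) - Y i (r n)) \<le> D" using tendsto_imp_norm_bounded[OF XY] by blast
    have Yb: "norm (Y i (r n)) \<le> C + D" for n
      using D[of n] C[OF i, of "r n"] norm_triangle_ineq4[of "X i (r n)" "X i (r n) - Y i (r n)"] by simp
    have "(\<lambda>n. (1 / \<gamma> (r n)) *\<^sub>R (X i (r n) - Y i (r n))) \<longlonglongrightarrow> 0"
    proof (rule tendsto_zero_of_norm_le)
      show "norm ((1 / \<gamma> (r n)) *\<^sub>R (X i (r n) - Y i (r n))) \<le> (1 / \<epsilon>) * norm (X i (r n) - Y i (r n))" for n
      proof -
        have "1 / \<gamma> (r n) \<le> 1 / \<epsilon>" using \<gamma>[of "r n"] \<epsilon> by (intro divide_left_mono) auto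
        then show ?thesis using \<gamma>0[of "r n"] unfolding norm_scaleR by (intro mult_right_mono) auto
      qed
      show "(\<lambda>n. (1 / \<epsilon>) * norm (X i (r n) - Y i (r n))) \<longlonglongrightarrow> 0"
        by (rule tendsto_mult_right_zero[OF tendsto_norm_zero[OF XY]])
    qed
    moreover have "(\<lambda>n. E i (r n)) \<longlonglongrightarrow> 0" using LIMSEQ_subseq_LIMSEQ[OF error_tendsto_zero[OF i] r] by (simp add: comp_def)
    ultimately have "(\<lambda>n. (1 / \<gamma> (r n)) *\<^sub>R (X i (r n) - Y i (r n)) - V i (r n) - E i (r n)) \<longlonglongrightarrow> 0 - cls T (BX q i) - 0"
      by (intro tendsto_diff Vr i)
    then have U: "(\<lambda>n. (1 / \<gamma> (r n)) *\<^sub>R (X i (r n) - Y i (r n)) - V i (r n) - E i (r n)) \<longlonglongrightarrow> - cls T (BX p i)"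
      using eq[OF i] by simp
    have "- cls T (BX p i) = cls T (\<lambda>t. (-1) *\<^sub>R BX p i t)" using cls_scaleR[OF BX_Lp2[OF p(1) i], of "-1"] by simp
    then have "- cls T (BX p i) \<in> cls T ` Lp 2 T (H i)" using Lp2_scaleR[OF sH[OF i] BX_Lp2[OF p(1) i]] by blast
    then show ?thesis
      by (intro periodic_op_weakly_closed[OF T H[OF i] f[OF i] step_in_periodic_op[OF i] wY Yb U]) (use p i in auto)
  qed
  then have "sol p" unfolding sol_def using p by auto
  then show ?thesis using p by (intro exI[of _ p]) simp
qed

text \<open>The difference of the squared distances to \<open>P\<close> and to \<open>Q\<close>
  converges and is affine in \<open>X\<close>, so its limits along the two subsequences coincide.
  They differ by twice the squared distance between \<open>P\<close> and \<open>Q\<close>. Only the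
  sum over the components is known to converge, hence the simultaneous cluster points.\<close>

lemma cluster_unique:
  assumes r: "strict_mono r" "\<And>i. i \<in> {1..m} \<Longrightarrow> wconv (X i \<circ> r) (P i)"
    and s: "strict_mono s" "\<And>i. i \<in> {1..m} \<Longrightarrow> wconv (X i \<circ> s) (Q i)" and i: "i \<in> {1..m}"
  shows "P i = Q i"
proof -
  obtain p where p: "sol p" "\<And>i. i \<in> {1..m} \<Longrightarrow> cls T (p i) = P i" using cluster_sol[OF r] by blast
  obtain q where q: "sol q" "\<And>i. i \<in> {1..m} \<Longrightarrow> cls T (q i) = Q i" using cluster_sol[OF s] by blast
  let ?c = "\<Sum>i=1..m. P i \<bullet> P i - Q i \<bullet> Q i"
  define g where "g = (\<lambda>n. (\<Sum>i=1..m. (norm (X i n - P i))\<^sup>2) - (\<Sum>i=1..m. (norm (X i n - Q i))\<^sup>2))"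
  have "(\<lambda>n. \<Sum>i=1..m. (norm (X i n - cls T (p i)))\<^sup>2) = (\<lambda>n. \<Sum>i=1..m. (norm (X i n - P i))\<^sup>2)"
    "(\<lambda>n. \<Sum>i=1..m. (norm (X i n - cls T (q i)))\<^sup>2) = (\<lambda>n. \<Sum>i=1..m. (norm (X i n - Q i))\<^sup>2)"
    by (intro ext sum.cong refl; simp add: p(2) q(2))+
  then have "convergent g" unfolding g_def using Fejer(1)[OF p(1)] Fejer(1)[OF q(1)] by (intro convergent_diff) simp_all
  then obtain l where l: "g \<longlonglongrightarrow> l" by (auto simp: convergent_def)
  have ge: "g n = (\<Sum>i=1..m. 2 * (X i n \<bullet> (Q i - P i))) + ?c" for n
    unfolding g_def sum_subtractf[symmetric] sum.distrib[symmetric]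
    by (rule sum.cong) (simp_all add: power2_norm_eq_inner inner_diff_left inner_diff_right inner_commute algebra_simps)
  have lim: "l = (\<Sum>i=1..m. 2 * (R i \<bullet> (Q i - P i))) + ?c"
    if t: "strict_mono t" "\<And>i. i \<in> {1..m} \<Longrightarrow> wconv (X i \<circ> t) (R i)" for t R
  proof -
    have "(\<lambda>n. (\<Sum>i=1..m. 2 * ((X i \<circ> t) n \<bullet> (Q i - P i))) + ?c) \<longlonglongrightarrow> (\<Sum>i=1..m. 2 * (R i \<bullet> (Q i - P i))) + ?c"
      by (intro tendsto_add tendsto_sum tendsto_mult_left tendsto_const) (use t(2) in \<open>simp add: wconv_def\<close>)
    moreover have "(\<lambda>n. (\<Sum>i=1..m. 2 * ((X i \<circ> t) n \<bullet> (Q i - P i))) + ?c) \<longlonglongrightarrow> l"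
      using LIMSEQ_subseq_LIMSEQ[OF l t(1)] by (simp add: comp_def ge)
    ultimately show ?thesis using LIMSEQ_unique by blast
  qed
  have "(\<Sum>i=1..m. 2 * (Q i \<bullet> (Q i - P i))) - (\<Sum>i=1..m. 2 * (P i \<bullet> (Q i - P i))) = 0"
    using lim[OF r] lim[OF s] by simp
  then have "(\<Sum>i=1..m. 2 * ((Q i - P i) \<bullet> (Q i - P i))) = 0"
    unfolding sum_subtractf[symmetric] by (simp add: inner_diff_left[of _ _ "Q _ - P _"] algebra_simps)
  moreover have "2 * ((Q i - P i) \<bullet> (Q i - P i)) \<le> (\<Sum>i=1..m. 2 * ((Q i - P i) \<bullet> (Q i - P i)))"
    by (rule member_le_sum[OF i]) auto
  ultimately have "(Q i - P i) \<bullet> (Q i - P i) \<le> 0" by linarith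
  then show ?thesis by (metis inner_gt_zero_iff not_less right_minus_eq)
qed

text \<open>A subsequence along which one component converges is thinned until all components
  converge, since \<open>cluster_unique\<close> compares cluster points of the whole family.\<close>

lemma X_weakly_convergent:
  "\<exists>z. solves_P m T H f B z \<and> (\<forall>i\<in>{1..m}. z i \<in> W_per T (H i) \<and> wconv (X i) (cls T (z i)))"
proof -
  obtain C where C: "\<And>i n. i \<in> {1..m} \<Longrightarrow> norm (X i n) \<le> C" using X_bounded by blast
  have "\<exists>r P. strict_mono r \<and> (\<forall>i\<in>{1..m}. wconv (X i \<circ> r) (P i))"
    by (rule weak_compactness_family) (use C in auto)
  then obtain r P where r: "strict_mono r" "\<And>i. i \<in> {1..m} \<Longrightarrow> wconv (X i \<circ> r) (P i)" by blast
  obtain p where p: "sol p" "\<And>i. i \<in> {1..m} \<Longrightarrow> cls T (p i) = P i" using cluster_sol[OF r] by blast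
  obtain z where z: "solves_P m T H f B z" "\<And>i. i \<in> {1..m} \<Longrightarrow> z i \<in> W_per T (H i) \<and> cls T (z i) = cls T (p i)"
    using sol_imp_solves_P[OF p(1)] by blast
  have "wconv (X i) (P i)" if i: "i \<in> {1..m}" for i
  proof (rule wconv_subseq_principle[OF C[OF i]])
    fix s k assume s: "strict_mono s" "wconv (X i \<circ> s) k"
    have "\<exists>t Q. strict_mono t \<and> (\<forall>j\<in>{1..m}. wconv ((X j \<circ> s) \<circ> t) (Q j))"
      by (rule weak_compactness_family) (use C in auto)
    then obtain t Q where t: "strict_mono t" "\<And>j. j \<in> {1..m} \<Longrightarrow> wconv ((X j \<circ> s) \<circ> t) (Q j)" by blast
    have "Q i = k" by (rule wconv_unique[OF t(2)[OF i] wconv_subseq[OF s(2) t(1)]])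
    moreover have "P i = Q i"
    proof (rule cluster_unique[OF r strict_mono_o[OF s(1) t(1)] _ i])
      show "wconv (X j \<circ> (s \<circ> t)) (Q j)" if "j \<in> {1..m}" for j unfolding o_assoc by (rule t(2)[OF that])
    qed
    ultimately show "k = P i" by simp
  qed
  then show ?thesis using z p(2) by (intro exI[of _ z]) simp
qed

text \<open>The derivative estimate of \<open>step_exists_unique\<close> concerns the solution
  constructed there, which uniqueness identifies with \<open>y i n\<close>. The derivatives of the
  iterates are convex combinations and inherit the bound, the starting derivative entering through a
  maximum.\<close>

lemma X'_bounded:
  assumes i: "i \<in> {1..m}"
  shows "\<exists>C. \<forall>n. norm (X' i n) \<le> C"
proof -
  obtain p where p: "sol p" using sol_exists by blast
  obtain C where C: "\<And>n. norm (X i n) \<le> C" using X_bounded i by blast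
  obtain CV where CV: "\<And>n. norm (V i n) \<le> CV" using tendsto_imp_norm_bounded[OF Fejer(2)[OF p i]] by blast
  obtain CE where CE: "\<And>n. norm (E i n) \<le> CE" using tendsto_imp_norm_bounded[OF error_tendsto_zero[OF i]] by blast
  define K where "K = (1 / \<epsilon>) * C + CV + CE"
  have Y'K: "norm (Y' i n) \<le> K" for n
  proof -
    have xn: "x j n \<in> Lp 2 T (H j)" if "j \<in> {1..m}" for j by (rule iterate_in_Lp2[OF that])
    obtain z where z: "is_unique_step T (H i) (f i) (\<gamma> n) (x i n) (\<lambda>t. B i (\<lambda>j\<in>{1..m}. x j n t) + b i n t) (e i n) z"
      "norm (cls T (weak_deriv T (H i) z)) \<le> norm ((1 / \<gamma> n) *\<^sub>R cls T (x i n) - cls T (\<lambda>t. B i (\<lambda>j\<in>{1..m}. x j n t) + b i n t) - cls T (e i n))"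
      using step_exists_unique[OF T H[OF i] f[OF i] \<gamma>0 iterate_in_Lp2[OF i] forward_Lp2(1)[of "\<lambda>j. x j n", OF xn i] e[OF i]] by blast
    have "z t = y i n t" if "t \<in> {0..T}" for t
      using iteration_step[OF i, of n] z(1) that unfolding is_unique_step_def by blast
    then have "Y' i n = cls T (weak_deriv T (H i) z)" unfolding Y'_def using weak_deriv_cong[of T z "y i n" "H i"] by simp
    then have "norm (Y' i n) \<le> norm ((1 / \<gamma> n) *\<^sub>R X i n - V i n - E i n)"
      using z(2) unfolding cls_forward[OF i] X_def[symmetric] by (simp add: E_def diff_diff_eq add.assoc)
    also have "\<dots> \<le> norm ((1 / \<gamma> n) *\<^sub>R X i n) + norm (V i n) + norm (E i n)"
      using norm_triangle_ineq4[of "(1 / \<gamma> n) *\<^sub>R X i n - V i n" "E i n"] norm_triangle_ineq4[of "(1 / \<gamma> n) *\<^sub>R X i n" "V i n"] by linarith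
    also have "norm ((1 / \<gamma> n) *\<^sub>R X i n) \<le> (1 / \<epsilon>) * C"
    proof -
      have "1 / \<gamma> n \<le> 1 / \<epsilon>" using \<gamma>[of n] \<epsilon> by (intro divide_left_mono) auto
      then show ?thesis using \<gamma>0[of n] C[of n] \<epsilon> unfolding norm_scaleR by (intro mult_mono) auto
    qed
    finally show ?thesis using CV[of n] CE[of n] by (simp add: K_def)
  qed
  have "norm (X' i n) \<le> max (norm (X' i 0)) K" for n
  proof (induction n)
    case (Suc n)
    let ?M = "max (norm (X' i 0)) K"
    have l: "0 \<le> lami i n" "lami i n \<le> 1" using lami[OF i, of n] by auto
    have "norm (X' i (Suc n)) \<le> lami i n * norm (X' i n) + (1 - lami i n) * norm (Y' i n)"
      unfolding X'_update[OF i] using norm_triangle_ineq[of "lami i n *\<^sub>R X' i n" "(1 - lami i n) *\<^sub>R Y' i n"] l by simp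
    also have "\<dots> \<le> lami i n * ?M + (1 - lami i n) * ?M"
      using Suc Y'K[of n] l by (intro add_mono mult_left_mono) auto
    also have "\<dots> = ?M" by (simp add: algebra_simps)
    finally show ?case .
  qed simp
  then show ?thesis by blast
qed

text \<open>The derivatives are bounded, and each of their weak cluster points is a weak derivative
  of \<open>z i\<close>, hence always the same class; so they converge weakly as well. The inner
  product of \<open>W12\<close> is the sum of the products of the two pairs of classes.\<close>

theorem iteration_converges:
  "\<exists>z. (\<forall>i\<in>{1..m}. z i \<in> W_per T (H i) \<and> W12_weakly_converges T (H i) (x i) (z i)) \<and> solves_P m T H f B z"
proof -
  obtain z where z: "solves_P m T H f B z" "\<And>i. i \<in> {1..m} \<Longrightarrow> z i \<in> W_per T (H i)" "\<And>i. i \<in> {1..m} \<Longrightarrow> wconv (X i) (cls T (z i))"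
    using X_weakly_convergent by blast
  have "W12_weakly_converges T (H i) (x i) (z i)" if i: "i \<in> {1..m}" for i
  proof -
    note dz = W_perD[OF T H[OF i] z(2)[OF i]]
    obtain C where C: "\<And>n. norm (X' i n) \<le> C" using X'_bounded[OF i] by blast
    have wX': "wconv (X' i) (cls T (weak_deriv T (H i) (z i)))"
    proof (rule wconv_subseq_principle[OF C])
      fix r k assume r: "strict_mono r" "wconv (X' i \<circ> r) k"
      have "k \<in> cls T ` Lp 2 T (H i)"
        by (rule wconv_closed_subspace[OF cls_closed_subspace[OF H[OF i]] r(2)])
          (use W12_weak_deriv(2)[OF T H[OF i] iterate_in_W12[OF i]] in \<open>simp add: X'_def\<close>)
      then obtain v where v: "v \<in> Lp 2 T (H i)" "k = cls T v" by blast
      have "has_weak_deriv T (H i) (z i) v"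
        by (rule weak_deriv_weakly_closed[OF T H[OF i] iterate_in_W12[OF i] dz(4) v(1), of r])
          (use wconv_subseq[OF z(3)[OF i] r(1)] r(2) v(2) in \<open>simp_all add: comp_def X_def X'_def\<close>)
      then show "k = cls T (weak_deriv T (H i) (z i))"
        unfolding v(2) cls_eq_iff[OF v(1) dz(3)] by (intro weak_deriv_unique[OF T H[OF i] _ dz(5)])
    qed
    have inner: "W12_inner T (H i) u w = cls T u \<bullet> cls T w + cls T (weak_deriv T (H i) u) \<bullet> cls T (weak_deriv T (H i) w)"
      if "u \<in> W12 T (H i)" "w \<in> W12 T (H i)" for u w
      unfolding W12_inner_def using W12_weak_deriv[OF T H[OF i]] that by (metis cls_inner)
    have zW: "z i \<in> W12 T (H i)" using z(2)[OF i] by (simp add: W_per_def)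
    show ?thesis unfolding W12_weakly_converges_def
    proof (intro conjI allI ballI)
      fix w assume w: "w \<in> W12 T (H i)"
      have "(\<lambda>n. X i n \<bullet> cls T w + X' i n \<bullet> cls T (weak_deriv T (H i) w)) \<longlonglongrightarrow>
          cls T (z i) \<bullet> cls T w + cls T (weak_deriv T (H i) (z i)) \<bullet> cls T (weak_deriv T (H i) w)"
        by (intro tendsto_add) (use z(3)[OF i] wX' in \<open>auto simp: wconv_def\<close>)
      then show "(\<lambda>n. W12_inner T (H i) (x i n) w) \<longlonglongrightarrow> W12_inner T (H i) (z i) w"
        by (simp add: inner[OF iterate_in_W12[OF i] w] inner[OF zW w] X_def X'_def)
    qed (use iterate_in_W12[OF i] zW in auto)
  qed
  then show ?thesis using z(1,2) by (intro exI[of _ z]) blast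
qed

end

end

theorem theorem5p3:
  fixes m :: nat
    and T \<beta> \<epsilon> :: real
    and H :: "nat \<Rightarrow> 'a::{real_inner, banach} set"
    and f :: "nat \<Rightarrow> 'a \<Rightarrow> ereal"
    and B :: "nat \<Rightarrow> (nat \<Rightarrow> 'a) \<Rightarrow> 'a"
    and \<gamma> lam :: "nat \<Rightarrow> real"
    and lami :: "nat \<Rightarrow> nat \<Rightarrow> real"
    and b e :: "nat \<Rightarrow> nat \<Rightarrow> real \<Rightarrow> 'a"
    and x0 :: "nat \<Rightarrow> real \<Rightarrow> 'a"
  assumes "m \<ge> 2"
    and "T > 0"
    and "\<And>i. i \<in> {1..m} \<Longrightarrow> hilbert_subspace (H i)"
    and "\<And>i. i \<in> {1..m} \<Longrightarrow> f i \<in> Gamma0 (H i)"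
    and "\<And>i. i \<in> {1..m} \<Longrightarrow> B i \<in> (\<Pi>\<^sub>E j\<in>{1..m}. H j) \<rightarrow> H i"
    and "\<beta> > 0"
    and "\<And>u v. u \<in> (\<Pi>\<^sub>E j\<in>{1..m}. H j) \<Longrightarrow> v \<in> (\<Pi>\<^sub>E j\<in>{1..m}. H j) \<Longrightarrow>
           (\<Sum>i=1..m. (B i u - B i v) \<bullet> (u i - v i)) \<ge> \<beta> * (\<Sum>i=1..m. (norm (B i u - B i v))\<^sup>2)"
    and "\<exists>z. solves_P m T H f B z"
    and "\<epsilon> \<in> {0<..<min 1 \<beta>}"
    and "\<And>n. \<gamma> n \<in> {\<epsilon>..2 * \<beta> - \<epsilon>}"
    and "\<And>n. lam n \<in> {0..1 - \<epsilon>}"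
    and "\<And>i. i \<in> {1..m} \<Longrightarrow> x0 i \<in> W12 T (H i)"
    and "\<And>i n. i \<in> {1..m} \<Longrightarrow> b i n \<in> Lp 2 T (H i)"
    and "\<And>i n. i \<in> {1..m} \<Longrightarrow> e i n \<in> Lp 2 T (H i)"
    and "\<And>i. i \<in> {1..m} \<Longrightarrow> summable (\<lambda>n. L2_norm T (b i n))"
    and "\<And>i. i \<in> {1..m} \<Longrightarrow> summable (\<lambda>n. L2_norm T (e i n))"
    and "\<And>i n. i \<in> {1..m} \<Longrightarrow> lami i n \<in> {0..<1}"
    and "\<And>i. i \<in> {1..m} \<Longrightarrow> summable (\<lambda>n. \<bar>lami i n - lam n\<bar>)"
  shows "(\<exists>x y. is_iteration m T H f B \<gamma> lami b e x0 x y) \<and>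
    (\<forall>x y. is_iteration m T H f B \<gamma> lami b e x0 x y \<longrightarrow>
      (\<exists>z. (\<forall>i\<in>{1..m}. z i \<in> W_per T (H i) \<and> W12_weakly_converges T (H i) (x i) (z i)) \<and>
           solves_P m T H f B z))"
proof -
  interpret coupled_iteration m T \<beta> H f B \<epsilon> \<gamma> lam lami b e x0
    by unfold_locales (use assms in auto)
  show ?thesis
    using iteration_exists iteration_converges assms(8) by blast
qed

end
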